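(* Let $2\le n\le m$. There is a constant $c_3=c_3(n)>0$, depending only on $n$, such that the following holds. Let $\Omega\subset\mathbb{R}^n$ be a domain, let $\omega$ be an $n$-volume form in $\mathbb{R}^m$ with constant coefficients, and let $f:\Omega\to\mathbb{R}^m$ be a finite distortion $\omega$-curve with distortion function $K_f$. If $\exp(\lambda K_f)\in L^1_{loc}(\Omega)$ for some $\lambda>0$ and $f\in W^{1,n}_{loc}(\Omega,\mathbb{R}^m)$, then $$\star f^*\omega\,\log^a(e+\star f^*\omega)\in L^1_{loc}(\Omega)\quad\text{and}\quad |Df(x)|^n\log^{a-1}(e+|Df(x)|)\in L^1_{loc}(\Omega)$$ for all $a<c_3\lambda$.
   Context: An $n$-volume form on $\mathbb{R}^m$ is a smooth, non-vanishing, closed differential $n$-form $\omega=\sum_I\phi_I\,dx_I$, the sum being over multi-indices $I=(i_1,\dots,i_n)$, $1\le i_1<\dots<i_n\le m$, with $dx_I=dx_{i_1}\wedge\dots\wedge dx_{i_n}$. It has constant coefficients if all $\phi_I$ are constant. The pointwise comass norm is $\|\omega\|(p)=\sup\{|\omega_p(v_1,\dots,v_n)|: v_1,\dots,v_n\in\mathbb{R}^m,\ |v_i|\le 1\}$. For a Sobolev map $f$, $\star f^*\omega$ denotes the real-valued function with $(\star f^*\omega)\,dx_1\wedge\dots\wedge dx_n=f^*\omega$ (pullback computed with weak derivatives). $|Df(x)|$ is the operator norm of the weak differential; $\log^a t=(\log t)^a$. Finite distortion $\omega$-curve: a map $f\in W^{1,1}_{loc}(\Omega,\mathbb{R}^m)$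 such that $\star f^*\omega\in L^1_{loc}(\Omega)$ and there is a measurable function $K_f\ge 1$, finite almost everywhere (the distortion function), with $(\|\omega\|\circ f)(x)\,|Df(x)|^n\le K_f(x)\,(\star f^*\omega)(x)$ for almost every $x\in\Omega$. *)

theory Defs
  imports "HOL-Analysis.Analysis"
begin

text \<open>
  The source dimension is the cardinality of a finite linearly ordered index type \<open>'n\<close>; the order
  is what makes sense of \<open>i\<^sub>1 < \<dots> < i\<^sub>n\<close> and of the orientation \<open>dx\<^sub>1 \<and> \<dots> \<and> dx\<^sub>n\<close>.  The target
  dimension \<open>m\<close> is a natural number, because the constant in the theorem must not depend on it: a
  vector of \<open>\<real>\<^sup>m\<close> is a function \<open>nat \<Rightarrow> real\<close> of which only the coordinates \<open>0, \<dots>, m - 1\<close> are used,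
  and its Euclidean norm is \<open>L2_set v {..<m}\<close>.
\<close>

subsection \<open>Local Lebesgue and Sobolev spaces\<close>

definition Lp_loc :: "nat \<Rightarrow> 'a::euclidean_space set \<Rightarrow> ('a \<Rightarrow> 'b::euclidean_space) \<Rightarrow> bool" where
  "Lp_loc p \<Omega> u \<longleftrightarrow>
     u \<in> borel_measurable (lebesgue_on \<Omega>) \<and>
     (\<forall>C. compact C \<and> C \<subseteq> \<Omega> \<longrightarrow> (\<lambda>x. norm (u x) ^ p) absolutely_integrable_on C)"

abbreviation L1_loc :: "'a::euclidean_space set \<Rightarrow> ('a \<Rightarrow> 'b::euclidean_space) \<Rightarrow> bool" where
  "L1_loc \<equiv> Lp_loc 1"

abbreviation partial_deriv :: "'a::euclidean_space \<Rightarrow> ('a \<Rightarrow> real) \<Rightarrow> 'a \<Rightarrow> real" where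
  "partial_deriv b \<phi> \<equiv> (\<lambda>x. frechet_derivative \<phi> (at x) b)"

primrec C_k :: "nat \<Rightarrow> ('a::euclidean_space \<Rightarrow> real) \<Rightarrow> bool" where
  "C_k 0 \<phi> \<longleftrightarrow> continuous_on UNIV \<phi>"
| "C_k (Suc k) \<phi> \<longleftrightarrow>
     (\<forall>x. \<phi> differentiable (at x)) \<and> (\<forall>b\<in>Basis. C_k k (partial_deriv b \<phi>))"

definition test_function :: "'a::euclidean_space set \<Rightarrow> ('a \<Rightarrow> real) \<Rightarrow> bool" where
  "test_function \<Omega> \<phi> \<longleftrightarrow>
     (\<forall>k. C_k k \<phi>) \<and> compact (closure {x. \<phi> x \<noteq> 0}) \<and> closure {x. \<phi> x \<noteq> 0} \<subseteq> \<Omega>"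

definition weak_gradient ::
    "'a::euclidean_space set \<Rightarrow> ('a \<Rightarrow> real) \<Rightarrow> ('a \<Rightarrow> 'a) \<Rightarrow> bool" where
  "weak_gradient \<Omega> u G \<longleftrightarrow>
     L1_loc \<Omega> u \<and> L1_loc \<Omega> G \<and>
     (\<forall>\<phi>. test_function \<Omega> \<phi> \<longrightarrow> (\<forall>b\<in>Basis.
        (LINT x:\<Omega>|lebesgue. u x * partial_deriv b \<phi> x) =
        - (LINT x:\<Omega>|lebesgue. (G x \<bullet> b) * \<phi> x)))"

text \<open>
  \<open>sobolev_loc p m \<Omega> f Df\<close>: the map \<open>f\<close> is in \<open>W\<^sup>1\<^sup>,\<^sup>p\<^sub>l\<^sub>o\<^sub>c(\<Omega>, \<real>\<^sup>m)\<close> and \<open>Df\<close> represents its weak differential,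
  \<open>Df x j\<close> being the weak gradient at \<open>x\<close> of the \<open>j\<close>-th component of \<open>f\<close>.  The weak differential is
  unique only almost everywhere, so the representative is a parameter.
\<close>

definition sobolev_loc ::
    "nat \<Rightarrow> nat \<Rightarrow> 'a::euclidean_space set \<Rightarrow> ('a \<Rightarrow> nat \<Rightarrow> real) \<Rightarrow> ('a \<Rightarrow> nat \<Rightarrow> 'a) \<Rightarrow> bool" where
  "sobolev_loc p m \<Omega> f Df \<longleftrightarrow>
     (\<forall>j<m. weak_gradient \<Omega> (\<lambda>x. f x j) (\<lambda>x. Df x j) \<and>
            Lp_loc p \<Omega> (\<lambda>x. f x j) \<and> Lp_loc p \<Omega> (\<lambda>x. Df x j))"

text \<open>Operator norm of the linear map \<open>h \<mapsto> (L j \<bullet> h)\<^sub>j\<close> into \<open>\<real>\<^sup>m\<close>.\<close>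

definition op_norm :: "nat \<Rightarrow> (nat \<Rightarrow> 'a::euclidean_space) \<Rightarrow> real" where
  "op_norm m L = (SUP h\<in>cball 0 1. L2_set (\<lambda>j. L j \<bullet> h) {..<m})"

subsection \<open>Forms with constant coefficients\<close>

text \<open>
  A form \<open>\<Sum>\<^sub>I \<phi>\<^sub>I dx\<^sub>I\<close> with constant coefficients is given by its coefficients \<open>\<phi> I\<close>, where \<open>I\<close> runs over
  the increasing multi-indices.  It is the same alternating form at every point of \<open>\<real>\<^sup>m\<close>, so its
  comass is a number.
\<close>

type_synonym 'n const_form = "('n \<Rightarrow> nat) \<Rightarrow> real"

definition multi_indices :: "nat \<Rightarrow> ('n::{finite,linorder} \<Rightarrow> nat) set" where
  "multi_indices m = {I. strict_mono I \<and> (\<forall>k. I k < m)}"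

definition dx :: "('n::{finite,linorder} \<Rightarrow> nat) \<Rightarrow> ('n \<Rightarrow> nat \<Rightarrow> real) \<Rightarrow> real" where
  "dx I v = det (\<chi> j k. v j (I k))"

definition form_eval ::
    "nat \<Rightarrow> 'n::{finite,linorder} const_form \<Rightarrow> ('n \<Rightarrow> nat \<Rightarrow> real) \<Rightarrow> real" where
  "form_eval m \<omega> v = (\<Sum>I\<in>multi_indices m. \<omega> I * dx I v)"

text \<open>
  Smoothness and closedness of a volume form hold automatically for constant coefficients; what
  remains is that the form does not vanish.
\<close>

definition const_volume_form :: "nat \<Rightarrow> 'n::{finite,linorder} const_form \<Rightarrow> bool" where
  "const_volume_form m \<omega> \<longleftrightarrow> (\<exists>v. form_eval m \<omega> v \<noteq> 0)"

definition comass :: "nat \<Rightarrow> 'n::{finite,linorder} const_form \<Rightarrow> real" where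
  "comass m \<omega> = (SUP v\<in>{v. \<forall>j. L2_set (v j) {..<m} \<le> 1}. \<bar>form_eval m \<omega> v\<bar>)"

text \<open>
  The function \<open>\<star>f\<^sup>*\<omega>\<close> at a point, computed from the differential \<open>L\<close> there: the form is evaluated at
  the partial derivatives, which are the images of the standard basis vectors.
\<close>

definition star_pullback ::
    "nat \<Rightarrow> 'n::{finite,linorder} const_form \<Rightarrow> (nat \<Rightarrow> (real, 'n) vec) \<Rightarrow> real" where
  "star_pullback m \<omega> L = form_eval m \<omega> (\<lambda>k j. L j \<bullet> axis k 1)"

subsection \<open>Curves of finite distortion\<close>

text \<open>
  The distortion function may be infinite on a null set, where \<open>real_of_ereal\<close> returns an irrelevant
  value.
\<close>

definition finite_distortion_curve ::
    "nat \<Rightarrow> (real, 'n::{finite,linorder}) vec set \<Rightarrow> 'n const_form \<Rightarrow>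
     ((real, 'n) vec \<Rightarrow> nat \<Rightarrow> real) \<Rightarrow> ((real, 'n) vec \<Rightarrow> nat \<Rightarrow> (real, 'n) vec) \<Rightarrow>
     ((real, 'n) vec \<Rightarrow> ereal) \<Rightarrow> bool" where
  "finite_distortion_curve m \<Omega> \<omega> f Df K \<longleftrightarrow>
     sobolev_loc 1 m \<Omega> f Df \<and>
     L1_loc \<Omega> (\<lambda>x. star_pullback m \<omega> (Df x)) \<and>
     K \<in> borel_measurable (lebesgue_on \<Omega>) \<and>
     (\<forall>x\<in>\<Omega>. 1 \<le> K x) \<and>
     (AE x in lebesgue_on \<Omega>. K x < \<infinity>) \<and>
     (AE x in lebesgue_on \<Omega>.
        comass m \<omega> * op_norm m (Df x) ^ CARD('n) \<le>
        real_of_ereal (K x) * star_pullback m \<omega> (Df x))"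

end

theory Submission
  imports Defs "HOL-Real_Asymp.Real_Asymp" "HOL-Computational_Algebra.Polynomial"
begin

text \<open>
  Write \<open>n = CARD('n)\<close>, \<open>J = \<star>f\<^sup>*\<omega>\<close> and \<open>\<kappa>\<close> for the comass of \<open>\<omega>\<close>.  Since \<open>\<omega>\<close> has constant coefficients, \<open>J\<close> is
  a null Lagrangian: for smooth maps an integration by parts bounds \<open>\<integral>\<eta> J\<close> by
  \<open>C \<kappa> / r \<cdot> \<integral>\<bar>f - c\<bar> \<bar>Df\<bar>\<^sup>n\<^sup>-\<^sup>1\<close> over a ball of radius \<open>r\<close>.  Averaging over the constants \<open>c = f y\<close> gives a
  reverse Hoelder inequality, which bounds the mean of \<open>J / \<kappa>\<close> by the mean of \<open>\<bar>Df\<bar>\<^sup>n\<^sup>\<theta>\<close> to the power \<open>1 / \<theta>\<close>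
  with \<open>\<theta> = (2 n - 1) / (2 n)\<close> and a constant depending only on \<open>n\<close>; mollification carries it over to
  \<open>W\<^sup>1\<^sup>,\<^sup>n\<close>.  With \<open>d\<close> the distance to the boundary of a ball in \<open>\<Omega>\<close>, put
  \<open>G = d\<^sup>n J / \<kappa>\<close> and \<open>H = d\<^sup>n \<bar>Df\<bar>\<^sup>n\<close>.  A stopping-radius covering argument yields
  \<open>\<integral>\<^sub>{\<^sub>G\<^sub>>\<^sub>t\<^sub>} G \<le> C t\<^sup>1\<^sup>-\<^sup>\<theta> \<integral>\<^sub>{\<^sub>H\<^sub>>\<^sub>c\<^sub>t\<^sub>} H\<^sup>\<theta>\<close> for large \<open>t\<close>.
  The distortion inequality \<open>H \<le> b K G\<close> gives
  \<open>H \<le> max (2 b / \<lambda> \<cdot> G log (e + G)) (b K exp (\<lambda> K / 2))\<close>, according to whether \<open>\<lambda> K / 2\<close> exceeds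
  \<open>log (e + G)\<close>.  Integrating the level set estimate against \<open>log\<^sup>a\<^sup>-\<^sup>1 t dt / t\<close>, truncated at a finite
  level, the first alternative contributes at most \<open>C(n) a / \<lambda>\<close> times the left-hand side, which can be
  absorbed when \<open>a / \<lambda>\<close> is small, and the second one is controlled by \<open>\<integral> exp (\<lambda> K)\<close>.
\<close>

section \<open>Forms with constant coefficients\<close>

text \<open>For a bounded distortion function the level set estimate would be Gehring's and would
  gain a power. An unbounded \<open>K\<close> costs a factor that exponential integrability turns
  into one logarithm, so after integration both sides carry the same power of the logarithm. The
  only smallness left is the factor \<open>a\<close> in the derivative a log^(a-1) t / t of log^a t;
  hence a threshold for \<open>a\<close> that is linear in \<lambda>.

  The exponent n \<theta> = n - 1/2 exceeds the Sobolev-Poincare exponent n^2 / (n + 1) exactly when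
  n > 1. The same condition reappears as n p < 1 with p = 1 / (2 n - 1): the singularity t^(-n p),
  where t is the position on the segment from x to y, is integrable at 0.

  To keep the constants free of m, the pullback is divided by the comass and the differential is
  measured in the Hilbert-Schmidt norm, which exceeds the operator norm at most by the factor sqrt
  n. Bounds that do involve m serve only integrability and limits.

  The weight d^n lets the level set estimate hold on one and the same ball: where G is large, the
  stopping radius is small compared with d, so nothing is lost to a larger ball and the absorption
  closes.\<close>

lemma form_eval_upd_add:
  fixes \<omega> :: "'n::{finite,linorder} const_form"
  shows "form_eval m \<omega> (v(k := \<lambda>i. x i + y i)) = form_eval m \<omega> (v(k := x)) + form_eval m \<omega> (v(k := y))"
proof -
  have "dx I (v(k := \<lambda>i. x i + y i)) = dx I (v(k := x)) + dx I (v(k := y))" for I :: "'n \<Rightarrow> nat"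
  proof -
    have *: "dx I (v(k := w)) = det (\<chi> i. if i = k then (\<chi> l. w (I l)) else (\<chi> l. v i (I l)))" for w
      unfolding dx_def by (intro arg_cong[where f = det]) (simp add: vec_eq_iff)
    show ?thesis
      unfolding * det_row_add[symmetric] by (intro arg_cong[where f = det]) (simp add: vec_eq_iff)
  qed
  then show ?thesis by (simp add: form_eval_def distrib_left sum.distrib)
qed

lemma form_eval_upd_scale:
  fixes \<omega> :: "'n::{finite,linorder} const_form"
  shows "form_eval m \<omega> (v(k := \<lambda>i. a * x i)) = a * form_eval m \<omega> (v(k := x))"
proof -
  have "dx I (v(k := \<lambda>i. a * x i)) = a * dx I (v(k := x))" for I :: "'n \<Rightarrow> nat"
  proof -
    have *: "dx I (v(k := w)) = det (\<chi> i. if i = k then (\<chi> l. w (I l)) else (\<chi> l. v i (I l)))" for w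
      unfolding dx_def by (intro arg_cong[where f = det]) (simp add: vec_eq_iff)
    show ?thesis
      unfolding * det_row_mul[symmetric] by (intro arg_cong[where f = det]) (simp add: vec_eq_iff)
  qed
  then show ?thesis by (simp add: form_eval_def sum_distrib_left mult.left_commute)
qed

lemma form_eval_identical:
  fixes \<omega> :: "'n::{finite,linorder} const_form"
  assumes "k \<noteq> l" "v k = v l"
  shows "form_eval m \<omega> v = 0"
proof -
  have "dx I v = 0" for I :: "'n \<Rightarrow> nat"
    unfolding dx_def by (rule det_identical_rows[OF assms(1)]) (simp add: row_def assms(2))
  then show ?thesis by (simp add: form_eval_def)
qed

text \<open>Polarisation: put \<open>x + y\<close> into both slots, expand by additivity and drop
  the terms with equal arguments.\<close>

lemma form_eval_swap:
  fixes \<omega> :: "'n::{finite,linorder} const_form"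
  assumes "k \<noteq> l"
  shows "form_eval m \<omega> (v(k := x, l := y)) = - form_eval m \<omega> (v(k := y, l := x))"
proof -
  define s where "s = (\<lambda>i::nat. x i + y i)"
  have "0 = form_eval m \<omega> (v(k := s, l := s))"
    using assms by (subst form_eval_identical[of k l]) auto
  also have "\<dots> = form_eval m \<omega> (v(k := s, l := x)) + form_eval m \<omega> (v(k := s, l := y))"
    unfolding s_def by (rule form_eval_upd_add)
  also have "\<dots> = form_eval m \<omega> (v(k := x, l := x)) + form_eval m \<omega> (v(k := y, l := x))
      + (form_eval m \<omega> (v(k := x, l := y)) + form_eval m \<omega> (v(k := y, l := y)))"
    using assms unfolding s_def by (simp add: fun_upd_twist[of k l] form_eval_upd_add)
  also have "form_eval m \<omega> (v(k := x, l := x)) = 0"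
    using assms by (subst form_eval_identical[of k l]) auto
  also have "form_eval m \<omega> (v(k := y, l := y)) = 0"
    using assms by (subst form_eval_identical[of k l]) auto
  finally show ?thesis by (simp add: fun_upd_def)
qed

lemma form_eval_cong:
  fixes \<omega> :: "'n::{finite,linorder} const_form"
  assumes "\<And>j i. i < m \<Longrightarrow> v j i = w j i"
  shows "form_eval m \<omega> v = form_eval m \<omega> w"
  unfolding form_eval_def dx_def
proof (intro sum.cong refl arg_cong2[where f = "(*)"] arg_cong[where f = det])
  fix I assume "I \<in> (multi_indices m :: ('n \<Rightarrow> nat) set)"
  then show "(\<chi> j k. v j (I k)) = (\<chi> j k. w j (I k))"
    using assms by (simp add: multi_indices_def vec_eq_iff)
qed

text \<open>A crude bound whose purpose is boundedness alone: without it the supremum in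
  \<open>comass\<close> would be an unspecified real number.\<close>

lemma form_eval_bound_unit:
  fixes \<omega> :: "'n::{finite,linorder} const_form"
  assumes "\<And>j. L2_set (v j) {..<m} \<le> 1"
  shows "\<bar>form_eval m \<omega> v\<bar> \<le> (\<Sum>I\<in>multi_indices m. \<bar>\<omega> I\<bar> * card {p. p permutes (UNIV::'n set)})"
proof -
  have v1: "\<bar>v j i\<bar> \<le> 1" if "i < m" for j i
  proof -
    have "\<bar>v j i\<bar> \<le> L2_set (\<lambda>i. \<bar>v j i\<bar>) {..<m}" using that by (intro member_le_L2_set) auto
    also have "\<dots> = L2_set (v j) {..<m}" by (simp add: L2_set_def)
    finally show ?thesis using assms[of j] by linarith
  qed
  have "\<bar>dx I v\<bar> \<le> card {p. p permutes (UNIV::'n set)}" if I: "I \<in> multi_indices m" for I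
  proof -
    have "\<bar>dx I v\<bar> \<le> (\<Sum>p | p permutes (UNIV::'n set). \<bar>of_int (sign p) * (\<Prod>i\<in>UNIV. v i (I (p i)))\<bar>)"
      unfolding dx_def det_def by (simp add: sum_abs)
    also have "\<dots> \<le> (\<Sum>p | p permutes (UNIV::'n set). 1)"
    proof (intro sum_mono)
      fix p :: "'n \<Rightarrow> 'n"
      have "\<bar>of_int (sign p) * (\<Prod>i\<in>UNIV. v i (I (p i)))\<bar> = (\<Prod>i\<in>UNIV. \<bar>v i (I (p i))\<bar>)"
        by (simp add: abs_mult abs_prod sign_def)
      also have "\<dots> \<le> 1"
        using I v1 by (intro prod_le_1) (auto simp: multi_indices_def)
      finally show "\<bar>of_int (sign p) * (\<Prod>i\<in>UNIV. v i (I (p i)))\<bar> \<le> 1" .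
    qed
    finally show ?thesis by simp
  qed
  then have "(\<Sum>I\<in>multi_indices m. \<bar>\<omega> I * dx I v\<bar>) \<le> (\<Sum>I\<in>multi_indices m. \<bar>\<omega> I\<bar> * card {p. p permutes (UNIV::'n set)})"
    unfolding abs_mult by (intro sum_mono mult_left_mono) auto
  with sum_abs show ?thesis unfolding form_eval_def by (rule order_trans)
qed

lemma bdd_above_comass:
  fixes \<omega> :: "'n::{finite,linorder} const_form"
  shows "bdd_above ((\<lambda>v. \<bar>form_eval m \<omega> v\<bar>) ` {v. \<forall>j. L2_set (v j) {..<m} \<le> 1})"
  using form_eval_bound_unit by (intro bdd_aboveI2) auto

lemma comass_nonneg: "0 \<le> comass m (\<omega> :: 'n::{finite,linorder} const_form)"
proof -
  have "0 \<le> \<bar>form_eval m \<omega> (\<lambda>j i. 0)\<bar>" by simp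
  also have "\<dots> \<le> comass m \<omega>"
    unfolding comass_def by (rule cSUP_upper2[OF bdd_above_comass, of "\<lambda>j i. 0"]) (auto simp: L2_set_def)
  finally show ?thesis .
qed

lemma form_eval_prod_scale:
  fixes \<omega> :: "'n::{finite,linorder} const_form"
  shows "form_eval m \<omega> (\<lambda>j i. a j * v j i) = (\<Prod>j\<in>UNIV. a j) * form_eval m \<omega> v"
proof -
  have "dx I (\<lambda>j i. a j * v j i) = (\<Prod>j\<in>UNIV. a j) * dx I v" for I :: "'n \<Rightarrow> nat"
    unfolding dx_def using det_rows_mul[of a "\<lambda>j. \<chi> k. v j (I k)"]
    by (simp add: vector_scalar_mult_def)
  then show ?thesis by (simp add: form_eval_def sum_distrib_left mult.left_commute)
qed

text \<open>Homogeneity: every argument is scaled to norm one. An argument of norm zero cannot be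
  scaled, but its first \<open>m\<close> coordinates vanish and the form with them.\<close>

lemma form_eval_le_comass:
  fixes \<omega> :: "'n::{finite,linorder} const_form"
  shows "\<bar>form_eval m \<omega> v\<bar> \<le> comass m \<omega> * (\<Prod>j\<in>UNIV. L2_set (v j) {..<m})"
proof (cases "\<exists>j. L2_set (v j) {..<m} = 0")
  case True
  then obtain j where j: "L2_set (v j) {..<m} = 0" by blast
  then have z: "\<And>i. i < m \<Longrightarrow> v j i = 0" by (simp add: L2_set_eq_0_iff)
  have "form_eval m \<omega> v = form_eval m \<omega> (v(j := \<lambda>i. 0 * v j i))"
    using z by (intro form_eval_cong) auto
  also have "\<dots> = 0" unfolding form_eval_upd_scale by simp
  finally show ?thesis by (auto intro!: mult_nonneg_nonneg prod_nonneg simp: comass_nonneg)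
next
  case False
  define w where "w = (\<lambda>j i. inverse (L2_set (v j) {..<m}) * v j i)"
  have w: "L2_set (w j) {..<m} \<le> 1" for j
    using False unfolding w_def by (subst L2_set_right_distrib[symmetric]) auto
  have vw: "v = (\<lambda>j i. L2_set (v j) {..<m} * w j i)" using False by (simp add: w_def fun_eq_iff)
  have "form_eval m \<omega> v = (\<Prod>j\<in>UNIV. L2_set (v j) {..<m}) * form_eval m \<omega> w"
    using arg_cong[OF vw, of "form_eval m \<omega>"] form_eval_prod_scale by (rule trans)
  then have "\<bar>form_eval m \<omega> v\<bar> = (\<Prod>j\<in>UNIV. L2_set (v j) {..<m}) * \<bar>form_eval m \<omega> w\<bar>"
    by (simp add: abs_mult prod_nonneg)
  also have "\<dots> \<le> (\<Prod>j\<in>UNIV. L2_set (v j) {..<m}) * comass m \<omega>"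
    unfolding comass_def using w by (intro mult_left_mono cSUP_upper bdd_above_comass) (auto intro!: prod_nonneg)
  finally show ?thesis by (simp only: mult.commute)
qed

lemma comass_pos:
  fixes \<omega> :: "'n::{finite,linorder} const_form"
  assumes "const_volume_form m \<omega>"
  shows "0 < comass m \<omega>"
proof -
  obtain v where "form_eval m \<omega> v \<noteq> 0" using assms by (auto simp: const_volume_form_def)
  then have "0 < comass m \<omega> * (\<Prod>j\<in>UNIV. L2_set (v j) {..<m})"
    using form_eval_le_comass[of m \<omega> v] by linarith
  then show ?thesis using comass_nonneg[of m \<omega>] by (cases "comass m \<omega> = 0") auto
qed

lemma form_eval_has_real_derivative:
  fixes \<omega> :: "'n::{finite,linorder} const_form"
  assumes "\<And>j i. i < m \<Longrightarrow> ((\<lambda>t. V t j i) has_real_derivative V' j i) (at t0)"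
  shows "((\<lambda>t. form_eval m \<omega> (V t)) has_real_derivative (\<Sum>k\<in>UNIV. form_eval m \<omega> ((V t0)(k := V' k)))) (at t0)"
proof -
  have d: "((\<lambda>t. dx I (V t)) has_real_derivative (\<Sum>k\<in>UNIV. dx I ((V t0)(k := V' k)))) (at t0)"
    if I: "I \<in> multi_indices m" for I :: "'n \<Rightarrow> nat"
  proof -
    have lt: "I k < m" for k using I by (simp add: multi_indices_def)
    have "((\<lambda>t. \<Sum>p | p permutes (UNIV::'n set). of_int (sign p) * (\<Prod>i\<in>UNIV. V t i (I (p i)))) has_real_derivative
        (\<Sum>p | p permutes (UNIV::'n set). of_int (sign p) * (\<Sum>k\<in>UNIV. V' k (I (p k)) * (\<Prod>i\<in>UNIV - {k}. V t0 i (I (p i)))))) (at t0)"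
      by (intro DERIV_sum DERIV_cmult has_field_derivative_prod assms lt)
    moreover have "V' k (I (p k)) * (\<Prod>i\<in>UNIV - {k}. V t0 i (I (p i))) = (\<Prod>i\<in>UNIV. ((V t0)(k := V' k)) i (I (p i)))"
      for k and p :: "'n \<Rightarrow> 'n"
      by (subst prod.remove[of UNIV k]) (auto intro!: prod.cong)
    ultimately show ?thesis unfolding dx_def det_def
      by (simp add: sum_distrib_left sum.swap[of _ UNIV])
  qed
  have "((\<lambda>t. \<Sum>I\<in>multi_indices m. \<omega> I * dx I (V t)) has_real_derivative
      (\<Sum>I\<in>multi_indices m. \<omega> I * (\<Sum>k\<in>UNIV. dx I ((V t0)(k := V' k))))) (at t0)"
    by (intro DERIV_sum DERIV_cmult d)
  then show ?thesis unfolding form_eval_def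
    by (simp add: sum_distrib_left sum.swap[of _ UNIV])
qed

section \<open>Hilbert-Schmidt norm and operator norm of the differential\<close>

text \<open>The Hilbert-Schmidt norm of the linear map with rows \<open>L j\<close>. Unlike
  \<open>op_norm\<close> it is an explicit continuous function of the rows, and it still bounds the
  images of unit vectors.\<close>

definition hs_norm :: "nat \<Rightarrow> (nat \<Rightarrow> 'a::euclidean_space) \<Rightarrow> real" where
  "hs_norm m L = L2_set (\<lambda>j. norm (L j)) {..<m}"

lemma hs_norm_nonneg [simp]: "0 \<le> hs_norm m L"
  by (simp add: hs_norm_def)

lemma L2_inner_le_hs_norm:
  fixes L :: "nat \<Rightarrow> 'a::euclidean_space"
  shows "L2_set (\<lambda>j. L j \<bullet> h) {..<m} \<le> hs_norm m L * norm h"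
proof -
  have "L2_set (\<lambda>j. L j \<bullet> h) {..<m} \<le> L2_set (\<lambda>j. norm (L j) * norm h) {..<m}"
    unfolding L2_set_def
    by (intro real_sqrt_le_mono sum_mono) (metis Cauchy_Schwarz_ineq2 abs_ge_zero power2_abs power_mono)
  also have "\<dots> = hs_norm m L * norm h"
    unfolding hs_norm_def by (simp add: L2_set_left_distrib)
  finally show ?thesis .
qed

lemma bdd_above_op_norm:
  fixes L :: "nat \<Rightarrow> 'a::euclidean_space"
  shows "bdd_above ((\<lambda>h. L2_set (\<lambda>j. L j \<bullet> h) {..<m}) ` cball 0 1)"
proof (rule bdd_aboveI2)
  fix h :: 'a assume "h \<in> cball 0 1"
  then have "hs_norm m L * norm h \<le> hs_norm m L * 1" by (intro mult_left_mono) auto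
  then show "L2_set (\<lambda>j. L j \<bullet> h) {..<m} \<le> hs_norm m L"
    using L2_inner_le_hs_norm[of L h m] by simp
qed

lemma op_norm_le_hs_norm: "op_norm m L \<le> hs_norm m L"
  unfolding op_norm_def
proof (rule cSUP_least)
  fix h :: 'a assume "h \<in> cball 0 1"
  then have "hs_norm m L * norm h \<le> hs_norm m L * 1" by (intro mult_left_mono) auto
  then show "L2_set (\<lambda>j. L j \<bullet> h) {..<m} \<le> hs_norm m L"
    using L2_inner_le_hs_norm[of L h m] by simp
qed simp

lemma op_norm_nonneg: "0 \<le> op_norm m L"
  unfolding op_norm_def by (rule cSUP_upper2[OF bdd_above_op_norm, of 0]) auto

text \<open>Summing the squared entries by columns instead of rows leaves one operator norm for each
  source direction, so the factor involves the source dimension and not \<open>m\<close>.\<close>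

lemma hs_norm_le_op_norm:
  fixes L :: "nat \<Rightarrow> 'a::euclidean_space"
  shows "hs_norm m L \<le> sqrt (DIM('a)) * op_norm m L"
proof -
  have "(norm x)\<^sup>2 = (\<Sum>b\<in>Basis. (x \<bullet> b)\<^sup>2)" for x :: 'a
    unfolding power2_norm_eq_inner unfolding power2_eq_square by (rule euclidean_inner)
  then have "(hs_norm m L)\<^sup>2 = (\<Sum>j<m. \<Sum>b\<in>Basis. (L j \<bullet> b)\<^sup>2)"
    by (simp add: hs_norm_def L2_set_def sum_nonneg)
  also have "\<dots> = (\<Sum>b\<in>Basis. (L2_set (\<lambda>j. L j \<bullet> b) {..<m})\<^sup>2)"
    by (subst sum.swap) (simp add: L2_set_def sum_nonneg)
  also have "\<dots> \<le> (\<Sum>b\<in>(Basis::'a set). (op_norm m L)\<^sup>2)"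
    unfolding op_norm_def by (intro sum_mono power_mono cSUP_upper bdd_above_op_norm) auto
  also have "\<dots> = (sqrt (DIM('a)) * op_norm m L)\<^sup>2" by (simp add: power_mult_distrib)
  finally show ?thesis by (rule power2_le_imp_le) (simp add: op_norm_nonneg)
qed

section \<open>The null Lagrangian identity\<close>

text \<open>Difference quotients of \<open>u\<close> have integral zero by translation invariance,
  and they converge to \<open>v\<close> under a uniform bound from the mean value theorem.\<close>

lemma integral_directional_derivative_zero:
  fixes u v :: "'a::euclidean_space \<Rightarrow> real"
  assumes cont: "continuous_on UNIV u" "continuous_on UNIV v"
    and supp: "\<And>x. x \<notin> cball z r \<Longrightarrow> u x = 0 \<and> v x = 0"
    and der: "\<And>x. ((\<lambda>t. u (x + t *\<^sub>R e)) has_real_derivative v x) (at 0)"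
  shows "(LINT x|lborel. v x) = 0"
proof -
  have [measurable]: "u \<in> borel_measurable borel" "v \<in> borel_measurable borel"
    using cont by (auto intro: borel_measurable_continuous_onI)
  have "bounded (v ` cball z r)"
    using cont(2) by (intro compact_imp_bounded compact_continuous_image) (auto intro: continuous_on_subset)
  then obtain B where B: "B > 0" "\<And>x. x \<in> cball z r \<Longrightarrow> \<bar>v x\<bar> \<le> B"
    unfolding bounded_pos by auto
  have vB: "\<bar>v x\<bar> \<le> B" for x using B supp[of x] by (cases "x \<in> cball z r") auto
  have int_u: "integrable lborel u"
  proof -
    have "integrable lborel (\<lambda>x. indicator (cball z r) x *\<^sub>R u x)"
      using cont(1) by (intro borel_integrable_compact) (auto intro: continuous_on_subset)
    also have "(\<lambda>x. indicator (cball z r) x *\<^sub>R u x) = u" using supp by (auto simp: indicator_def fun_eq_iff)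
    finally show ?thesis .
  qed
  have der': "((\<lambda>t. u (x + t *\<^sub>R e)) has_real_derivative v (x + s *\<^sub>R e)) (at s)" for x s
  proof -
    have "((\<lambda>t. u (x + s *\<^sub>R e + t *\<^sub>R e)) has_real_derivative v (x + s *\<^sub>R e)) (at (s - s))"
      using der[of "x + s *\<^sub>R e"] by simp
    then have "((\<lambda>t. u (x + s *\<^sub>R e + (t - s) *\<^sub>R e)) has_real_derivative v (x + s *\<^sub>R e) * 1) (at s)"
      by (rule DERIV_chain2[where f = "\<lambda>t. u (x + s *\<^sub>R e + t *\<^sub>R e)" and g = "\<lambda>t. t - s"])
         (auto intro!: derivative_eq_intros)
    then show ?thesis by (simp add: algebra_simps)
  qed
  \<comment> \<open>Steps of at most 1 keep the supports of all difference quotients inside the ball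
    of radius \<open>r + norm e\<close>.\<close>
  define h where "h = (\<lambda>i::nat. 1 / real (Suc i))"
  have h: "0 < h i" "h i \<le> 1" for i by (auto simp: h_def field_simps)
  have h0: "h \<longlonglongrightarrow> 0" unfolding h_def by (rule LIMSEQ_Suc[OF lim_1_over_n])
  define q where "q = (\<lambda>i x. (u (x + h i *\<^sub>R e) - u x) / h i)"
  have q0: "(LINT x|lborel. q i x) = 0" for i
  proof -
    have eq: "(LINT x|lborel. u (h i *\<^sub>R e + x)) = (LINT x|lborel. u x)"
      using integral_distr[of "(+) (h i *\<^sub>R e)" lborel borel u] by (simp add: lborel_distr_plus)
    have "integrable lborel (\<lambda>x. u (h i *\<^sub>R e + x))"
      using int_u integrable_distr_eq[of "(+) (h i *\<^sub>R e)" lborel borel u] by (simp add: lborel_distr_plus)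
    then show ?thesis unfolding q_def using int_u eq by (simp add: add.commute)
  qed
  have "(\<lambda>i. LINT x|lborel. q i x) \<longlonglongrightarrow> (LINT x|lborel. v x)"
  proof (rule integral_dominated_convergence)
    show "integrable lborel (\<lambda>x. B * indicator (cball z (r + norm e)) x)"
      by (intro integrable_mult_right integrable_real_indicator) (auto intro: emeasure_lborel_cball_finite[unfolded infinity_ennreal_def])
    show "AE x in lborel. (\<lambda>i. q i x) \<longlonglongrightarrow> v x"
    proof (rule AE_I2)
      fix x
      have "((\<lambda>t. (u (x + t *\<^sub>R e) - u x) / t) \<longlongrightarrow> v x) (at 0)"
        using der[of x] by (simp add: has_field_derivative_iff)
      moreover have "filterlim h (at 0) sequentially"
        using h0 h(1) by (auto simp: filterlim_at less_imp_neq[OF h(1), symmetric])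
      ultimately show "(\<lambda>i. q i x) \<longlonglongrightarrow> v x"
        unfolding q_def by (rule filterlim_compose[where f = h])
    qed
    show "AE x in lborel. norm (q i x) \<le> B * indicator (cball z (r + norm e)) x" for i
    proof (rule AE_I2)
      fix x
      obtain s where s: "0 < s" "s < h i" "u (x + h i *\<^sub>R e) - u (x + 0 *\<^sub>R e) = (h i - 0) * v (x + s *\<^sub>R e)"
        using MVT2[OF h(1)[of i], where f = "\<lambda>t. u (x + t *\<^sub>R e)" and f' = "\<lambda>s. v (x + s *\<^sub>R e)"] der' by blast
      then have q: "q i x = v (x + s *\<^sub>R e)" using h(1)[of i] by (simp add: q_def)
      show "norm (q i x) \<le> B * indicator (cball z (r + norm e)) x"
      proof (cases "x \<in> cball z (r + norm e)")
        case True
        then show ?thesis using q vB by simp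
      next
        case False
        have "s * norm e \<le> 1 * norm e" using s h(2)[of i] by (intro mult_right_mono) auto
        moreover have "dist z x \<le> dist z (x + s *\<^sub>R e) + dist (x + s *\<^sub>R e) x" by (rule dist_triangle)
        ultimately have "r < dist z (x + s *\<^sub>R e)" using False s by (simp add: dist_norm)
        then show ?thesis using q supp[of "x + s *\<^sub>R e"] False by simp
      qed
    qed
  qed (auto simp: q_def)
  then show ?thesis unfolding q0 using LIMSEQ_unique tendsto_const by blast
qed

text \<open>C^2 maps with gradient and Hessian as explicit data: \<open>D2F j k\<close> is the
  gradient of the \<open>k\<close>-th partial derivative of the component \<open>j\<close>.
  Derivatives along lines and a symmetric Hessian are what the integration by parts uses, and for
  mollifications both are read off from the kernel.\<close>

definition smooth_map ::
    "(nat \<Rightarrow> (real, 'n::finite) vec \<Rightarrow> real) \<Rightarrow> (nat \<Rightarrow> (real, 'n) vec \<Rightarrow> (real, 'n) vec) \<Rightarrow>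
     (nat \<Rightarrow> 'n \<Rightarrow> (real, 'n) vec \<Rightarrow> (real, 'n) vec) \<Rightarrow> bool" where
  "smooth_map F DF D2F \<longleftrightarrow> (\<forall>j.
     continuous_on UNIV (F j) \<and> continuous_on UNIV (DF j) \<and> (\<forall>k. continuous_on UNIV (D2F j k)) \<and>
     (\<forall>x h. ((\<lambda>t. F j (x + t *\<^sub>R h)) has_real_derivative DF j x \<bullet> h) (at 0)) \<and>
     (\<forall>k x h. ((\<lambda>t. DF j (x + t *\<^sub>R h) $ k) has_real_derivative D2F j k x \<bullet> h) (at 0)) \<and>
     (\<forall>k l x. D2F j k x $ l = D2F j l x $ k))"

lemma sum_antisymmetric:
  fixes A :: "'n::finite \<Rightarrow> 'n \<Rightarrow> real"
  assumes "\<And>k l. k \<noteq> l \<Longrightarrow> A k l = - A l k"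
  shows "(\<Sum>k\<in>UNIV. \<Sum>l\<in>UNIV - {k}. A k l) = 0"
proof -
  define S where "S = (\<Sum>k\<in>UNIV. \<Sum>l\<in>UNIV. if l = k then 0 else A k l)"
  have eq: "(\<Sum>l\<in>UNIV - {k}. A k l) = (\<Sum>l\<in>UNIV. if l = k then 0 else A k l)" for k
    by (rule sum.mono_neutral_cong_left) auto
  have "S = (\<Sum>l\<in>UNIV. \<Sum>k\<in>UNIV. if l = k then 0 else A k l)" unfolding S_def by (rule sum.swap)
  also have "\<dots> = (\<Sum>l\<in>UNIV. \<Sum>k\<in>UNIV. - (if k = l then 0 else A l k))"
  proof (intro sum.cong refl)
    fix k l
    show "(if l = k then 0 else A k l) = - (if k = l then 0 else A l k)"
      using assms[of k l] by (cases "k = l") auto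
  qed
  also have "\<dots> = - S" by (simp add: S_def sum_negf)
  finally show ?thesis by (simp add: eq S_def)
qed

lemma continuous_on_form_eval:
  fixes \<omega> :: "'n::{finite,linorder} const_form" and v :: "'a::topological_space \<Rightarrow> 'n \<Rightarrow> nat \<Rightarrow> real"
  assumes "\<And>j i. continuous_on S (\<lambda>x. v x j i)"
  shows "continuous_on S (\<lambda>x. form_eval m \<omega> (v x))"
  unfolding form_eval_def dx_def det_def by (simp, intro continuous_intros assms)

section \<open>A cutoff function and Caccioppoli's inequality\<close>

text \<open>Squaring the positive part makes the cutoff C^1 across the sphere, which is enough for a
  single integration by parts; its gradient is at most \<open>4 / r\<close>.\<close>

definition bump :: "'a::euclidean_space \<Rightarrow> real \<Rightarrow> 'a \<Rightarrow> real" where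
  "bump z r x = (max 0 (1 - (norm (x - z))\<^sup>2 / r\<^sup>2))\<^sup>2"

lemma bump_has_derivative:
  fixes z :: "'a::euclidean_space"
  shows "((\<lambda>t. bump z r (x + t *\<^sub>R h)) has_real_derivative
     2 * max 0 (1 - (norm (x - z))\<^sup>2 / r\<^sup>2) * (- (2 * ((x - z) \<bullet> h) / r\<^sup>2))) (at 0)"
proof -
  have max_der: "((\<lambda>s::real. (max 0 s)\<^sup>2) has_real_derivative 2 * max 0 s) (at s)" for s
  proof (cases "s = 0")
    case True
    have "((\<lambda>t::real. (max 0 t)\<^sup>2 / t) \<longlongrightarrow> 0) (at 0)"
    proof (rule Lim_null_comparison)
      show "\<forall>\<^sub>F t in at 0. norm ((max 0 t)\<^sup>2 / t) \<le> \<bar>t\<bar>"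
        by (intro always_eventually allI) (auto simp: max_def power2_eq_square)
      show "((\<lambda>t::real. \<bar>t\<bar>) \<longlongrightarrow> 0) (at 0)" by (intro tendsto_eq_intros) auto
    qed
    then show ?thesis using True by (simp add: has_field_derivative_iff)
  next
    case False
    show ?thesis
    proof (cases "s > 0")
      case True
      have "((\<lambda>s::real. s\<^sup>2) has_real_derivative 2 * s) (at s)" by (auto intro!: derivative_eq_intros)
      then have "((\<lambda>s::real. (max 0 s)\<^sup>2) has_real_derivative 2 * s) (at s)"
        by (rule has_field_derivative_transform_within_open[where S = "{0<..}"]) (use True in auto)
      then show ?thesis using True by simp
    next
      case False2: False
      have "((\<lambda>s::real. 0) has_real_derivative 0) (at s)" by simp
      then have "((\<lambda>s::real. (max 0 s)\<^sup>2) has_real_derivative 0) (at s)"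
        by (rule has_field_derivative_transform_within_open[where S = "{..<0}"]) (use False False2 in auto)
      then show ?thesis using False2 by simp
    qed
  qed
  have in_der: "((\<lambda>t. 1 - (norm (x + t *\<^sub>R h - z))\<^sup>2 / r\<^sup>2) has_real_derivative - (2 * ((x - z) \<bullet> h) / r\<^sup>2)) (at 0)"
  proof -
    have "(norm (x + t *\<^sub>R h - z))\<^sup>2 = (norm (x - z))\<^sup>2 + t * (2 * ((x - z) \<bullet> h)) + t\<^sup>2 * (norm h)\<^sup>2" for t
    proof -
      have "(norm (x - z + t *\<^sub>R h))\<^sup>2 = (norm (x - z))\<^sup>2 + (norm (t *\<^sub>R h))\<^sup>2 + 2 * ((x - z) \<bullet> (t *\<^sub>R h))"
        using dot_norm[of "x - z" "t *\<^sub>R h"] by (simp add: field_simps)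
      moreover have eq: "x + t *\<^sub>R h - z = x - z + t *\<^sub>R h" by simp
      ultimately show ?thesis unfolding eq by (simp add: power_mult_distrib)
    qed
    then show ?thesis
      by (auto intro!: derivative_eq_intros simp: divide_inverse)
  qed
  show ?thesis unfolding bump_def
    by (rule DERIV_chain2[where f = "\<lambda>s. (max 0 s)\<^sup>2" and g = "\<lambda>t. 1 - (norm (x + t *\<^sub>R h - z))\<^sup>2 / r\<^sup>2"])
       (use max_der[of "1 - (norm (x - z))\<^sup>2 / r\<^sup>2"] in_der in simp_all)
qed

lemma bump_nonneg: "0 \<le> bump z r x" by (simp add: bump_def)

lemma bump_le_1: "bump z r x \<le> 1"
  by (simp add: bump_def power_le_one)

lemma bump_eq_0:
  assumes "r > 0" "x \<notin> ball z r"
  shows "bump z r x = 0"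
proof -
  have "r\<^sup>2 \<le> (norm (x - z))\<^sup>2" using assms by (intro power_mono) (auto simp: dist_norm norm_minus_commute)
  then have "1 \<le> (norm (x - z))\<^sup>2 / r\<^sup>2" using assms by simp
  then show ?thesis by (simp add: bump_def)
qed

lemma bump_ge:
  assumes "r > 0" "x \<in> ball z (r / 2)"
  shows "9 / 16 \<le> bump z r x"
proof -
  have "(norm (x - z))\<^sup>2 \<le> (r / 2)\<^sup>2" using assms by (intro power_mono) (auto simp: dist_norm norm_minus_commute)
  then have "(norm (x - z))\<^sup>2 / r\<^sup>2 \<le> 1 / 4" using assms by (simp add: field_simps power2_eq_square)
  then have "3 / 4 \<le> max 0 (1 - (norm (x - z))\<^sup>2 / r\<^sup>2)" by linarith
  then have "(3 / 4)\<^sup>2 \<le> (max 0 (1 - (norm (x - z))\<^sup>2 / r\<^sup>2))\<^sup>2" by (rule power_mono) simp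
  moreover have "(9 / 16 :: real) = (3 / 4)\<^sup>2" by (simp add: power2_eq_square)
  ultimately show ?thesis by (simp only: bump_def)
qed

lemma integrable_continuous_compact_support:
  fixes u :: "'a::euclidean_space \<Rightarrow> real"
  assumes "continuous_on UNIV u" "\<And>x. x \<notin> cball z r \<Longrightarrow> u x = 0"
  shows "integrable lborel u"
proof -
  have "integrable lborel (\<lambda>x. indicator (cball z r) x *\<^sub>R u x)"
    using assms(1) by (intro borel_integrable_compact) (auto intro: continuous_on_subset)
  also have "(\<lambda>x. indicator (cball z r) x *\<^sub>R u x) = u" using assms(2) by (auto simp: indicator_def fun_eq_iff)
  finally show ?thesis .
qed

lemma continuous_on_hs_norm:
  assumes "\<And>j. continuous_on S (L j)"
  shows "continuous_on S (\<lambda>x. hs_norm m (\<lambda>j. L j x))"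
  unfolding hs_norm_def L2_set_def by (intro continuous_intros assms)

text \<open>Let P be the form evaluated at the partial derivatives of F, and V_k the same with F - c
  in slot k. Then \<partial>_k V_k is P plus terms with the second derivative \<partial>_k
  \<partial>_l F in slot l. These terms are antisymmetric in k and l and cancel in the sum over k,
  so n P is the divergence of (V_1, ..., V_n). Against the cutoff the derivative moves to the
  cutoff, and each V_k contains F - c once and n - 1 first derivatives.\<close>

lemma caccioppoli:
  fixes \<omega> :: "'n::{finite,linorder} const_form" and z :: "(real, 'n) vec"
  assumes smooth: "smooth_map F DF D2F" and r: "r > 0"
  shows "\<bar>LINT x|lborel. bump z r x * star_pullback m \<omega> (\<lambda>j. DF j x)\<bar>
    \<le> 4 / r * comass m \<omega> * (LINT x|lborel. indicator (ball z r) x *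
        (L2_set (\<lambda>j. F j x - c j) {..<m} * hs_norm m (\<lambda>j. DF j x) ^ (CARD('n) - 1)))"
proof -
  note sm = smooth[unfolded smooth_map_def, rule_format]
  have cont: "continuous_on UNIV (F j)" "continuous_on UNIV (\<lambda>x. DF j x $ k)" "continuous_on UNIV (\<lambda>x. D2F j k x $ l)" for j k l
    using sm by (auto intro!: continuous_on_component)
  have contDF: "continuous_on UNIV (DF j)" for j using sm by auto
  have der: "((\<lambda>t. F j (x + t *\<^sub>R h)) has_real_derivative DF j x \<bullet> h) (at 0)"
    "((\<lambda>t. DF j (x + t *\<^sub>R h) $ k) has_real_derivative D2F j k x \<bullet> h) (at 0)" for j k x h
    using sm by auto
  have sym: "D2F j k x $ l = D2F j l x $ k" for j k l x using sm by auto
  define W where "W = (\<lambda>x k j. DF j x $ k)"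
  define X where "X = (\<lambda>x j. F j x - c j)"
  define Y where "Y = (\<lambda>x k l j. D2F j l x $ k)"
  define P where "P = (\<lambda>x. form_eval m \<omega> (W x))"
  define V where "V = (\<lambda>k x. form_eval m \<omega> ((W x)(k := X x)))"
  define A where "A = (\<lambda>x k l. form_eval m \<omega> ((W x)(k := X x, l := Y x k l)))"
  define b' where "b' = (\<lambda>k x. 2 * max 0 (1 - (norm (x - z))\<^sup>2 / r\<^sup>2) * (- (2 * ((x - z) \<bullet> axis k 1) / r\<^sup>2)))"
  have P: "star_pullback m \<omega> (\<lambda>j. DF j x) = P x" for x
    by (simp add: star_pullback_def P_def W_def inner_axis)
  have contW: "continuous_on UNIV (\<lambda>x. W x j i)" "continuous_on UNIV (\<lambda>x. X x i)" "continuous_on UNIV (\<lambda>x. Y x k l i)" for i j k l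
    unfolding W_def X_def Y_def by (intro continuous_intros cont)+
  have contP: "continuous_on UNIV P"
    unfolding P_def by (intro continuous_on_form_eval contW)
  have contV: "continuous_on UNIV (V k)" for k
    unfolding V_def
  proof (intro continuous_on_form_eval)
    show "continuous_on UNIV (\<lambda>x. ((W x)(k := X x)) j i)" for j i
      by (cases "j = k") (auto intro: contW)
  qed
  have contA: "continuous_on UNIV (\<lambda>x. A x k l)" for k l
    unfolding A_def
  proof (intro continuous_on_form_eval)
    show "continuous_on UNIV (\<lambda>x. ((W x)(k := X x, l := Y x k l)) j i)" for j i
      by (cases "j = k"; cases "j = l") (auto intro: contW)
  qed
  have contb: "continuous_on UNIV (bump z r)" "continuous_on UNIV (b' k)" for k
    using r unfolding bump_def b'_def by (auto intro!: continuous_intros)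
  have derV: "((\<lambda>t. V k (x + t *\<^sub>R axis k 1)) has_real_derivative P x + (\<Sum>l\<in>UNIV - {k}. A x k l)) (at 0)" for k x
  proof -
    define Vt where "Vt = (\<lambda>t. (W (x + t *\<^sub>R axis k 1))(k := X (x + t *\<^sub>R axis k 1)))"
    have Vt0: "Vt 0 = (W x)(k := X x)" by (simp add: Vt_def)
    \<comment> \<open>The derivative of slot k, where F - c stands, restores \<partial>_k F and
      thereby P; that of another slot l is a second derivative.\<close>
    define V' where "V' = (\<lambda>l j. if l = k then W x k j else Y x k l j)"
    have "((\<lambda>t. form_eval m \<omega> (Vt t)) has_real_derivative (\<Sum>l\<in>UNIV. form_eval m \<omega> ((Vt 0)(l := V' l)))) (at 0)"
    proof (rule form_eval_has_real_derivative)
      fix l i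
      show "((\<lambda>t. Vt t l i) has_real_derivative V' l i) (at 0)"
      proof (cases "l = k")
        case True
        have "((\<lambda>t. F i (x + t *\<^sub>R axis k 1) - c i) has_real_derivative DF i x \<bullet> axis k 1 - 0) (at 0)"
          by (intro DERIV_diff der DERIV_const)
        then show ?thesis using True by (simp add: Vt_def V'_def X_def W_def inner_axis)
      next
        case False
        then show ?thesis using der(2)[where h = "axis k 1"] by (simp add: Vt_def V'_def W_def Y_def inner_axis)
      qed
    qed
    also have "(\<Sum>l\<in>UNIV. form_eval m \<omega> ((Vt 0)(l := V' l))) = form_eval m \<omega> ((Vt 0)(k := V' k)) + (\<Sum>l\<in>UNIV - {k}. form_eval m \<omega> ((Vt 0)(l := V' l)))"
      by (rule sum.remove) auto
    also have "form_eval m \<omega> ((Vt 0)(k := V' k)) = P x"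
    proof -
      have "(Vt 0)(k := V' k) = W x" by (auto simp: Vt_def V'_def fun_eq_iff)
      then show ?thesis by (simp add: P_def)
    qed
    also have "(\<Sum>l\<in>UNIV - {k}. form_eval m \<omega> ((Vt 0)(l := V' l))) = (\<Sum>l\<in>UNIV - {k}. A x k l)"
    proof (intro sum.cong refl)
      fix l assume "l \<in> UNIV - {k}"
      then have "V' l = Y x k l" by (auto simp: V'_def)
      then show "form_eval m \<omega> ((Vt 0)(l := V' l)) = A x k l" using Vt0 by (simp only: A_def)
    qed
    finally show ?thesis by (simp only: Vt_def V_def)
  qed
  \<comment> \<open>Exchanging \<open>k\<close> and \<open>l\<close> swaps the arguments
    \<open>X x\<close> and \<open>Y x k l\<close>. The latter is symmetric in \<open>k\<close> and
    \<open>l\<close> as a second derivative, and the form changes sign.\<close>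
  have A0: "(\<Sum>k\<in>UNIV. \<Sum>l\<in>UNIV - {k}. A x k l) = 0" for x
  proof (rule sum_antisymmetric)
    fix k l :: 'n assume kl: "k \<noteq> l"
    have "Y x k l = Y x l k" unfolding Y_def by (rule ext) (rule sym)
    then have "A x l k = form_eval m \<omega> ((W x)(k := Y x k l, l := X x))"
      using fun_upd_twist[OF kl, of "W x" "Y x k l" "X x"] by (simp only: A_def)
    moreover have "A x k l = - form_eval m \<omega> ((W x)(k := Y x k l, l := X x))"
      unfolding A_def by (rule form_eval_swap[OF kl])
    ultimately show "A x k l = - A x l k" by simp
  qed
  define v where "v = (\<lambda>k x. b' k x * V k x + (P x + (\<Sum>l\<in>UNIV - {k}. A x k l)) * bump z r x)"
  have out: "bump z r x = 0 \<and> b' k x = 0" if "x \<notin> ball z r" for x k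
  proof -
    have "r\<^sup>2 \<le> (norm (x - z))\<^sup>2" using r that by (intro power_mono) (auto simp: dist_norm norm_minus_commute)
    then have "max 0 (1 - (norm (x - z))\<^sup>2 / r\<^sup>2) = 0" using r by (simp add: max_def)
    then show ?thesis by (simp add: bump_def b'_def)
  qed
  have v0: "v k x = 0" if "x \<notin> cball z r" for k x
    using out[of x k] that by (auto simp: v_def)
  have contv: "continuous_on UNIV (v k)" for k
    unfolding v_def by (intro continuous_intros contb contV contP contA)
  have intv: "integrable lborel (v k)" for k
    using contv v0 by (rule integrable_continuous_compact_support)
  have "(LINT x|lborel. v k x) = 0" for k
  proof (rule integral_directional_derivative_zero[where u = "\<lambda>x. bump z r x * V k x" and z = z and r = r and e = "axis k 1"])
    show "continuous_on UNIV (\<lambda>x. bump z r x * V k x)" by (intro continuous_intros contb contV)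
    fix x
    have "((\<lambda>t. bump z r (x + t *\<^sub>R axis k 1) * V k (x + t *\<^sub>R axis k 1)) has_real_derivative
        b' k x * V k (x + 0 *\<^sub>R axis k 1) + (P x + (\<Sum>l\<in>UNIV - {k}. A x k l)) * bump z r (x + 0 *\<^sub>R axis k 1)) (at 0)"
      unfolding b'_def by (intro DERIV_mult bump_has_derivative derV)
    then show "((\<lambda>t. bump z r (x + t *\<^sub>R axis k 1) * V k (x + t *\<^sub>R axis k 1)) has_real_derivative v k x) (at 0)"
      by (simp add: v_def)
    show "x \<notin> cball z r \<Longrightarrow> bump z r x * V k x = 0 \<and> v k x = 0"
      using out[of x k] v0[of x k] by auto
  qed (rule contv)
  then have "(LINT x|lborel. (\<Sum>k\<in>UNIV. v k x)) = 0"
    by (subst Bochner_Integration.integral_sum) (auto intro: intv)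
  moreover have "(\<Sum>k\<in>UNIV. v k x) = (\<Sum>k\<in>UNIV. b' k x * V k x) + real CARD('n) * (bump z r x * P x)" for x
    using A0[of x] by (simp add: v_def sum.distrib distrib_right sum_distrib_right[symmetric])
  moreover have int1: "integrable lborel (\<lambda>x. \<Sum>k\<in>UNIV. b' k x * V k x)"
  proof (rule integrable_continuous_compact_support)
    show "continuous_on UNIV (\<lambda>x. \<Sum>k\<in>UNIV. b' k x * V k x)" by (intro continuous_intros contb contV)
    show "x \<notin> cball z r \<Longrightarrow> (\<Sum>k\<in>UNIV. b' k x * V k x) = 0" for x
      using out[of x] by (intro sum.neutral) auto
  qed
  moreover have int2: "integrable lborel (\<lambda>x. bump z r x * P x)"
  proof (rule integrable_continuous_compact_support)
    show "continuous_on UNIV (\<lambda>x. bump z r x * P x)" by (intro continuous_intros contb contP)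
    show "x \<notin> cball z r \<Longrightarrow> bump z r x * P x = 0" for x
      using out[of x] by auto
  qed
  ultimately have eq: "real CARD('n) * (LINT x|lborel. bump z r x * P x) = - (LINT x|lborel. (\<Sum>k\<in>UNIV. b' k x * V k x))"
    by simp
  define T where "T = (\<lambda>x. indicator (ball z r) x * (L2_set (X x) {..<m} * hs_norm m (\<lambda>j. DF j x) ^ (CARD('n) - 1)))"
  have intT: "integrable lborel T"
  proof -
    have "integrable lborel (\<lambda>x. indicator (cball z r) x *\<^sub>R (L2_set (X x) {..<m} * hs_norm m (\<lambda>j. DF j x) ^ (CARD('n) - 1)))"
      unfolding L2_set_def
      by (intro borel_integrable_compact continuous_intros continuous_on_hs_norm
          continuous_on_subset[OF contW(2) subset_UNIV] continuous_on_subset[OF contDF subset_UNIV]) auto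
    then have "integrable lborel (\<lambda>x. indicator (ball z r) x *\<^sub>R (indicator (cball z r) x *\<^sub>R (L2_set (X x) {..<m} * hs_norm m (\<lambda>j. DF j x) ^ (CARD('n) - 1))))"
      by (rule integrable_mult_indicator[rotated]) simp
    also have "(\<lambda>x. indicator (ball z r) x *\<^sub>R (indicator (cball z r) x *\<^sub>R (L2_set (X x) {..<m} * hs_norm m (\<lambda>j. DF j x) ^ (CARD('n) - 1)))) = T"
      by (auto simp: T_def indicator_def fun_eq_iff)
    finally show ?thesis .
  qed
  \<comment> \<open>The factor \<open>CARD('n)\<close> counts the summands; it cancels against the
    one in front of P.\<close>
  have bound: "\<bar>\<Sum>k\<in>UNIV. b' k x * V k x\<bar> \<le> real CARD('n) * (4 / r * comass m \<omega>) * T x" for x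
  proof (cases "x \<in> ball z r")
    case False
    then have "(\<Sum>k\<in>UNIV. b' k x * V k x) = 0" using out[of x] by (intro sum.neutral) auto
    then show ?thesis using False by (simp add: T_def)
  next
    case True
    have "\<bar>b' k x * V k x\<bar> \<le> 4 / r * (comass m \<omega> * T x)" for k
      unfolding abs_mult
    proof (rule mult_mono)
      have "\<bar>(x - z) \<bullet> axis k 1\<bar> \<le> norm (x - z) * norm (axis k (1::real))" by (rule Cauchy_Schwarz_ineq2)
      then have 1: "\<bar>(x - z) \<bullet> axis k 1\<bar> \<le> r" using True by (simp add: dist_norm norm_minus_commute)
      have "\<bar>b' k x\<bar> = (2 * max 0 (1 - (norm (x - z))\<^sup>2 / r\<^sup>2)) * (2 * \<bar>(x - z) \<bullet> axis k 1\<bar> / r\<^sup>2)"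
        by (simp add: b'_def abs_mult)
      also have "\<dots> \<le> 2 * (2 * r / r\<^sup>2)"
        using 1 r by (intro mult_mono divide_right_mono) auto
      also have "\<dots> = 4 / r" using r by (simp add: power2_eq_square)
      finally show "\<bar>b' k x\<bar> \<le> 4 / r" .
      have "(\<Prod>l\<in>UNIV. L2_set (((W x)(k := X x)) l) {..<m}) = L2_set (X x) {..<m} * (\<Prod>l\<in>UNIV - {k}. L2_set (W x l) {..<m})"
        by (subst prod.remove[of UNIV k]) (auto intro!: prod.cong)
      also have "\<dots> \<le> L2_set (X x) {..<m} * (\<Prod>l\<in>UNIV - {k}. hs_norm m (\<lambda>j. DF j x))"
      proof (intro mult_left_mono prod_mono conjI L2_set_nonneg)
        fix l
        show "L2_set (W x l) {..<m} \<le> hs_norm m (\<lambda>j. DF j x)"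
          using L2_inner_le_hs_norm[of "\<lambda>j. DF j x" "axis l 1" m] by (simp add: W_def inner_axis)
      qed
      finally have le: "comass m \<omega> * (\<Prod>l\<in>UNIV. L2_set (((W x)(k := X x)) l) {..<m})
          \<le> comass m \<omega> * (L2_set (X x) {..<m} * (\<Prod>l\<in>UNIV - {k}. hs_norm m (\<lambda>j. DF j x)))"
        by (intro mult_left_mono comass_nonneg)
      have "\<bar>V k x\<bar> \<le> comass m \<omega> * (L2_set (X x) {..<m} * (\<Prod>l\<in>UNIV - {k}. hs_norm m (\<lambda>j. DF j x)))"
        unfolding V_def by (rule order_trans[OF form_eval_le_comass le])
      moreover have "(\<Prod>l\<in>UNIV - {k}. hs_norm m (\<lambda>j. DF j x)) = hs_norm m (\<lambda>j. DF j x) ^ (CARD('n) - 1)"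
        by (simp add: card_Diff_singleton)
      ultimately have "\<bar>V k x\<bar> \<le> comass m \<omega> * (L2_set (X x) {..<m} * hs_norm m (\<lambda>j. DF j x) ^ (CARD('n) - 1))"
        by (simp only:)
      then show "\<bar>V k x\<bar> \<le> comass m \<omega> * T x" using True by (simp add: T_def less_imp_le)
    qed (use r in auto)
    then have "(\<Sum>k\<in>UNIV. \<bar>b' k x * V k x\<bar>) \<le> (\<Sum>k\<in>(UNIV::'n set). 4 / r * (comass m \<omega> * T x))"
      by (rule sum_mono)
    then have "(\<Sum>k\<in>UNIV. \<bar>b' k x * V k x\<bar>) \<le> real CARD('n) * (4 / r * comass m \<omega>) * T x"
      by (simp add: mult.assoc)
    with sum_abs show ?thesis by (rule order_trans)
  qed
  have "real CARD('n) * \<bar>LINT x|lborel. bump z r x * P x\<bar> = \<bar>LINT x|lborel. (\<Sum>k\<in>UNIV. b' k x * V k x)\<bar>"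
    using arg_cong[OF eq, of abs] unfolding abs_mult by simp
  also have "\<dots> \<le> (LINT x|lborel. \<bar>\<Sum>k\<in>UNIV. b' k x * V k x\<bar>)" by (rule integral_abs_bound)
  also have "\<dots> \<le> (LINT x|lborel. real CARD('n) * (4 / r * comass m \<omega>) * T x)"
    by (intro integral_mono bound integrable_abs int1 integrable_mult_right intT)
  also have "\<dots> = real CARD('n) * (4 / r * comass m \<omega> * (LINT x|lborel. T x))" by (simp add: mult.assoc)
  finally have "\<bar>LINT x|lborel. bump z r x * P x\<bar> \<le> 4 / r * comass m \<omega> * (LINT x|lborel. T x)"
    by (rule mult_left_le_imp_le) simp
  then show ?thesis unfolding P T_def X_def .
qed

section \<open>Mollification\<close>

lemma power_le_fact_exp:
  fixes s :: real
  assumes "0 \<le> s"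
  shows "s ^ N \<le> fact N * exp s"
proof -
  have "s ^ N / fact N \<le> (\<Sum>n. s ^ n / fact n)"
    using sum_le_suminf[of "\<lambda>n. s ^ n / fact n" "{N}"] summable_exp[of s] assms by (simp add: divide_inverse mult.commute)
  also have "\<dots> = exp s" by (simp add: exp_def divide_inverse mult.commute)
  finally show ?thesis by (simp add: field_simps)
qed

text \<open>Numerators of the derivatives of exp(-1 / D) with D = 1 - t^2, which is
  \<open>[:1, 0, -1:]\<close>. The recursion is the quotient rule over the common denominator D^(2 k
  + 2): its three terms come from differentiating the numerator, the denominator and the
  exponential.\<close>

primrec bump_poly :: "nat \<Rightarrow> real poly" where
  "bump_poly 0 = 1"
| "bump_poly (Suc k) = pderiv (bump_poly k) * [:1, 0, -1:] ^ 2
     + smult (4 * real k) ([:0, 1:] * bump_poly k * [:1, 0, -1:]) - smult 2 ([:0, 1:] * bump_poly k)"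

text \<open>\<open>smooth_bump k\<close> is the \<open>k\<close>-th derivative of \<open>exp (- 1 / (1 - t\<^sup>2))\<close> on \<open>(-1, 1)\<close>.\<close>

definition smooth_bump :: "nat \<Rightarrow> real \<Rightarrow> real" where
  "smooth_bump k t = (if \<bar>t\<bar> < 1 then poly (bump_poly k) t / (1 - t\<^sup>2) ^ (2 * k) * exp (- (1 / (1 - t\<^sup>2))) else 0)"

text \<open>The point is the double zero at both ends of the interval, which forces the derivative
  to vanish there.\<close>

lemma smooth_bump_bound: "\<exists>C. \<forall>t. \<bar>smooth_bump k t\<bar> \<le> C * (1 - t\<^sup>2)\<^sup>2"
proof -
  have "bounded (poly (bump_poly k) ` {-1..1})"
    by (intro compact_imp_bounded compact_continuous_image continuous_intros) auto
  then obtain B where B: "B > 0" "\<And>t. t \<in> {-1..1} \<Longrightarrow> \<bar>poly (bump_poly k) t\<bar> \<le> B"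
    unfolding bounded_pos by auto
  show ?thesis
  \<comment> \<open>With s = 1 / (1 - t^2) the bound amounts to s^(2 k + 2) exp(-s) \<le> (2 k +
    2)!, a single term of the exponential series.\<close>
  proof (intro exI[of _ "B * fact (2 * k + 2)"] allI)
    fix t
    show "\<bar>smooth_bump k t\<bar> \<le> B * fact (2 * k + 2) * (1 - t\<^sup>2)\<^sup>2"
    proof (cases "\<bar>t\<bar> < 1")
      case True
      define s where "s = 1 / (1 - t\<^sup>2)"
      have t2: "t\<^sup>2 < 1" using True by (simp add: abs_square_less_1)
      then have s: "s > 0" by (simp add: s_def)
      have inv: "1 - t\<^sup>2 = 1 / s" by (simp add: s_def)
      have "s ^ (2 * k + 2) * exp (- s) \<le> fact (2 * k + 2)"
        using power_le_fact_exp[of s "2 * k + 2"] s by (simp add: exp_minus field_simps)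
      then have le: "s ^ (2 * k) * exp (- s) \<le> fact (2 * k + 2) * (1 / s)\<^sup>2"
        using s by (simp add: field_simps power_add power2_eq_square)
      have "\<bar>smooth_bump k t\<bar> = \<bar>poly (bump_poly k) t\<bar> * (s ^ (2 * k) * exp (- s))"
        using True s t2 by (simp add: smooth_bump_def s_def abs_mult power_divide)
      also have "\<dots> \<le> B * (fact (2 * k + 2) * (1 / s)\<^sup>2)"
      proof (rule mult_mono)
        show "\<bar>poly (bump_poly k) t\<bar> \<le> B" using True by (intro B(2)) auto
      qed (use B le s in auto)
      finally show ?thesis by (simp add: inv)
    next
      case False
      then show ?thesis using B by (simp add: smooth_bump_def)
    qed
  qed
qed

lemma smooth_bump_derivative: "(smooth_bump k has_real_derivative smooth_bump (Suc k) t) (at t)"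
proof -
  consider "\<bar>t\<bar> < 1" | "\<bar>t\<bar> = 1" | "\<bar>t\<bar> > 1" by linarith
  then show ?thesis
  proof cases
    case 1
    have t2: "t\<^sup>2 < 1" using 1 by (simp add: abs_square_less_1)
    define D where "D = 1 - t\<^sup>2"
    have D: "D > 0" using t2 by (simp add: D_def)
    have e: "((\<lambda>t. exp (- (1 / (1 - t\<^sup>2)))) has_real_derivative - (2 * t / D\<^sup>2) * exp (- (1 / D))) (at t)"
      using D by (auto intro!: derivative_eq_intros simp: D_def power2_eq_square)
    have p: "((\<lambda>t. (1 - t\<^sup>2) ^ (2 * k)) has_real_derivative real (2 * k) * D ^ (2 * k - 1) * (- (2 * t))) (at t)"
      by (auto intro!: derivative_eq_intros simp: D_def)
    have pd: "((\<lambda>t. poly (bump_poly k) t / (1 - t\<^sup>2) ^ (2 * k)) has_real_derivative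
       (poly (pderiv (bump_poly k)) t * D ^ (2 * k) - poly (bump_poly k) t * (real (2 * k) * D ^ (2 * k - 1) * (- (2 * t)))) / (D ^ (2 * k) * D ^ (2 * k))) (at t)"
      using DERIV_divide[OF poly_DERIV[of "bump_poly k" t] p] D by (simp add: D_def)
    have "((\<lambda>t. poly (bump_poly k) t / (1 - t\<^sup>2) ^ (2 * k) * exp (- (1 / (1 - t\<^sup>2)))) has_real_derivative
       (poly (pderiv (bump_poly k)) t * D ^ (2 * k) - poly (bump_poly k) t * (real (2 * k) * D ^ (2 * k - 1) * (- (2 * t)))) / (D ^ (2 * k) * D ^ (2 * k)) * exp (- (1 / D))
        + - (2 * t / D\<^sup>2) * exp (- (1 / D)) * (poly (bump_poly k) t / D ^ (2 * k))) (at t)"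
      using DERIV_mult[OF pd e] by (simp add: D_def)
    also have "(poly (pderiv (bump_poly k)) t * D ^ (2 * k) - poly (bump_poly k) t * (real (2 * k) * D ^ (2 * k - 1) * (- (2 * t)))) / (D ^ (2 * k) * D ^ (2 * k)) * exp (- (1 / D))
        + - (2 * t / D\<^sup>2) * exp (- (1 / D)) * (poly (bump_poly k) t / D ^ (2 * k))
        = smooth_bump (Suc k) t"
    proof -
      have sb: "smooth_bump (Suc k) t = (poly (pderiv (bump_poly k)) t * D\<^sup>2 + 4 * real k * t * poly (bump_poly k) t * D - 2 * t * poly (bump_poly k) t)
          / (D ^ (2 * k) * D\<^sup>2) * exp (- (1 / D))"
        using 1 by (simp add: smooth_bump_def D_def power2_eq_square algebra_simps power_add)
      have c1: "real (2 * k) * D ^ (2 * k - 1) = 2 * real k * D ^ (2 * k) / D"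
        using D by (cases k) (auto simp: field_simps)
      show ?thesis unfolding sb c1 using D by (simp add: field_simps power2_eq_square)
    qed
    finally show ?thesis
      by (rule has_field_derivative_transform_within_open[where S = "{-1<..<1}"]) (use 1 in \<open>auto simp: smooth_bump_def abs_if split: if_splits\<close>)
  next
    case 2
    obtain C where C: "\<And>t. \<bar>smooth_bump k t\<bar> \<le> C * (1 - t\<^sup>2)\<^sup>2" using smooth_bump_bound by blast
    have z: "smooth_bump j t = 0" for j using 2 by (simp add: smooth_bump_def)
    have "((\<lambda>y. (smooth_bump k y - smooth_bump k t) / (y - t)) \<longlongrightarrow> 0) (at t)"
    proof (rule Lim_null_comparison)
      \<comment> \<open>Since t^2 = 1, (1 - y^2)^2 is the product of (y - t)^2 and (y + t)^2, so the
        difference quotient keeps a factor that tends to 0.\<close>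
      have t2: "t\<^sup>2 = 1" using 2 by (simp add: abs_square_eq_1)
      show "\<forall>\<^sub>F y in at t. norm ((smooth_bump k y - smooth_bump k t) / (y - t)) \<le> \<bar>C\<bar> * (\<bar>y - t\<bar> * (y + t)\<^sup>2)"
      proof (intro always_eventually allI)
        fix y
        have "\<bar>smooth_bump k y\<bar> \<le> \<bar>C\<bar> * (1 - y\<^sup>2)\<^sup>2"
          using C[of y] by (meson abs_ge_self mult_right_mono order_trans zero_le_power2)
        also have "(1 - y\<^sup>2)\<^sup>2 = (y - t)\<^sup>2 * (y + t)\<^sup>2"
          using t2 by (simp flip: power_mult_distrib) (simp add: power2_eq_square algebra_simps)
        finally have "\<bar>smooth_bump k y\<bar> \<le> \<bar>C\<bar> * ((y - t)\<^sup>2 * (y + t)\<^sup>2)" .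
        then show "norm ((smooth_bump k y - smooth_bump k t) / (y - t)) \<le> \<bar>C\<bar> * (\<bar>y - t\<bar> * (y + t)\<^sup>2)"
          by (cases "y = t") (simp_all add: z abs_mult power2_eq_square field_simps abs_if split: if_splits)
      qed
      show "((\<lambda>y. \<bar>C\<bar> * (\<bar>y - t\<bar> * (y + t)\<^sup>2)) \<longlongrightarrow> 0) (at t)"
        by (auto intro!: tendsto_eq_intros)
    qed
    then show ?thesis by (simp add: has_field_derivative_iff z)
  next
    case 3
    have "((\<lambda>t. 0) has_real_derivative 0) (at t)" by simp
    then have "(smooth_bump k has_real_derivative 0) (at t)"
      by (rule has_field_derivative_transform_within_open[where S = "- {-1..1}"]) (use 3 in \<open>auto simp: smooth_bump_def\<close>)
    then show ?thesis using 3 by (simp add: smooth_bump_def)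
  qed
qed

lemma smooth_bump_outside: "\<bar>t\<bar> \<ge> 1 \<Longrightarrow> smooth_bump k t = 0"
  by (simp add: smooth_bump_def)

lemma smooth_bump_0_nonneg: "0 \<le> smooth_bump 0 t" and smooth_bump_0_pos: "\<bar>t\<bar> < 1 \<Longrightarrow> 0 < smooth_bump 0 t"
  by (simp_all add: smooth_bump_def)

lemma continuous_smooth_bump: "continuous_on S (smooth_bump k)"
  using smooth_bump_derivative DERIV_isCont continuous_at_imp_continuous_on by blast

text \<open>\<open>\<kappa> b\<close> counts the derivatives in direction \<open>b\<close>. A
  product of one-dimensional bumps has partial derivatives of the same form. Its support is the cube
  [-1, 1]^n, enclosed below in a ball of radius \<open>DIM('a)\<close>.\<close>

definition bump_prod :: "('a::euclidean_space \<Rightarrow> nat) \<Rightarrow> 'a \<Rightarrow> real" where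
  "bump_prod \<kappa> x = (\<Prod>b\<in>Basis. smooth_bump (\<kappa> b) (x \<bullet> b))"

lemma continuous_bump_prod: "continuous_on S (bump_prod \<kappa>)"
  unfolding bump_prod_def
  by (intro continuous_on_prod continuous_on_compose2[OF continuous_smooth_bump[where S = UNIV]] continuous_intros) auto

lemma bump_prod_outside:
  fixes x :: "'a::euclidean_space"
  assumes "x \<notin> cball 0 (DIM('a))"
  shows "bump_prod \<kappa> x = 0"
proof -
  have "\<exists>b\<in>Basis. 1 \<le> \<bar>x \<bullet> b\<bar>"
  proof (rule ccontr)
    assume "\<not> ?thesis"
    then have "(\<Sum>b\<in>Basis. \<bar>x \<bullet> b\<bar>) \<le> (\<Sum>b\<in>(Basis::'a set). 1)" by (intro sum_mono) (simp add: not_le less_imp_le)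
    then have "norm x \<le> DIM('a)" using norm_le_l1[of x] by simp
    then show False using assms by simp
  qed
  then show ?thesis unfolding bump_prod_def
    by (auto intro!: prod_zero dest: smooth_bump_outside)
qed

lemma bump_prod_bounded: "\<exists>B>0. \<forall>x::'a::euclidean_space. \<bar>bump_prod \<kappa> x\<bar> \<le> B"
proof -
  have "bounded (bump_prod \<kappa> ` cball (0::'a) (DIM('a)))"
    by (intro compact_imp_bounded compact_continuous_image continuous_bump_prod compact_cball)
  then obtain B where B: "B > 0" "\<And>x. x \<in> cball (0::'a) (DIM('a)) \<Longrightarrow> \<bar>bump_prod \<kappa> x\<bar> \<le> B"
    unfolding bounded_pos by auto
  then show ?thesis using bump_prod_outside by (metis abs_zero less_imp_le)
qed

lemma bump_prod_has_derivative:
  fixes x :: "'a::euclidean_space"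
  shows "(bump_prod \<kappa> has_derivative (\<lambda>h. \<Sum>b\<in>Basis. bump_prod (\<kappa>(b := Suc (\<kappa> b))) x * (h \<bullet> b))) (at x)"
proof -
  have "(bump_prod \<kappa> has_derivative (\<lambda>h. \<Sum>b\<in>Basis. (smooth_bump (Suc (\<kappa> b)) (x \<bullet> b) * (h \<bullet> b)) * (\<Prod>c\<in>Basis - {b}. smooth_bump (\<kappa> c) (x \<bullet> c)))) (at x)"
    unfolding bump_prod_def
  proof (rule has_derivative_prod)
    fix b :: 'a
    have "((\<lambda>x. x \<bullet> b) has_derivative (\<lambda>h. h \<bullet> b)) (at x)" by (auto intro!: derivative_eq_intros)
    then show "((\<lambda>x. smooth_bump (\<kappa> b) (x \<bullet> b)) has_derivative (\<lambda>h. smooth_bump (Suc (\<kappa> b)) (x \<bullet> b) * (h \<bullet> b))) (at x)"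
      by (rule has_derivative_compose[OF _ smooth_bump_derivative[unfolded has_field_derivative_def]])
  qed
  also have "(\<lambda>h. \<Sum>b\<in>Basis. (smooth_bump (Suc (\<kappa> b)) (x \<bullet> b) * (h \<bullet> b)) * (\<Prod>c\<in>Basis - {b}. smooth_bump (\<kappa> c) (x \<bullet> c)))
     = (\<lambda>h. \<Sum>b\<in>Basis. bump_prod (\<kappa>(b := Suc (\<kappa> b))) x * (h \<bullet> b))"
  proof (intro ext sum.cong refl)
    fix h b :: 'a assume b: "b \<in> Basis"
    have "bump_prod (\<kappa>(b := Suc (\<kappa> b))) x = smooth_bump (Suc (\<kappa> b)) (x \<bullet> b) * (\<Prod>c\<in>Basis - {b}. smooth_bump (\<kappa> c) (x \<bullet> c))"
      unfolding bump_prod_def using b by (subst prod.remove[of _ b]) (auto intro!: prod.cong)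
    then show "(smooth_bump (Suc (\<kappa> b)) (x \<bullet> b) * (h \<bullet> b)) * (\<Prod>c\<in>Basis - {b}. smooth_bump (\<kappa> c) (x \<bullet> c))
      = bump_prod (\<kappa>(b := Suc (\<kappa> b))) x * (h \<bullet> b)" by simp
  qed
  finally show ?thesis .
qed

lemma scaled_bump_has_derivative:
  fixes x y :: "'a::euclidean_space"
  assumes "\<epsilon> \<noteq> 0"
  shows "((\<lambda>y. c * bump_prod \<kappa> ((x - y) /\<^sub>R \<epsilon>)) has_derivative
     (\<lambda>h. \<Sum>b\<in>Basis. - (c / \<epsilon>) * bump_prod (\<kappa>(b := Suc (\<kappa> b))) ((x - y) /\<^sub>R \<epsilon>) * (h \<bullet> b))) (at y)"
proof -
  have "((\<lambda>y. (x - y) /\<^sub>R \<epsilon>) has_derivative (\<lambda>h. - (h /\<^sub>R \<epsilon>))) (at y)"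
    by (auto intro!: derivative_eq_intros)
  from has_derivative_compose[OF this bump_prod_has_derivative]
  have "((\<lambda>y. c * bump_prod \<kappa> ((x - y) /\<^sub>R \<epsilon>)) has_derivative
     (\<lambda>h. c * (\<Sum>b\<in>Basis. bump_prod (\<kappa>(b := Suc (\<kappa> b))) ((x - y) /\<^sub>R \<epsilon>) * ((- (h /\<^sub>R \<epsilon>)) \<bullet> b)))) (at y)"
    by (rule has_derivative_mult_right)
  then show ?thesis by (simp add: sum_distrib_left divide_inverse mult_ac)
qed

lemma frechet_scaled_bump:
  fixes x y :: "'a::euclidean_space"
  assumes "\<epsilon> \<noteq> 0" "b \<in> Basis"
  shows "partial_deriv b (\<lambda>y. c * bump_prod \<kappa> ((x - y) /\<^sub>R \<epsilon>)) y
     = (- (c / \<epsilon>)) * bump_prod (\<kappa>(b := Suc (\<kappa> b))) ((x - y) /\<^sub>R \<epsilon>)"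
proof -
  have "partial_deriv b (\<lambda>y. c * bump_prod \<kappa> ((x - y) /\<^sub>R \<epsilon>)) y
     = (\<Sum>b'\<in>Basis. - (c / \<epsilon>) * bump_prod (\<kappa>(b' := Suc (\<kappa> b'))) ((x - y) /\<^sub>R \<epsilon>) * (b \<bullet> b'))"
    by (simp only: frechet_derivative_at[OF scaled_bump_has_derivative[OF assms(1)], symmetric])
  also have "\<dots> = (\<Sum>b'\<in>Basis. if b' = b then - (c / \<epsilon>) * bump_prod (\<kappa>(b' := Suc (\<kappa> b'))) ((x - y) /\<^sub>R \<epsilon>) else 0)"
    using assms(2) by (intro sum.cong) (auto simp: inner_Basis)
  also have "\<dots> = - (c / \<epsilon>) * bump_prod (\<kappa>(b := Suc (\<kappa> b))) ((x - y) /\<^sub>R \<epsilon>)"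
    using assms(2) by simp
  finally show ?thesis .
qed

text \<open>A partial derivative changes only \<open>c\<close> and one entry of
  \<open>\<kappa>\<close>, so the family is closed under differentiation; this is why both are
  generalised in the induction.\<close>

lemma C_k_scaled_bump:
  fixes x :: "'a::euclidean_space"
  assumes "\<epsilon> \<noteq> 0"
  shows "C_k k (\<lambda>y. c * bump_prod \<kappa> ((x - y) /\<^sub>R \<epsilon>))"
proof (induction k arbitrary: c \<kappa>)
  case 0
  show ?case unfolding C_k.simps
    by (intro continuous_intros continuous_on_compose2[OF continuous_bump_prod[where S = UNIV]]) auto
next
  case (Suc k)
  show ?case unfolding C_k.simps
  proof (intro conjI allI ballI)
    show "(\<lambda>y. c * bump_prod \<kappa> ((x - y) /\<^sub>R \<epsilon>)) differentiable (at y)" for y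
      using scaled_bump_has_derivative[OF assms] unfolding differentiable_def by blast
    show "C_k k (partial_deriv b (\<lambda>y. c * bump_prod \<kappa> ((x - y) /\<^sub>R \<epsilon>)))" if "b \<in> Basis" for b
      unfolding frechet_scaled_bump[OF assms that] by (rule Suc.IH)
  qed
qed

lemma test_function_scaled_bump:
  fixes x :: "'a::euclidean_space" and \<epsilon> :: real
  assumes "\<epsilon> > 0" "cball x (DIM('a) * \<epsilon>) \<subseteq> \<Omega>"
  shows "test_function \<Omega> (\<lambda>y. c * bump_prod \<kappa> ((x - y) /\<^sub>R \<epsilon>))"
proof -
  have "{y. c * bump_prod \<kappa> ((x - y) /\<^sub>R \<epsilon>) \<noteq> 0} \<subseteq> cball x (DIM('a) * \<epsilon>)"
  proof
    fix y assume "y \<in> {y. c * bump_prod \<kappa> ((x - y) /\<^sub>R \<epsilon>) \<noteq> 0}"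
    then have "(x - y) /\<^sub>R \<epsilon> \<in> cball 0 (DIM('a))" using bump_prod_outside[of "(x - y) /\<^sub>R \<epsilon>" \<kappa>] by auto
    then have "inverse \<epsilon> * norm (x - y) \<le> DIM('a)" using assms(1) by simp
    then have "norm (x - y) / \<epsilon> \<le> DIM('a)" by (simp only: divide_inverse mult.commute)
    then have "norm (x - y) \<le> DIM('a) * \<epsilon>" using assms(1) by (simp only: pos_divide_le_eq)
    then show "y \<in> cball x (DIM('a) * \<epsilon>)" by (simp add: dist_norm)
  qed
  then have sub: "closure {y. c * bump_prod \<kappa> ((x - y) /\<^sub>R \<epsilon>) \<noteq> 0} \<subseteq> cball x (DIM('a) * \<epsilon>)"
    by (intro closure_minimal) auto
  then have "compact (closure {y. c * bump_prod \<kappa> ((x - y) /\<^sub>R \<epsilon>) \<noteq> 0})"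
    by (meson bounded_cball bounded_subset closed_closure compact_eq_bounded_closed)
  then show ?thesis unfolding test_function_def using sub assms C_k_scaled_bump[of \<epsilon>] by auto
qed

section \<open>Convolution with a smooth kernel\<close>

text \<open>The kernel is Lipschitz along \<open>h\<close> with constant \<open>B\<close>, so a
  multiple of the absolute value of \<open>u\<close> dominates the difference quotients although
  \<open>u\<close> is merely integrable.\<close>

lemma convolution_directional_derivative:
  fixes u \<Psi> \<Psi>' :: "'a::euclidean_space \<Rightarrow> real"
  assumes u: "integrable lborel u"
    and cont: "continuous_on UNIV \<Psi>" "continuous_on UNIV \<Psi>'"
    and bd: "\<And>x. \<bar>\<Psi> x\<bar> \<le> B" "\<And>x. \<bar>\<Psi>' x\<bar> \<le> B"
    and der: "\<And>x. ((\<lambda>t. \<Psi> (x + t *\<^sub>R h)) has_real_derivative \<Psi>' x) (at 0)"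
  shows "((\<lambda>t. LINT y|lborel. u y * \<Psi> (x + t *\<^sub>R h - y)) has_real_derivative (LINT y|lborel. u y * \<Psi>' (x - y))) (at 0)"
proof -
  have [measurable]: "u \<in> borel_measurable borel" "\<Psi> \<in> borel_measurable borel" "\<Psi>' \<in> borel_measurable borel"
    using u cont by (auto intro: borel_measurable_continuous_onI)
  have der': "((\<lambda>t. \<Psi> (x + t *\<^sub>R h)) has_real_derivative \<Psi>' (x + s *\<^sub>R h)) (at s)" for x s
  proof -
    have "((\<lambda>t. \<Psi> (x + s *\<^sub>R h + t *\<^sub>R h)) has_real_derivative \<Psi>' (x + s *\<^sub>R h)) (at (s - s))"
      using der[of "x + s *\<^sub>R h"] by simp
    then have "((\<lambda>t. \<Psi> (x + s *\<^sub>R h + (t - s) *\<^sub>R h)) has_real_derivative \<Psi>' (x + s *\<^sub>R h) * 1) (at s)"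
      by (rule DERIV_chain2[where f = "\<lambda>t. \<Psi> (x + s *\<^sub>R h + t *\<^sub>R h)" and g = "\<lambda>t. t - s"])
         (auto intro!: derivative_eq_intros)
    then show ?thesis by (simp add: algebra_simps)
  qed
  have lip: "\<bar>\<Psi> (x + s *\<^sub>R h) - \<Psi> x\<bar> \<le> B * \<bar>s\<bar>" for x s
  proof -
    have "norm (\<Psi> (x + s *\<^sub>R h) - \<Psi> (x + 0 *\<^sub>R h)) \<le> B * norm (s - 0)"
      by (rule field_differentiable_bound[where S = UNIV and f = "\<lambda>t. \<Psi> (x + t *\<^sub>R h)" and f' = "\<lambda>t. \<Psi>' (x + t *\<^sub>R h)"])
         (use der' bd in auto)
    then show ?thesis by simp
  qed
  have int: "integrable lborel (\<lambda>y. u y * \<Psi> (w - y))" for w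
  proof (rule Bochner_Integration.integrable_bound)
    show "integrable lborel (\<lambda>y. B * u y)" using u by simp
    show "AE y in lborel. norm (u y * \<Psi> (w - y)) \<le> norm (B * u y)"
    proof (rule AE_I2)
      fix y
      have "\<bar>\<Psi> (w - y)\<bar> \<le> \<bar>B\<bar>" using bd(1)[of "w - y"] by linarith
      from mult_left_mono[OF this, of "\<bar>u y\<bar>"] show "norm (u y * \<Psi> (w - y)) \<le> norm (B * u y)"
        by (simp add: abs_mult mult.commute)
    qed
  qed measurable
  show ?thesis unfolding has_field_derivative_iff tendsto_at_iff_sequentially
  proof (intro allI impI)
    fix X :: "nat \<Rightarrow> real" assume X0: "\<forall>i. X i \<in> UNIV - {0}" and X: "X \<longlonglongrightarrow> 0"
    have Xn: "X i \<noteq> 0" for i using X0 by auto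
    have "(\<lambda>i. LINT y|lborel. u y * ((\<Psi> (x - y + X i *\<^sub>R h) - \<Psi> (x - y)) / X i)) \<longlonglongrightarrow> (LINT y|lborel. u y * \<Psi>' (x - y))"
    proof (rule integral_dominated_convergence)
      show "integrable lborel (\<lambda>y. B * \<bar>u y\<bar>)" using u by simp
      show "AE y in lborel. (\<lambda>i. u y * ((\<Psi> (x - y + X i *\<^sub>R h) - \<Psi> (x - y)) / X i)) \<longlonglongrightarrow> u y * \<Psi>' (x - y)"
      proof (intro AE_I2 tendsto_mult tendsto_const)
        fix y
        have "((\<lambda>t. (\<Psi> (x - y + t *\<^sub>R h) - \<Psi> (x - y)) / t) \<longlongrightarrow> \<Psi>' (x - y)) (at 0)"
          using der[of "x - y"] by (simp add: has_field_derivative_iff)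
        then show "(\<lambda>i. (\<Psi> (x - y + X i *\<^sub>R h) - \<Psi> (x - y)) / X i) \<longlonglongrightarrow> \<Psi>' (x - y)"
          using X Xn unfolding tendsto_at_iff_sequentially by (auto simp: o_def)
      qed
      show "AE y in lborel. norm (u y * ((\<Psi> (x - y + X i *\<^sub>R h) - \<Psi> (x - y)) / X i)) \<le> B * \<bar>u y\<bar>" for i
      proof (rule AE_I2)
        fix y
        have "\<bar>(\<Psi> (x - y + X i *\<^sub>R h) - \<Psi> (x - y)) / X i\<bar> \<le> B"
          using lip[of "x - y" "X i"] Xn[of i] by (simp add: abs_divide field_simps)
        from mult_left_mono[OF this, of "\<bar>u y\<bar>"] show "norm (u y * ((\<Psi> (x - y + X i *\<^sub>R h) - \<Psi> (x - y)) / X i)) \<le> B * \<bar>u y\<bar>"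
          by (simp add: abs_mult mult.commute)
      qed
    qed measurable
    moreover have "(\<lambda>i. LINT y|lborel. u y * ((\<Psi> (x - y + X i *\<^sub>R h) - \<Psi> (x - y)) / X i))
        = (\<lambda>i. ((LINT y|lborel. u y * \<Psi> (x + X i *\<^sub>R h - y)) - (LINT y|lborel. u y * \<Psi> (x + 0 *\<^sub>R h - y))) / (X i - 0))"
    proof
      fix i
      have eq: "x - y + X i *\<^sub>R h = x + X i *\<^sub>R h - y" for y by simp
      have "(LINT y|lborel. u y * ((\<Psi> (x - y + X i *\<^sub>R h) - \<Psi> (x - y)) / X i))
          = (LINT y|lborel. (u y * \<Psi> (x + X i *\<^sub>R h - y) - u y * \<Psi> (x - y)) / X i)"
        unfolding eq by (simp only: right_diff_distrib times_divide_eq_right)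
      also have "\<dots> = (LINT y|lborel. u y * \<Psi> (x + X i *\<^sub>R h - y) - u y * \<Psi> (x - y)) / X i"
        by (rule integral_divide_zero)
      also have "\<dots> = ((LINT y|lborel. u y * \<Psi> (x + X i *\<^sub>R h - y)) - (LINT y|lborel. u y * \<Psi> (x - y))) / X i"
        by (subst Bochner_Integration.integral_diff) (rule int refl)+
      finally show "(LINT y|lborel. u y * ((\<Psi> (x - y + X i *\<^sub>R h) - \<Psi> (x - y)) / X i))
        = ((LINT y|lborel. u y * \<Psi> (x + X i *\<^sub>R h - y)) - (LINT y|lborel. u y * \<Psi> (x + 0 *\<^sub>R h - y))) / (X i - 0)"
        by simp
    qed
    ultimately show "((\<lambda>y. ((LINT ya|lborel. u ya * \<Psi> (x + y *\<^sub>R h - ya)) - (LINT y|lborel. u y * \<Psi> (x + 0 *\<^sub>R h - y))) / (y - 0)) \<circ> X)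
        \<longlonglongrightarrow> (LINT y|lborel. u y * \<Psi>' (x - y))" by (simp only: o_def)
  qed
qed

lemma continuous_convolution:
  fixes u \<Psi> :: "'a::euclidean_space \<Rightarrow> real"
  assumes u: "integrable lborel u" and cont: "continuous_on UNIV \<Psi>" and bd: "\<And>x. \<bar>\<Psi> x\<bar> \<le> B"
  shows "continuous_on UNIV (\<lambda>x. LINT y|lborel. u y * \<Psi> (x - y))"
proof (rule continuous_on_sequentiallyI)
  fix X :: "nat \<Rightarrow> 'a" and x assume X: "X \<longlonglongrightarrow> x"
  have [measurable]: "u \<in> borel_measurable borel" "\<Psi> \<in> borel_measurable borel"
    using u cont by (auto intro: borel_measurable_continuous_onI)
  show "(\<lambda>i. LINT y|lborel. u y * \<Psi> (X i - y)) \<longlonglongrightarrow> (LINT y|lborel. u y * \<Psi> (x - y))"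
  proof (rule integral_dominated_convergence)
    show "integrable lborel (\<lambda>y. B * \<bar>u y\<bar>)" using u by simp
    show "AE y in lborel. (\<lambda>i. u y * \<Psi> (X i - y)) \<longlonglongrightarrow> u y * \<Psi> (x - y)"
    proof (intro AE_I2 tendsto_mult tendsto_const)
      fix y
      have "(\<lambda>i. X i - y) \<longlonglongrightarrow> x - y" by (intro tendsto_diff X tendsto_const)
      then show "(\<lambda>i. \<Psi> (X i - y)) \<longlonglongrightarrow> \<Psi> (x - y)"
        using cont by (metis UNIV_I continuous_on_tendsto_compose eventually_sequentiallyI)
    qed
    show "AE y in lborel. norm (u y * \<Psi> (X i - y)) \<le> B * \<bar>u y\<bar>" for i
    proof (rule AE_I2)
      fix y
      from mult_left_mono[OF bd[of "X i - y"], of "\<bar>u y\<bar>"] show "norm (u y * \<Psi> (X i - y)) \<le> B * \<bar>u y\<bar>"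
        by (simp add: abs_mult mult.commute)
    qed
  qed measurable
qed

section \<open>Continuity of translations in L^p\<close>

lemma tendsto_0_ennrealI:
  fixes X :: "nat \<Rightarrow> ennreal"
  assumes "\<And>e::real. e > 0 \<Longrightarrow> \<forall>\<^sub>F i in sequentially. X i \<le> ennreal e"
  shows "X \<longlonglongrightarrow> 0"
proof (rule order_tendstoI)
  fix a :: ennreal assume "0 < a"
  then obtain y where y: "0 < y" "y < a" using dense by blast
  then obtain e where e: "y = ennreal e" "e > 0" by (cases y) (auto simp: ennreal_less_zero_iff)
  show "\<forall>\<^sub>F i in sequentially. X i < a"
    using assms[OF e(2)] by eventually_elim (use y e in auto)
qed auto

lemma nn_integral_translation:
  fixes f :: "'a::euclidean_space \<Rightarrow> ennreal"
  assumes [measurable]: "f \<in> borel_measurable borel"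
  shows "(\<integral>\<^sup>+x. f (x + w) \<partial>lborel) = (\<integral>\<^sup>+x. f x \<partial>lborel)"
proof -
  have "(\<integral>\<^sup>+x. f x \<partial>distr lborel borel ((+) w)) = (\<integral>\<^sup>+x. f (w + x) \<partial>lborel)"
    by (rule nn_integral_distr) auto
  then show ?thesis by (simp add: lborel_distr_plus add.commute)
qed

text \<open>Sequences of translations suit dominated convergence, and an integral in
  \<open>ennreal\<close> makes sense before any integrability is known.\<close>

definition translation_continuous :: "nat \<Rightarrow> ('a::euclidean_space \<Rightarrow> real) \<Rightarrow> bool" where
  "translation_continuous p f \<longleftrightarrow> (\<forall>w::nat \<Rightarrow> 'a. w \<longlonglongrightarrow> 0 \<longrightarrow>
     (\<lambda>i. \<integral>\<^sup>+x. ennreal (\<bar>f (x + w i) - f x\<bar> ^ p) \<partial>lborel) \<longlonglongrightarrow> 0)"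

text \<open>The three-term argument; translation invariance makes its first and last terms
  equal.\<close>

lemma translation_continuous_approx:
  fixes f :: "'a::euclidean_space \<Rightarrow> real"
  assumes [measurable]: "f \<in> borel_measurable borel"
    and ex: "\<And>e::real. e > 0 \<Longrightarrow> \<exists>g\<in>borel_measurable borel. translation_continuous 1 g \<and> (\<integral>\<^sup>+x. ennreal \<bar>f x - g x\<bar> \<partial>lborel) \<le> ennreal e"
  shows "translation_continuous 1 f"
  unfolding translation_continuous_def
proof (intro allI impI tendsto_0_ennrealI)
  fix w :: "nat \<Rightarrow> 'a" and e :: real assume w: "w \<longlonglongrightarrow> 0" and e: "e > 0"
  obtain g where g [measurable]: "g \<in> borel_measurable borel" and tg: "translation_continuous 1 g"
    and fg: "(\<integral>\<^sup>+x. ennreal \<bar>f x - g x\<bar> \<partial>lborel) \<le> ennreal (e / 3)"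
    using ex[of "e / 3"] e by auto
  have "(\<lambda>i. \<integral>\<^sup>+x. ennreal (\<bar>g (x + w i) - g x\<bar> ^ 1) \<partial>lborel) \<longlonglongrightarrow> 0"
    using tg w by (simp add: translation_continuous_def)
  then have "\<forall>\<^sub>F i in sequentially. (\<integral>\<^sup>+x. ennreal (\<bar>g (x + w i) - g x\<bar> ^ 1) \<partial>lborel) < ennreal (e / 3)"
    by (rule order_tendstoD) (use e in simp)
  then show "\<forall>\<^sub>F i in sequentially. (\<integral>\<^sup>+x. ennreal (\<bar>f (x + w i) - f x\<bar> ^ 1) \<partial>lborel) \<le> ennreal e"
  proof eventually_elim
    case (elim i)
    have "(\<integral>\<^sup>+x. ennreal (\<bar>f (x + w i) - f x\<bar> ^ 1) \<partial>lborel) \<le>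
       (\<integral>\<^sup>+x. ennreal \<bar>f (x + w i) - g (x + w i)\<bar> + (ennreal (\<bar>g (x + w i) - g x\<bar> ^ 1) + ennreal \<bar>f x - g x\<bar>) \<partial>lborel)"
      by (intro nn_integral_mono) (simp add: ennreal_plus[symmetric] del: ennreal_plus)
    also have "\<dots> = (\<integral>\<^sup>+x. ennreal \<bar>f (x + w i) - g (x + w i)\<bar> \<partial>lborel)
       + ((\<integral>\<^sup>+x. ennreal (\<bar>g (x + w i) - g x\<bar> ^ 1) \<partial>lborel) + (\<integral>\<^sup>+x. ennreal \<bar>f x - g x\<bar> \<partial>lborel))"
      by (simp add: nn_integral_add)
    also have "(\<integral>\<^sup>+x. ennreal \<bar>f (x + w i) - g (x + w i)\<bar> \<partial>lborel) = (\<integral>\<^sup>+x. ennreal \<bar>f x - g x\<bar> \<partial>lborel)"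
      by (rule nn_integral_translation[where f = "\<lambda>x. ennreal \<bar>f x - g x\<bar>"]) measurable
    also have "(\<integral>\<^sup>+x. ennreal \<bar>f x - g x\<bar> \<partial>lborel) + ((\<integral>\<^sup>+x. ennreal (\<bar>g (x + w i) - g x\<bar> ^ 1) \<partial>lborel) + (\<integral>\<^sup>+x. ennreal \<bar>f x - g x\<bar> \<partial>lborel))
       \<le> ennreal (e / 3) + (ennreal (e / 3) + ennreal (e / 3))"
      using elim by (intro add_mono fg) auto
    also have "\<dots> = ennreal e" using e by (simp add: ennreal_plus[symmetric] del: ennreal_plus)
    finally show ?case .
  qed
qed

text \<open>A translate of U has the same finite measure, so the integral of the absolute difference
  of the two indicators is twice that of the positive part of 1_U(x) - 1_U(x + w). This positive
  part is dominated by 1_U and, U being open, is eventually zero at each point.\<close>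

lemma translation_continuous_open:
  fixes U :: "'a::euclidean_space set"
  assumes U: "open U" and fin: "emeasure lborel U < \<infinity>"
  shows "translation_continuous 1 (indicat_real U)"
  unfolding translation_continuous_def
proof (intro allI impI)
  fix w :: "nat \<Rightarrow> 'a" assume w: "w \<longlonglongrightarrow> 0"
  have [measurable]: "U \<in> sets borel" using U by simp
  define s where "s = (\<lambda>i x. ennreal (max 0 (indicat_real U x - indicat_real U (x + w i))))"
  have [measurable]: "s i \<in> borel_measurable borel" for i unfolding s_def by measurable
  have "(\<lambda>i. \<integral>\<^sup>+x. s i x \<partial>lborel) \<longlonglongrightarrow> (\<integral>\<^sup>+(x::'a). 0 \<partial>lborel)"
  proof (rule nn_integral_dominated_convergence[where w = "indicator U"])
    show "AE x in lborel. (\<lambda>i. s i x) \<longlonglongrightarrow> 0"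
    proof (rule AE_I2)
      fix x
      show "(\<lambda>i. s i x) \<longlonglongrightarrow> 0"
      proof (cases "x \<in> U")
        case True
        have "(\<lambda>i. x + w i) \<longlonglongrightarrow> x + 0" by (intro tendsto_intros w)
        then have "\<forall>\<^sub>F i in sequentially. x + w i \<in> U" using topological_tendstoD[OF _ U] True by fastforce
        then have "\<forall>\<^sub>F i in sequentially. s i x = 0" by eventually_elim (use True in \<open>simp add: s_def\<close>)
        then show ?thesis by (rule tendsto_eventually)
      qed (simp add: s_def indicator_def)
    qed
    show "(\<integral>\<^sup>+x. indicator U x \<partial>lborel) < \<infinity>" using fin by simp
  qed (use fin in \<open>auto simp: s_def indicator_def\<close>)
  then have s0: "(\<lambda>i. 2 * (\<integral>\<^sup>+x. s i x \<partial>lborel)) \<longlonglongrightarrow> 2 * 0"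
    by (intro ennreal_tendsto_cmult) simp_all
  have "(\<integral>\<^sup>+x. ennreal (\<bar>indicat_real U (x + w i) - indicat_real U x\<bar> ^ 1) \<partial>lborel) = 2 * (\<integral>\<^sup>+x. s i x \<partial>lborel)" for i
  proof -
    have "emeasure lborel U + (\<integral>\<^sup>+x. ennreal (\<bar>indicat_real U (x + w i) - indicat_real U x\<bar> ^ 1) \<partial>lborel)
       = (\<integral>\<^sup>+x. indicator U x + ennreal (\<bar>indicat_real U (x + w i) - indicat_real U x\<bar> ^ 1) \<partial>lborel)"
      by (simp add: nn_integral_add)
    also have "\<dots> = (\<integral>\<^sup>+x. indicator U (x + w i) + 2 * s i x \<partial>lborel)"
      by (intro nn_integral_cong) (auto simp: indicator_def s_def)
    also have "\<dots> = (\<integral>\<^sup>+x. indicator U (x + w i) \<partial>lborel) + 2 * (\<integral>\<^sup>+x. s i x \<partial>lborel)"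
      by (simp add: nn_integral_add nn_integral_cmult)
    also have "(\<integral>\<^sup>+x. indicator U (x + w i) \<partial>lborel) = emeasure lborel U"
      using nn_integral_translation[of "indicator U" "w i"] by simp
    finally show ?thesis using fin by (auto simp: ennreal_add_left_cancel)
  qed
  then show "(\<lambda>i. \<integral>\<^sup>+x. ennreal (\<bar>indicat_real U (x + w i) - indicat_real U x\<bar> ^ 1) \<partial>lborel) \<longlonglongrightarrow> 0"
    using s0 by simp
qed

lemma translation_continuous_cmult:
  assumes [measurable]: "f \<in> borel_measurable borel" and "translation_continuous 1 f"
  shows "translation_continuous 1 (\<lambda>x. f x * c)"
  unfolding translation_continuous_def
proof (intro allI impI)
  fix w :: "nat \<Rightarrow> 'a" assume w: "w \<longlonglongrightarrow> 0"
  have "(\<lambda>i. ennreal \<bar>c\<bar> * (\<integral>\<^sup>+x. ennreal (\<bar>f (x + w i) - f x\<bar> ^ 1) \<partial>lborel)) \<longlonglongrightarrow> ennreal \<bar>c\<bar> * 0"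
    using assms(2) w by (intro ennreal_tendsto_cmult) (auto simp: translation_continuous_def)
  moreover have "(\<integral>\<^sup>+x. ennreal (\<bar>f (x + w i) * c - f x * c\<bar> ^ 1) \<partial>lborel) = ennreal \<bar>c\<bar> * (\<integral>\<^sup>+x. ennreal (\<bar>f (x + w i) - f x\<bar> ^ 1) \<partial>lborel)" for i
    by (subst nn_integral_cmult[symmetric])
       (auto simp: abs_mult[symmetric] ennreal_mult'[symmetric] algebra_simps intro!: nn_integral_cong)
  ultimately show "(\<lambda>i. \<integral>\<^sup>+x. ennreal (\<bar>f (x + w i) * c - f x * c\<bar> ^ 1) \<partial>lborel) \<longlonglongrightarrow> 0" by simp
qed

text \<open>Outer regularity leads from open sets to measurable sets of finite measure; sums and L^1
  limits then reach all integrable functions.\<close>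

lemma translation_continuous_integrable:
  fixes f :: "'a::euclidean_space \<Rightarrow> real"
  assumes "integrable lborel f"
  shows "translation_continuous 1 f"
  using assms
proof (induction rule: integrable_induct)
  case (base A c)
  have [measurable]: "A \<in> sets borel" using base by simp
  have "translation_continuous 1 (indicat_real A)"
  proof (rule translation_continuous_approx)
    fix e :: real assume e: "e > 0"
    obtain U where U: "open U" "A \<subseteq> U" "emeasure lborel (U - A) < ennreal e"
      using outer_regular_lborel[of A e] e by auto
    have [measurable]: "U \<in> sets borel" using U by simp
    have "emeasure lborel U = emeasure lborel A + emeasure lborel (U - A)"
      using U by (subst plus_emeasure) (auto simp: Un_absorb1)
    also have "\<dots> < \<infinity>" using base U(3) by (auto simp: less_top[symmetric] intro: order_less_trans)
    finally have "translation_continuous 1 (indicat_real U)" using U by (intro translation_continuous_open)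
    moreover have "(\<integral>\<^sup>+x. ennreal \<bar>indicat_real A x - indicat_real U x\<bar> \<partial>lborel) = (\<integral>\<^sup>+x. indicator (U - A) x \<partial>lborel)"
      using U by (intro nn_integral_cong) (auto simp: indicator_def)
    ultimately show "\<exists>g\<in>borel_measurable borel. translation_continuous 1 g \<and> (\<integral>\<^sup>+x. ennreal \<bar>indicat_real A x - g x\<bar> \<partial>lborel) \<le> ennreal e"
      using U(3) by (intro bexI[of _ "indicat_real U"]) auto
  qed measurable
  then have "translation_continuous 1 (\<lambda>x. indicat_real A x * c)"
    by (intro translation_continuous_cmult) simp_all
  then show ?case by simp
next
  case (add f g)
  have [measurable]: "f \<in> borel_measurable borel" "g \<in> borel_measurable borel" using add by auto
  show ?case unfolding translation_continuous_def
  proof (intro allI impI)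
    fix w :: "nat \<Rightarrow> 'a" assume w: "w \<longlonglongrightarrow> 0"
    have lim: "(\<lambda>i. (\<integral>\<^sup>+x. ennreal (\<bar>f (x + w i) - f x\<bar> ^ 1) \<partial>lborel) + (\<integral>\<^sup>+x. ennreal (\<bar>g (x + w i) - g x\<bar> ^ 1) \<partial>lborel)) \<longlonglongrightarrow> 0 + 0"
      using add w by (intro tendsto_add) (auto simp: translation_continuous_def)
    show "(\<lambda>i. \<integral>\<^sup>+x. ennreal (\<bar>f (x + w i) + g (x + w i) - (f x + g x)\<bar> ^ 1) \<partial>lborel) \<longlonglongrightarrow> 0"
    proof (rule tendsto_sandwich[OF _ _ tendsto_const])
      show "\<forall>\<^sub>F i in sequentially. (\<integral>\<^sup>+x. ennreal (\<bar>f (x + w i) + g (x + w i) - (f x + g x)\<bar> ^ 1) \<partial>lborel)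
          \<le> (\<integral>\<^sup>+x. ennreal (\<bar>f (x + w i) - f x\<bar> ^ 1) \<partial>lborel) + (\<integral>\<^sup>+x. ennreal (\<bar>g (x + w i) - g x\<bar> ^ 1) \<partial>lborel)"
        by (intro always_eventually allI, subst nn_integral_add[symmetric])
           (auto intro!: nn_integral_mono ennreal_leI simp: ennreal_plus[symmetric] simp del: ennreal_plus)
    qed (use lim in auto)
  qed
next
  case (lim f s)
  have [measurable]: "f \<in> borel_measurable borel" "\<And>i. s i \<in> borel_measurable borel" using lim by auto
  show ?case
  proof (rule translation_continuous_approx)
    fix e :: real assume e: "e > 0"
    have "(\<lambda>i. \<integral>\<^sup>+x. ennreal (norm (f x - s i x)) \<partial>lborel) \<longlonglongrightarrow> 0"
    proof (rule nn_integral_dominated_convergence_norm[where w = "\<lambda>x. 2 * norm (f x)"])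
      show "AE x in lborel. norm (s j x) \<le> 2 * norm (f x)" for j
        by (intro AE_I2) (use lim.hyps in simp)
      have "integrable lborel (\<lambda>x. 2 * norm (f x))" using lim.hyps by auto
      then show "(\<integral>\<^sup>+x. ennreal (2 * norm (f x)) \<partial>lborel) < \<infinity>"
        unfolding integrable_iff_bounded by (simp add: abs_mult)
    qed (use lim.hyps in auto)
    then have "\<forall>\<^sub>F i in sequentially. (\<integral>\<^sup>+x. ennreal (norm (f x - s i x)) \<partial>lborel) < ennreal e"
      by (rule order_tendstoD) (use e in simp)
    then obtain i where "(\<integral>\<^sup>+x. ennreal (norm (f x - s i x)) \<partial>lborel) < ennreal e"
      unfolding eventually_sequentially by blast
    then show "\<exists>g\<in>borel_measurable borel. translation_continuous 1 g \<and> (\<integral>\<^sup>+x. ennreal \<bar>f x - g x\<bar> \<partial>lborel) \<le> ennreal e"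
      using lim.IH by (intro bexI[of _ "s i"]) auto
  qed measurable
qed

text \<open>Superadditivity of the \<open>p\<close>-th power. It lets an L^1 estimate for powers
  control an L^p estimate for the functions themselves.\<close>

lemma power_diff_le:
  fixes a b :: real
  assumes "0 \<le> a" "0 \<le> b" "1 \<le> p"
  shows "\<bar>a - b\<bar> ^ p \<le> \<bar>a ^ p - b ^ p\<bar>"
proof -
  have *: "(c - d) ^ p \<le> c ^ p - d ^ p" if "0 \<le> d" "d \<le> c" for c d :: real
    using assms(3)
  proof (induction p rule: dec_induct)
    case (step k)
    have "(c - d) ^ Suc k = (c - d) * (c - d) ^ k" by simp
    also have "\<dots> \<le> (c - d) * (c ^ k - d ^ k)" using step that by (intro mult_left_mono) auto
    also have "\<dots> \<le> c * c ^ k - d * d ^ k"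
    proof -
      have "0 \<le> d * (c ^ k - d ^ k)" "0 \<le> (c - d) * d ^ k" using that by (auto intro!: mult_nonneg_nonneg power_mono)
      then show ?thesis by (simp add: algebra_simps)
    qed
    finally show ?case by simp
  qed simp
  show ?thesis
  proof (cases "b \<le> a")
    case True
    then show ?thesis using *[of b a] assms by (simp add: power_mono)
  next
    case False
    then show ?thesis using *[of a b] assms by (simp add: power_mono abs_minus_commute)
  qed
qed

lemma add_power_le:
  fixes a b :: real
  assumes "0 \<le> a" "0 \<le> b"
  shows "(a + b) ^ p \<le> 2 ^ p * (a ^ p + b ^ p)"
proof -
  have "(a + b) ^ p \<le> (2 * max a b) ^ p" using assms by (intro power_mono) auto
  also have "\<dots> = 2 ^ p * (max a b) ^ p" by (simp add: power_mult_distrib)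
  also have "(max a b) ^ p \<le> a ^ p + b ^ p" using assms by (auto simp: max_def)
  finally show ?thesis by simp
qed

text \<open>The case p = 1 is applied to the \<open>p\<close>-th powers of the positive and of the
  negative part of \<open>f\<close>, and \<open>power_diff_le\<close> returns to \<open>f\<close>.
  The parts are separated because that inequality concerns non-negative numbers.\<close>

lemma translation_continuous_power:
  fixes f :: "'a::euclidean_space \<Rightarrow> real"
  assumes [measurable]: "f \<in> borel_measurable borel" and int: "integrable lborel (\<lambda>x. \<bar>f x\<bar> ^ p)" and p: "1 \<le> p"
  shows "translation_continuous p f"
proof -
  have pos: "translation_continuous 1 (\<lambda>x. (max 0 (c * f x)) ^ p)" if c: "c = 1 \<or> c = -1" for c
  proof (rule translation_continuous_integrable)
    show "integrable lborel (\<lambda>x. (max 0 (c * f x)) ^ p)"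
      by (rule Bochner_Integration.integrable_bound[OF int]) (use c in \<open>auto intro!: power_mono\<close>)
  qed
  show ?thesis unfolding translation_continuous_def
  proof (intro allI impI)
    fix w :: "nat \<Rightarrow> 'a" assume w: "w \<longlonglongrightarrow> 0"
    define D where "D = (\<lambda>c i. \<integral>\<^sup>+x. ennreal (\<bar>(max 0 (c * f (x + w i))) ^ p - (max 0 (c * f x)) ^ p\<bar> ^ 1) \<partial>lborel)"
    have "D c \<longlonglongrightarrow> 0" if c: "c = 1 \<or> c = -1" for c
      using pos[OF c] w unfolding translation_continuous_def D_def by auto
    then have lim: "(\<lambda>i. ennreal (2 ^ p) * (D 1 i + D (-1) i)) \<longlonglongrightarrow> ennreal (2 ^ p) * (0 + 0)"
      by (intro ennreal_tendsto_cmult tendsto_add) auto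
    show "(\<lambda>i. \<integral>\<^sup>+x. ennreal (\<bar>f (x + w i) - f x\<bar> ^ p) \<partial>lborel) \<longlonglongrightarrow> 0"
    proof (rule tendsto_sandwich[OF _ _ tendsto_const])
      show "\<forall>\<^sub>F i in sequentially. (\<integral>\<^sup>+x. ennreal (\<bar>f (x + w i) - f x\<bar> ^ p) \<partial>lborel) \<le> ennreal (2 ^ p) * (D 1 i + D (-1) i)"
      proof (intro always_eventually allI)
        fix i
        have "(\<integral>\<^sup>+x. ennreal (\<bar>f (x + w i) - f x\<bar> ^ p) \<partial>lborel) \<le>
          (\<integral>\<^sup>+x. ennreal (2 ^ p) * (ennreal (\<bar>(max 0 (1 * f (x + w i))) ^ p - (max 0 (1 * f x)) ^ p\<bar> ^ 1)
             + ennreal (\<bar>(max 0 ((-1) * f (x + w i))) ^ p - (max 0 ((-1) * f x)) ^ p\<bar> ^ 1)) \<partial>lborel)"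
        proof (rule nn_integral_mono)
          fix x
          define y where "y = x + w i"
          have "\<bar>f y - f x\<bar> \<le> \<bar>max 0 (f y) - max 0 (f x)\<bar> + \<bar>max 0 (- f y) - max 0 (- f x)\<bar>" by auto
          then have "\<bar>f y - f x\<bar> ^ p \<le> (\<bar>max 0 (f y) - max 0 (f x)\<bar> + \<bar>max 0 (- f y) - max 0 (- f x)\<bar>) ^ p"
            by (intro power_mono) auto
          also have "\<dots> \<le> 2 ^ p * (\<bar>max 0 (f y) - max 0 (f x)\<bar> ^ p + \<bar>max 0 (- f y) - max 0 (- f x)\<bar> ^ p)"
            by (rule add_power_le) auto
          also have "\<dots> \<le> 2 ^ p * (\<bar>(max 0 (f y)) ^ p - (max 0 (f x)) ^ p\<bar> + \<bar>(max 0 (- f y)) ^ p - (max 0 (- f x)) ^ p\<bar>)"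
            using p by (intro mult_left_mono add_mono power_diff_le) auto
          finally have "ennreal (\<bar>f y - f x\<bar> ^ p) \<le> ennreal (2 ^ p * (\<bar>(max 0 (f y)) ^ p - (max 0 (f x)) ^ p\<bar> + \<bar>(max 0 (- f y)) ^ p - (max 0 (- f x)) ^ p\<bar>))"
            by (rule ennreal_leI)
          also have "\<dots> = ennreal (2 ^ p) * (ennreal \<bar>(max 0 (f y)) ^ p - (max 0 (f x)) ^ p\<bar> + ennreal \<bar>(max 0 (- f y)) ^ p - (max 0 (- f x)) ^ p\<bar>)"
            by (subst ennreal_mult') auto
          finally show "ennreal (\<bar>f (x + w i) - f x\<bar> ^ p) \<le> ennreal (2 ^ p) * (ennreal (\<bar>(max 0 (1 * f (x + w i))) ^ p - (max 0 (1 * f x)) ^ p\<bar> ^ 1)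
             + ennreal (\<bar>(max 0 ((-1) * f (x + w i))) ^ p - (max 0 ((-1) * f x)) ^ p\<bar> ^ 1))"
            by (simp add: y_def)
        qed
        also have "\<dots> = ennreal (2 ^ p) * (D 1 i + D (-1) i)"
          unfolding D_def by (subst nn_integral_cmult, measurable) (subst nn_integral_add, auto)
        finally show "(\<integral>\<^sup>+x. ennreal (\<bar>f (x + w i) - f x\<bar> ^ p) \<partial>lborel) \<le> ennreal (2 ^ p) * (D 1 i + D (-1) i)" .
      qed
    qed (use lim in auto)
  qed
qed

section \<open>Jensen's inequality and convergence of mollifications\<close>

lemma power_tangent_le:
  fixes h c :: real
  assumes "0 \<le> h" "0 \<le> c" "1 \<le> p"
  shows "c ^ p + real p * c ^ (p - 1) * (h - c) \<le> h ^ p"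
proof (cases "c = 0")
  case True
  then show ?thesis using assms by (cases "p = 1") (auto simp: power_0_left)
next
  case False
  then have c: "c > 0" using assms by simp
  have "1 + real p * (h / c - 1) \<le> (1 + (h / c - 1)) ^ p"
    using c assms by (intro Bernoulli_inequality) (simp add: field_simps)
  then have "c ^ p * (1 + real p * (h / c - 1)) \<le> c ^ p * (h / c) ^ p"
    using c by (intro mult_left_mono) auto
  also have "c ^ p * (h / c) ^ p = h ^ p" using c by (simp add: power_divide)
  also have "c ^ p * (1 + real p * (h / c - 1)) = c ^ p + real p * (c ^ (p - 1) * c) * (h / c - 1)"
    using assms(3) by (simp add: algebra_simps power_eq_if)
  also have "\<dots> = c ^ p + real p * c ^ (p - 1) * (h - c)" using c by (simp add: field_simps)
  finally show ?thesis .
qed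

text \<open>Integrate the tangent inequality of the \<open>p\<close>-th power at the mean
  \<open>c\<close> against the weight. In the non-integrable case the right side is
  infinite.\<close>

lemma jensen_power_weight:
  fixes h \<phi> :: "'a::euclidean_space \<Rightarrow> real"
  assumes int: "integrable lborel (\<lambda>x. h x * \<phi> x)" "integrable lborel \<phi>" "(LINT x|lborel. \<phi> x) = 1"
    and nonneg: "\<And>x. 0 \<le> h x" "\<And>x. 0 \<le> \<phi> x" and p: "1 \<le> p"
    and [measurable]: "h \<in> borel_measurable borel" "\<phi> \<in> borel_measurable borel"
  shows "ennreal ((LINT x|lborel. h x * \<phi> x) ^ p) \<le> (\<integral>\<^sup>+x. ennreal (h x ^ p * \<phi> x) \<partial>lborel)"
proof (cases "integrable lborel (\<lambda>x. h x ^ p * \<phi> x)")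
  case True
  define c where "c = (LINT x|lborel. h x * \<phi> x)"
  have c: "0 \<le> c" unfolding c_def by (intro Bochner_Integration.integral_nonneg) (simp add: nonneg)
  have "c ^ p = (LINT x|lborel. (c ^ p - real p * c ^ (p - 1) * c) * \<phi> x + real p * c ^ (p - 1) * (h x * \<phi> x))"
    using int by (simp add: c_def[symmetric])
  also have "\<dots> \<le> (LINT x|lborel. h x ^ p * \<phi> x)"
  proof (intro integral_mono True)
    show "integrable lborel (\<lambda>x. (c ^ p - real p * c ^ (p - 1) * c) * \<phi> x + real p * c ^ (p - 1) * (h x * \<phi> x))"
      using int by simp
    fix x
    have "(c ^ p + real p * c ^ (p - 1) * (h x - c)) * \<phi> x \<le> h x ^ p * \<phi> x"
      using power_tangent_le[OF nonneg(1) c p] nonneg(2) by (intro mult_right_mono) auto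
    then show "(c ^ p - real p * c ^ (p - 1) * c) * \<phi> x + real p * c ^ (p - 1) * (h x * \<phi> x) \<le> h x ^ p * \<phi> x"
      by (simp add: algebra_simps)
  qed
  finally have "ennreal (c ^ p) \<le> ennreal (LINT x|lborel. h x ^ p * \<phi> x)" by (rule ennreal_leI)
  also have "\<dots> = (\<integral>\<^sup>+x. ennreal (h x ^ p * \<phi> x) \<partial>lborel)"
    by (rule nn_integral_eq_integral[symmetric, OF True]) (simp add: nonneg)
  finally show ?thesis by (simp add: c_def)
next
  case False
  then have "(\<integral>\<^sup>+x. ennreal (h x ^ p * \<phi> x) \<partial>lborel) = \<infinity>"
    unfolding integrable_iff_bounded using nonneg by (simp add: less_top[symmetric])
  then show ?thesis by simp
qed

lemma integrable_translate_scale: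
  fixes f :: "'a::euclidean_space \<Rightarrow> real"
  assumes "integrable lborel f" "c \<noteq> 0"
  shows "integrable lborel (\<lambda>w. f (T + c *\<^sub>R w))"
proof -
  have [measurable]: "f \<in> borel_measurable borel" using assms by auto
  have "integrable (density (distr lborel borel (\<lambda>x. T + c *\<^sub>R x)) (\<lambda>_. ennreal (\<bar>c\<bar> ^ DIM('a)))) f"
    using assms lborel_affine[OF assms(2), of T] by simp
  then have "integrable (distr lborel borel (\<lambda>x. T + c *\<^sub>R x)) (\<lambda>x. \<bar>c\<bar> ^ DIM('a) *\<^sub>R f x)"
    by (subst (asm) integrable_density) auto
  then have "integrable lborel (\<lambda>x. \<bar>c\<bar> ^ DIM('a) *\<^sub>R f (T + c *\<^sub>R x))"
    by (subst (asm) integrable_distr_eq) auto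
  then show ?thesis using assms(2) by simp
qed

lemma integral_translate_scale:
  fixes f :: "'a::euclidean_space \<Rightarrow> real"
  assumes [measurable]: "f \<in> borel_measurable borel" and "c \<noteq> 0"
  shows "(LINT x|lborel. f x) = \<bar>c\<bar> ^ DIM('a) * (LINT w|lborel. f (T + c *\<^sub>R w))"
proof -
  have "(LINT x|lborel. f x) = (LINT x|density (distr lborel borel (\<lambda>x. T + c *\<^sub>R x)) (\<lambda>_. ennreal (\<bar>c\<bar> ^ DIM('a))). f x)"
    using lborel_affine[OF assms(2), of T] by simp
  also have "\<dots> = (LINT x|distr lborel borel (\<lambda>x. T + c *\<^sub>R x). \<bar>c\<bar> ^ DIM('a) *\<^sub>R f x)"
    by (rule integral_density) auto
  also have "\<dots> = (LINT x|lborel. \<bar>c\<bar> ^ DIM('a) *\<^sub>R f (T + c *\<^sub>R x))"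
    by (rule integral_distr) auto
  finally show ?thesis by simp
qed

text \<open>By Jensen and Fubini the \<open>p\<close>-th power of the error is at most the average,
  with weight \<phi>, of the translation modulus \<open>N\<close> at - \<epsilon> w. The modulus is
  bounded and tends to 0 at the origin, so dominated convergence applies.\<close>

lemma mollify_power_tendsto:
  fixes f \<phi> :: "'a::euclidean_space \<Rightarrow> real" and \<epsilon> :: "nat \<Rightarrow> real"
  assumes f: "integrable lborel f" "integrable lborel (\<lambda>x. \<bar>f x\<bar> ^ p)" and p: "1 \<le> p"
    and \<phi>: "integrable lborel \<phi>" "(LINT x|lborel. \<phi> x) = 1" "\<And>x. 0 \<le> \<phi> x" "\<And>x. \<phi> x \<le> B"
    and \<epsilon>: "\<epsilon> \<longlonglongrightarrow> 0" "\<And>i. \<epsilon> i \<noteq> 0"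
  shows "(\<lambda>i. \<integral>\<^sup>+x. ennreal (\<bar>(LINT w|lborel. f (x - \<epsilon> i *\<^sub>R w) * \<phi> w) - f x\<bar> ^ p) \<partial>lborel) \<longlonglongrightarrow> 0"
proof -
  have [measurable]: "f \<in> borel_measurable borel" "\<phi> \<in> borel_measurable borel" using f \<phi> by auto
  define N where "N = (\<lambda>v. \<integral>\<^sup>+x. ennreal (\<bar>f (x + v) - f x\<bar> ^ p) \<partial>lborel)"
  have [measurable]: "N \<in> borel_measurable borel" unfolding N_def by measurable
  define I where "I = (\<integral>\<^sup>+x. ennreal (\<bar>f x\<bar> ^ p) \<partial>lborel)"
  have I: "I < \<infinity>" using f(2) unfolding integrable_iff_bounded I_def by simp
  have Nb: "N v \<le> ennreal (2 ^ p) * (I + I)" for v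
  proof -
    have "N v \<le> (\<integral>\<^sup>+x. ennreal (2 ^ p) * (ennreal (\<bar>f (x + v)\<bar> ^ p) + ennreal (\<bar>f x\<bar> ^ p)) \<partial>lborel)"
      unfolding N_def
    proof (rule nn_integral_mono)
      fix x
      have "\<bar>f (x + v) - f x\<bar> ^ p \<le> (\<bar>f (x + v)\<bar> + \<bar>f x\<bar>) ^ p" by (intro power_mono) auto
      also have "\<dots> \<le> 2 ^ p * (\<bar>f (x + v)\<bar> ^ p + \<bar>f x\<bar> ^ p)" by (rule add_power_le) auto
      finally have "ennreal (\<bar>f (x + v) - f x\<bar> ^ p) \<le> ennreal (2 ^ p * (\<bar>f (x + v)\<bar> ^ p + \<bar>f x\<bar> ^ p))" by (rule ennreal_leI)
      also have "\<dots> = ennreal (2 ^ p) * (ennreal (\<bar>f (x + v)\<bar> ^ p) + ennreal (\<bar>f x\<bar> ^ p))"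
        by (subst ennreal_mult') auto
      finally show "ennreal (\<bar>f (x + v) - f x\<bar> ^ p) \<le> ennreal (2 ^ p) * (ennreal (\<bar>f (x + v)\<bar> ^ p) + ennreal (\<bar>f x\<bar> ^ p))" .
    qed
    also have "\<dots> = ennreal (2 ^ p) * ((\<integral>\<^sup>+x. ennreal (\<bar>f (x + v)\<bar> ^ p) \<partial>lborel) + I)"
      unfolding I_def by (simp add: nn_integral_cmult nn_integral_add)
    also have "(\<integral>\<^sup>+x. ennreal (\<bar>f (x + v)\<bar> ^ p) \<partial>lborel) = I"
      unfolding I_def by (rule nn_integral_translation[where f = "\<lambda>x. ennreal (\<bar>f x\<bar> ^ p)"]) measurable
    finally show ?thesis .
  qed
  have \<phi>1: "(\<integral>\<^sup>+w. ennreal (\<phi> w) \<partial>lborel) = 1"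
    using nn_integral_eq_integral[OF \<phi>(1)] \<phi> by simp
  have le: "(\<integral>\<^sup>+x. ennreal (\<bar>(LINT w|lborel. f (x - \<epsilon> i *\<^sub>R w) * \<phi> w) - f x\<bar> ^ p) \<partial>lborel)
     \<le> (\<integral>\<^sup>+w. N (- (\<epsilon> i *\<^sub>R w)) * ennreal (\<phi> w) \<partial>lborel)" for i
  proof -
    have "(\<integral>\<^sup>+x. ennreal (\<bar>(LINT w|lborel. f (x - \<epsilon> i *\<^sub>R w) * \<phi> w) - f x\<bar> ^ p) \<partial>lborel)
       \<le> (\<integral>\<^sup>+x. \<integral>\<^sup>+w. ennreal (\<bar>f (x - \<epsilon> i *\<^sub>R w) - f x\<bar> ^ p * \<phi> w) \<partial>lborel \<partial>lborel)"
    proof (rule nn_integral_mono)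
      fix x
      define h where "h = (\<lambda>w. \<bar>f (x - \<epsilon> i *\<^sub>R w) - f x\<bar>)"
      have int1: "integrable lborel (\<lambda>w. f (x - \<epsilon> i *\<^sub>R w) * \<phi> w)"
      proof (rule Bochner_Integration.integrable_bound)
        show "integrable lborel (\<lambda>w. B * f (x - \<epsilon> i *\<^sub>R w))"
          using integrable_translate_scale[OF f(1), of "- \<epsilon> i" x] \<epsilon>(2) by simp
        show "AE w in lborel. norm (f (x - \<epsilon> i *\<^sub>R w) * \<phi> w) \<le> norm (B * f (x - \<epsilon> i *\<^sub>R w))"
        proof (rule AE_I2)
          fix w
          have "\<bar>\<phi> w\<bar> \<le> \<bar>B\<bar>" using \<phi>(3)[of w] \<phi>(4)[of w] by simp
          from mult_right_mono[OF this, of "\<bar>f (x - \<epsilon> i *\<^sub>R w)\<bar>"]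
          show "norm (f (x - \<epsilon> i *\<^sub>R w) * \<phi> w) \<le> norm (B * f (x - \<epsilon> i *\<^sub>R w))"
            by (simp add: abs_mult mult.commute)
        qed
      qed measurable
      have int2: "integrable lborel (\<lambda>w. (f (x - \<epsilon> i *\<^sub>R w) - f x) * \<phi> w)"
        using int1 \<phi>(1) by (simp add: left_diff_distrib)
      then have int3: "integrable lborel (\<lambda>w. h w * \<phi> w)"
        by (rule Bochner_Integration.integrable_bound) (auto simp: h_def abs_mult \<phi>(3))
      have "(LINT w|lborel. f (x - \<epsilon> i *\<^sub>R w) * \<phi> w) - f x = (LINT w|lborel. (f (x - \<epsilon> i *\<^sub>R w) - f x) * \<phi> w)"
        using int1 \<phi>(1,2) by (simp add: left_diff_distrib)
      also have "\<bar>\<dots>\<bar> \<le> (LINT w|lborel. \<bar>(f (x - \<epsilon> i *\<^sub>R w) - f x) * \<phi> w\<bar>)" by (rule integral_abs_bound)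
      also have "\<dots> = (LINT w|lborel. h w * \<phi> w)" by (simp add: h_def abs_mult \<phi>(3))
      finally have "ennreal (\<bar>(LINT w|lborel. f (x - \<epsilon> i *\<^sub>R w) * \<phi> w) - f x\<bar> ^ p) \<le> ennreal ((LINT w|lborel. h w * \<phi> w) ^ p)"
        by (intro ennreal_leI power_mono) auto
      also have "\<dots> \<le> (\<integral>\<^sup>+w. ennreal (h w ^ p * \<phi> w) \<partial>lborel)"
        by (rule jensen_power_weight[OF int3 \<phi>(1,2)]) (use \<phi>(3) p in \<open>auto simp: h_def\<close>)
      finally show "ennreal (\<bar>(LINT w|lborel. f (x - \<epsilon> i *\<^sub>R w) * \<phi> w) - f x\<bar> ^ p)
         \<le> (\<integral>\<^sup>+w. ennreal (\<bar>f (x - \<epsilon> i *\<^sub>R w) - f x\<bar> ^ p * \<phi> w) \<partial>lborel)" by (simp add: h_def)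
    qed
    also have "\<dots> = (\<integral>\<^sup>+w. \<integral>\<^sup>+x. ennreal (\<bar>f (x - \<epsilon> i *\<^sub>R w) - f x\<bar> ^ p * \<phi> w) \<partial>lborel \<partial>lborel)"
      by (rule lborel_pair.Fubini') measurable
    also have "\<dots> = (\<integral>\<^sup>+w. N (- (\<epsilon> i *\<^sub>R w)) * ennreal (\<phi> w) \<partial>lborel)"
    proof (rule nn_integral_cong)
      fix w
      have "(\<integral>\<^sup>+x. ennreal (\<bar>f (x - \<epsilon> i *\<^sub>R w) - f x\<bar> ^ p * \<phi> w) \<partial>lborel) = (\<integral>\<^sup>+x. ennreal (\<bar>f (x - \<epsilon> i *\<^sub>R w) - f x\<bar> ^ p) * ennreal (\<phi> w) \<partial>lborel)"
        by (intro nn_integral_cong ennreal_mult') simp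
      also have "\<dots> = N (- (\<epsilon> i *\<^sub>R w)) * ennreal (\<phi> w)" unfolding N_def by (subst nn_integral_multc) simp_all
      finally show "(\<integral>\<^sup>+x. ennreal (\<bar>f (x - \<epsilon> i *\<^sub>R w) - f x\<bar> ^ p * \<phi> w) \<partial>lborel) = N (- (\<epsilon> i *\<^sub>R w)) * ennreal (\<phi> w)" .
    qed
    finally show ?thesis .
  qed
  have tc: "translation_continuous p f" by (rule translation_continuous_power) (use f p in auto)
  have "(\<lambda>i. \<integral>\<^sup>+w. N (- (\<epsilon> i *\<^sub>R w)) * ennreal (\<phi> w) \<partial>lborel) \<longlonglongrightarrow> (\<integral>\<^sup>+(w::'a). 0 \<partial>lborel)"
  proof (rule nn_integral_dominated_convergence[where w = "\<lambda>w. ennreal (2 ^ p) * (I + I) * ennreal (\<phi> w)"])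
    show "AE w in lborel. N (- (\<epsilon> j *\<^sub>R w)) * ennreal (\<phi> w) \<le> ennreal (2 ^ p) * (I + I) * ennreal (\<phi> w)" for j
      by (intro AE_I2 mult_right_mono Nb) simp
    show "(\<integral>\<^sup>+w. ennreal (2 ^ p) * (I + I) * ennreal (\<phi> w) \<partial>lborel) < \<infinity>"
      using I by (subst nn_integral_cmult) (auto simp: \<phi>1 ennreal_mult_less_top)
    show "AE w in lborel. (\<lambda>i. N (- (\<epsilon> i *\<^sub>R w)) * ennreal (\<phi> w)) \<longlonglongrightarrow> 0"
    proof (rule AE_I2)
      fix w :: 'a
      have "(\<lambda>i. - (\<epsilon> i *\<^sub>R w)) \<longlonglongrightarrow> - (0 *\<^sub>R w)" using tendsto_minus[OF tendsto_scaleR[OF \<epsilon>(1) tendsto_const[of w]]] .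
      then have "(\<lambda>i. - (\<epsilon> i *\<^sub>R w)) \<longlonglongrightarrow> 0" by simp
      then have "(\<lambda>i. N (- (\<epsilon> i *\<^sub>R w))) \<longlonglongrightarrow> 0"
        unfolding N_def by (rule tc[unfolded translation_continuous_def, rule_format])
      then have "(\<lambda>i. ennreal (\<phi> w) * N (- (\<epsilon> i *\<^sub>R w))) \<longlonglongrightarrow> ennreal (\<phi> w) * 0"
        by (intro ennreal_tendsto_cmult) simp_all
      then show "(\<lambda>i. N (- (\<epsilon> i *\<^sub>R w)) * ennreal (\<phi> w)) \<longlonglongrightarrow> 0" by (simp add: mult.commute)
    qed
  qed measurable
  then have lim: "(\<lambda>i. \<integral>\<^sup>+w. N (- (\<epsilon> i *\<^sub>R w)) * ennreal (\<phi> w) \<partial>lborel) \<longlonglongrightarrow> 0" by simp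
  show ?thesis
    by (rule tendsto_sandwich[OF _ _ tendsto_const lim]) (auto intro!: always_eventually le)
qed

section \<open>Reverse Hoelder inequality for smooth maps\<close>

lemma nn_integral_affine:
  fixes h :: "'a::euclidean_space \<Rightarrow> ennreal"
  assumes [measurable]: "h \<in> borel_measurable borel" and c: "c \<noteq> 0"
  shows "ennreal (\<bar>c\<bar> ^ DIM('a)) * (\<integral>\<^sup>+x. h (T + c *\<^sub>R x) \<partial>lborel) = (\<integral>\<^sup>+x. h x \<partial>lborel)"
proof -
  have "(\<integral>\<^sup>+x. h x \<partial>lborel) = (\<integral>\<^sup>+x. h x \<partial>density (distr lborel borel (\<lambda>x. T + c *\<^sub>R x)) (\<lambda>_. ennreal (\<bar>c\<bar> ^ DIM('a))))"
    by (subst lborel_affine[OF c, of T]) simp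
  also have "\<dots> = ennreal (\<bar>c\<bar> ^ DIM('a)) * (\<integral>\<^sup>+x. h (T + c *\<^sub>R x) \<partial>lborel)"
    by (simp add: nn_integral_density nn_integral_distr nn_integral_cmult)
  finally show ?thesis by simp
qed

text \<open>A lower bound \<open>c\<close> in place of the actual factor \<open>c'\<close> makes the
  constant uniform; it is used with \<open>c = 1/2\<close> and with \<open>c = c'\<close>.\<close>

lemma nn_integral_affine_le:
  fixes h :: "'a::euclidean_space \<Rightarrow> ennreal"
  assumes [measurable]: "h \<in> borel_measurable borel" and c: "0 < c" "c \<le> c'"
  shows "(\<integral>\<^sup>+x. h (T + c' *\<^sub>R x) \<partial>lborel) \<le> ennreal (1 / c ^ DIM('a)) * (\<integral>\<^sup>+x. h x \<partial>lborel)"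
proof -
  have "(\<integral>\<^sup>+x. h (T + c' *\<^sub>R x) \<partial>lborel) = ennreal (1 / c' ^ DIM('a)) * (ennreal (\<bar>c'\<bar> ^ DIM('a)) * (\<integral>\<^sup>+x. h (T + c' *\<^sub>R x) \<partial>lborel))"
    using c by (simp add: mult.assoc[symmetric] ennreal_mult'[symmetric])
  also have "\<dots> = ennreal (1 / c' ^ DIM('a)) * (\<integral>\<^sup>+x. h x \<partial>lborel)"
    using c by (subst nn_integral_affine) auto
  also have "\<dots> \<le> ennreal (1 / c ^ DIM('a)) * (\<integral>\<^sup>+x. h x \<partial>lborel)"
    using c by (intro mult_right_mono ennreal_leI divide_left_mono power_mono) auto
  finally show ?thesis .
qed

text \<open>A product of degree n is to be bounded by quantities of degree q = n - 1/2 at the price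
  of half a power of the level \<mu>. If one factor is at most \<mu>, half a power of that factor is
  split off. If both exceed \<mu>, writing \<beta> = \<beta>^(1-q) \<beta>^q with 1 - q \<le> 0
  gives the extra term, which contains \<beta> only in the power q that can be averaged.\<close>

lemma interpolation_pointwise:
  fixes a \<beta> \<mu> :: real
  assumes "0 \<le> a" "0 \<le> \<beta>" "0 < \<mu>" and n: "2 \<le> n"
  defines "q \<equiv> real n - 1/2"
  shows "a ^ (n - 1) * \<beta> \<le> sqrt \<mu> * (a powr q + \<beta> powr q) + (if \<mu> < a then a ^ (n - 1) * \<mu> powr (1 - q) * \<beta> powr q else 0)"
proof -
  have q1: "1 \<le> q" using n by (simp add: q_def)
  have pw: "x powr q = x ^ (n - 1) * sqrt x" if "0 \<le> x" for x
  proof (cases "x = 0")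
    case False
    then have "x powr q = x powr (real (n - 1) + 1/2)" using n by (simp add: q_def of_nat_diff)
    also have "\<dots> = x ^ (n - 1) * sqrt x" using False that by (simp add: powr_add powr_realpow powr_half_sqrt)
    finally show ?thesis .
  qed simp
  have young: "x ^ (n - 1) * sqrt y \<le> x powr q + y powr q" if "0 \<le> x" "0 \<le> y" for x y
  proof (cases "y \<le> x")
    case True
    then have "x ^ (n - 1) * sqrt y \<le> x ^ (n - 1) * sqrt x" using that by (intro mult_left_mono) auto
    then show ?thesis using that by (simp add: pw add_increasing2)
  next
    case False
    then have "x ^ (n - 1) * sqrt y \<le> y ^ (n - 1) * sqrt y" using that by (intro mult_right_mono power_mono) auto
    then show ?thesis using that by (simp add: pw add_increasing)
  qed
  have extra: "0 \<le> (if \<mu> < a then a ^ (n - 1) * \<mu> powr (1 - q) * \<beta> powr q else 0)" using assms by simp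
  consider "\<beta> \<le> \<mu>" | "a \<le> \<mu>" "\<mu> < \<beta>" | "\<mu> < a" "\<mu> < \<beta>" by linarith
  then show ?thesis
  proof cases
    case 1
    have "a ^ (n - 1) * \<beta> = sqrt \<beta> * (a ^ (n - 1) * sqrt \<beta>)" using assms by simp
    also have "\<dots> \<le> sqrt \<mu> * (a powr q + \<beta> powr q)"
      using 1 assms young[of a \<beta>] by (intro mult_mono) auto
    finally show ?thesis using extra by linarith
  next
    case 2
    have "a ^ (n - 1) * \<beta> \<le> sqrt a * \<beta> powr q"
    proof (cases "a = 0")
      case False
      then have a: "a > 0" using assms by simp
      have "\<beta> = \<beta> powr (1 - q) * \<beta> powr q" using 2 assms by (simp flip: powr_add)
      also have "\<dots> \<le> a powr (1 - q) * \<beta> powr q"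
        using 2 a q1 by (intro mult_right_mono powr_mono2') auto
      finally have "a ^ (n - 1) * \<beta> \<le> a ^ (n - 1) * (a powr (1 - q) * \<beta> powr q)"
        using a by (intro mult_left_mono) auto
      also have "\<dots> = sqrt a * \<beta> powr q"
      proof -
        have 1: "a ^ (n - 1) = a powr q / sqrt a" using a by (simp add: pw)
        have "a powr q * a powr (1 - q) = a" using a by (simp flip: powr_add)
        then have "a powr q / sqrt a * (a powr (1 - q) * \<beta> powr q) = a / sqrt a * \<beta> powr q"
          by (metis mult.assoc times_divide_eq_left)
        then show ?thesis using a by (simp only: 1) (simp add: real_div_sqrt)
      qed
      finally show ?thesis .
    qed (use n in \<open>simp add: power_0_left\<close>)
    also have "\<dots> \<le> sqrt \<mu> * (a powr q + \<beta> powr q)" using 2 assms by (intro mult_mono) auto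
    finally show ?thesis using extra by linarith
  next
    case 3
    have "\<beta> = \<beta> powr (1 - q) * \<beta> powr q" using 3 assms by (simp flip: powr_add)
    also have "\<dots> \<le> \<mu> powr (1 - q) * \<beta> powr q"
      using 3 assms q1 by (intro mult_right_mono powr_mono2') auto
    finally have "a ^ (n - 1) * \<beta> \<le> a ^ (n - 1) * (\<mu> powr (1 - q) * \<beta> powr q)"
      using assms by (intro mult_left_mono) auto
    moreover have "0 \<le> sqrt \<mu> * (a powr q + \<beta> powr q)" using assms by simp
    ultimately show ?thesis using 3 by (simp add: mult.assoc)
  qed
qed

text \<open>
  For fixed \<open>t\<close> the points \<open>x + t (y - x)\<close> stay in the ball, so that substituting in \<open>y\<close> costs
  \<open>t\<^sup>-\<^sup>n\<close>, while substituting in \<open>y\<close> or in \<open>x\<close>, whichever has the larger coefficient, costs only \<open>2\<^sup>n\<close>.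
\<close>

lemma convex_combination_integrals:
  fixes \<phi> :: "'a::euclidean_space \<Rightarrow> ennreal" and z x :: 'a and r t :: real
  assumes [measurable]: "\<phi> \<in> borel_measurable borel" and t: "0 < t" "t < 1"
  defines "B \<equiv> ball z r"
  shows "x \<in> B \<Longrightarrow> (\<integral>\<^sup>+y\<in>B. \<phi> (x + t *\<^sub>R (y - x)) \<partial>lborel) \<le> ennreal (1 / t ^ DIM('a)) * (\<integral>\<^sup>+y\<in>B. \<phi> y \<partial>lborel)"
    and "(\<integral>\<^sup>+x\<in>B. (\<integral>\<^sup>+y\<in>B. \<phi> (x + t *\<^sub>R (y - x)) \<partial>lborel) \<partial>lborel)
      \<le> ennreal (2 ^ DIM('a)) * emeasure lborel B * (\<integral>\<^sup>+y\<in>B. \<phi> y \<partial>lborel)"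
proof -
  have [measurable]: "B \<in> sets borel" by (simp add: B_def)
  have conv: "x + t *\<^sub>R (y - x) \<in> B" if "x \<in> B" "y \<in> B" for x y
  proof -
    have "(1 - t) *\<^sub>R x + t *\<^sub>R y \<in> B"
      unfolding B_def by (rule convexD[OF convex_ball]) (use that t in \<open>auto simp: B_def\<close>)
    then show ?thesis by (simp add: algebra_simps)
  qed
  \<comment> \<open>The segment between two points of the ball stays in the ball, so \<phi> may be
    cut off there first; the substitution can then be made over the whole space.\<close>
  define \<psi> where "\<psi> = (\<lambda>y. \<phi> y * indicator B y)"
  have [measurable]: "\<psi> \<in> borel_measurable borel" unfolding \<psi>_def by measurable
  have le: "\<phi> (x + t *\<^sub>R (y - x)) * indicator B y * indicator B x \<le> \<psi> (x + t *\<^sub>R (y - x)) * indicator B x * indicator B y" for x y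
    using conv[of x y] by (auto simp: \<psi>_def indicator_def)
  have in_y: "(\<integral>\<^sup>+y\<in>B. \<phi> (x + t *\<^sub>R (y - x)) \<partial>lborel) \<le> ennreal (1 / c ^ DIM('a)) * (\<integral>\<^sup>+y\<in>B. \<phi> y \<partial>lborel)"
    if x: "x \<in> B" and c: "0 < c" "c \<le> t" for x c
  proof -
    have "(\<integral>\<^sup>+y\<in>B. \<phi> (x + t *\<^sub>R (y - x)) \<partial>lborel) \<le> (\<integral>\<^sup>+y. \<psi> ((x - t *\<^sub>R x) + t *\<^sub>R y) \<partial>lborel)"
    proof (intro nn_integral_mono)
      fix y
      have eq: "(x - t *\<^sub>R x) + t *\<^sub>R y = x + t *\<^sub>R (y - x)" by (simp add: algebra_simps)
      show "\<phi> (x + t *\<^sub>R (y - x)) * indicator B y \<le> \<psi> ((x - t *\<^sub>R x) + t *\<^sub>R y)"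
        unfolding eq using le[of x y] x by (auto simp: indicator_def split: if_splits)
    qed
    also have "\<dots> \<le> ennreal (1 / c ^ DIM('a)) * (\<integral>\<^sup>+y. \<psi> y \<partial>lborel)"
      using c by (intro nn_integral_affine_le) auto
    finally show ?thesis by (simp add: \<psi>_def)
  qed
  show "x \<in> B \<Longrightarrow> (\<integral>\<^sup>+y\<in>B. \<phi> (x + t *\<^sub>R (y - x)) \<partial>lborel) \<le> ennreal (1 / t ^ DIM('a)) * (\<integral>\<^sup>+y\<in>B. \<phi> y \<partial>lborel)"
    using in_y[of x t] t by simp
  define A where "A = (\<integral>\<^sup>+y\<in>B. \<phi> y \<partial>lborel)"
  have two: "1 / (1/2) ^ DIM('a) = (2::real) ^ DIM('a)" by (simp add: power_divide)
  show "(\<integral>\<^sup>+x\<in>B. (\<integral>\<^sup>+y\<in>B. \<phi> (x + t *\<^sub>R (y - x)) \<partial>lborel) \<partial>lborel)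
      \<le> ennreal (2 ^ DIM('a)) * emeasure lborel B * (\<integral>\<^sup>+y\<in>B. \<phi> y \<partial>lborel)"
  proof (cases "1/2 \<le> t")
    case True
    have "(\<integral>\<^sup>+x\<in>B. (\<integral>\<^sup>+y\<in>B. \<phi> (x + t *\<^sub>R (y - x)) \<partial>lborel) \<partial>lborel) \<le> (\<integral>\<^sup>+x\<in>B. ennreal (2 ^ DIM('a)) * A \<partial>lborel)"
    proof (rule nn_integral_mono)
      fix x
      show "(\<integral>\<^sup>+y\<in>B. \<phi> (x + t *\<^sub>R (y - x)) \<partial>lborel) * indicator B x \<le> ennreal (2 ^ DIM('a)) * A * indicator B x"
        using in_y[of x "1/2"] True by (auto simp: indicator_def A_def two)
    qed
    also have "\<dots> = ennreal (2 ^ DIM('a)) * A * emeasure lborel B" by (simp add: nn_integral_cmult_indicator)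
    finally show ?thesis by (simp only: A_def mult.commute mult.left_commute)
  next
    case False
    have "(\<integral>\<^sup>+x\<in>B. (\<integral>\<^sup>+y\<in>B. \<phi> (x + t *\<^sub>R (y - x)) \<partial>lborel) \<partial>lborel)
        = (\<integral>\<^sup>+x. (\<integral>\<^sup>+y. \<phi> (x + t *\<^sub>R (y - x)) * indicator B y * indicator B x \<partial>lborel) \<partial>lborel)"
      by (simp add: nn_integral_multc)
    also have "\<dots> \<le> (\<integral>\<^sup>+x. (\<integral>\<^sup>+y. \<psi> (x + t *\<^sub>R (y - x)) * indicator B x * indicator B y \<partial>lborel) \<partial>lborel)"
      by (intro nn_integral_mono le)
    also have "\<dots> = (\<integral>\<^sup>+y. (\<integral>\<^sup>+x. \<psi> (x + t *\<^sub>R (y - x)) * indicator B x * indicator B y \<partial>lborel) \<partial>lborel)"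
      by (rule lborel_pair.Fubini') measurable
    also have "\<dots> \<le> (\<integral>\<^sup>+y. ennreal (2 ^ DIM('a)) * A * indicator B y \<partial>lborel)"
    proof (rule nn_integral_mono)
      fix y
      have "(\<integral>\<^sup>+x. \<psi> (x + t *\<^sub>R (y - x)) * indicator B x * indicator B y \<partial>lborel)
          \<le> (\<integral>\<^sup>+x. \<psi> (t *\<^sub>R y + (1 - t) *\<^sub>R x) * indicator B y \<partial>lborel)"
        by (intro nn_integral_mono) (auto simp: indicator_def algebra_simps)
      also have "\<dots> = (\<integral>\<^sup>+x. \<psi> (t *\<^sub>R y + (1 - t) *\<^sub>R x) \<partial>lborel) * indicator B y"
        by (rule nn_integral_multc) measurable
      also have "\<dots> \<le> ennreal (1 / (1/2) ^ DIM('a)) * (\<integral>\<^sup>+x. \<psi> x \<partial>lborel) * indicator B y"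
        using False by (intro mult_right_mono nn_integral_affine_le) auto
      finally show "(\<integral>\<^sup>+x. \<psi> (x + t *\<^sub>R (y - x)) * indicator B x * indicator B y \<partial>lborel)
          \<le> ennreal (2 ^ DIM('a)) * A * indicator B y"
        by (simp only: two A_def \<psi>_def)
    qed
    also have "\<dots> = ennreal (2 ^ DIM('a)) * A * emeasure lborel B" by (simp add: nn_integral_cmult_indicator)
    finally show ?thesis by (simp only: A_def mult.commute mult.left_commute)
  qed
qed

lemma nn_integral_powr_0_1:
  fixes e :: real
  assumes "e > -1"
  shows "(\<integral>\<^sup>+t\<in>{0<..<1}. ennreal (t powr e) \<partial>lborel) \<le> ennreal (1 / (1 + e))"
proof -
  have "((\<lambda>t. if t \<in> {0..1} then t powr e else 0) has_integral 1 / (1 + e)) UNIV"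
    using has_integral_powr_from_0[of e 1] assms by (subst has_integral_restrict_UNIV) (simp add: add.commute)
  then have "(\<integral>\<^sup>+t. ennreal (if t \<in> {0..1} then t powr e else 0) \<partial>lborel) = ennreal (1 / (1 + e))"
    by (intro nn_integral_has_integral_lborel) auto
  moreover have "(\<integral>\<^sup>+t\<in>{0<..<1}. ennreal (t powr e) \<partial>lborel) \<le> (\<integral>\<^sup>+t. ennreal (if t \<in> {0..1} then t powr e else 0) \<partial>lborel)"
    by (intro nn_integral_mono) (auto simp: indicator_def)
  ultimately show ?thesis by simp
qed

context
  fixes g :: "'a::euclidean_space \<Rightarrow> real" and z :: 'a and r A' :: real
  assumes g_meas [measurable]: "g \<in> borel_measurable borel" and g0: "\<And>x. 0 \<le> g x"
    and r: "0 < r" and A': "0 < A'" and n2: "2 \<le> DIM('a)"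
    and A: "(\<integral>\<^sup>+x\<in>ball z r. ennreal (g x powr (real DIM('a) - 1/2)) \<partial>lborel) \<le> ennreal A'"
begin

lemma kernel_integral_slice:
  fixes t b p :: real
  assumes t: "0 < t" "t < 1"
  defines "b \<equiv> unit_ball_vol (real DIM('a)) * r ^ DIM('a)"
  defines "p \<equiv> 1 / (2 * real DIM('a) - 1)"
  shows "(\<integral>\<^sup>+x\<in>ball z r. (\<integral>\<^sup>+y\<in>ball z r. ennreal (g x ^ (DIM('a) - 1) * g (x + t *\<^sub>R (y - x))) \<partial>lborel) \<partial>lborel)
    \<le> ennreal (2 * (1 + 2 ^ DIM('a)) * b * A' * (A' / b) powr p * t powr (- (real DIM('a) * p)))"
proof -
  define n where "n = DIM('a)"
  define q where "q = real n - 1/2"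
  define B where "B = ball z r"
  have [measurable]: "B \<in> sets borel" by (simp add: B_def)
  have b: "b > 0" using r by (simp add: b_def)
  have eB: "emeasure lborel B = ennreal b" using r by (simp add: B_def b_def emeasure_ball)
  have q: "q \<ge> 1" using n2 by (simp add: q_def n_def)
  have p: "p = 1 / (2 * q)" by (simp add: p_def q_def n_def algebra_simps)
  \<comment> \<open>\<mu>^q is the bound that substitution in y gives for the mean of g(x + t (y -
    x))^q over the ball. With this choice the extra term of the interpolation integrates to at most
    \<mu> g(x)^(n-1) b, hence to at most sqrt \<mu> g(x)^q b where g(x) > \<mu>. As p = 1 / (2 q),
    the factor sqrt \<mu> carries the singularity t^(-n p).\<close>
  define \<mu> where "\<mu> = (A' / (t ^ n * b)) powr (1 / q)"
  have \<mu>: "\<mu> > 0" using A' t b by (simp add: \<mu>_def)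
  have \<mu>q: "\<mu> powr q = A' / (t ^ n * b)" using q A' t b by (simp add: \<mu>_def powr_powr)
  have sq: "sqrt \<mu> = (A' / b) powr p * t powr (- (real n * p))"
  proof -
    have "sqrt \<mu> = (A' / (t ^ n * b)) powr p"
      using \<mu> by (simp add: \<mu>_def powr_half_sqrt[symmetric] powr_powr p mult.commute)
    also have "A' / (t ^ n * b) = (A' / b) * (t powr (- real n))"
      using t b by (simp add: powr_minus powr_realpow divide_inverse)
    also have "\<dots> powr p = (A' / b) powr p * t powr (- (real n * p))"
      using t b A' by (subst powr_mult) (simp_all add: powr_powr)
    finally show ?thesis .
  qed
  define N where "N = (\<lambda>x. \<integral>\<^sup>+y. ennreal (g (x + t *\<^sub>R (y - x)) powr q) * indicator B y \<partial>lborel)"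
  have [measurable]: "N \<in> borel_measurable borel" unfolding N_def by measurable
  have A2: "(\<integral>\<^sup>+y\<in>B. ennreal (g y powr q) \<partial>lborel) \<le> ennreal A'"
    using A by (simp add: B_def q_def n_def)
  have N1: "N x \<le> ennreal (\<mu> powr q * b)" if "x \<in> B" for x
  proof -
    have "N x \<le> ennreal (1 / t ^ DIM('a)) * (\<integral>\<^sup>+y\<in>B. ennreal (g y powr q) \<partial>lborel)"
      unfolding N_def B_def
      by (rule convex_combination_integrals(1)[where \<phi> = "\<lambda>y. ennreal (g y powr q)"]) (use t that B_def in auto)
    also have "\<dots> \<le> ennreal (1 / t ^ DIM('a)) * ennreal A'" by (intro mult_left_mono A2) simp
    also have "\<dots> = ennreal (\<mu> powr q * b)" using t b by (simp add: \<mu>q n_def ennreal_mult'[symmetric])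
    finally show ?thesis .
  qed
  have N2: "(\<integral>\<^sup>+x\<in>B. N x \<partial>lborel) \<le> ennreal (2 ^ n * b * A')"
  proof -
    have "(\<integral>\<^sup>+x\<in>B. N x \<partial>lborel) \<le> ennreal (2 ^ DIM('a)) * emeasure lborel B * (\<integral>\<^sup>+y\<in>B. ennreal (g y powr q) \<partial>lborel)"
      unfolding N_def B_def
      by (rule convex_combination_integrals(2)[where \<phi> = "\<lambda>y. ennreal (g y powr q)"]) (use t in auto)
    also have "\<dots> \<le> ennreal (2 ^ DIM('a)) * emeasure lborel B * ennreal A'" by (intro mult_left_mono A2) simp
    also have "\<dots> = ennreal (2 ^ n * b * A')" using b A' by (simp add: eB n_def ennreal_mult'[symmetric] del: ennreal_power)
    finally show ?thesis .
  qed
  have inner: "(\<integral>\<^sup>+y\<in>B. ennreal (g x ^ (n - 1) * g (x + t *\<^sub>R (y - x))) \<partial>lborel)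
      \<le> ennreal (sqrt \<mu>) * (ennreal (2 * b) * ennreal (g x powr q) + N x)" if x: "x \<in> B" for x
  proof -
    \<comment> \<open>The coefficient of g^q at the moving point that comes from the extra term; it
      vanishes unless \<open>g x\<close> exceeds \<mu>.\<close>
    define e where "e = (if \<mu> < g x then g x ^ (n - 1) * \<mu> powr (1 - q) else 0)"
    have e0: "0 \<le> e" using g0 by (simp add: e_def)
    have "(\<integral>\<^sup>+y\<in>B. ennreal (g x ^ (n - 1) * g (x + t *\<^sub>R (y - x))) \<partial>lborel)
      \<le> (\<integral>\<^sup>+y. ennreal (sqrt \<mu> * g x powr q) * indicator B y
          + ennreal (sqrt \<mu> + e) * (ennreal (g (x + t *\<^sub>R (y - x)) powr q) * indicator B y) \<partial>lborel)"
    proof (rule nn_integral_mono)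
      fix y
      have "g x ^ (n - 1) * g (x + t *\<^sub>R (y - x)) \<le> sqrt \<mu> * g x powr q + (sqrt \<mu> + e) * g (x + t *\<^sub>R (y - x)) powr q"
        using interpolation_pointwise[of "g x" "g (x + t *\<^sub>R (y - x))" \<mu> n] g0 \<mu> n2
        by (auto simp: e_def q_def n_def algebra_simps split: if_splits)
      then have "ennreal (g x ^ (n - 1) * g (x + t *\<^sub>R (y - x))) \<le> ennreal (sqrt \<mu> * g x powr q + (sqrt \<mu> + e) * g (x + t *\<^sub>R (y - x)) powr q)"
        by (rule ennreal_leI)
      also have "\<dots> = ennreal (sqrt \<mu> * g x powr q) + ennreal (sqrt \<mu> + e) * ennreal (g (x + t *\<^sub>R (y - x)) powr q)"
        using e0 \<mu> by (subst ennreal_plus) (auto simp: ennreal_mult')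
      finally show "ennreal (g x ^ (n - 1) * g (x + t *\<^sub>R (y - x))) * indicator B y
         \<le> ennreal (sqrt \<mu> * g x powr q) * indicator B y
          + ennreal (sqrt \<mu> + e) * (ennreal (g (x + t *\<^sub>R (y - x)) powr q) * indicator B y)"
        by (auto simp: indicator_def)
    qed
    also have "\<dots> = ennreal (sqrt \<mu> * g x powr q) * ennreal b + ennreal (sqrt \<mu> + e) * N x"
      unfolding N_def by (simp add: nn_integral_add nn_integral_cmult eB)
    also have "ennreal (sqrt \<mu> + e) * N x = ennreal (sqrt \<mu>) * N x + ennreal e * N x"
      using \<mu> e0 by (simp add: ennreal_plus distrib_right)
    also have "ennreal (sqrt \<mu> * g x powr q) * ennreal b + (ennreal (sqrt \<mu>) * N x + ennreal e * N x)
        \<le> ennreal (sqrt \<mu> * g x powr q) * ennreal b + (ennreal (sqrt \<mu>) * N x + ennreal (sqrt \<mu> * g x powr q) * ennreal b)"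
    proof (intro add_left_mono)
      have "ennreal e * N x \<le> ennreal e * ennreal (\<mu> powr q * b)" by (intro mult_left_mono N1 x) simp
      also have "\<dots> \<le> ennreal (sqrt \<mu> * g x powr q) * ennreal b"
      proof (cases "\<mu> < g x")
        case True
        have "g x powr q = g x ^ (n - 1) * sqrt (g x)"
        proof -
          have "g x powr q = g x powr (real (n - 1) + 1/2)" using n2 by (simp add: q_def of_nat_diff n_def)
          also have "\<dots> = g x ^ (n - 1) * sqrt (g x)" using True \<mu> by (simp add: powr_add powr_realpow powr_half_sqrt)
          finally show ?thesis .
        qed
        have "e * (\<mu> powr q * b) = g x ^ (n - 1) * (\<mu> powr (1 - q) * \<mu> powr q) * b" using True by (simp add: e_def)
        also have "\<mu> powr (1 - q) * \<mu> powr q = sqrt \<mu> * sqrt \<mu>" using \<mu> by (simp flip: powr_add)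
        also have "g x ^ (n - 1) * (sqrt \<mu> * sqrt \<mu>) * b \<le> g x ^ (n - 1) * (sqrt \<mu> * sqrt (g x)) * b"
          using True \<mu> b g0 by (intro mult_right_mono mult_left_mono) auto
        also have "\<dots> = sqrt \<mu> * g x powr q * b" by (simp add: \<open>g x powr q = g x ^ (n - 1) * sqrt (g x)\<close>)
        finally have "ennreal (e * (\<mu> powr q * b)) \<le> ennreal (sqrt \<mu> * g x powr q * b)" by (rule ennreal_leI)
        moreover have "ennreal (e * (\<mu> powr q * b)) = ennreal e * ennreal (\<mu> powr q * b)"
          using e0 by (rule ennreal_mult')
        moreover have "ennreal (sqrt \<mu> * g x powr q * b) = ennreal (sqrt \<mu> * g x powr q) * ennreal b"
          using \<mu> by (intro ennreal_mult') simp
        ultimately show ?thesis by simp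
      qed (simp add: e_def)
      finally show "ennreal e * N x \<le> ennreal (sqrt \<mu> * g x powr q) * ennreal b" .
    qed
    also have "\<dots> = ennreal (sqrt \<mu>) * (ennreal (2 * b) * ennreal (g x powr q) + N x)"
    proof -
      have "ennreal (sqrt \<mu> * g x powr q) * ennreal b + ennreal (sqrt \<mu> * g x powr q) * ennreal b
        = ennreal (sqrt \<mu>) * (ennreal (2 * b) * ennreal (g x powr q))"
        using \<mu> b by (simp add: ennreal_mult'[symmetric] ennreal_plus[symmetric] del: ennreal_plus)
      then show ?thesis by (simp add: distrib_left add_ac)
    qed
    finally show ?thesis .
  qed
  have "(\<integral>\<^sup>+x\<in>B. (\<integral>\<^sup>+y\<in>B. ennreal (g x ^ (n - 1) * g (x + t *\<^sub>R (y - x))) \<partial>lborel) \<partial>lborel)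
      \<le> (\<integral>\<^sup>+x. ennreal (sqrt \<mu>) * (ennreal (2 * b) * (ennreal (g x powr q) * indicator B x) + N x * indicator B x) \<partial>lborel)"
    using inner by (intro nn_integral_mono) (auto simp: indicator_def)
  also have "\<dots> = ennreal (sqrt \<mu>) * (ennreal (2 * b) * (\<integral>\<^sup>+x\<in>B. ennreal (g x powr q) \<partial>lborel) + (\<integral>\<^sup>+x\<in>B. N x \<partial>lborel))"
    by (simp add: nn_integral_cmult nn_integral_add)
  also have "\<dots> \<le> ennreal (sqrt \<mu>) * (ennreal (2 * b) * ennreal A' + ennreal (2 ^ n * b * A'))"
    by (intro mult_left_mono add_mono A2 N2) auto
  also have "\<dots> = ennreal (sqrt \<mu> * (2 * b * A' + 2 ^ n * b * A'))"
  proof -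
    have "ennreal (2 * b) * ennreal A' + ennreal (2 ^ n * b * A') = ennreal (2 * b * A' + 2 ^ n * b * A')"
      using b A' by (subst ennreal_plus) (auto simp: ennreal_mult'[symmetric])
    then show ?thesis using \<mu> by (subst ennreal_mult') auto
  qed
  also have "\<dots> \<le> ennreal (2 * (1 + 2 ^ DIM('a)) * b * A' * (A' / b) powr p * t powr (- (real DIM('a) * p)))"
  proof (rule ennreal_leI)
    have "sqrt \<mu> * (2 * b * A' + 2 ^ n * b * A') \<le> sqrt \<mu> * (2 * b * A' + 2 * (2 ^ n * b * A'))"
      using b A' \<mu> by (intro mult_left_mono add_left_mono) auto
    also have "\<dots> = 2 * (1 + 2 ^ n) * b * A' * sqrt \<mu>" by (simp add: algebra_simps)
    finally show "sqrt \<mu> * (2 * b * A' + 2 ^ n * b * A')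
        \<le> 2 * (1 + 2 ^ DIM('a)) * b * A' * (A' / b) powr p * t powr (- (real DIM('a) * p))"
      unfolding sq n_def by (simp add: mult.assoc)
  qed
  finally show ?thesis by (simp only: B_def n_def)
qed

text \<open>Fubini moves t outermost, where the slices leave t^(-n p) with n p = n / (2 n - 1) < 1
  for n \<ge> 2. In contrast to the t^(-n) of a direct substitution in y, this is integrable at
  0.\<close>

lemma kernel_integral:
  fixes b p :: real
  defines "b \<equiv> unit_ball_vol (real DIM('a)) * r ^ DIM('a)"
  defines "p \<equiv> 1 / (2 * real DIM('a) - 1)"
  shows "(\<integral>\<^sup>+y\<in>ball z r. (\<integral>\<^sup>+x\<in>ball z r. (\<integral>\<^sup>+t\<in>{0<..<1}.
        ennreal (g x ^ (DIM('a) - 1) * g (x + t *\<^sub>R (y - x))) \<partial>lborel) \<partial>lborel) \<partial>lborel)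
    \<le> ennreal (2 * (1 + 2 ^ DIM('a)) * b * A' * (A' / b) powr p * (1 / (1 - real DIM('a) * p)))"
proof -
  define n where "n = DIM('a)"
  define B where "B = ball z r"
  have [measurable]: "B \<in> sets borel" by (simp add: B_def)
  have b: "b > 0" using r by (simp add: b_def)
  define k where "k = (\<lambda>x y t. ennreal (g x ^ (n - 1) * g (x + t *\<^sub>R (y - x))) * indicator {0<..<1} t * indicator B x * indicator B y)"
  have km [measurable (raw)]: "(\<lambda>w. k (u w) (v w) (s w)) \<in> borel_measurable M"
    if [measurable]: "u \<in> borel_measurable M" "v \<in> borel_measurable M" "s \<in> borel_measurable M" for M :: "'b measure" and u v s
    unfolding k_def by measurable
  have "(\<integral>\<^sup>+y\<in>B. (\<integral>\<^sup>+x\<in>B. (\<integral>\<^sup>+t\<in>{0<..<1}. ennreal (g x ^ (n - 1) * g (x + t *\<^sub>R (y - x))) \<partial>lborel) \<partial>lborel) \<partial>lborel)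
     = (\<integral>\<^sup>+y. \<integral>\<^sup>+x. \<integral>\<^sup>+t. k x y t \<partial>lborel \<partial>lborel \<partial>lborel)"
    unfolding k_def by (simp add: nn_integral_multc)
  also have "\<dots> = (\<integral>\<^sup>+y. \<integral>\<^sup>+t. \<integral>\<^sup>+x. k x y t \<partial>lborel \<partial>lborel \<partial>lborel)"
    by (intro nn_integral_cong lborel_pair.Fubini') measurable
  also have "\<dots> = (\<integral>\<^sup>+t. \<integral>\<^sup>+y. \<integral>\<^sup>+x. k x y t \<partial>lborel \<partial>lborel \<partial>lborel)"
    by (rule lborel_pair.Fubini') measurable
  also have "\<dots> = (\<integral>\<^sup>+t. \<integral>\<^sup>+x. \<integral>\<^sup>+y. k x y t \<partial>lborel \<partial>lborel \<partial>lborel)"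
    by (intro nn_integral_cong lborel_pair.Fubini') measurable
  also have "\<dots> \<le> (\<integral>\<^sup>+t. ennreal (2 * (1 + 2 ^ n) * b * A' * (A' / b) powr p) * (ennreal (t powr (- (real n * p))) * indicator {0<..<1} t) \<partial>lborel)"
  proof (rule nn_integral_mono)
    fix t :: real
    show "(\<integral>\<^sup>+x. \<integral>\<^sup>+y. k x y t \<partial>lborel \<partial>lborel)
      \<le> ennreal (2 * (1 + 2 ^ n) * b * A' * (A' / b) powr p) * (ennreal (t powr (- (real n * p))) * indicator {0<..<1} t)"
    proof (cases "t \<in> {0<..<1}")
      case True
      have "(\<integral>\<^sup>+x. \<integral>\<^sup>+y. k x y t \<partial>lborel \<partial>lborel)
         = (\<integral>\<^sup>+x\<in>B. (\<integral>\<^sup>+y\<in>B. ennreal (g x ^ (n - 1) * g (x + t *\<^sub>R (y - x))) \<partial>lborel) \<partial>lborel)"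
      proof (rule nn_integral_cong)
        fix x
        have "(\<integral>\<^sup>+y. k x y t \<partial>lborel) = (\<integral>\<^sup>+y. ennreal (g x ^ (n - 1) * g (x + t *\<^sub>R (y - x))) * indicator B y * indicator B x \<partial>lborel)"
          using True by (intro nn_integral_cong) (auto simp: k_def indicator_def)
        then show "(\<integral>\<^sup>+y. k x y t \<partial>lborel) = (\<integral>\<^sup>+y\<in>B. ennreal (g x ^ (n - 1) * g (x + t *\<^sub>R (y - x))) \<partial>lborel) * indicator B x"
          by (simp add: nn_integral_multc)
      qed
      also have "\<dots> \<le> ennreal (2 * (1 + 2 ^ n) * b * A' * (A' / b) powr p * t powr (- (real n * p)))"
        unfolding B_def b_def p_def n_def using True by (intro kernel_integral_slice) auto
      finally show ?thesis using True b A' by (simp add: ennreal_mult' )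
    qed (simp add: k_def)
  qed
  also have "\<dots> = ennreal (2 * (1 + 2 ^ n) * b * A' * (A' / b) powr p) * (\<integral>\<^sup>+t\<in>{0<..<1}. ennreal (t powr (- (real n * p))) \<partial>lborel)"
    by (rule nn_integral_cmult) measurable
  also have "\<dots> \<le> ennreal (2 * (1 + 2 ^ n) * b * A' * (A' / b) powr p) * ennreal (1 / (1 + - (real n * p)))"
    using n2 by (intro mult_left_mono nn_integral_powr_0_1) (auto simp: p_def n_def field_simps)
  also have "\<dots> = ennreal (2 * (1 + 2 ^ n) * b * A' * (A' / b) powr p * (1 / (1 - real n * p)))"
    using b A' by (subst ennreal_mult'[symmetric]) auto
  finally show ?thesis by (simp only: B_def n_def)
qed

end

text \<open>The increment is tested against itself: for v = F y - F x, the inner product of v with F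
  along the segment grows by the square of the norm of v, and one factor is divided out. This keeps
  the Euclidean norm and brings in no constant depending on \<open>m\<close>.\<close>

lemma smooth_map_increment:
  fixes x y :: "(real, 'n::finite) vec"
  assumes smooth: "smooth_map F DF D2F"
  shows "ennreal (L2_set (\<lambda>j. F j x - F j y) {..<m})
    \<le> ennreal (dist x y) * (\<integral>\<^sup>+t\<in>{0<..<1}. ennreal (hs_norm m (\<lambda>j. DF j (x + t *\<^sub>R (y - x)))) \<partial>lborel)"
proof -
  note sm = smooth[unfolded smooth_map_def, rule_format]
  have contDF: "continuous_on UNIV (DF j)" for j using sm by auto
  have der: "((\<lambda>t. F j (x + t *\<^sub>R h)) has_real_derivative DF j x \<bullet> h) (at 0)" for j x h using sm by auto
  define h where "h = y - x"
  define v where "v = (\<lambda>j. F j y - F j x)"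
  define \<nu> where "\<nu> = L2_set v {..<m}"
  have \<nu>0: "0 \<le> \<nu>" by (simp add: \<nu>_def)
  have contDFt: "continuous_on S (\<lambda>t. DF j (x + t *\<^sub>R h))" for j S
    by (rule continuous_on_compose2[OF contDF]) (auto intro!: continuous_intros)
  define gt where "gt = (\<lambda>t. hs_norm m (\<lambda>j. DF j (x + t *\<^sub>R h)))"
  have contg: "continuous_on S gt" for S
    unfolding gt_def by (rule continuous_on_hs_norm) (rule contDFt)
  have gm [measurable]: "gt \<in> borel_measurable borel"
    using contg by (rule borel_measurable_continuous_onI)
  define \<phi> where "\<phi> = (\<lambda>t. \<Sum>j<m. v j * F j (x + t *\<^sub>R h))"
  define \<phi>' where "\<phi>' = (\<lambda>t. \<Sum>j<m. v j * (DF j (x + t *\<^sub>R h) \<bullet> h))"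
  have d\<phi>: "(\<phi> has_real_derivative \<phi>' s) (at s)" for s
    unfolding \<phi>_def \<phi>'_def
  proof (intro DERIV_sum DERIV_cmult)
    fix j
    have "((\<lambda>t. F j (x + s *\<^sub>R h + t *\<^sub>R h)) has_real_derivative DF j (x + s *\<^sub>R h) \<bullet> h) (at (s - s))"
      using der[of j "x + s *\<^sub>R h"] by simp
    then have "((\<lambda>t. F j (x + s *\<^sub>R h + (t - s) *\<^sub>R h)) has_real_derivative (DF j (x + s *\<^sub>R h) \<bullet> h) * 1) (at s)"
      by (rule DERIV_chain2[where f = "\<lambda>t. F j (x + s *\<^sub>R h + t *\<^sub>R h)" and g = "\<lambda>t. t - s"])
         (auto intro!: derivative_eq_intros)
    then show "((\<lambda>t. F j (x + t *\<^sub>R h)) has_real_derivative DF j (x + s *\<^sub>R h) \<bullet> h) (at s)"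
      by (simp add: algebra_simps)
  qed
  have cont\<phi>': "continuous_on UNIV \<phi>'"
    unfolding \<phi>'_def by (intro continuous_intros contDFt)
  have eq: "(LINT t|lborel. \<phi>' t * indicator {0..1} t) = \<phi> 1 - \<phi> 0"
    using cont\<phi>' by (intro integral_FTC_Icc_real d\<phi>) (auto simp: continuous_on_eq_continuous_at)
  have "\<phi> 1 - \<phi> 0 = (\<Sum>j<m. v j * v j)"
    by (simp add: \<phi>_def h_def v_def sum_subtractf[symmetric] algebra_simps)
  then have \<phi>\<nu>: "\<phi> 1 - \<phi> 0 = \<nu> * \<nu>"
    by (simp add: \<nu>_def L2_set_def sum_nonneg power2_eq_square)
  have bd: "\<phi>' t \<le> \<nu> * norm h * gt t" for t
  proof -
    have "\<phi>' t \<le> (\<Sum>j<m. \<bar>v j\<bar> * \<bar>DF j (x + t *\<^sub>R h) \<bullet> h\<bar>)"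
      unfolding \<phi>'_def by (intro sum_mono) (metis abs_ge_self abs_mult)
    also have "\<dots> \<le> L2_set v {..<m} * L2_set (\<lambda>j. DF j (x + t *\<^sub>R h) \<bullet> h) {..<m}"
      by (rule L2_set_mult_ineq)
    also have "\<dots> \<le> \<nu> * (gt t * norm h)"
      unfolding \<nu>_def gt_def by (intro mult_left_mono L2_inner_le_hs_norm) simp
    finally show ?thesis by (simp add: mult_ac)
  qed
  have int1: "integrable lborel (\<lambda>t. \<phi>' t * indicator {0..1} t)"
    using borel_integrable_compact[of "{0..1}" \<phi>'] cont\<phi>' continuous_on_subset by (fastforce simp: mult.commute)
  have intg: "integrable lborel (\<lambda>t. gt t * indicator {0..1} t)"
    using borel_integrable_compact[of "{0..1::real}" gt] contg by (simp add: mult.commute)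
  have "\<nu> * \<nu> \<le> (LINT t|lborel. \<nu> * norm h * (gt t * indicator {0..1} t))"
    unfolding \<phi>\<nu>[symmetric] eq[symmetric]
    by (intro integral_mono int1 integrable_mult_right intg) (use bd in \<open>auto simp: indicator_def\<close>)
  also have "\<dots> = \<nu> * (norm h * (LINT t|lborel. gt t * indicator {0..1} t))"
    by (simp only: integral_mult_right_zero mult.assoc)
  finally have \<nu>le: "\<nu> \<le> norm h * (LINT t|lborel. gt t * indicator {0..1} t)"
  proof (cases "\<nu> = 0")
    case True
    have "0 \<le> (LINT t|lborel. gt t * indicator {0..1} t)" by (intro Bochner_Integration.integral_nonneg) (auto simp: gt_def)
    then show ?thesis using True by simp
  qed (use \<nu>0 in auto)
  have "ennreal \<nu> \<le> ennreal (norm h * (LINT t|lborel. gt t * indicator {0..1} t))"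
    using \<nu>le by (rule ennreal_leI)
  also have "\<dots> = ennreal (norm h) * ennreal (LINT t|lborel. gt t * indicator {0..1} t)"
    by (intro ennreal_mult') simp
  also have "ennreal (LINT t|lborel. gt t * indicator {0..1} t) = (\<integral>\<^sup>+t. ennreal (gt t * indicator {0..1} t) \<partial>lborel)"
    by (rule nn_integral_eq_integral[symmetric]) (use intg in \<open>auto simp: gt_def\<close>)
  also have "\<dots> = (\<integral>\<^sup>+t\<in>{0<..<1}. ennreal (gt t) \<partial>lborel)"
    using AE_lborel_singleton[of "0::real"] AE_lborel_singleton[of "1::real"]
    by (intro nn_integral_cong_AE, eventually_elim) (auto simp: indicator_def)
  also have "ennreal \<nu> = ennreal (L2_set (\<lambda>j. F j x - F j y) {..<m})"
    by (simp add: \<nu>_def v_def L2_set_def power2_commute)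
  also have "norm h = dist x y" by (simp add: h_def dist_norm norm_minus_commute)
  finally show ?thesis by (simp add: gt_def h_def)
qed

text \<open>
  Caccioppoli's inequality holds with every constant \<open>c = F y\<close>, and averaging it over \<open>y\<close> replaces the Sobolev-Poincare inequality.
\<close>

lemma reverse_hoelder_smooth:
  fixes \<omega> :: "'n::{finite,linorder} const_form" and z :: "(real, 'n) vec" and r A' b p :: real
  assumes n2: "2 \<le> CARD('n)" and smooth: "smooth_map F DF D2F" and r: "r > 0" and A': "A' > 0"
    and A: "(\<integral>\<^sup>+x\<in>ball z r. ennreal (hs_norm m (\<lambda>j. DF j x) powr (real CARD('n) - 1/2)) \<partial>lborel) \<le> ennreal A'"
  defines "b \<equiv> unit_ball_vol (real CARD('n)) * r ^ CARD('n)"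
  defines "p \<equiv> 1 / (2 * real CARD('n) - 1)"
  shows "\<bar>LINT x|lborel. bump z r x * star_pullback m \<omega> (\<lambda>j. DF j x)\<bar>
     \<le> 16 * (1 + 2 ^ CARD('n)) / (1 - real CARD('n) * p) * comass m \<omega> * A' * (A' / b) powr p"
proof -
  note sm = smooth[unfolded smooth_map_def, rule_format]
  have contDF: "continuous_on UNIV (DF j)" and contF: "continuous_on UNIV (F j)" for j using sm by auto
  define n where "n = CARD('n)"
  define B where "B = ball z r"
  have [measurable]: "B \<in> sets borel" by (simp add: B_def)
  have b: "b > 0" using r by (simp add: b_def)
  have eB: "emeasure lborel B = ennreal b" using r by (simp add: B_def b_def emeasure_ball)
  have np: "1 - real n * p > 0" using n2 by (simp add: p_def n_def field_simps)
  define g where "g = (\<lambda>x. hs_norm m (\<lambda>j. DF j x))"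
  have gm [measurable]: "g \<in> borel_measurable borel"
    unfolding g_def by (intro borel_measurable_continuous_onI continuous_on_hs_norm contDF)
  have [measurable]: "F j \<in> borel_measurable borel" for j by (intro borel_measurable_continuous_onI contF)
  define X where "X = \<bar>LINT x|lborel. bump z r x * star_pullback m \<omega> (\<lambda>j. DF j x)\<bar>"
  define k where "k = (\<lambda>x y t. ennreal (g x ^ (n - 1) * g (x + t *\<^sub>R (y - x))))"
  define E where "E = (\<lambda>x y. ennreal (L2_set (\<lambda>j. F j x - F j y) {..<m} * g x ^ (n - 1)))"
  have X: "ennreal X \<le> ennreal (4 / r * comass m \<omega>) * (\<integral>\<^sup>+x\<in>B. E x y \<partial>lborel)" for y
  proof -
    define T where "T = (\<lambda>x. indicator B x * (L2_set (\<lambda>j. F j x - F j y) {..<m} * g x ^ (n - 1)))"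
    have contT: "continuous_on UNIV (\<lambda>x. L2_set (\<lambda>j. F j x - F j y) {..<m} * g x ^ (n - 1))"
      unfolding L2_set_def g_def by (intro continuous_intros continuous_on_hs_norm contF contDF)
    have "integrable lborel (\<lambda>x. indicator (cball z r) x *\<^sub>R (L2_set (\<lambda>j. F j x - F j y) {..<m} * g x ^ (n - 1)))"
      using contT by (intro borel_integrable_compact) (auto intro: continuous_on_subset)
    then have "integrable lborel (\<lambda>x. indicator B x *\<^sub>R (indicator (cball z r) x *\<^sub>R (L2_set (\<lambda>j. F j x - F j y) {..<m} * g x ^ (n - 1))))"
      by (rule integrable_mult_indicator[rotated]) simp
    also have "(\<lambda>x. indicator B x *\<^sub>R (indicator (cball z r) x *\<^sub>R (L2_set (\<lambda>j. F j x - F j y) {..<m} * g x ^ (n - 1)))) = T"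
      by (auto simp: T_def indicator_def fun_eq_iff B_def)
    finally have intT: "integrable lborel T" .
    have "X \<le> 4 / r * comass m \<omega> * (LINT x|lborel. T x)"
      unfolding X_def T_def B_def g_def n_def by (rule caccioppoli[OF smooth r])
    then have "ennreal X \<le> ennreal (4 / r * comass m \<omega> * (LINT x|lborel. T x))" by (rule ennreal_leI)
    also have "\<dots> = ennreal (4 / r * comass m \<omega>) * ennreal (LINT x|lborel. T x)"
      using r by (intro ennreal_mult') (simp add: comass_nonneg)
    also have "ennreal (LINT x|lborel. T x) = (\<integral>\<^sup>+x. ennreal (T x) \<partial>lborel)"
      by (rule nn_integral_eq_integral[symmetric, OF intT]) (simp add: T_def g_def L2_set_nonneg)
    also have "\<dots> = (\<integral>\<^sup>+x\<in>B. E x y \<partial>lborel)"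
      by (intro nn_integral_cong) (auto simp: T_def E_def indicator_def)
    finally show ?thesis .
  qed
  have E: "E x y \<le> ennreal (2 * r) * (\<integral>\<^sup>+t\<in>{0<..<1}. k x y t \<partial>lborel)" if "x \<in> B" "y \<in> B" for x y
  proof -
    have "dist x y \<le> dist x z + dist z y" by (rule dist_triangle)
    then have d: "dist x y \<le> 2 * r" using that by (simp add: B_def dist_commute)
    have "E x y = ennreal (L2_set (\<lambda>j. F j x - F j y) {..<m}) * ennreal (g x ^ (n - 1))"
      unfolding E_def by (intro ennreal_mult') (simp add: L2_set_nonneg)
    also have "\<dots> \<le> ennreal (dist x y) * (\<integral>\<^sup>+t\<in>{0<..<1}. ennreal (g (x + t *\<^sub>R (y - x))) \<partial>lborel) * ennreal (g x ^ (n - 1))"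
      unfolding g_def by (intro mult_right_mono smooth_map_increment[OF smooth]) simp
    also have "\<dots> \<le> ennreal (2 * r) * (\<integral>\<^sup>+t\<in>{0<..<1}. ennreal (g (x + t *\<^sub>R (y - x))) \<partial>lborel) * ennreal (g x ^ (n - 1))"
      using d by (intro mult_right_mono ennreal_leI) auto
    also have "\<dots> = ennreal (2 * r) * (\<integral>\<^sup>+t\<in>{0<..<1}. k x y t \<partial>lborel)"
    proof -
      have "(\<integral>\<^sup>+t\<in>{0<..<1}. k x y t \<partial>lborel) = (\<integral>\<^sup>+t. (ennreal (g (x + t *\<^sub>R (y - x))) * indicator {0<..<1} t) * ennreal (g x ^ (n - 1)) \<partial>lborel)"
        by (intro nn_integral_cong) (simp add: k_def ennreal_mult' g_def mult_ac)
      also have "\<dots> = (\<integral>\<^sup>+t\<in>{0<..<1}. ennreal (g (x + t *\<^sub>R (y - x))) \<partial>lborel) * ennreal (g x ^ (n - 1))"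
        by (rule nn_integral_multc) measurable
      finally show ?thesis by (simp only: mult.assoc)
    qed
    finally show ?thesis .
  qed
  define Tot where "Tot = (\<integral>\<^sup>+y\<in>B. (\<integral>\<^sup>+x\<in>B. (\<integral>\<^sup>+t\<in>{0<..<1}. k x y t \<partial>lborel) \<partial>lborel) \<partial>lborel)"
  define Cn where "Cn = 2 * (1 + 2 ^ n) * b * A' * (A' / b) powr p * (1 / (1 - real n * p))"
  have Tot: "Tot \<le> ennreal Cn"
    using kernel_integral[OF gm _ r A', where z = z] A n2
    unfolding Tot_def k_def B_def Cn_def n_def b_def p_def by (simp add: g_def)
  have km [measurable (raw)]: "(\<lambda>w. k (u w) (v w) (s w)) \<in> borel_measurable M"
    if [measurable]: "u \<in> borel_measurable M" "v \<in> borel_measurable M" "s \<in> borel_measurable M" for M :: "'b measure" and u v s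
    unfolding k_def by measurable
  have "ennreal X * ennreal b = (\<integral>\<^sup>+y\<in>B. ennreal X \<partial>lborel)"
    by (simp add: nn_integral_cmult_indicator eB)
  \<comment> \<open>The factor 8 is the bound 4 / r of the cutoff gradient times the diameter 2 r,
    so the radius disappears.\<close>
  also have "\<dots> \<le> (\<integral>\<^sup>+y. ennreal (8 * comass m \<omega>) * ((\<integral>\<^sup>+x\<in>B. (\<integral>\<^sup>+t\<in>{0<..<1}. k x y t \<partial>lborel) \<partial>lborel) * indicator B y) \<partial>lborel)"
  proof (rule nn_integral_mono)
    fix y
    show "ennreal X * indicator B y \<le> ennreal (8 * comass m \<omega>) * ((\<integral>\<^sup>+x\<in>B. (\<integral>\<^sup>+t\<in>{0<..<1}. k x y t \<partial>lborel) \<partial>lborel) * indicator B y)"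
    proof (cases "y \<in> B")
      case True
      have "(\<integral>\<^sup>+x\<in>B. E x y \<partial>lborel) \<le> (\<integral>\<^sup>+x. ennreal (2 * r) * ((\<integral>\<^sup>+t\<in>{0<..<1}. k x y t \<partial>lborel) * indicator B x) \<partial>lborel)"
        using E True by (intro nn_integral_mono) (auto simp: indicator_def)
      also have "\<dots> = ennreal (2 * r) * (\<integral>\<^sup>+x\<in>B. (\<integral>\<^sup>+t\<in>{0<..<1}. k x y t \<partial>lborel) \<partial>lborel)"
        by (rule nn_integral_cmult) measurable
      finally have "ennreal X \<le> ennreal (4 / r * comass m \<omega>) * (ennreal (2 * r) * (\<integral>\<^sup>+x\<in>B. (\<integral>\<^sup>+t\<in>{0<..<1}. k x y t \<partial>lborel) \<partial>lborel))"
        using X[of y] by (meson mult_left_mono order_trans zero_le)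
      also have "\<dots> = ennreal (8 * comass m \<omega>) * (\<integral>\<^sup>+x\<in>B. (\<integral>\<^sup>+t\<in>{0<..<1}. k x y t \<partial>lborel) \<partial>lborel)"
        using r by (simp add: mult.assoc[symmetric] ennreal_mult''[symmetric])
      finally show ?thesis using True by simp
    qed simp
  qed
  also have "\<dots> = ennreal (8 * comass m \<omega>) * Tot"
    unfolding Tot_def by (rule nn_integral_cmult) measurable
  also have "\<dots> \<le> ennreal (8 * comass m \<omega>) * ennreal Cn" by (intro mult_left_mono Tot) simp
  finally have "ennreal (X * b) \<le> ennreal (8 * comass m \<omega> * Cn)"
    using comass_nonneg[of m \<omega>] by (simp add: ennreal_mult' X_def)
  then have "X * b \<le> 8 * comass m \<omega> * Cn"
    using b np A' comass_nonneg[of m \<omega>] by (subst (asm) ennreal_le_iff) (auto simp: Cn_def)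
  \<comment> \<open>\<open>Cn\<close> contains the volume \<open>b\<close>, which cancels against
    the one from averaging over y.\<close>
  also have "\<dots> = (16 * (1 + 2 ^ n) / (1 - real n * p) * comass m \<omega> * A' * (A' / b) powr p) * b"
    by (simp add: Cn_def)
  finally have "X \<le> 16 * (1 + 2 ^ n) / (1 - real n * p) * comass m \<omega> * A' * (A' / b) powr p"
    using b by (rule mult_right_le_imp_le)
  then show ?thesis by (simp only: X_def n_def)
qed

section \<open>Smooth approximation of Sobolev maps\<close>

text \<open>Left without normalisation: a derivative in direction b raises \<open>\<kappa> b\<close>
  by one and divides by \<epsilon>, so all derivatives of a mollification are again of this
  kind.\<close>

definition bump_conv :: "real \<Rightarrow> ('a::euclidean_space \<Rightarrow> nat) \<Rightarrow> ('a \<Rightarrow> real) \<Rightarrow> 'a \<Rightarrow> real" where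
  "bump_conv \<epsilon> \<kappa> u x = (LINT y|lborel. u y * bump_prod \<kappa> ((x - y) /\<^sub>R \<epsilon>))"

lemma continuous_bump_conv:
  fixes u :: "'a::euclidean_space \<Rightarrow> real"
  assumes "integrable lborel u"
  shows "continuous_on UNIV (bump_conv \<epsilon> \<kappa> u)"
proof -
  obtain B where "\<forall>x::'a. \<bar>bump_prod \<kappa> x\<bar> \<le> B" using bump_prod_bounded by blast
  then show ?thesis unfolding bump_conv_def
    by (intro continuous_convolution[where \<Psi> = "\<lambda>x. bump_prod \<kappa> (x /\<^sub>R \<epsilon>)" and B = B] assms
        continuous_on_compose2[OF continuous_bump_prod[where S = UNIV]] continuous_intros) auto
qed

lemma bump_conv_directional_derivative:
  fixes u :: "'a::euclidean_space \<Rightarrow> real"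
  assumes u: "integrable lborel u"
  shows "((\<lambda>t. bump_conv \<epsilon> \<kappa> u (x + t *\<^sub>R h)) has_real_derivative
     (\<Sum>b\<in>Basis. bump_conv \<epsilon> (\<kappa>(b := Suc (\<kappa> b))) u x / \<epsilon> * (h \<bullet> b))) (at 0)"
proof -
  define \<Psi> where "\<Psi> = (\<lambda>x::'a. bump_prod \<kappa> (x /\<^sub>R \<epsilon>))"
  define \<Psi>b where "\<Psi>b = (\<lambda>b x::'a. bump_prod (\<kappa>(b := Suc (\<kappa> b))) (x /\<^sub>R \<epsilon>))"
  define \<Psi>' where "\<Psi>' = (\<lambda>x. \<Sum>b\<in>Basis. \<Psi>b b x * (h \<bullet> b) / \<epsilon>)"
  have cont: "continuous_on UNIV \<Psi>" "continuous_on UNIV (\<Psi>b b)" for b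
    unfolding \<Psi>_def \<Psi>b_def
    by (intro continuous_on_compose2[OF continuous_bump_prod[where S = UNIV]] continuous_intros; simp)+
  have cont': "continuous_on UNIV \<Psi>'" unfolding \<Psi>'_def divide_inverse by (intro continuous_intros cont)
  obtain B1 where B1: "\<And>x. \<bar>\<Psi> x\<bar> \<le> B1" using bump_prod_bounded unfolding \<Psi>_def by blast
  have "\<exists>B. \<forall>x. \<bar>\<Psi>b b x\<bar> \<le> B" for b using bump_prod_bounded unfolding \<Psi>b_def by blast
  then obtain Bb where Bb: "\<And>b x. \<bar>\<Psi>b b x\<bar> \<le> Bb b" by metis
  define B2 where "B2 = (\<Sum>b\<in>Basis. Bb b * \<bar>h \<bullet> b\<bar> / \<bar>\<epsilon>\<bar>)"
  have B2: "\<bar>\<Psi>' x\<bar> \<le> B2" for x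
    unfolding \<Psi>'_def B2_def
    by (intro order_trans[OF sum_abs] sum_mono) (auto simp: abs_mult abs_divide intro!: divide_right_mono mult_right_mono Bb)
  have der: "((\<lambda>t. \<Psi> (x + t *\<^sub>R h)) has_real_derivative \<Psi>' x) (at 0)" for x
  proof -
    have "((\<lambda>t. (x + t *\<^sub>R h) /\<^sub>R \<epsilon>) has_derivative (\<lambda>t. (t *\<^sub>R h) /\<^sub>R \<epsilon>)) (at 0)"
      by (auto intro!: derivative_eq_intros)
    from has_derivative_compose[OF this bump_prod_has_derivative]
    have "((\<lambda>t. \<Psi> (x + t *\<^sub>R h)) has_derivative
        (\<lambda>t. \<Sum>b\<in>Basis. bump_prod (\<kappa>(b := Suc (\<kappa> b))) ((x + 0 *\<^sub>R h) /\<^sub>R \<epsilon>) * (((t *\<^sub>R h) /\<^sub>R \<epsilon>) \<bullet> b))) (at 0)"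
      unfolding \<Psi>_def .
    also have "(\<lambda>t. \<Sum>b\<in>Basis. bump_prod (\<kappa>(b := Suc (\<kappa> b))) ((x + 0 *\<^sub>R h) /\<^sub>R \<epsilon>) * (((t *\<^sub>R h) /\<^sub>R \<epsilon>) \<bullet> b)) = (\<lambda>t. \<Psi>' x * t)"
      unfolding \<Psi>'_def \<Psi>b_def sum_distrib_right
      by (intro ext sum.cong) (auto simp: divide_inverse mult_ac)
    finally show ?thesis by (simp add: has_field_derivative_def)
  qed
  have "((\<lambda>t. LINT y|lborel. u y * \<Psi> (x + t *\<^sub>R h - y)) has_real_derivative (LINT y|lborel. u y * \<Psi>' (x - y))) (at 0)"
    by (rule convolution_directional_derivative[where B = "max B1 B2", OF u cont(1) cont' _ _ der])
       (use B1 B2 in \<open>auto simp: le_max_iff_disj\<close>)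
  also have "(LINT y|lborel. u y * \<Psi>' (x - y)) = (LINT y|lborel. (\<Sum>b\<in>Basis. (u y * \<Psi>b b (x - y)) * ((h \<bullet> b) / \<epsilon>)))"
    by (simp add: \<Psi>'_def sum_distrib_left mult.assoc)
  also have "\<dots> = (\<Sum>b\<in>Basis. (LINT y|lborel. (u y * \<Psi>b b (x - y)) * ((h \<bullet> b) / \<epsilon>)))"
  proof (intro Bochner_Integration.integral_sum integrable_mult_left)
    fix b
    have [measurable]: "\<Psi>b b \<in> borel_measurable borel" using cont(2) by (rule borel_measurable_continuous_onI)
    have [measurable]: "u \<in> borel_measurable borel" using u by auto
    show "integrable lborel (\<lambda>y. u y * \<Psi>b b (x - y))"
    proof (rule Bochner_Integration.integrable_bound)
      show "integrable lborel (\<lambda>y. Bb b * u y)" using u by simp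
      show "AE y in lborel. norm (u y * \<Psi>b b (x - y)) \<le> norm (Bb b * u y)"
      proof (rule AE_I2)
        fix y
        have "\<bar>\<Psi>b b (x - y)\<bar> \<le> \<bar>Bb b\<bar>" using Bb[of b "x - y"] by linarith
        from mult_left_mono[OF this, of "\<bar>u y\<bar>"] show "norm (u y * \<Psi>b b (x - y)) \<le> norm (Bb b * u y)"
          by (simp add: abs_mult mult.commute)
      qed
    qed measurable
  qed
  also have "\<dots> = (\<Sum>b\<in>Basis. bump_conv \<epsilon> (\<kappa>(b := Suc (\<kappa> b))) u x / \<epsilon> * (h \<bullet> b))"
    unfolding bump_conv_def \<Psi>b_def integral_mult_left_zero by simp
  finally show ?thesis unfolding bump_conv_def \<Psi>_def .
qed

lemma sum_Basis_vec:
  fixes g :: "(real, 'n::finite) vec \<Rightarrow> real"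
  shows "(\<Sum>b\<in>Basis. g b) = (\<Sum>k\<in>UNIV. g (axis k 1))"
proof -
  have eq: "(Basis :: (real, 'n) vec set) = range (\<lambda>k. axis k 1)" by (auto simp: Basis_vec_def)
  have "inj (\<lambda>k::'n. axis k (1::real))" by (auto simp: inj_def axis_eq_axis)
  then show ?thesis unfolding eq by (subst sum.reindex) auto
qed

text \<open>\<open>e k\<close> raises the order of differentiation in direction \<open>k\<close>.
  Raising in two directions commutes, which is the symmetry of the Hessian. The factor
  \<open>c\<close> is reserved for normalising the kernel.\<close>

lemma smooth_map_bump_conv:
  fixes u :: "nat \<Rightarrow> (real, 'n::finite) vec \<Rightarrow> real" and c \<epsilon> :: real
  assumes u: "\<And>j. integrable lborel (u j)"
  defines "e \<equiv> (\<lambda>k \<kappa>. \<kappa>(axis k 1 := Suc (\<kappa> (axis k 1))))"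
  shows "smooth_map (\<lambda>j x. c * bump_conv \<epsilon> (\<lambda>_. 0) (u j) x)
     (\<lambda>j x. \<chi> k. c * (bump_conv \<epsilon> (e k (\<lambda>_. 0)) (u j) x / \<epsilon>))
     (\<lambda>j k x. \<chi> l. c * (bump_conv \<epsilon> (e l (e k (\<lambda>_. 0))) (u j) x / \<epsilon> / \<epsilon>))"
  unfolding smooth_map_def
proof (intro allI conjI)
  fix j k l and x h :: "(real, 'n) vec"
  have cont: "continuous_on UNIV (\<lambda>x. bump_conv \<epsilon> \<kappa> (u j) x)" for \<kappa>
    by (rule continuous_bump_conv[OF u])
  show "continuous_on UNIV (\<lambda>x. c * bump_conv \<epsilon> (\<lambda>_. 0) (u j) x)" by (intro continuous_intros cont)
  show "continuous_on UNIV (\<lambda>x. \<chi> k. c * (bump_conv \<epsilon> (e k (\<lambda>_. 0)) (u j) x / \<epsilon>))"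
    unfolding divide_inverse by (intro continuous_intros cont)
  show "continuous_on UNIV (\<lambda>x. \<chi> l. c * (bump_conv \<epsilon> (e l (e k (\<lambda>_. 0))) (u j) x / \<epsilon> / \<epsilon>))"
    unfolding divide_inverse by (intro continuous_intros cont)
  have der: "((\<lambda>t. bump_conv \<epsilon> \<kappa> (u j) (x + t *\<^sub>R h)) has_real_derivative
     (\<Sum>k\<in>UNIV. bump_conv \<epsilon> (e k \<kappa>) (u j) x / \<epsilon> * h $ k)) (at 0)" for \<kappa>
    using bump_conv_directional_derivative[OF u, of \<epsilon> \<kappa> j x h]
    unfolding sum_Basis_vec by (simp add: e_def inner_axis)
  have "((\<lambda>t. c * bump_conv \<epsilon> (\<lambda>_. 0) (u j) (x + t *\<^sub>R h)) has_real_derivative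
      c * (\<Sum>k\<in>UNIV. bump_conv \<epsilon> (e k (\<lambda>_. 0)) (u j) x / \<epsilon> * h $ k)) (at 0)"
    by (intro DERIV_cmult der)
  then show "((\<lambda>t. c * bump_conv \<epsilon> (\<lambda>_. 0) (u j) (x + t *\<^sub>R h)) has_real_derivative
      (\<chi> k. c * (bump_conv \<epsilon> (e k (\<lambda>_. 0)) (u j) x / \<epsilon>)) \<bullet> h) (at 0)"
    by (simp add: inner_vec_def sum_distrib_left mult.assoc)
  have "((\<lambda>t. c * (bump_conv \<epsilon> (e k (\<lambda>_. 0)) (u j) (x + t *\<^sub>R h) / \<epsilon>)) has_real_derivative
      c * ((\<Sum>l\<in>UNIV. bump_conv \<epsilon> (e l (e k (\<lambda>_. 0))) (u j) x / \<epsilon> * h $ l) / \<epsilon>)) (at 0)"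
    by (intro DERIV_cmult DERIV_cdivide der)
  then show "((\<lambda>t. (\<chi> k. c * (bump_conv \<epsilon> (e k (\<lambda>_. 0)) (u j) (x + t *\<^sub>R h) / \<epsilon>)) $ k) has_real_derivative
      (\<chi> l. c * (bump_conv \<epsilon> (e l (e k (\<lambda>_. 0))) (u j) x / \<epsilon> / \<epsilon>)) \<bullet> h) (at 0)"
    by (simp add: inner_vec_def sum_distrib_left sum_divide_distrib mult_ac)
  have "e l (e k (\<lambda>_. 0)) = e k (e l (\<lambda>_. 0))"
    by (auto simp: e_def fun_eq_iff axis_eq_axis)
  then show "(\<chi> l. c * (bump_conv \<epsilon> (e l (e k (\<lambda>_. 0))) (u j) x / \<epsilon> / \<epsilon>)) $ l =
      (\<chi> la. c * (bump_conv \<epsilon> (e la (e l (\<lambda>_. 0))) (u j) x / \<epsilon> / \<epsilon>)) $ k" by simp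
qed

text \<open>
  The data of a Sobolev map near a closed ball, in a Borel representative that vanishes outside the
  ball; the defining identity of the weak derivative is only needed for the mollifying kernels.
\<close>

definition local_sobolev_data ::
    "(real, 'n::finite) vec \<Rightarrow> real \<Rightarrow> (nat \<Rightarrow> (real, 'n) vec \<Rightarrow> real) \<Rightarrow> (nat \<Rightarrow> (real, 'n) vec \<Rightarrow> (real, 'n) vec) \<Rightarrow> bool" where
  "local_sobolev_data z R u D \<longleftrightarrow> (\<forall>j.
     integrable lborel (u j) \<and> integrable lborel (D j) \<and> integrable lborel (\<lambda>x. norm (D j x) ^ CARD('n)) \<and>
     (\<forall>x (\<epsilon>::real) k. 0 < \<epsilon> \<and> cball x (CARD('n) * \<epsilon>) \<subseteq> cball z R \<longrightarrow>
        bump_conv \<epsilon> ((\<lambda>_. 0)(axis k 1 := Suc 0)) (u j) x / \<epsilon> = bump_conv \<epsilon> (\<lambda>_. 0) (\<lambda>y. D j y $ k) x))"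

text \<open>For \<epsilon> small compared with R - r the derivative passes from the kernel to
  \<open>D\<close> at all points of the smaller ball. There the gradient of the mollification is the
  mollification of \<open>D\<close>, and mollifications converge in L^n.\<close>

lemma smooth_approximation:
  fixes z :: "(real, 'n::finite) vec"
  assumes data: "local_sobolev_data z R u D" and r: "r < R"
  shows "\<exists>F DF D2F. (\<forall>i::nat. smooth_map (F i) (DF i) (D2F i)) \<and>
     (\<forall>j. (\<lambda>i. \<integral>\<^sup>+x\<in>ball z r. ennreal (norm (DF i j x - D j x) ^ CARD('n)) \<partial>lborel) \<longlonglongrightarrow> 0)"
proof -
  define n where "n = CARD('n)"
  have n1: "1 \<le> n" by (simp add: n_def Suc_leI)
  note dat = data[unfolded local_sobolev_data_def, rule_format]
  define N where "N = (LINT w|lborel. bump_prod (\<lambda>_. 0) (w :: (real, 'n) vec))"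
  have int0: "integrable lborel (bump_prod (\<lambda>_. 0) :: (real, 'n) vec \<Rightarrow> real)"
    by (rule integrable_continuous_compact_support[OF continuous_bump_prod bump_prod_outside])
  have nn0: "0 \<le> bump_prod (\<lambda>_. 0) (w :: (real, 'n) vec)" for w
    unfolding bump_prod_def by (intro prod_nonneg) (simp add: smooth_bump_0_nonneg)
  \<comment> \<open>The kernel is positive on the open unit ball, whose points have all coordinates
    below 1 in absolute value.\<close>
  have N: "N > 0"
  proof -
    have "N \<ge> 0" unfolding N_def by (intro Bochner_Integration.integral_nonneg nn0)
    moreover have "N \<noteq> 0"
    proof
      assume "N = 0"
      then have "AE w in lborel. bump_prod (\<lambda>_. 0) (w :: (real, 'n) vec) = 0"
        unfolding N_def by (subst (asm) integral_nonneg_eq_0_iff_AE[OF int0]) (auto simp: nn0)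
      then have "AE w in lborel. (w :: (real, 'n) vec) \<notin> ball 0 1"
      proof eventually_elim
        case (elim w)
        show ?case
        proof
          assume "w \<in> ball 0 1"
          then have "\<bar>w \<bullet> b\<bar> < 1" if "b \<in> Basis" for b using Basis_le_norm[OF that, of w] by simp
          then have "0 < bump_prod (\<lambda>_. 0) w" unfolding bump_prod_def by (intro prod_pos) (simp add: smooth_bump_0_pos)
          then show False using elim by simp
        qed
      qed
      then have "ball (0::(real, 'n) vec) 1 \<in> null_sets lborel" by (subst AE_iff_null_sets) auto
      then have "emeasure lborel (ball (0::(real, 'n) vec) 1) = 0" by auto
      then show False using unit_ball_vol_pos[of "real CARD('n)"] by (simp add: emeasure_ball)
    qed
    ultimately show ?thesis by simp
  qed
  define \<phi> where "\<phi> = (\<lambda>w :: (real, 'n) vec. bump_prod (\<lambda>_. 0) w / N)"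
  have \<phi>: "integrable lborel \<phi>" "(LINT w|lborel. \<phi> w) = 1" "\<And>w. 0 \<le> \<phi> w"
    using int0 N nn0 by (auto simp: \<phi>_def N_def[symmetric])
  obtain B where B: "\<And>w. \<phi> w \<le> B"
  proof -
    obtain B where "\<And>w :: (real, 'n) vec. \<bar>bump_prod (\<lambda>_. 0) w\<bar> \<le> B" using bump_prod_bounded by blast
    then have "\<phi> w \<le> B / N" for w using N unfolding \<phi>_def by (intro divide_right_mono) (auto intro: order_trans[OF abs_ge_self])
    then show ?thesis by (rule that)
  qed
  \<comment> \<open>The kernel is supported in a ball of radius \<open>n\<close>; the division by
    \<open>n\<close> keeps its copies around points of \<open>ball z r\<close> inside
    \<open>cball z R\<close>.\<close>
  define \<epsilon> where "\<epsilon> = (\<lambda>i::nat. (R - r) / n * (1 / real (Suc i)))"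
  have \<epsilon>: "\<epsilon> \<longlonglongrightarrow> 0" "\<And>i. 0 < \<epsilon> i" "\<And>i. n * \<epsilon> i \<le> R - r"
  proof -
    show "\<epsilon> \<longlonglongrightarrow> 0" unfolding \<epsilon>_def using tendsto_mult[OF tendsto_const LIMSEQ_Suc[OF lim_1_over_n], of "(R - r) / n"] by simp
    show "0 < \<epsilon> i" for i using r n1 by (simp add: \<epsilon>_def)
    show "n * \<epsilon> i \<le> R - r" for i
    proof -
      have "n * \<epsilon> i = (R - r) * (1 / real (Suc i))" using n1 unfolding \<epsilon>_def by simp
      also have "\<dots> \<le> (R - r) * 1" using r by (intro mult_left_mono) auto
      finally show ?thesis by simp
    qed
  qed
  \<comment> \<open>Normalisation: \<open>N\<close> is the mass of the kernel, and \<epsilon>^n is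
    the Jacobian of the substitution y = x - \<epsilon> w.\<close>
  define c where "c = (\<lambda>i. 1 / (N * \<epsilon> i ^ n))"
  define e where "e = (\<lambda>k (\<kappa> :: (real, 'n) vec \<Rightarrow> nat). \<kappa>(axis k 1 := Suc (\<kappa> (axis k 1))))"
  define F where "F = (\<lambda>i j x. c i * bump_conv (\<epsilon> i) (\<lambda>_. 0) (u j) x)"
  define DF where "DF = (\<lambda>i j x. \<chi> k. c i * (bump_conv (\<epsilon> i) (e k (\<lambda>_. 0)) (u j) x / \<epsilon> i))"
  define D2F where "D2F = (\<lambda>i j k x. \<chi> l. c i * (bump_conv (\<epsilon> i) (e l (e k (\<lambda>_. 0))) (u j) x / \<epsilon> i / \<epsilon> i))"
  have sm: "smooth_map (F i) (DF i) (D2F i)" for i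
    unfolding F_def DF_def D2F_def e_def by (rule smooth_map_bump_conv) (use dat in auto)
  have DFeq: "DF i j x $ k = (LINT w|lborel. D j (x - \<epsilon> i *\<^sub>R w) $ k * \<phi> w)" if x: "x \<in> ball z r" for i j x k
  proof -
    have "cball x (n * \<epsilon> i) \<subseteq> cball z R"
      using \<epsilon>(3)[of i] x by (intro cball_subset_cball_iff[THEN iffD2] disjI1) (simp add: dist_commute)
    then have "bump_conv (\<epsilon> i) (e k (\<lambda>_. 0)) (u j) x / \<epsilon> i = bump_conv (\<epsilon> i) (\<lambda>_. 0) (\<lambda>y. D j y $ k) x"
      using dat[of j] \<epsilon>(2) by (auto simp: e_def n_def)
    then have "DF i j x $ k = c i * bump_conv (\<epsilon> i) (\<lambda>_. 0) (\<lambda>y. D j y $ k) x" by (simp only: DF_def vec_lambda_beta)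
    also have "bump_conv (\<epsilon> i) (\<lambda>_. 0) (\<lambda>y. D j y $ k) x
       = \<bar>- \<epsilon> i\<bar> ^ n * (LINT w|lborel. D j (x + (- \<epsilon> i) *\<^sub>R w) $ k * bump_prod (\<lambda>_. 0) ((x - (x + (- \<epsilon> i) *\<^sub>R w)) /\<^sub>R \<epsilon> i))"
    proof -
      have [measurable]: "D j \<in> borel_measurable borel" using dat[of j] by auto
      have [measurable]: "(\<lambda>x. D j x $ k) \<in> borel_measurable borel"
        unfolding cart_eq_inner_axis by measurable
      have [measurable]: "(bump_prod (\<lambda>_. 0) :: (real, 'n) vec \<Rightarrow> real) \<in> borel_measurable borel" using int0 by auto
      show ?thesis unfolding bump_conv_def n_def
        using integral_translate_scale[of "\<lambda>y. D j y $ k * bump_prod (\<lambda>_. 0) ((x - y) /\<^sub>R \<epsilon> i)" "- \<epsilon> i" x] \<epsilon>(2)[of i]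
        by simp
    qed
    also have "(LINT w|lborel. D j (x + (- \<epsilon> i) *\<^sub>R w) $ k * bump_prod (\<lambda>_. 0) ((x - (x + (- \<epsilon> i) *\<^sub>R w)) /\<^sub>R \<epsilon> i))
       = (LINT w|lborel. N * (D j (x - \<epsilon> i *\<^sub>R w) $ k * \<phi> w))"
      using \<epsilon>(2)[of i] N by (intro Bochner_Integration.integral_cong) (auto simp: \<phi>_def)
    also have "\<dots> = N * (LINT w|lborel. D j (x - \<epsilon> i *\<^sub>R w) $ k * \<phi> w)" by simp
    finally show ?thesis using \<epsilon>(2)[of i] N by (simp add: c_def)
  qed
  have "(\<lambda>i. \<integral>\<^sup>+x\<in>ball z r. ennreal (norm (DF i j x - D j x) ^ CARD('n)) \<partial>lborel) \<longlonglongrightarrow> 0" for j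
  proof -
    have [measurable]: "D j \<in> borel_measurable borel" using dat[of j] by auto
    have [measurable]: "(\<lambda>x. D j x $ k) \<in> borel_measurable borel" for k
      unfolding cart_eq_inner_axis by measurable
    have [measurable]: "\<phi> \<in> borel_measurable borel" using \<phi>(1) by auto
    define E where "E = (\<lambda>k i. \<integral>\<^sup>+x. ennreal (\<bar>(LINT w|lborel. D j (x - \<epsilon> i *\<^sub>R w) $ k * \<phi> w) - D j x $ k\<bar> ^ n) \<partial>lborel)"
    have "E k \<longlonglongrightarrow> 0" for k
      unfolding E_def
    proof (rule mollify_power_tendsto[OF _ _ n1 \<phi> B \<epsilon>(1)])
      show "integrable lborel (\<lambda>x. D j x $ k)"
        by (rule Bochner_Integration.integrable_bound[of _ "D j"]) (use dat[of j] in \<open>auto simp: component_le_norm_cart\<close>)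
      show "integrable lborel (\<lambda>x. \<bar>D j x $ k\<bar> ^ n)"
        by (rule Bochner_Integration.integrable_bound[of _ "\<lambda>x. norm (D j x) ^ CARD('n)"])
           (use dat[of j] in \<open>auto simp: n_def component_le_norm_cart intro!: power_mono\<close>)
      show "\<epsilon> i \<noteq> 0" for i using \<epsilon>(2)[of i] by simp
    qed
    then have lim: "(\<lambda>i. ennreal (n ^ n) * (\<Sum>k\<in>UNIV. E k i)) \<longlonglongrightarrow> ennreal (n ^ n) * (\<Sum>k\<in>(UNIV::'n set). 0)"
      by (intro ennreal_tendsto_cmult tendsto_sum) auto
    have le: "(\<integral>\<^sup>+x\<in>ball z r. ennreal (norm (DF i j x - D j x) ^ CARD('n)) \<partial>lborel) \<le> ennreal (n ^ n) * (\<Sum>k\<in>UNIV. E k i)" for i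
    proof -
      have "(\<integral>\<^sup>+x\<in>ball z r. ennreal (norm (DF i j x - D j x) ^ CARD('n)) \<partial>lborel)
        \<le> (\<integral>\<^sup>+x. ennreal (n ^ n) * (\<Sum>k\<in>UNIV. ennreal (\<bar>(LINT w|lborel. D j (x - \<epsilon> i *\<^sub>R w) $ k * \<phi> w) - D j x $ k\<bar> ^ n)) \<partial>lborel)"
      proof (rule nn_integral_mono)
        fix x
        show "ennreal (norm (DF i j x - D j x) ^ CARD('n)) * indicator (ball z r) x
          \<le> ennreal (n ^ n) * (\<Sum>k\<in>UNIV. ennreal (\<bar>(LINT w|lborel. D j (x - \<epsilon> i *\<^sub>R w) $ k * \<phi> w) - D j x $ k\<bar> ^ n))"
        proof (cases "x \<in> ball z r")
          case True
          define d where "d = (\<lambda>k. \<bar>(LINT w|lborel. D j (x - \<epsilon> i *\<^sub>R w) $ k * \<phi> w) - D j x $ k\<bar>)"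
          \<comment> \<open>The norm is at most n times the largest component, whence the factor
            n^n.\<close>
          define mx where "mx = Max (range d)"
          have dm: "d k \<le> mx" for k unfolding mx_def by (intro Max_ge) auto
          obtain k0 where k0: "mx = d k0" using Max_in[of "range d"] unfolding mx_def by fastforce
          have d0: "0 \<le> d k" for k by (simp add: d_def)
          have "norm (DF i j x - D j x) \<le> (\<Sum>k\<in>UNIV. \<bar>(DF i j x - D j x) $ k\<bar>)" by (rule norm_le_l1_cart)
          also have "\<dots> = (\<Sum>k\<in>UNIV. d k)" using DFeq[OF True] by (simp add: d_def)
          also have "\<dots> \<le> (\<Sum>k\<in>(UNIV::'n set). mx)" by (intro sum_mono dm)
          also have "\<dots> = n * mx" by (simp add: n_def)
          finally have "norm (DF i j x - D j x) ^ n \<le> (n * mx) ^ n" by (intro power_mono) auto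
          also have "\<dots> = n ^ n * d k0 ^ n" by (simp add: k0 power_mult_distrib)
          also have "\<dots> \<le> n ^ n * (\<Sum>k\<in>UNIV. d k ^ n)"
            using d0 by (intro mult_left_mono member_le_sum) auto
          finally have "ennreal (norm (DF i j x - D j x) ^ n) \<le> ennreal (n ^ n * (\<Sum>k\<in>UNIV. d k ^ n))" by (rule ennreal_leI)
          also have "\<dots> = ennreal (n ^ n) * (\<Sum>k\<in>UNIV. ennreal (d k ^ n))"
            using d0 by (subst ennreal_mult') (auto intro: sum_nonneg)
          finally show ?thesis using True by (simp add: d_def n_def)
        qed simp
      qed
      also have "\<dots> = ennreal (n ^ n) * (\<Sum>k\<in>UNIV. E k i)"
        unfolding E_def by (subst nn_integral_cmult, measurable) (subst nn_integral_sum, auto)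
      finally show ?thesis .
    qed
    show ?thesis
    proof (rule tendsto_sandwich[OF _ _ tendsto_const])
      show "\<forall>\<^sub>F i in sequentially. (\<integral>\<^sup>+x\<in>ball z r. ennreal (norm (DF i j x - D j x) ^ CARD('n)) \<partial>lborel)
          \<le> ennreal (n ^ n) * (\<Sum>k\<in>UNIV. E k i)"
        by (intro always_eventually allI le)
    qed (use lim in simp_all)
  qed
  then show ?thesis using sm by blast
qed

section \<open>Reverse Hoelder inequality for Sobolev maps\<close>

text \<open>Telescoping: the arguments are exchanged one after another, \<open>mix S\<close> being
  the state in which those with index in \<open>S\<close> have been replaced. Each exchange changes
  one slot by at most \<open>e\<close> and meets n - 1 others of size at most
  \<open>s\<close>.\<close>

lemma form_eval_diff_le:
  fixes \<omega> :: "'n::{finite,linorder} const_form"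
  assumes v: "\<And>k. L2_set (v k) {..<m} \<le> s" and w: "\<And>k. L2_set (w k) {..<m} \<le> s"
    and vw: "\<And>k. L2_set (\<lambda>j. w k j - v k j) {..<m} \<le> e"
  shows "\<bar>form_eval m \<omega> w - form_eval m \<omega> v\<bar> \<le> CARD('n) * (comass m \<omega> * (e * s ^ (CARD('n) - 1)))"
proof -
  have s0: "0 \<le> s" using order_trans[OF L2_set_nonneg v] .
  define mix where "mix = (\<lambda>S k. if k \<in> S then w k else v k)"
  have mix: "L2_set (mix S k) {..<m} \<le> s" for S k using v w by (simp add: mix_def)
  have "\<bar>form_eval m \<omega> (mix S) - form_eval m \<omega> (mix {})\<bar> \<le> card S * (comass m \<omega> * (e * s ^ (CARD('n) - 1)))" for S :: "'n set"
    using finite[of S]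
  proof (induction S rule: finite_induct)
    case (insert k S)
    have eq: "mix (insert k S) = (mix S)(k := \<lambda>j. mix S k j + (w k j - v k j))"
      using insert by (auto simp: mix_def fun_eq_iff)
    have "form_eval m \<omega> (mix (insert k S)) = form_eval m \<omega> ((mix S)(k := mix S k)) + form_eval m \<omega> ((mix S)(k := \<lambda>j. w k j - v k j))"
      unfolding eq by (rule form_eval_upd_add)
    then have d: "form_eval m \<omega> (mix (insert k S)) - form_eval m \<omega> (mix S) = form_eval m \<omega> ((mix S)(k := \<lambda>j. w k j - v k j))"
      by simp
    have "(\<Prod>l\<in>UNIV. L2_set (((mix S)(k := \<lambda>j. w k j - v k j)) l) {..<m})
      = L2_set (\<lambda>j. w k j - v k j) {..<m} * (\<Prod>l\<in>UNIV - {k}. L2_set (mix S l) {..<m})"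
      by (subst prod.remove[of UNIV k]) (auto intro!: prod.cong)
    also have "\<dots> \<le> e * (\<Prod>l\<in>UNIV - {k}. s)"
      using s0 vw mix order_trans[OF L2_set_nonneg vw] by (intro mult_mono prod_mono prod_nonneg) auto
    also have "(\<Prod>l\<in>UNIV - {k}. s) = s ^ (CARD('n) - 1)" by (simp add: card_Diff_singleton)
    finally have "comass m \<omega> * (\<Prod>l\<in>UNIV. L2_set (((mix S)(k := \<lambda>j. w k j - v k j)) l) {..<m}) \<le> comass m \<omega> * (e * s ^ (CARD('n) - 1))"
      by (intro mult_left_mono comass_nonneg)
    then have "\<bar>form_eval m \<omega> (mix (insert k S)) - form_eval m \<omega> (mix S)\<bar> \<le> comass m \<omega> * (e * s ^ (CARD('n) - 1))"
      unfolding d by (rule order_trans[OF form_eval_le_comass])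
    then have "\<bar>form_eval m \<omega> (mix (insert k S)) - form_eval m \<omega> (mix {})\<bar>
        \<le> comass m \<omega> * (e * s ^ (CARD('n) - 1)) + card S * (comass m \<omega> * (e * s ^ (CARD('n) - 1)))"
      using insert.IH by linarith
    then show ?case using insert.hyps by (simp add: algebra_simps)
  qed simp
  from this[of UNIV] show ?thesis by (simp add: mix_def)
qed

lemma hs_norm_triangle: "hs_norm m L \<le> hs_norm m L' + (\<Sum>j<m. norm (L j - L' j))"
proof -
  have "hs_norm m L \<le> L2_set (\<lambda>j. norm (L' j) + norm (L j - L' j)) {..<m}"
    unfolding hs_norm_def by (intro L2_set_mono) (auto intro: norm_triangle_sub)
  also have "\<dots> \<le> hs_norm m L' + L2_set (\<lambda>j. norm (L j - L' j)) {..<m}"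
    unfolding hs_norm_def by (rule L2_set_triangle_ineq)
  also have "L2_set (\<lambda>j. norm (L j - L' j)) {..<m} \<le> (\<Sum>j<m. norm (L j - L' j))" by (rule L2_set_le_sum) auto
  finally show ?thesis by simp
qed

lemma star_pullback_diff_le:
  fixes \<omega> :: "'n::{finite,linorder} const_form" and L L' :: "nat \<Rightarrow> (real, 'n) vec" and m :: nat
  defines "e \<equiv> \<Sum>j<m. norm (L j - L' j)"
  shows "\<bar>star_pullback m \<omega> L - star_pullback m \<omega> L'\<bar> \<le> CARD('n) * (comass m \<omega> * (e * (hs_norm m L' + e) ^ (CARD('n) - 1)))"
proof -
  have e0: "0 \<le> e" unfolding e_def by (intro sum_nonneg) simp
  have col: "L2_set (\<lambda>j. M j \<bullet> axis k 1) {..<m} \<le> hs_norm m M" for M :: "nat \<Rightarrow> (real, 'n) vec" and k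
    using L2_inner_le_hs_norm[of M "axis k 1" m] by simp
  have e2: "hs_norm m (\<lambda>j. L j - L' j) \<le> e"
    unfolding hs_norm_def e_def by (rule L2_set_le_sum) auto
  show ?thesis unfolding star_pullback_def
  proof (rule form_eval_diff_le)
    fix k
    show "L2_set (\<lambda>j. L' j \<bullet> axis k 1) {..<m} \<le> hs_norm m L' + e" using col[of L' k] e0 by simp
    show "L2_set (\<lambda>j. L j \<bullet> axis k 1) {..<m} \<le> hs_norm m L' + e"
      using col[of L k] hs_norm_triangle[of m L L'] by (simp add: e_def)
    show "L2_set (\<lambda>j. L j \<bullet> axis k 1 - L' j \<bullet> axis k 1) {..<m} \<le> e"
      using col[of "\<lambda>j. L j - L' j" k] e2 by (simp add: inner_diff_left)
  qed
qed

lemma star_pullback_le_hs_norm: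
  fixes \<omega> :: "'n::{finite,linorder} const_form" and L :: "nat \<Rightarrow> (real, 'n) vec"
  shows "\<bar>star_pullback m \<omega> L\<bar> \<le> comass m \<omega> * hs_norm m L ^ CARD('n)"
proof -
  have "\<bar>star_pullback m \<omega> L\<bar> \<le> comass m \<omega> * (\<Prod>k\<in>(UNIV::'n set). L2_set (\<lambda>j. L j \<bullet> axis k 1) {..<m})"
    unfolding star_pullback_def by (rule form_eval_le_comass)
  also have "\<dots> \<le> comass m \<omega> * (\<Prod>k\<in>(UNIV::'n set). hs_norm m L)"
  proof (intro mult_left_mono comass_nonneg prod_mono conjI L2_set_nonneg)
    fix k :: 'n
    show "L2_set (\<lambda>j. L j \<bullet> axis k 1) {..<m} \<le> hs_norm m L"
      using L2_inner_le_hs_norm[of L "axis k 1" m] by simp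
  qed
  finally show ?thesis by simp
qed

lemma borel_measurable_star_pullback [measurable]:
  fixes \<omega> :: "'n::{finite,linorder} const_form" and D :: "nat \<Rightarrow> 'b \<Rightarrow> (real, 'n) vec"
  assumes [measurable]: "\<And>j. j < m \<Longrightarrow> D j \<in> borel_measurable M"
  shows "(\<lambda>x. star_pullback m \<omega> (\<lambda>j. D j x)) \<in> borel_measurable M"
proof -
  have m: "(\<lambda>x. D (I (p k)) x \<bullet> axis k' 1) \<in> borel_measurable M" if "I \<in> multi_indices m" for I :: "'n \<Rightarrow> nat" and p k k'
  proof -
    have "I (p k) < m" using that by (simp add: multi_indices_def)
    then show ?thesis by measurable
  qed
  show ?thesis unfolding star_pullback_def form_eval_def dx_def det_def
    by (simp, intro borel_measurable_sum borel_measurable_times borel_measurable_const borel_measurable_prod m) auto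
qed

lemma borel_measurable_hs_norm [measurable]:
  fixes D :: "nat \<Rightarrow> 'b \<Rightarrow> 'a::euclidean_space"
  assumes [measurable]: "\<And>j. j < m \<Longrightarrow> D j \<in> borel_measurable M"
  shows "(\<lambda>x. hs_norm m (\<lambda>j. D j x)) \<in> borel_measurable M"
proof -
  have "(\<lambda>x. norm (D j x)) \<in> borel_measurable M" if "j \<in> {..<m}" for j using that by simp
  then have "(\<lambda>x. \<Sum>j<m. (norm (D j x))\<^sup>2) \<in> borel_measurable M"
    by (intro borel_measurable_sum borel_measurable_power)
  then show ?thesis unfolding hs_norm_def L2_set_def
    by (rule measurable_compose[OF _ borel_measurable_sqrt])
qed

text \<open>The factor m^n is harmless, because this bound serves integrability and convergence and
  enters no constant of the final estimate.\<close>

lemma hs_norm_power_le_sum: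
  fixes L :: "nat \<Rightarrow> 'a::euclidean_space"
  assumes "1 \<le> n"
  shows "(\<Sum>j<m. norm (L j)) ^ n \<le> real m ^ n * (\<Sum>j<m. norm (L j) ^ n)"
proof (cases "m = 0")
  case True
  then show ?thesis using assms by (simp add: power_0_left)
next
  case False
  define mx where "mx = Max ((\<lambda>j. norm (L j)) ` {..<m})"
  have "mx \<in> (\<lambda>j. norm (L j)) ` {..<m}" unfolding mx_def using False by (intro Max_in) auto
  then obtain j0 where j0: "j0 < m" "mx = norm (L j0)" by auto
  have "(\<Sum>j<m. norm (L j)) \<le> (\<Sum>j<m. mx)" unfolding mx_def by (intro sum_mono Max_ge) auto
  then have "(\<Sum>j<m. norm (L j)) ^ n \<le> (real m * mx) ^ n" by (intro power_mono sum_nonneg) auto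
  also have "\<dots> = real m ^ n * norm (L j0) ^ n" by (simp add: power_mult_distrib j0)
  also have "\<dots> \<le> real m ^ n * (\<Sum>j<m. norm (L j) ^ n)"
    using j0 by (intro mult_left_mono member_le_sum) auto
  finally show ?thesis .
qed

text \<open>Young's inequality with a small parameter, by comparing \<open>e\<close> with
  \<open>\<tau> * s\<close>.\<close>

lemma mult_power_le_split:
  fixes e s \<tau> :: real
  assumes "0 \<le> e" "0 \<le> s" "0 < \<tau>" "1 \<le> n"
  shows "e * s ^ (n - 1) \<le> \<tau> * s ^ n + (1 / \<tau>) ^ (n - 1) * e ^ n"
proof -
  obtain k where n: "n = Suc k" using assms(4) by (cases n) auto
  show ?thesis
  proof (cases "e \<le> \<tau> * s")
  case True
  then have "e * s ^ (n - 1) \<le> \<tau> * s * s ^ (n - 1)" using assms by (intro mult_right_mono) auto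
  also have "\<dots> = \<tau> * s ^ n" by (simp add: n)
  finally show ?thesis using assms by (simp add: add_increasing2)
next
  case False
  then have "s \<le> e / \<tau>" using assms by (simp add: field_simps)
  then have "e * s ^ (n - 1) \<le> e * (e / \<tau>) ^ (n - 1)" using assms by (intro mult_left_mono power_mono) auto
  also have "\<dots> = (1 / \<tau>) ^ (n - 1) * e ^ n" by (simp add: n power_divide)
  finally show ?thesis using assms by (simp add: add_increasing)
  qed
qed

text \<open>On sets of finite measure L^n convergence entails L^q convergence for q = n - 1/2. The
  threshold is e^q = \<eta>; above it e^(-1/2) is bounded and turns e^n into e^q.\<close>

lemma powr_le_split:
  fixes e \<eta> :: real and n :: nat
  assumes "0 \<le> e" "0 < \<eta>" "2 \<le> n"
  defines "q \<equiv> real n - 1/2"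
  shows "e powr q \<le> \<eta> + \<eta> powr (- (1 / (2 * q))) * e ^ n"
proof (cases "e \<le> \<eta> powr (1 / q)")
  case True
  have q: "q > 0" using assms(3) by (simp add: q_def)
  have "e powr q \<le> (\<eta> powr (1 / q)) powr q" using True assms q by (intro powr_mono2) auto
  also have "\<dots> = \<eta>" using q assms by (simp add: powr_powr)
  finally show ?thesis using assms by (simp add: add_increasing2)
next
  case False
  have q: "q > 0" using assms(3) by (simp add: q_def)
  have e: "e > 0" using False assms by (smt (verit) powr_ge_zero)
  have "e powr q = e powr (- (1/2)) * e powr real n" using e by (simp add: q_def flip: powr_add)
  also have "\<dots> \<le> (\<eta> powr (1 / q)) powr (- (1/2)) * e powr real n"
    using False assms by (intro mult_right_mono powr_mono2') auto
  also have "\<dots> = \<eta> powr (- (1 / (2 * q))) * e ^ n" using e by (simp add: powr_powr powr_realpow mult.commute)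
  finally show ?thesis using assms by simp
qed

lemma add_powr_le:
  fixes a b q :: real
  assumes "0 \<le> a" "0 \<le> b" "0 < q"
  shows "(a + b) powr q \<le> 2 powr q * (a powr q + b powr q)"
proof -
  have "(a + b) powr q \<le> (2 * max a b) powr q" using assms by (intro powr_mono2) auto
  also have "\<dots> = 2 powr q * (max a b) powr q" using assms by (subst powr_mult) auto
  also have "\<dots> \<le> 2 powr q * (a powr q + b powr q)" by (intro mult_left_mono) (auto simp: max_def)
  finally show ?thesis .
qed

text \<open>The strict bound by \<open>A'\<close> leaves room for the mollification error, so that
  eventually the mollified gradients have L^q mass at most 2^n A', the factor coming from the
  triangle inequality. The smooth estimate then holds with one bound for all large indices, while
  the pullbacks converge in L^1 on the ball.\<close>

lemma reverse_hoelder_limit: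
  fixes \<omega> :: "'n::{finite,linorder} const_form" and z x0 :: "(real, 'n) vec" and r A' b p :: real and m :: nat
  assumes n2: "2 \<le> CARD('n)" and data: "local_sobolev_data z R u D"
    and r: "0 < r" "cball x0 r \<subseteq> ball z R"
    and A: "(\<integral>\<^sup>+x\<in>ball x0 r. ennreal (hs_norm m (\<lambda>j. D j x) powr (real CARD('n) - 1/2)) \<partial>lborel) < ennreal A'"
  defines "b \<equiv> unit_ball_vol (real CARD('n)) * r ^ CARD('n)"
  defines "p \<equiv> 1 / (2 * real CARD('n) - 1)"
  shows "\<bar>LINT x|lborel. bump x0 r x * star_pullback m \<omega> (\<lambda>j. D j x)\<bar>
     \<le> 16 * (1 + 2 ^ CARD('n)) / (1 - real CARD('n) * p) * comass m \<omega> * (2 ^ CARD('n) * A') * (2 ^ CARD('n) * A' / b) powr p"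
proof -
  define n where "n = CARD('n)"
  define q where "q = real n - 1/2"
  have nn: "2 \<le> n" using n2 by (simp add: n_def)
  have q: "q > 0" using nn by (simp add: q_def)
  note dat = data[unfolded local_sobolev_data_def, rule_format]
  have [measurable]: "D j \<in> borel_measurable borel" for j using dat[of j] by auto
  have A'0: "A' > 0"
    using le_less_trans[OF zero_le A] by simp
  define B where "B = ball x0 r"
  have [measurable]: "B \<in> sets borel" by (simp add: B_def)
  have [measurable]: "ball y s \<in> sets borel" for y :: "(real, 'n) vec" and s by simp
  have vb: "emeasure lborel B = ennreal b" "b > 0" using r by (simp_all add: B_def b_def emeasure_ball)
  \<comment> \<open>Room for mollifying: the ball around \<open>x0\<close> lies in the ball of
    radius \<open>r'\<close> around \<open>z\<close>, and r' < R because even the closed ball around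
    \<open>x0\<close> lies in the open one.\<close>
  define r' where "r' = dist z x0 + r"
  have r': "r' < R" using r by (auto simp: cball_subset_ball_iff r'_def dist_commute)
  have Bsub: "B \<subseteq> ball z r'"
  proof
    fix x assume "x \<in> B"
    then show "x \<in> ball z r'" using dist_triangle[of z x x0] by (simp add: B_def r'_def)
  qed
  obtain F DF D2F where sm: "\<And>i::nat. smooth_map (F i) (DF i) (D2F i)"
    and conv: "\<And>j. (\<lambda>i. \<integral>\<^sup>+x\<in>ball z r'. ennreal (norm (DF i j x - D j x) ^ CARD('n)) \<partial>lborel) \<longlonglongrightarrow> 0"
    using smooth_approximation[OF data r'] by blast
  have contDF: "continuous_on UNIV (DF i j)" for i j using sm[of i] by (simp add: smooth_map_def)
  have DFm [measurable]: "DF i j \<in> borel_measurable borel" for i j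
    by (rule borel_measurable_continuous_onI[OF contDF])
  define e where "e = (\<lambda>i x. \<Sum>j<m. norm (DF i j x - D j x))"
  have [measurable]: "e i \<in> borel_measurable borel" for i unfolding e_def by measurable
  have e0: "0 \<le> e i x" for i x unfolding e_def by (intro sum_nonneg) simp
  define g where "g = (\<lambda>x. hs_norm m (\<lambda>j. D j x))"
  have [measurable]: "g \<in> borel_measurable borel" unfolding g_def by measurable
  have g0: "0 \<le> g x" for x by (simp add: g_def)
  define En where "En = (\<lambda>i. \<integral>\<^sup>+x\<in>B. ennreal (e i x ^ n) \<partial>lborel)"
  have En: "En \<longlonglongrightarrow> 0"
  proof (rule tendsto_sandwich[OF _ _ tendsto_const])
    have "(\<lambda>i. ennreal (real m ^ n) * (\<Sum>j<m. \<integral>\<^sup>+x\<in>ball z r'. ennreal (norm (DF i j x - D j x) ^ CARD('n)) \<partial>lborel)) \<longlonglongrightarrow> ennreal (real m ^ n) * (\<Sum>j<m. 0)"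
      by (intro ennreal_tendsto_cmult tendsto_sum conv) simp
    then show "(\<lambda>i. ennreal (real m ^ n) * (\<Sum>j<m. \<integral>\<^sup>+x\<in>ball z r'. ennreal (norm (DF i j x - D j x) ^ CARD('n)) \<partial>lborel)) \<longlonglongrightarrow> 0"
      by simp
    show "\<forall>\<^sub>F i in sequentially. En i \<le> ennreal (real m ^ n) * (\<Sum>j<m. \<integral>\<^sup>+x\<in>ball z r'. ennreal (norm (DF i j x - D j x) ^ CARD('n)) \<partial>lborel)"
    proof (intro always_eventually allI)
      fix i
      have "En i \<le> (\<integral>\<^sup>+x. ennreal (real m ^ n) * (\<Sum>j<m. ennreal (norm (DF i j x - D j x) ^ CARD('n)) * indicator (ball z r') x) \<partial>lborel)"
        unfolding En_def
      proof (rule nn_integral_mono)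
        fix x
        show "ennreal (e i x ^ n) * indicator B x \<le> ennreal (real m ^ n) * (\<Sum>j<m. ennreal (norm (DF i j x - D j x) ^ CARD('n)) * indicator (ball z r') x)"
        proof (cases "x \<in> B")
          case True
          have "e i x ^ n \<le> real m ^ n * (\<Sum>j<m. norm (DF i j x - D j x) ^ n)"
            unfolding e_def using nn by (intro hs_norm_power_le_sum) simp
          then have "ennreal (e i x ^ n) \<le> ennreal (real m ^ n * (\<Sum>j<m. norm (DF i j x - D j x) ^ n))" by (rule ennreal_leI)
          also have "\<dots> = ennreal (real m ^ n) * (\<Sum>j<m. ennreal (norm (DF i j x - D j x) ^ n))"
            by (subst ennreal_mult') (auto intro: sum_nonneg)
          finally have le: "ennreal (e i x ^ n) \<le> ennreal (real m ^ n) * (\<Sum>j<m. ennreal (norm (DF i j x - D j x) ^ n))" .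
          have "x \<in> ball z r'" using True Bsub by blast
          then have "indicator (ball z r') x = (1::ennreal)" by (rule indicator_simps(1))
          then show ?thesis using le True by (simp only: n_def mult_1_right indicator_simps)
        qed simp
      qed
      also have "\<dots> = ennreal (real m ^ n) * (\<Sum>j<m. \<integral>\<^sup>+x\<in>ball z r'. ennreal (norm (DF i j x - D j x) ^ CARD('n)) \<partial>lborel)"
        by (subst nn_integral_cmult, measurable) (subst nn_integral_sum, auto)
      finally show "En i \<le> ennreal (real m ^ n) * (\<Sum>j<m. \<integral>\<^sup>+x\<in>ball z r'. ennreal (norm (DF i j x - D j x) ^ CARD('n)) \<partial>lborel)" .
    qed
  qed simp
  define Aq where "Aq = (\<integral>\<^sup>+x\<in>B. ennreal (g x powr q) \<partial>lborel)"
  have Aq: "Aq < ennreal A'" using A by (simp add: Aq_def B_def g_def q_def n_def)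
  then obtain aq where aq: "Aq = ennreal aq" "0 \<le> aq" by (cases Aq) auto
  then have aqA: "aq < A'" using Aq A'0 by (simp add: ennreal_less_iff)
  have eqlim: "\<forall>\<^sub>F i in sequentially. (\<integral>\<^sup>+x\<in>B. ennreal (e i x powr q) \<partial>lborel) \<le> ennreal (A' - aq)"
  proof -
    \<comment> \<open>Half of the room A' - aq is spent on \<eta> times the volume, the other half
      on the L^n error.\<close>
    define \<eta> where "\<eta> = (A' - aq) / (2 * b)"
    have \<eta>: "\<eta> > 0" using aqA vb by (simp add: \<eta>_def)
    define c where "c = \<eta> powr (- (1 / (2 * q)))"
    have "(\<lambda>i. ennreal c * En i) \<longlonglongrightarrow> ennreal c * 0" by (intro ennreal_tendsto_cmult En) simp
    then have "\<forall>\<^sub>F i in sequentially. ennreal c * En i < ennreal ((A' - aq) / 2)"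
      by (rule order_tendstoD) (use aqA in simp)
    then show ?thesis
    proof eventually_elim
      case (elim i)
      have "(\<integral>\<^sup>+x\<in>B. ennreal (e i x powr q) \<partial>lborel) \<le> (\<integral>\<^sup>+x. ennreal \<eta> * indicator B x + ennreal c * (ennreal (e i x ^ n) * indicator B x) \<partial>lborel)"
      proof (rule nn_integral_mono)
        fix x
        have "e i x powr q \<le> \<eta> + c * e i x ^ n"
          unfolding c_def q_def by (rule powr_le_split[OF e0 \<eta> nn])
        then have "ennreal (e i x powr q) \<le> ennreal (\<eta> + c * e i x ^ n)" by (rule ennreal_leI)
        also have "\<dots> = ennreal \<eta> + ennreal c * ennreal (e i x ^ n)"
          using \<eta> e0 by (subst ennreal_plus) (auto simp: c_def ennreal_mult')
        finally show "ennreal (e i x powr q) * indicator B x \<le> ennreal \<eta> * indicator B x + ennreal c * (ennreal (e i x ^ n) * indicator B x)"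
          by (auto simp: indicator_def)
      qed
      also have "\<dots> = ennreal \<eta> * ennreal b + ennreal c * En i"
        unfolding En_def by (simp add: nn_integral_add nn_integral_cmult vb)
      also have "\<dots> \<le> ennreal ((A' - aq) / 2) + ennreal ((A' - aq) / 2)"
      proof (rule add_mono)
        show "ennreal \<eta> * ennreal b \<le> ennreal ((A' - aq) / 2)"
          using \<eta> vb by (simp add: ennreal_mult'[symmetric] \<eta>_def)
      qed (use elim in simp)
      also have "\<dots> = ennreal (A' - aq)" using aqA by (subst ennreal_plus[symmetric]) auto
      finally show ?case .
    qed
  qed
  define P where "P = (\<lambda>x. star_pullback m \<omega> (\<lambda>j. D j x))"
  define Pi where "Pi = (\<lambda>i x. star_pullback m \<omega> (\<lambda>j. DF i j x))"
  have [measurable]: "P \<in> borel_measurable borel" "Pi i \<in> borel_measurable borel" for i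
    unfolding P_def Pi_def by measurable
  have [measurable]: "bump x0 r \<in> borel_measurable borel"
    unfolding bump_def by measurable
  define M where "M = 16 * (1 + 2 ^ n) / (1 - real n * p) * comass m \<omega> * (2 ^ n * A') * (2 ^ n * A' / b) powr p"
  have intP: "integrable lborel P"
  proof (rule Bochner_Integration.integrable_bound)
    show "integrable lborel (\<lambda>x. comass m \<omega> * (real m ^ n * (\<Sum>j<m. norm (D j x) ^ n)))"
      using dat by (intro integrable_mult_right Bochner_Integration.integrable_sum) (auto simp: n_def)
    show "AE x in lborel. norm (P x) \<le> norm (comass m \<omega> * (real m ^ n * (\<Sum>j<m. norm (D j x) ^ n)))"
    proof (rule AE_I2)
      fix x
      have "hs_norm m (\<lambda>j. D j x) \<le> (\<Sum>j<m. norm (D j x))" unfolding hs_norm_def by (rule L2_set_le_sum) simp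
      then have "hs_norm m (\<lambda>j. D j x) ^ n \<le> (\<Sum>j<m. norm (D j x)) ^ n" by (intro power_mono) auto
      also have "\<dots> \<le> real m ^ n * (\<Sum>j<m. norm (D j x) ^ n)" using nn by (intro hs_norm_power_le_sum) simp
      finally have "comass m \<omega> * hs_norm m (\<lambda>j. D j x) ^ n \<le> comass m \<omega> * (real m ^ n * (\<Sum>j<m. norm (D j x) ^ n))"
        by (intro mult_left_mono comass_nonneg)
      then have "\<bar>P x\<bar> \<le> comass m \<omega> * (real m ^ n * (\<Sum>j<m. norm (D j x) ^ n))"
        using star_pullback_le_hs_norm[of m \<omega> "\<lambda>j. D j x"] unfolding P_def n_def by linarith
      then show "norm (P x) \<le> norm (comass m \<omega> * (real m ^ n * (\<Sum>j<m. norm (D j x) ^ n)))" by simp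
    qed
  qed measurable
  define Gn where "Gn = (\<integral>\<^sup>+x\<in>B. ennreal (g x ^ n) \<partial>lborel)"
  have Gn: "Gn < \<infinity>"
  proof -
    have "Gn \<le> (\<integral>\<^sup>+x. ennreal (real m ^ n * (\<Sum>j<m. norm (D j x) ^ n)) \<partial>lborel)"
      unfolding Gn_def
    proof (rule nn_integral_mono)
      fix x
      have "g x \<le> (\<Sum>j<m. norm (D j x))" unfolding hs_norm_def g_def by (rule L2_set_le_sum) simp
      then have "g x ^ n \<le> (\<Sum>j<m. norm (D j x)) ^ n" using g0 by (intro power_mono) auto
      also have "\<dots> \<le> real m ^ n * (\<Sum>j<m. norm (D j x) ^ n)" using nn by (intro hs_norm_power_le_sum) simp
      finally show "ennreal (g x ^ n) * indicator B x \<le> ennreal (real m ^ n * (\<Sum>j<m. norm (D j x) ^ n))"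
        by (auto simp: indicator_def intro: ennreal_leI)
    qed
    also have "\<dots> < \<infinity>"
    proof -
      have "integrable lborel (\<lambda>x. real m ^ n * (\<Sum>j<m. norm (D j x) ^ n))"
        using dat by (intro integrable_mult_right Bochner_Integration.integrable_sum) (auto simp: n_def)
      then show ?thesis unfolding integrable_iff_bounded by (simp add: sum_nonneg abs_mult)
    qed
    finally show ?thesis .
  qed
  have Pdiff: "(\<lambda>i. \<integral>\<^sup>+x\<in>B. ennreal \<bar>Pi i x - P x\<bar> \<partial>lborel) \<longlonglongrightarrow> 0"
  proof (rule tendsto_0_ennrealI)
    fix \<delta> :: real assume \<delta>: "\<delta> > 0"
    define K where "K = n * comass m \<omega>"
    have K: "K \<ge> 0" by (simp add: K_def comass_nonneg)
    obtain gr where gr: "Gn = ennreal gr" "gr \<ge> 0" using Gn by (cases Gn) auto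
    \<comment> \<open>The summand 1 keeps the denominator positive when \<open>K\<close> or
      \<open>gr\<close> is zero.\<close>
    define \<tau> where "\<tau> = \<delta> / (2 * (K * 2 ^ n * gr + 1))"
    have \<tau>: "\<tau> > 0" using \<delta> K gr by (simp add: \<tau>_def add_nonneg_pos)
    have \<tau>K: "K * \<tau> * 2 ^ n * gr \<le> \<delta> / 2"
    proof -
      have "K * \<tau> * 2 ^ n * gr = (K * 2 ^ n * gr) / (K * 2 ^ n * gr + 1) * (\<delta> / 2)" by (simp add: \<tau>_def mult_ac)
      also have "\<dots> \<le> 1 * (\<delta> / 2)"
      proof (rule mult_right_mono)
        have "0 \<le> K * 2 ^ n * gr" using K gr by simp
        then show "(K * 2 ^ n * gr) / (K * 2 ^ n * gr + 1) \<le> 1" by (subst divide_le_eq_1) auto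
      qed (use \<delta> in simp)
      finally show ?thesis by simp
    qed
    \<comment> \<open>Collects both coefficients of e^n, from expanding (g + e)^n and from the
      splitting with parameter \<tau>.\<close>
    define c where "c = K * (\<tau> * 2 ^ n + (1 / \<tau>) ^ (n - 1))"
    have c0: "c \<ge> 0" using K \<tau> by (simp add: c_def)
    have "(\<lambda>i. ennreal c * En i) \<longlonglongrightarrow> ennreal c * 0" by (intro ennreal_tendsto_cmult En) simp
    then have "\<forall>\<^sub>F i in sequentially. ennreal c * En i < ennreal (\<delta> / 2)"
      by (rule order_tendstoD) (use \<delta> in simp)
    then show "\<forall>\<^sub>F i in sequentially. (\<integral>\<^sup>+x\<in>B. ennreal \<bar>Pi i x - P x\<bar> \<partial>lborel) \<le> ennreal \<delta>"
    proof eventually_elim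
      case (elim i)
      have "(\<integral>\<^sup>+x\<in>B. ennreal \<bar>Pi i x - P x\<bar> \<partial>lborel)
        \<le> (\<integral>\<^sup>+x. ennreal (K * \<tau> * 2 ^ n) * (ennreal (g x ^ n) * indicator B x) + ennreal c * (ennreal (e i x ^ n) * indicator B x) \<partial>lborel)"
      proof (rule nn_integral_mono)
        fix x
        have "\<bar>Pi i x - P x\<bar> \<le> K * (e i x * (g x + e i x) ^ (n - 1))"
          unfolding Pi_def P_def K_def n_def e_def g_def using star_pullback_diff_le by (simp only: mult.assoc)
        also have "\<dots> \<le> K * (\<tau> * (g x + e i x) ^ n + (1 / \<tau>) ^ (n - 1) * e i x ^ n)"
          using K e0 g0 \<tau> nn by (intro mult_left_mono mult_power_le_split) auto
        also have "\<dots> \<le> K * (\<tau> * (2 ^ n * (g x ^ n + e i x ^ n)) + (1 / \<tau>) ^ (n - 1) * e i x ^ n)"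
          using K e0 g0 \<tau> by (intro mult_left_mono add_right_mono add_power_le) auto
        also have "\<dots> = K * \<tau> * 2 ^ n * g x ^ n + c * e i x ^ n" by (simp add: c_def algebra_simps)
        finally have "ennreal \<bar>Pi i x - P x\<bar> \<le> ennreal (K * \<tau> * 2 ^ n * g x ^ n + c * e i x ^ n)" by (rule ennreal_leI)
        also have "\<dots> = ennreal (K * \<tau> * 2 ^ n) * ennreal (g x ^ n) + ennreal c * ennreal (e i x ^ n)"
          using K \<tau> g0 e0 c0 by (subst ennreal_plus) (auto simp: ennreal_mult'[symmetric] simp del: ennreal_power)
        finally show "ennreal \<bar>Pi i x - P x\<bar> * indicator B x
          \<le> ennreal (K * \<tau> * 2 ^ n) * (ennreal (g x ^ n) * indicator B x) + ennreal c * (ennreal (e i x ^ n) * indicator B x)"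
          by (auto simp: indicator_def)
      qed
      also have "\<dots> = ennreal (K * \<tau> * 2 ^ n) * Gn + ennreal c * En i"
        unfolding Gn_def En_def by (subst nn_integral_add) (auto simp: nn_integral_cmult)
      also have "\<dots> \<le> ennreal (\<delta> / 2) + ennreal (\<delta> / 2)"
      proof (rule add_mono)
        show "ennreal (K * \<tau> * 2 ^ n) * Gn \<le> ennreal (\<delta> / 2)"
          using \<tau>K K \<tau> gr by (simp add: ennreal_mult'[symmetric] ennreal_leI)
      qed (use elim in simp)
      also have "\<dots> = ennreal \<delta>" using \<delta> by (subst ennreal_plus[symmetric]) auto
      finally show ?case .
    qed
  qed
  have bmz: "bump x0 r x = 0" if "x \<notin> B" for x using bump_eq_0[OF r(1)] that by (simp add: B_def)
  have "\<bar>LINT x|lborel. bump x0 r x * P x\<bar> \<le> M + \<delta>" if \<delta>: "\<delta> > 0" for \<delta>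
  proof -
    have "\<forall>\<^sub>F i in sequentially. (\<integral>\<^sup>+x\<in>B. ennreal \<bar>Pi i x - P x\<bar> \<partial>lborel) < ennreal \<delta>"
      using Pdiff by (rule order_tendstoD) (use \<delta> in simp)
    from eventually_conj[OF this eqlim] obtain i
      where i: "(\<integral>\<^sup>+x\<in>B. ennreal \<bar>Pi i x - P x\<bar> \<partial>lborel) < ennreal \<delta>"
        "(\<integral>\<^sup>+x\<in>B. ennreal (e i x powr q) \<partial>lborel) \<le> ennreal (A' - aq)"
      unfolding eventually_sequentially by blast
    have Ai: "(\<integral>\<^sup>+x\<in>B. ennreal (hs_norm m (\<lambda>j. DF i j x) powr q) \<partial>lborel) \<le> ennreal (2 ^ n * A')"
    proof -
      have "(\<integral>\<^sup>+x\<in>B. ennreal (hs_norm m (\<lambda>j. DF i j x) powr q) \<partial>lborel)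
        \<le> (\<integral>\<^sup>+x. ennreal (2 ^ n) * (ennreal (g x powr q) * indicator B x + ennreal (e i x powr q) * indicator B x) \<partial>lborel)"
      proof (rule nn_integral_mono)
        fix x
        have "hs_norm m (\<lambda>j. DF i j x) powr q \<le> (g x + e i x) powr q"
          unfolding g_def e_def using q by (intro powr_mono2 hs_norm_triangle) auto
        also have "\<dots> \<le> 2 powr q * (g x powr q + e i x powr q)" using g0 e0 q by (intro add_powr_le) auto
        also have "\<dots> \<le> 2 powr (real n) * (g x powr q + e i x powr q)"
          by (intro mult_right_mono powr_mono) (auto simp: q_def)
        also have "\<dots> = 2 ^ n * (g x powr q + e i x powr q)" by (simp add: powr_realpow)
        finally have "ennreal (hs_norm m (\<lambda>j. DF i j x) powr q) \<le> ennreal (2 ^ n * (g x powr q + e i x powr q))" by (rule ennreal_leI)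
        also have "\<dots> = ennreal (2 ^ n) * (ennreal (g x powr q) + ennreal (e i x powr q))"
          by (subst ennreal_mult') auto
        finally show "ennreal (hs_norm m (\<lambda>j. DF i j x) powr q) * indicator B x
          \<le> ennreal (2 ^ n) * (ennreal (g x powr q) * indicator B x + ennreal (e i x powr q) * indicator B x)"
          by (auto simp: indicator_def)
      qed
      also have "\<dots> = ennreal (2 ^ n) * (Aq + (\<integral>\<^sup>+x\<in>B. ennreal (e i x powr q) \<partial>lborel))"
        unfolding Aq_def by (subst nn_integral_cmult, measurable) (subst nn_integral_add, auto)
      also have "\<dots> \<le> ennreal (2 ^ n) * (ennreal aq + ennreal (A' - aq))"
        using i(2) aq by (intro mult_left_mono add_mono) auto
      also have "\<dots> = ennreal (2 ^ n * A')"
      proof -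
        have "ennreal aq + ennreal (A' - aq) = ennreal A'" using aq aqA by (subst ennreal_plus[symmetric]) auto
        then show ?thesis by (subst ennreal_mult') auto
      qed
      finally show ?thesis .
    qed
    have RHi: "\<bar>LINT x|lborel. bump x0 r x * Pi i x\<bar> \<le> M"
      unfolding Pi_def M_def n_def b_def p_def
      by (rule reverse_hoelder_smooth[OF n2 sm r(1)]) (use A'0 Ai in \<open>auto simp: B_def q_def n_def\<close>)
    have bP: "integrable lborel (\<lambda>x. bump x0 r x * P x)"
    proof (rule Bochner_Integration.integrable_bound[OF intP])
      show "AE x in lborel. norm (bump x0 r x * P x) \<le> norm (P x)"
      proof (rule AE_I2)
        fix x
        have "\<bar>bump x0 r x\<bar> * \<bar>P x\<bar> \<le> 1 * \<bar>P x\<bar>"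
          using bump_nonneg[of x0 r x] bump_le_1[of x0 r x] by (intro mult_right_mono) auto
        then show "norm (bump x0 r x * P x) \<le> norm (P x)" by (simp add: abs_mult)
      qed
    qed measurable
    have bPi: "integrable lborel (\<lambda>x. bump x0 r x * Pi i x)"
    proof (rule integrable_continuous_compact_support)
      have "continuous_on UNIV (Pi i)"
        unfolding Pi_def star_pullback_def
        by (intro continuous_on_form_eval continuous_intros contDF)
      then show "continuous_on UNIV (\<lambda>x. bump x0 r x * Pi i x)"
        using r(1) unfolding bump_def by (auto intro!: continuous_intros)
      show "bump x0 r x * Pi i x = 0" if "x \<notin> cball x0 r" for x
        using bmz[of x] that by (auto simp: B_def)
    qed
    have "\<bar>(LINT x|lborel. bump x0 r x * Pi i x) - (LINT x|lborel. bump x0 r x * P x)\<bar> = \<bar>LINT x|lborel. bump x0 r x * (Pi i x - P x)\<bar>"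
      using bP bPi by (simp add: right_diff_distrib)
    also have "\<dots> \<le> (LINT x|lborel. \<bar>bump x0 r x * (Pi i x - P x)\<bar>)" by (rule integral_abs_bound)
    also have "\<dots> \<le> \<delta>"
    proof -
      have int: "integrable lborel (\<lambda>x. \<bar>bump x0 r x * (Pi i x - P x)\<bar>)"
        using bP bPi by (intro integrable_abs) (simp add: right_diff_distrib)
      have "ennreal (LINT x|lborel. \<bar>bump x0 r x * (Pi i x - P x)\<bar>) = (\<integral>\<^sup>+x. ennreal \<bar>bump x0 r x * (Pi i x - P x)\<bar> \<partial>lborel)"
        by (rule nn_integral_eq_integral[symmetric, OF int]) simp
      also have "\<dots> \<le> (\<integral>\<^sup>+x\<in>B. ennreal \<bar>Pi i x - P x\<bar> \<partial>lborel)"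
      proof (rule nn_integral_mono)
        fix x
        show "ennreal \<bar>bump x0 r x * (Pi i x - P x)\<bar> \<le> ennreal \<bar>Pi i x - P x\<bar> * indicator B x"
        proof (cases "x \<in> B")
          case True
          have "\<bar>bump x0 r x\<bar> * \<bar>Pi i x - P x\<bar> \<le> 1 * \<bar>Pi i x - P x\<bar>"
            using bump_nonneg[of x0 r x] bump_le_1[of x0 r x] by (intro mult_right_mono) auto
          then show ?thesis using True by (simp add: abs_mult ennreal_leI)
        qed (simp add: bmz)
      qed
      also have "\<dots> \<le> ennreal \<delta>" using i(1) by simp
      finally show ?thesis using \<delta> by (subst (asm) ennreal_le_iff) auto
    qed
    finally show ?thesis using RHi by linarith
  qed
  then have "\<bar>LINT x|lborel. bump x0 r x * P x\<bar> \<le> M" by (rule field_le_epsilon)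
  then show ?thesis by (simp only: P_def M_def n_def)
qed

lemma star_pullback_integrable:
  fixes \<omega> :: "'n::{finite,linorder} const_form" and z x0 :: "(real, 'n) vec"
  assumes data: "local_sobolev_data z R u D"
  shows "integrable lborel (\<lambda>x. star_pullback m \<omega> (\<lambda>j. D j x))" (is ?A)
    and "integrable lborel (\<lambda>x. hs_norm m (\<lambda>j. D j x) ^ CARD('n))" (is ?B)
    and "integrable lborel (\<lambda>x. bump x0 r x * star_pullback m \<omega> (\<lambda>j. D j x))" (is ?C)
proof -
  define n where "n = CARD('n)"
  have nn: "1 \<le> n" by (simp add: n_def Suc_leI)
  note dat = data[unfolded local_sobolev_data_def, rule_format]
  have [measurable]: "D j \<in> borel_measurable borel" for j using dat[of j] by auto
  have int: "integrable lborel (\<lambda>x. real m ^ n * (\<Sum>j<m. norm (D j x) ^ n))"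
    using dat by (intro integrable_mult_right Bochner_Integration.integrable_sum) (auto simp: n_def)
  have hs: "hs_norm m (\<lambda>j. D j x) ^ n \<le> real m ^ n * (\<Sum>j<m. norm (D j x) ^ n)" for x
  proof -
    have "hs_norm m (\<lambda>j. D j x) \<le> (\<Sum>j<m. norm (D j x))" unfolding hs_norm_def by (rule L2_set_le_sum) simp
    then have "hs_norm m (\<lambda>j. D j x) ^ n \<le> (\<Sum>j<m. norm (D j x)) ^ n" by (intro power_mono) auto
    also have "\<dots> \<le> real m ^ n * (\<Sum>j<m. norm (D j x) ^ n)" using nn by (rule hs_norm_power_le_sum)
    finally show ?thesis .
  qed
  show B: ?B
    by (rule Bochner_Integration.integrable_bound[OF int])
       (auto simp: n_def[symmetric] abs_of_nonneg sum_nonneg hs)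
  show A: ?A
  proof (rule Bochner_Integration.integrable_bound[OF integrable_mult_right[OF B, of "comass m \<omega>"]])
    show "AE x in lborel. norm (star_pullback m \<omega> (\<lambda>j. D j x)) \<le> norm (comass m \<omega> * hs_norm m (\<lambda>j. D j x) ^ CARD('n))"
      using star_pullback_le_hs_norm by (intro AE_I2) (simp add: abs_mult comass_nonneg)
  qed measurable
  show ?C
  proof (rule Bochner_Integration.integrable_bound[OF A])
    show "AE x in lborel. norm (bump x0 r x * star_pullback m \<omega> (\<lambda>j. D j x)) \<le> norm (star_pullback m \<omega> (\<lambda>j. D j x))"
    proof (rule AE_I2)
      fix x
      have "\<bar>bump x0 r x\<bar> * \<bar>star_pullback m \<omega> (\<lambda>j. D j x)\<bar> \<le> 1 * \<bar>star_pullback m \<omega> (\<lambda>j. D j x)\<bar>"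
        using bump_nonneg[of x0 r x] bump_le_1[of x0 r x] by (intro mult_right_mono) auto
      then show "norm (bump x0 r x * star_pullback m \<omega> (\<lambda>j. D j x)) \<le> norm (star_pullback m \<omega> (\<lambda>j. D j x))" by (simp add: abs_mult)
    qed
    show "(\<lambda>x. bump x0 r x * star_pullback m \<omega> (\<lambda>j. D j x)) \<in> borel_measurable lborel"
      unfolding bump_def by measurable
  qed
qed

section \<open>Level sets\<close>

abbreviation ball_vol :: "'a::euclidean_space itself \<Rightarrow> real" where
  "ball_vol _ \<equiv> unit_ball_vol (real DIM('a))"

text \<open>The sum over the balls is written as an integral for the counting measure, so that it
  can be exchanged with the Lebesgue integral.\<close>

lemma nn_integral_disjoint_balls:
  fixes c :: "'i \<Rightarrow> 'a::euclidean_space" and F :: "'a \<Rightarrow> ennreal"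
  assumes "countable I" "pairwise (\<lambda>i j. disjnt (ball (c i) (r i)) (ball (c j) (r j))) I"
    and [measurable]: "F \<in> borel_measurable borel"
  shows "(\<integral>\<^sup>+i. (\<integral>\<^sup>+y\<in>ball (c i) (r i). F y \<partial>lborel) \<partial>count_space I)
     = (\<integral>\<^sup>+y\<in>(\<Union>i\<in>I. ball (c i) (r i)). F y \<partial>lborel)"
proof -
  have d: "disjoint_family_on (\<lambda>i. ball (c i) (r i)) I"
    using assms(2) by (auto simp: disjoint_family_on_def pairwise_def disjnt_def)
  have e: "(\<integral>\<^sup>+y\<in>A. F y \<partial>lborel) = emeasure (density lborel F) A" if "A \<in> sets borel" for A
    using that by (simp add: emeasure_density)
  have "(\<Union>i\<in>I. ball (c i) (r i)) \<in> sets borel" by (intro borel_open open_UN) auto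
  then show ?thesis
    using emeasure_UN_countable[of I "\<lambda>i. ball (c i) (r i)" "density lborel F", OF _ assms(1) d]
    by (simp add: e)
qed

lemma borel_measurable_nn_integral_ball:
  fixes J :: "'a::euclidean_space \<Rightarrow> real" and \<delta> :: "'a \<Rightarrow> real"
  assumes [measurable]: "J \<in> borel_measurable borel" "\<delta> \<in> borel_measurable borel"
  shows "(\<lambda>x. (\<integral>\<^sup>+y\<in>ball x (\<delta> x). ennreal (J y) \<partial>lborel)) \<in> borel_measurable borel"
proof -
  have "(\<lambda>x. \<integral>\<^sup>+y. ennreal (J y) * (if dist x y < \<delta> x then 1 else 0) \<partial>lborel) \<in> borel_measurable borel"
    by measurable
  then show ?thesis by (simp add: indicator_def of_bool_def)
qed

text \<open>The lower half of Lebesgue's differentiation theorem, along prescribed radii.\<close>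

lemma lower_density_AE:
  fixes J :: "'a::euclidean_space \<Rightarrow> real" and \<delta> :: "nat \<Rightarrow> 'a \<Rightarrow> real"
  assumes [measurable]: "J \<in> borel_measurable borel" "A \<in> sets borel" "\<And>k. \<delta> k \<in> borel_measurable borel"
    and J0: "\<And>x. 0 \<le> J x" and fin: "(\<integral>\<^sup>+x. ennreal (J x) \<partial>lborel) < \<infinity>"
    and \<delta>: "\<And>x k. x \<in> A \<Longrightarrow> 0 < \<delta> k x" "\<And>x. x \<in> A \<Longrightarrow> (\<lambda>k. \<delta> k x) \<longlonglongrightarrow> 0"
  shows "AE x in lborel. x \<in> A \<longrightarrow> (\<forall>s. 0 \<le> s \<and> s < J x \<longrightarrow> (\<forall>\<^sub>F k in sequentially.
     ennreal (s * (ball_vol TYPE('a) * \<delta> k x ^ DIM('a))) < (\<integral>\<^sup>+y\<in>ball x (\<delta> k x). ennreal (J y) \<partial>lborel)))"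
proof -
  define v where "v = ball_vol TYPE('a)"
  have v: "v > 0" by (simp add: v_def)
  define av where "av = (\<lambda>k x. (\<integral>\<^sup>+y\<in>ball x (\<delta> k x). ennreal (J y) \<partial>lborel))"
  have [measurable]: "av k \<in> borel_measurable borel" for k
    unfolding av_def by (rule borel_measurable_nn_integral_ball) auto
  \<comment> \<open>The bad set for the level \<open>s\<close>: the value exceeds \<open>s\<close>,
    yet infinitely many of the prescribed balls have mean at most \<open>s\<close>.\<close>
  define N where "N = (\<lambda>s. {x \<in> A. s < J x \<and> (\<forall>K. \<exists>k\<ge>K. av k x \<le> ennreal (s * (v * \<delta> k x ^ DIM('a))))})"
  have null: "N s \<in> null_sets lborel" if s: "s > 0" for s
  proof -
    have [measurable]: "N s \<in> sets borel" unfolding N_def by measurable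
    have NJ: "ennreal s * emeasure lborel (N s) \<le> (\<integral>\<^sup>+x\<in>N s. ennreal (J x) \<partial>lborel)"
    proof -
      have "ennreal s * emeasure lborel (N s) = (\<integral>\<^sup>+x\<in>N s. ennreal s \<partial>lborel)"
        by (simp add: nn_integral_cmult_indicator)
      also have "\<dots> \<le> (\<integral>\<^sup>+x\<in>N s. ennreal (J x) \<partial>lborel)"
        by (intro nn_integral_mono) (auto simp: indicator_def N_def intro!: ennreal_leI)
      finally show ?thesis .
    qed
    have Jfin: "(\<integral>\<^sup>+x\<in>N s. ennreal (J x) \<partial>lborel) < \<infinity>"
      by (rule le_less_trans[OF nn_integral_mono fin]) (auto simp: indicator_def)
    then have "ennreal s * emeasure lborel (N s) < \<infinity>" using NJ by (rule le_less_trans[rotated])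
    then have Nfin: "emeasure lborel (N s) < \<infinity>" using s
      by (metis ennreal_mult_eq_top_iff ennreal_eq_0_iff infinity_ennreal_def less_top not_le)
    \<comment> \<open>The bad balls inside a slightly larger open set form a Vitali cover of the bad
      set, and a disjoint subfamily with means at most \<open>s\<close> covers almost all of it. As
      the values on the bad set exceed \<open>s\<close>, the resulting bound forces it to be
      null.\<close>
    have up: "(\<integral>\<^sup>+x\<in>N s. ennreal (J x) \<partial>lborel) \<le> ennreal s * emeasure lborel (N s) + ennreal \<epsilon>" if \<epsilon>: "\<epsilon> > 0" for \<epsilon>
    proof -
      obtain U where U: "open U" "N s \<subseteq> U" "emeasure lborel (U - N s) < ennreal (\<epsilon> / s)"
        using outer_regular_lborel[of "N s" "\<epsilon> / s"] s \<epsilon> by auto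
      define K where "K = {(x, \<rho>). x \<in> N s \<and> 0 < \<rho> \<and> ball x \<rho> \<subseteq> U \<and>
          (\<integral>\<^sup>+y\<in>ball x \<rho>. ennreal (J y) \<partial>lborel) \<le> ennreal (s * (v * \<rho> ^ DIM('a)))}"
      have "\<exists>i. i \<in> K \<and> x \<in> ball (fst i) (snd i) \<and> snd i < d" if x: "x \<in> N s" and d: "0 < d" for x d
      proof -
        obtain e where e: "e > 0" "ball x e \<subseteq> U" using U x by (meson open_contains_ball subsetD)
        have xA: "x \<in> A" using x by (auto simp: N_def)
        have "\<forall>\<^sub>F k in sequentially. \<delta> k x < min d e"
          using \<delta>(2)[OF xA] by (rule order_tendstoD) (use d e in auto)
        then obtain k0 where k0: "\<And>k. k \<ge> k0 \<Longrightarrow> \<delta> k x < min d e"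
          unfolding eventually_sequentially by blast
        obtain k where k: "k \<ge> k0" "av k x \<le> ennreal (s * (v * \<delta> k x ^ DIM('a)))"
          using x unfolding N_def by blast
        have "(x, \<delta> k x) \<in> K"
          using x \<delta>(1)[OF xA, of k] k k0[of k] e unfolding K_def av_def by fastforce
        then show ?thesis using k0[OF k(1)] \<delta>(1)[OF xA, of k] by force
      qed
      then obtain C where C: "countable C" "C \<subseteq> K"
        "pairwise (\<lambda>i j. disjnt (ball (fst i) (snd i)) (ball (fst j) (snd j))) C"
        "negligible (N s - (\<Union>i\<in>C. ball (fst i) (snd i)))"
        using Vitali_covering_theorem_balls[of "N s" K fst snd] by blast
      define W where "W = (\<Union>i\<in>C. ball (fst i) (snd i))"
      have Wm [measurable]: "W \<in> sets borel" unfolding W_def by (intro borel_open open_UN) auto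
      have WU: "W \<subseteq> U"
      proof
        fix y assume "y \<in> W"
        then obtain i where i: "i \<in> C" "y \<in> ball (fst i) (snd i)" unfolding W_def by blast
        then have "i \<in> K" using C(2) by blast
        then have "ball (fst i) (snd i) \<subseteq> U" by (simp add: K_def case_prod_unfold)
        then show "y \<in> U" using i(2) by blast
      qed
      have "N s - W \<in> null_sets lborel"
        using C(4) by (simp add: W_def[symmetric] negligible_iff_null_sets null_sets_completion_iff)
      then have "AE x in lborel. x \<notin> N s - W" by (rule AE_not_in)
      then have "(\<integral>\<^sup>+x\<in>N s. ennreal (J x) \<partial>lborel) \<le> (\<integral>\<^sup>+x\<in>W. ennreal (J x) \<partial>lborel)"
        by (intro nn_integral_mono_AE, eventually_elim) (auto simp: indicator_def)
      also have "\<dots> = (\<integral>\<^sup>+i. (\<integral>\<^sup>+y\<in>ball (fst i) (snd i). ennreal (J y) \<partial>lborel) \<partial>count_space C)"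
        unfolding W_def by (rule nn_integral_disjoint_balls[symmetric]) (use C in auto)
      also have "\<dots> \<le> (\<integral>\<^sup>+i. (\<integral>\<^sup>+y\<in>ball (fst i) (snd i). ennreal s \<partial>lborel) \<partial>count_space C)"
      proof (rule nn_integral_mono)
        fix i assume "i \<in> space (count_space C)"
        then have i: "i \<in> K" using C(2) by auto
        then have "(\<integral>\<^sup>+y\<in>ball (fst i) (snd i). ennreal (J y) \<partial>lborel) \<le> ennreal (s * (v * snd i ^ DIM('a)))"
          by (auto simp: K_def)
        also have "\<dots> = ennreal s * emeasure lborel (ball (fst i) (snd i))"
          using i s v by (subst emeasure_ball) (auto simp: K_def v_def ennreal_mult')
        also have "\<dots> = (\<integral>\<^sup>+y\<in>ball (fst i) (snd i). ennreal s \<partial>lborel)"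
          by (simp add: nn_integral_cmult_indicator)
        finally show "(\<integral>\<^sup>+y\<in>ball (fst i) (snd i). ennreal (J y) \<partial>lborel) \<le> (\<integral>\<^sup>+y\<in>ball (fst i) (snd i). ennreal s \<partial>lborel)" .
      qed
      also have "\<dots> = (\<integral>\<^sup>+y\<in>W. ennreal s \<partial>lborel)"
        unfolding W_def by (rule nn_integral_disjoint_balls) (use C in auto)
      also have "\<dots> \<le> ennreal s * emeasure lborel U"
        using WU U by (simp add: nn_integral_cmult_indicator emeasure_mono mult_left_mono)
      also have "emeasure lborel U = emeasure lborel (N s) + emeasure lborel (U - N s)"
        using U by (subst plus_emeasure) (auto simp: Un_absorb1)
      also have "ennreal s * \<dots> \<le> ennreal s * (emeasure lborel (N s) + ennreal (\<epsilon> / s))"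
        using U(3) by (intro mult_left_mono add_left_mono) auto
      also have "\<dots> = ennreal s * emeasure lborel (N s) + ennreal \<epsilon>"
        using s \<epsilon> by (simp add: distrib_left ennreal_mult'[symmetric])
      finally show ?thesis .
    qed
    have le: "(\<integral>\<^sup>+x\<in>N s. ennreal (J x) \<partial>lborel) \<le> ennreal s * emeasure lborel (N s)"
      by (rule ennreal_le_epsilon) (use up in auto)
    have "(\<integral>\<^sup>+x\<in>N s. ennreal (J x) \<partial>lborel) = (\<integral>\<^sup>+x. ennreal (J x - s) * indicator (N s) x + ennreal s * indicator (N s) x \<partial>lborel)"
    proof (intro nn_integral_cong)
      fix x
      have "ennreal (J x) = ennreal (J x - s) + ennreal s" if "x \<in> N s"
        using that s by (subst ennreal_plus[symmetric]) (auto simp: N_def)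
      then show "ennreal (J x) * indicator (N s) x = ennreal (J x - s) * indicator (N s) x + ennreal s * indicator (N s) x"
        by (auto simp: indicator_def)
    qed
    also have "\<dots> = (\<integral>\<^sup>+x\<in>N s. ennreal (J x - s) \<partial>lborel) + ennreal s * emeasure lborel (N s)"
      by (simp add: nn_integral_add nn_integral_cmult_indicator)
    finally have eq: "(\<integral>\<^sup>+x\<in>N s. ennreal (J x) \<partial>lborel)
        = (\<integral>\<^sup>+x\<in>N s. ennreal (J x - s) \<partial>lborel) + ennreal s * emeasure lborel (N s)" .
    have "ennreal s * emeasure lborel (N s) + (\<integral>\<^sup>+x\<in>N s. ennreal (J x - s) \<partial>lborel) \<le> ennreal s * emeasure lborel (N s) + 0"
      using le unfolding eq by (simp only: add.commute[of _ "ennreal s * emeasure lborel (N s)"] add_0_right)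
    moreover have "ennreal s * emeasure lborel (N s) \<noteq> \<infinity>" using Nfin by (auto simp: ennreal_mult_eq_top_iff)
    ultimately have "(\<integral>\<^sup>+x\<in>N s. ennreal (J x - s) \<partial>lborel) = 0"
      unfolding ennreal_add_left_cancel_le by simp
    then have "AE x in lborel. ennreal (J x - s) * indicator (N s) x = 0"
      by (subst (asm) nn_integral_0_iff_AE) auto
    then have "AE x in lborel. x \<notin> N s"
      by eventually_elim (auto simp: N_def indicator_def ennreal_eq_0_iff)
    then show ?thesis by (subst AE_iff_null_sets) auto
  qed
  \<comment> \<open>Positive rational levels keep the union countable. A real level
    \<open>s < J x\<close>, including \<open>s = 0\<close>, is handled through a rational number
    between the two.\<close>
  have "(\<Union>s\<in>{s\<in>\<rat>. s > 0}. N s) \<in> null_sets lborel"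
    by (intro null_sets_UN') (auto intro: null countable_subset[OF _ countable_rat])
  then have "AE x in lborel. x \<notin> (\<Union>s\<in>{s\<in>\<rat>. s > 0}. N s)" by (rule AE_not_in)
  then show ?thesis
  proof eventually_elim
    case (elim x)
    show ?case
    proof (intro impI allI)
      fix s assume xA: "x \<in> A" and s: "0 \<le> s \<and> s < J x"
      obtain q where q: "q \<in> \<rat>" "s < q" "q < J x" using Rats_dense_in_real[of s "J x"] s by auto
      then have "x \<notin> N q" using elim s by auto
      then have "\<exists>K. \<forall>k\<ge>K. \<not> av k x \<le> ennreal (q * (v * \<delta> k x ^ DIM('a)))"
        using xA q(3) unfolding N_def by blast
      then obtain K where K: "\<And>k. k \<ge> K \<Longrightarrow> ennreal (q * (v * \<delta> k x ^ DIM('a))) < av k x"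
        unfolding not_le by blast
      show "\<forall>\<^sub>F k in sequentially. ennreal (s * (ball_vol TYPE('a) * \<delta> k x ^ DIM('a))) <
           (\<integral>\<^sup>+y\<in>ball x (\<delta> k x). ennreal (J y) \<partial>lborel)"
        unfolding eventually_sequentially
      proof (intro exI[of _ K] allI impI)
        fix k assume "K \<le> k"
        have "ennreal (s * (v * \<delta> k x ^ DIM('a))) \<le> ennreal (q * (v * \<delta> k x ^ DIM('a)))"
          using q v \<delta>(1)[OF xA, of k] by (intro ennreal_leI mult_right_mono) auto
        with K[OF \<open>K \<le> k\<close>] show "ennreal (s * (ball_vol TYPE('a) * \<delta> k x ^ DIM('a))) <
           (\<integral>\<^sup>+y\<in>ball x (\<delta> k x). ennreal (J y) \<partial>lborel)"
          unfolding av_def v_def by (rule le_less_trans[rotated])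
      qed
    qed
  qed
qed

text \<open>A stopping time: the first of the radii d / 2^(k+1) whose mean exceeds \<tau>. By
  \<open>large\<close>, radii of at least d / 64 do not qualify, so at least four earlier radii
  exist, and the one 16 times as large has mean at most \<tau>. The factor 16 leaves room for
  enlarging a ball of radius 2 \<rho> five times.\<close>

lemma stopping_ball:
  fixes J :: "'a::euclidean_space \<Rightarrow> real"
  assumes d: "d > 0" and \<tau>: "\<tau> \<ge> 0"
    and ev: "\<forall>\<^sub>F k in sequentially. ennreal (\<tau> * (V * (d / 2 ^ Suc k) ^ DIM('a)))
          < (\<integral>\<^sup>+y\<in>ball x (d / 2 ^ Suc k). ennreal (J y) \<partial>lborel)"
    and large: "(\<integral>\<^sup>+y. ennreal (J y) \<partial>lborel) \<le> ennreal (\<tau> * (V * (d / 64) ^ DIM('a)))"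
    and V: "V > 0"
  obtains \<rho> where "0 < \<rho>" "\<rho> < d / 64"
    "ennreal (\<tau> * (V * \<rho> ^ DIM('a))) < (\<integral>\<^sup>+y\<in>ball x \<rho>. ennreal (J y) \<partial>lborel)"
    "(\<integral>\<^sup>+y\<in>ball x (16 * \<rho>). ennreal (J y) \<partial>lborel) \<le> ennreal (\<tau> * (V * (16 * \<rho>) ^ DIM('a)))"
proof -
  define \<rho> where "\<rho> = (\<lambda>k::nat. d / 2 ^ Suc k)"
  define B where "B = (\<lambda>k. ennreal (\<tau> * (V * \<rho> k ^ DIM('a))) < (\<integral>\<^sup>+y\<in>ball x (\<rho> k). ennreal (J y) \<partial>lborel))"
  have "\<exists>k. B k" using ev unfolding B_def \<rho>_def eventually_sequentially by blast
  define k where "k = (LEAST k. B k)"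
  have k: "B k" unfolding k_def using \<open>\<exists>k. B k\<close> by (rule LeastI_ex)
  have small: "\<rho> i < d / 64" if "B i" for i
  proof (rule ccontr)
    assume "\<not> \<rho> i < d / 64"
    then have "ennreal (\<tau> * (V * (d / 64) ^ DIM('a))) \<le> ennreal (\<tau> * (V * \<rho> i ^ DIM('a)))"
      using d \<tau> V by (intro ennreal_leI mult_left_mono power_mono) auto
    moreover have "(\<integral>\<^sup>+y\<in>ball x (\<rho> i). ennreal (J y) \<partial>lborel) \<le> (\<integral>\<^sup>+y. ennreal (J y) \<partial>lborel)"
      by (intro nn_integral_mono) (auto simp: indicator_def)
    ultimately show False using that large unfolding B_def by (meson leD le_less_trans less_le_trans)
  qed
  have "k \<ge> 5"
  proof (rule ccontr)
    assume "\<not> 5 \<le> k"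
    then have "(2::real) ^ Suc k \<le> 2 ^ 5" by (intro power_increasing) auto
    moreover have "d / 2 ^ Suc k < d / 64" using small[OF k] by (simp add: \<rho>_def)
    ultimately show False using d by (simp add: field_simps)
  qed
  define i where "i = k - 4"
  have i: "k = i + 4" using \<open>k \<ge> 5\<close> by (simp add: i_def)
  have "i < (LEAST k. B k)" using i by (simp add: k_def)
  then have "\<not> B i" by (rule not_less_Least)
  moreover have "16 * \<rho> k = \<rho> i" by (simp add: \<rho>_def i power_add)
  moreover have "\<rho> k > 0" using d by (simp add: \<rho>_def)
  ultimately show thesis using k small[OF k] by (intro that[of "\<rho> k"]) (auto simp: B_def not_less)
qed

text \<open>The weight turns the level t of \<open>G\<close> into the level t / d(x)^n of
  \<open>J\<close>, at which each point can be treated with a radius far below its distance d(x) to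
  the boundary, so that \<open>d\<close> varies at most by a factor 2. The reverse Hoelder
  inequality is used on the stopping ball, the upper bound for the mean of \<open>J\<close> on the
  ball 16 times as large, and Vitali's lemma makes the doubled balls disjoint while their fivefold
  enlargements cover.\<close>

lemma level_set_estimate:
  fixes J h :: "'a::euclidean_space \<Rightarrow> real" and \<theta> C R t :: real and z :: 'a
  defines "n \<equiv> DIM('a)"
  defines "d \<equiv> \<lambda>x. max 0 (R - dist z x)"
  defines "G \<equiv> \<lambda>x. d x ^ n * J x" and "H \<equiv> \<lambda>x. d x ^ n * h x"
  defines "c \<equiv> (1 / (2 * C * 4 ^ n)) powr (1 / \<theta>)"
  defines "t0 \<equiv> 64 ^ n * enn2real (\<integral>\<^sup>+x. ennreal (J x) \<partial>lborel) / ball_vol TYPE('a) + 1"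
  assumes [measurable]: "J \<in> borel_measurable borel" "h \<in> borel_measurable borel"
    and J0: "\<And>x. 0 \<le> J x" and h0: "\<And>x. 0 \<le> h x"
    and fin: "(\<integral>\<^sup>+x. ennreal (J x) \<partial>lborel) < \<infinity>"
    and \<theta>: "0 < \<theta>" "\<theta> < 1" and C: "C > 0"
    and RH: "\<And>x \<rho> \<tau>. 0 < \<rho> \<Longrightarrow> cball x (2 * \<rho>) \<subseteq> ball z R \<Longrightarrow> 0 < \<tau> \<Longrightarrow>
      ennreal (\<tau> * (ball_vol TYPE('a) * \<rho> ^ n)) < (\<integral>\<^sup>+y\<in>ball x \<rho>. ennreal (J y) \<partial>lborel) \<Longrightarrow>
      ennreal (\<tau> powr \<theta> * (ball_vol TYPE('a) * \<rho> ^ n)) \<le> ennreal C * (\<integral>\<^sup>+y\<in>ball x (2 * \<rho>). ennreal (h y powr \<theta>) \<partial>lborel)"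
    and t: "t0 \<le> t"
  shows "(\<integral>\<^sup>+x. ennreal (G x) * indicator {x. t < G x} x \<partial>lborel)
    \<le> ennreal (2 * C * 64 ^ n * t powr (1 - \<theta>)) * (\<integral>\<^sup>+x. ennreal (H x powr \<theta>) * indicator {x. c * t < H x} x \<partial>lborel)"
proof -
  define V where "V = ball_vol TYPE('a)"
  have V: "V > 0" by (simp add: V_def)
  have n: "n > 0" by (simp add: n_def)
  have [measurable]: "d \<in> borel_measurable borel" unfolding d_def by measurable
  have [measurable]: "ball y r \<in> sets borel" for y :: 'a and r by simp
  have [measurable]: "G \<in> borel_measurable borel" "H \<in> borel_measurable borel"
    unfolding G_def H_def by measurable
  have d0: "0 \<le> d x" for x by (simp add: d_def)
  \<comment> \<open>The summand 1 in \<open>t0\<close> secures this even when \<open>J\<close>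
    vanishes.\<close>
  have t_pos: "t > 0"
  proof -
    have "0 \<le> 64 ^ n * enn2real (\<integral>\<^sup>+x. ennreal (J x) \<partial>lborel) / V" using V by simp
    then show ?thesis using t unfolding t0_def V_def by linarith
  qed
  \<comment> \<open>The identity for which \<open>c\<close> is chosen: the part of \<open>H\<close>
    below the level c t will contribute half of the left side.\<close>
  have c\<theta>: "C * 4 ^ n * (c * t) powr \<theta> = t powr \<theta> / 2"
    using t_pos \<theta> C by (simp add: c_def powr_mult powr_powr)
  have c0: "c \<ge> 0" by (simp add: c_def)
  define A where "A = ball z R"
  have dA: "x \<in> A \<longleftrightarrow> 0 < d x" for x by (auto simp: A_def d_def max_def)
  have [measurable]: "A \<in> sets borel" by (simp add: A_def)
  define I where "I = (\<integral>\<^sup>+x. ennreal (J x) \<partial>lborel)"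
  obtain ir where ir: "I = ennreal ir" "ir \<ge> 0" using fin by (cases I) (auto simp: I_def)
  define good where "good = (\<lambda>x. \<forall>s. 0 \<le> s \<and> s < J x \<longrightarrow> (\<forall>\<^sub>F k in sequentially.
     ennreal (s * (V * (d x / 2 ^ Suc k) ^ n)) < (\<integral>\<^sup>+y\<in>ball x (d x / 2 ^ Suc k). ennreal (J y) \<partial>lborel)))"
  have good: "AE x in lborel. x \<in> A \<longrightarrow> good x"
    unfolding good_def V_def n_def
  proof (rule lower_density_AE[where A = A and J = J and \<delta> = "\<lambda>k x. d x / 2 ^ Suc k"])
    fix x assume "x \<in> A"
    show "(\<lambda>k. d x / 2 ^ Suc k) \<longlonglongrightarrow> 0"
      by (rule LIMSEQ_divide_realpow_zero[THEN LIMSEQ_Suc]) simp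
  qed (use J0 fin dA in \<open>auto intro!: divide_pos_pos simp del: power_Suc\<close>)
  have stop: "\<exists>\<rho>. 0 < \<rho> \<and> \<rho> < d x / 64 \<and> ball x (10 * \<rho>) \<subseteq> A \<and>
      (\<integral>\<^sup>+y\<in>ball x (10 * \<rho>). ennreal (G y) \<partial>lborel)
        \<le> ennreal (2 * C * 64 ^ n * t powr (1 - \<theta>)) *
           (\<integral>\<^sup>+y\<in>ball x (2 * \<rho>). ennreal (H y powr \<theta>) * indicator {y. c * t < H y} y \<partial>lborel)"
    if x: "x \<in> A" "good x" "t < G x" for x
  proof -
    have dx: "d x > 0" using x dA by simp
    define \<tau> where "\<tau> = t / d x ^ n"
    have \<tau>: "\<tau> > 0" "\<tau> < J x" using t_pos dx x by (auto simp: \<tau>_def G_def field_simps)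
    obtain \<rho> where \<rho>: "0 < \<rho>" "\<rho> < d x / 64"
      "ennreal (\<tau> * (V * \<rho> ^ n)) < (\<integral>\<^sup>+y\<in>ball x \<rho>. ennreal (J y) \<partial>lborel)"
      "(\<integral>\<^sup>+y\<in>ball x (16 * \<rho>). ennreal (J y) \<partial>lborel) \<le> ennreal (\<tau> * (V * (16 * \<rho>) ^ n))"
    proof (rule stopping_ball[where d = "d x" and \<tau> = \<tau> and V = V and x = x and J = J, folded n_def])
      \<comment> \<open>The origin of \<open>t0\<close>: the whole mass of \<open>J\<close> is then
        at most that of the constant \<tau> on a ball of radius d(x) / 64.\<close>
      have "64 ^ n * ir / V \<le> t" using t ir by (simp add: t0_def I_def[symmetric] V_def)
      then have "ir \<le> \<tau> * (V * (d x / 64) ^ n)"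
        using V dx by (simp add: \<tau>_def field_simps)
      then show "(\<integral>\<^sup>+y. ennreal (J y) \<partial>lborel) \<le> ennreal (\<tau> * (V * (d x / 64) ^ n))"
        using ir by (simp add: I_def[symmetric] ennreal_leI)
      show "\<forall>\<^sub>F k in sequentially. ennreal (\<tau> * (V * (d x / 2 ^ Suc k) ^ n))
          < (\<integral>\<^sup>+y\<in>ball x (d x / 2 ^ Suc k). ennreal (J y) \<partial>lborel)"
        using x \<tau> unfolding good_def by auto
    qed (use dx \<tau> V in auto)
    \<comment> \<open>\<open>d\<close> is 1-Lipschitz, and 16 \<rho> < d(x) / 4.\<close>
    have dcmp: "d x \<le> 2 * d y \<and> d y \<le> 2 * d x \<and> y \<in> A" if "dist x y < 16 * \<rho>" for y
    proof -
      have 1: "dist z y \<le> dist z x + dist x y" by (rule dist_triangle)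
      have 2: "dist z x \<le> dist z y + dist x y" using dist_triangle[of z x y] by (simp add: dist_commute)
      show ?thesis using 1 2 that \<rho> dx by (auto simp: d_def A_def max_def split: if_splits)
    qed
    have sub: "cball x (2 * \<rho>) \<subseteq> ball z R" using dcmp \<rho>(1) by (auto simp: A_def)
    define E where "E = (\<integral>\<^sup>+y\<in>ball x (2 * \<rho>). ennreal (H y powr \<theta>) * indicator {y. c * t < H y} y \<partial>lborel)"
    \<comment> \<open>The comparison d(x) \<le> 2 d(y) raised to the power n \<theta>, with 2^(n
      \<theta>) enlarged to 2^n.\<close>
    have hH: "ennreal ((d x ^ n) powr \<theta>) * ennreal (h y powr \<theta>) \<le> ennreal (2 ^ n) * ennreal (H y powr \<theta>)" if "y \<in> ball x (2 * \<rho>)" for y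
    proof -
      have dd: "d x \<le> 2 * d y" using dcmp[of y] that \<rho> by auto
      have "d x ^ n * h y \<le> (2 * d y) ^ n * h y" using dd d0[of x] h0 by (intro mult_right_mono power_mono) auto
      also have "\<dots> = 2 ^ n * H y" by (simp add: H_def power_mult_distrib)
      finally have le: "d x ^ n * h y \<le> 2 ^ n * H y" .
      have "(d x ^ n) powr \<theta> * h y powr \<theta> = (d x ^ n * h y) powr \<theta>"
        using d0 h0 by (simp add: powr_mult)
      also have "\<dots> \<le> (2 ^ n * H y) powr \<theta>" using le d0 h0 \<theta> by (intro powr_mono2) auto
      also have "\<dots> = (2 ^ n) powr \<theta> * H y powr \<theta>" using d0 h0 by (simp add: powr_mult H_def)
      also have "\<dots> \<le> (2 ^ n) powr 1 * H y powr \<theta>"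
        using \<theta> by (intro mult_right_mono powr_mono) auto
      finally show ?thesis by (simp add: ennreal_mult'[symmetric] ennreal_leI)
    qed
    have "ennreal (t powr \<theta> * (V * \<rho> ^ n)) = ennreal ((d x ^ n) powr \<theta>) * ennreal (\<tau> powr \<theta> * (V * \<rho> ^ n))"
      using dx t_pos by (simp add: \<tau>_def powr_divide ennreal_mult'[symmetric])
    also have "\<dots> \<le> ennreal ((d x ^ n) powr \<theta>) * (ennreal C * (\<integral>\<^sup>+y\<in>ball x (2 * \<rho>). ennreal (h y powr \<theta>) \<partial>lborel))"
      using RH[OF \<rho>(1) sub \<tau>(1) \<rho>(3)[unfolded V_def]] unfolding V_def by (rule mult_left_mono) simp
    also have "\<dots> = ennreal C * (\<integral>\<^sup>+y. ennreal ((d x ^ n) powr \<theta>) * (ennreal (h y powr \<theta>) * indicator (ball x (2 * \<rho>)) y) \<partial>lborel)"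
      by (subst nn_integral_cmult) (simp, rule mult.left_commute)
    also have "\<dots> = ennreal C * (\<integral>\<^sup>+y. ennreal ((d x ^ n) powr \<theta>) * ennreal (h y powr \<theta>) * indicator (ball x (2 * \<rho>)) y \<partial>lborel)"
      by (simp only: mult.assoc)
    \<comment> \<open>\<open>H\<close> is split at the level c t. In the lower part the 2^n from
      comparing weights and the (2 \<rho>)^n of the doubled ball combine to the 4^n in
      \<open>c\<close>.\<close>
    also have "\<dots> \<le> ennreal C * (\<integral>\<^sup>+y. ennreal (2 ^ n) * (ennreal (H y powr \<theta>) * indicator {y. c * t < H y} y * indicator (ball x (2 * \<rho>)) y)
          + ennreal (2 ^ n * (c * t) powr \<theta>) * indicator (ball x (2 * \<rho>)) y \<partial>lborel)"
    proof (intro mult_left_mono nn_integral_mono)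
      fix y
      show "ennreal ((d x ^ n) powr \<theta>) * ennreal (h y powr \<theta>) * indicator (ball x (2 * \<rho>)) y
         \<le> ennreal (2 ^ n) * (ennreal (H y powr \<theta>) * indicator {y. c * t < H y} y * indicator (ball x (2 * \<rho>)) y)
          + ennreal (2 ^ n * (c * t) powr \<theta>) * indicator (ball x (2 * \<rho>)) y"
      proof (cases "y \<in> ball x (2 * \<rho>)")
        case True
        show ?thesis
        proof (cases "c * t < H y")
          case False
          then have "H y powr \<theta> \<le> (c * t) powr \<theta>" using d0 h0 \<theta> by (intro powr_mono2) (auto simp: H_def)
          then have "ennreal (2 ^ n) * ennreal (H y powr \<theta>) \<le> ennreal (2 ^ n * (c * t) powr \<theta>)"
            by (simp add: ennreal_mult'[symmetric] ennreal_leI)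
          then show ?thesis using True False hH[OF True] by (simp add: order_trans)
        qed (use True hH[OF True] in \<open>simp add: add_increasing2\<close>)
      qed simp
    qed simp
    also have "\<dots> = ennreal C * (ennreal (2 ^ n) * E + ennreal (2 ^ n * (c * t) powr \<theta>) * emeasure lborel (ball x (2 * \<rho>)))"
      unfolding E_def by (simp add: nn_integral_add nn_integral_cmult)
    also have "emeasure lborel (ball x (2 * \<rho>)) = ennreal (V * (2 * \<rho>) ^ n)"
      using \<rho>(1) by (subst emeasure_ball) (auto simp: V_def n_def)
    also have "ennreal C * (ennreal (2 ^ n) * E + ennreal (2 ^ n * (c * t) powr \<theta>) * ennreal (V * (2 * \<rho>) ^ n))
        = ennreal (C * 2 ^ n) * E + ennreal (t powr \<theta> / 2 * (V * \<rho> ^ n))"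
    proof -
      have "ennreal C * (ennreal (2 ^ n * (c * t) powr \<theta>) * ennreal (V * (2 * \<rho>) ^ n))
          = ennreal (C * (2 ^ n * (c * t) powr \<theta> * (V * (2 * \<rho>) ^ n)))"
        using C V \<rho>(1) by (simp add: ennreal_mult'[symmetric])
      also have "C * (2 ^ n * (c * t) powr \<theta> * (V * (2 * \<rho>) ^ n)) = C * 4 ^ n * (c * t) powr \<theta> * (V * \<rho> ^ n)"
        using power_mult_distrib[of "2::real" 2 n] by (simp add: power_mult_distrib)
      also have "\<dots> = t powr \<theta> / 2 * (V * \<rho> ^ n)" by (simp add: c\<theta>)
      finally show ?thesis using C by (simp add: distrib_left ennreal_mult' mult.assoc)
    qed
    finally have main: "ennreal (t powr \<theta> * (V * \<rho> ^ n)) \<le> ennreal (C * 2 ^ n) * E + ennreal (t powr \<theta> / 2 * (V * \<rho> ^ n))" .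
    have half: "ennreal (t powr \<theta> * (V * \<rho> ^ n)) \<le> ennreal (2 * C * 2 ^ n) * E"
    proof (cases "E = top")
      case True
      then show ?thesis using C by (simp add: ennreal_mult_top)
    next
      case False
      then obtain e where e: "E = ennreal e" "e \<ge> 0" by (cases E) auto
      have w: "0 \<le> t powr \<theta> / 2 * (V * \<rho> ^ n)" using V \<rho>(1) by simp
      have "ennreal (t powr \<theta> * (V * \<rho> ^ n)) \<le> ennreal (C * 2 ^ n * e + t powr \<theta> / 2 * (V * \<rho> ^ n))"
        using main w e C by (subst ennreal_plus) (auto simp: ennreal_mult')
      then have "t powr \<theta> * (V * \<rho> ^ n) \<le> C * 2 ^ n * e + t powr \<theta> / 2 * (V * \<rho> ^ n)"
        using w e C by (subst (asm) ennreal_le_iff) auto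
      then have "t powr \<theta> * (V * \<rho> ^ n) \<le> 2 * C * 2 ^ n * e" by simp
      then show ?thesis using e C by (simp add: ennreal_mult'[symmetric] ennreal_leI)
    qed
    have "(\<integral>\<^sup>+y\<in>ball x (10 * \<rho>). ennreal (G y) \<partial>lborel)
       \<le> (\<integral>\<^sup>+y. ennreal ((2 * d x) ^ n) * (ennreal (J y) * indicator (ball x (16 * \<rho>)) y) \<partial>lborel)"
    proof (intro nn_integral_mono)
      fix y
      show "ennreal (G y) * indicator (ball x (10 * \<rho>)) y
          \<le> ennreal ((2 * d x) ^ n) * (ennreal (J y) * indicator (ball x (16 * \<rho>)) y)"
      proof (cases "y \<in> ball x (10 * \<rho>)")
        case True
        then have *: "dist x y < 16 * \<rho>" using \<rho>(1) by auto
        then have "G y \<le> (2 * d x) ^ n * J y"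
          unfolding G_def using dcmp[OF *] d0 J0 by (intro mult_right_mono power_mono) auto
        then show ?thesis using True * J0[of y]
          by (simp add: ennreal_mult''[symmetric] ennreal_leI)
      qed simp
    qed
    also have "\<dots> = ennreal ((2 * d x) ^ n) * (\<integral>\<^sup>+y\<in>ball x (16 * \<rho>). ennreal (J y) \<partial>lborel)"
      by (intro nn_integral_cmult) measurable
    also have "\<dots> \<le> ennreal ((2 * d x) ^ n) * ennreal (\<tau> * (V * (16 * \<rho>) ^ n))"
      using \<rho>(4) by (intro mult_left_mono) auto
    \<comment> \<open>32 is the factor 2 of the weight times the 16 of the enlarged radius; the 2^n
      in \<open>half\<close> then makes 64^n.\<close>
    also have "\<dots> = ennreal (32 ^ n * t powr (1 - \<theta>)) * ennreal (t powr \<theta> * (V * \<rho> ^ n))"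
    proof -
      have "(2 * d x) ^ n * (\<tau> * (V * (16 * \<rho>) ^ n)) = (2 ^ n * 16 ^ n) * (t * (V * \<rho> ^ n))"
        using dx by (simp add: \<tau>_def power_mult_distrib)
      also have "\<dots> = 32 ^ n * (t * (V * \<rho> ^ n))" using power_mult_distrib[of "2::real" 16 n] by simp
      also have "t = t powr (1 - \<theta>) * t powr \<theta>" using t_pos by (simp flip: powr_add)
      finally show ?thesis using V \<rho>(1) d0 \<tau>(1)
        by (simp add: ennreal_mult'[symmetric] ennreal_mult''[symmetric] mult.assoc)
    qed
    also have "\<dots> \<le> ennreal (32 ^ n * t powr (1 - \<theta>)) * (ennreal (2 * C * 2 ^ n) * E)"
      using half by (intro mult_left_mono) auto
    also have "\<dots> = ennreal (2 * C * 64 ^ n * t powr (1 - \<theta>)) * E"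
    proof -
      have "(64::real) ^ n = 32 ^ n * 2 ^ n" using power_mult_distrib[of "32::real" 2 n] by simp
      then have eq: "32 ^ n * t powr (1 - \<theta>) * (2 * C * 2 ^ n) = 2 * C * 64 ^ n * t powr (1 - \<theta>)" by simp
      have "ennreal (32 ^ n * t powr (1 - \<theta>)) * ennreal (2 * C * 2 ^ n) = ennreal (2 * C * 64 ^ n * t powr (1 - \<theta>))"
        by (subst ennreal_mult'[symmetric]) (simp, simp only: eq)
      then show ?thesis by (simp only: mult.assoc[symmetric])
    qed
    finally have "(\<integral>\<^sup>+y\<in>ball x (10 * \<rho>). ennreal (G y) \<partial>lborel) \<le> ennreal (2 * C * 64 ^ n * t powr (1 - \<theta>)) * E" .
    moreover have "ball x (10 * \<rho>) \<subseteq> A"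
    proof
      fix y assume "y \<in> ball x (10 * \<rho>)"
      then have "dist x y < 16 * \<rho>" using \<rho>(1) by simp
      then show "y \<in> A" using dcmp by blast
    qed
    ultimately show ?thesis using \<rho>(1,2) unfolding E_def by (intro exI[of _ \<rho>] conjI)
  qed
  define S where "S = {x \<in> A. good x \<and> t < G x}"
  have "\<forall>x\<in>S. \<exists>\<rho>. 0 < \<rho> \<and> \<rho> < d x / 64 \<and> ball x (10 * \<rho>) \<subseteq> A \<and>
      (\<integral>\<^sup>+y\<in>ball x (10 * \<rho>). ennreal (G y) \<partial>lborel)
        \<le> ennreal (2 * C * 64 ^ n * t powr (1 - \<theta>)) *
           (\<integral>\<^sup>+y\<in>ball x (2 * \<rho>). ennreal (H y powr \<theta>) * indicator {y. c * t < H y} y \<partial>lborel)"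
    using stop unfolding S_def by blast
  then obtain \<rho> where \<rho>: "\<And>x. x \<in> S \<Longrightarrow> 0 < \<rho> x \<and> \<rho> x < d x / 64 \<and> ball x (10 * \<rho> x) \<subseteq> A \<and>
      (\<integral>\<^sup>+y\<in>ball x (10 * \<rho> x). ennreal (G y) \<partial>lborel)
        \<le> ennreal (2 * C * 64 ^ n * t powr (1 - \<theta>)) *
           (\<integral>\<^sup>+y\<in>ball x (2 * \<rho> x). ennreal (H y powr \<theta>) * indicator {y. c * t < H y} y \<partial>lborel)"
    unfolding bchoice_iff by blast
  \<comment> \<open>Vitali's covering lemma asks for bounded radii.\<close>
  have dR: "d x \<le> R" if "x \<in> S" for x using that by (auto simp: d_def S_def A_def max_def)
  have cov: "S \<subseteq> (\<Union>x\<in>S. ball x (2 * \<rho> x))"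
  proof
    fix x assume x: "x \<in> S"
    then have "x \<in> ball x (2 * \<rho> x)" using \<rho>[OF x] by simp
    with x show "x \<in> (\<Union>x\<in>S. ball x (2 * \<rho> x))" by (rule UN_I)
  qed
  have bd: "0 < 2 * \<rho> x \<and> 2 * \<rho> x \<le> R" if "x \<in> S" for x
    using \<rho>[OF that] dR[OF that] by linarith
  obtain K where K: "countable K" "K \<subseteq> S"
    "pairwise (\<lambda>x y. disjnt (ball x (2 * \<rho> x)) (ball y (2 * \<rho> y))) K"
    "S \<subseteq> (\<Union>x\<in>K. ball x (5 * (2 * \<rho> x)))"
    using Vitali_covering_lemma_balls[where K = S and a = "\<lambda>x. x" and r = "\<lambda>x. 2 * \<rho> x", OF cov bd] by blast
  define F where "F = (\<lambda>y. ennreal (H y powr \<theta>) * indicator {y. c * t < H y} y)"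
  have [measurable]: "F \<in> borel_measurable borel" unfolding F_def by measurable
  have "(\<integral>\<^sup>+x. ennreal (G x) * indicator {x. t < G x} x \<partial>lborel)
      \<le> (\<integral>\<^sup>+y. (\<integral>\<^sup>+x. ennreal (G y) * indicator (ball x (10 * \<rho> x)) y \<partial>count_space K) \<partial>lborel)"
    using good
  proof (intro nn_integral_mono_AE, eventually_elim)
    case (elim y)
    show ?case
    proof (cases "t < G y")
      case True
      then have "y \<in> A" using t_pos n by (cases "d y = 0") (auto simp: dA G_def power_0_left d_def)
      then have "y \<in> S" using elim True by (simp add: S_def)
      then obtain x where x: "x \<in> K" "y \<in> ball x (10 * \<rho> x)" using K(4) by auto
      have "ennreal (G y) = (\<integral>\<^sup>+x'. ennreal (G y) * indicator {x} x' \<partial>count_space K)"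
        using x by (subst nn_integral_cmult_indicator) auto
      also have "\<dots> \<le> (\<integral>\<^sup>+x. ennreal (G y) * indicator (ball x (10 * \<rho> x)) y \<partial>count_space K)"
        using x by (intro nn_integral_mono) (auto simp: indicator_def)
      finally show ?thesis using True by simp
    qed simp
  qed
  also have "\<dots> = (\<integral>\<^sup>+x. (\<integral>\<^sup>+y\<in>ball x (10 * \<rho> x). ennreal (G y) \<partial>lborel) \<partial>count_space K)"
    using K(1) by (intro nn_integral_count_space_nn_integral) measurable
  also have "\<dots> \<le> (\<integral>\<^sup>+x. ennreal (2 * C * 64 ^ n * t powr (1 - \<theta>)) * (\<integral>\<^sup>+y\<in>ball x (2 * \<rho> x). F y \<partial>lborel) \<partial>count_space K)"
  proof (rule nn_integral_mono)
    fix x assume "x \<in> space (count_space K)"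
    then have "x \<in> S" using K(2) by auto
    from \<rho>[OF this] show "(\<integral>\<^sup>+y\<in>ball x (10 * \<rho> x). ennreal (G y) \<partial>lborel)
        \<le> ennreal (2 * C * 64 ^ n * t powr (1 - \<theta>)) * (\<integral>\<^sup>+y\<in>ball x (2 * \<rho> x). F y \<partial>lborel)"
      unfolding F_def by (elim conjE)
  qed
  also have "\<dots> = ennreal (2 * C * 64 ^ n * t powr (1 - \<theta>)) * (\<integral>\<^sup>+x. (\<integral>\<^sup>+y\<in>ball x (2 * \<rho> x). F y \<partial>lborel) \<partial>count_space K)"
    by (intro nn_integral_cmult) simp
  also have "\<dots> \<le> ennreal (2 * C * 64 ^ n * t powr (1 - \<theta>)) * (\<integral>\<^sup>+y. F y \<partial>lborel)"
  proof (rule mult_left_mono)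
    have "(\<integral>\<^sup>+x. (\<integral>\<^sup>+y\<in>ball x (2 * \<rho> x). F y \<partial>lborel) \<partial>count_space K) = (\<integral>\<^sup>+y\<in>(\<Union>x\<in>K. ball x (2 * \<rho> x)). F y \<partial>lborel)"
      using K by (intro nn_integral_disjoint_balls) auto
    also have "\<dots> \<le> (\<integral>\<^sup>+y. F y \<partial>lborel)" by (rule nn_integral_mono) (simp add: indicator_def)
    finally show "(\<integral>\<^sup>+x. (\<integral>\<^sup>+y\<in>ball x (2 * \<rho> x). F y \<partial>lborel) \<partial>count_space K) \<le> (\<integral>\<^sup>+y. F y \<partial>lborel)" .
  qed simp
  finally show ?thesis unfolding F_def .
qed

section \<open>Logarithmic integrability from level set estimates\<close>

text \<open>What matters is that the factor in front does not involve \<open>a\<close>,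
  \<open>T\<close> or \<open>j\<close>: all dependence on \<open>a\<close> goes into the threshold
  \<open>T0\<close>. For g \<le> j the logarithms of P(g) / c and of g are comparable, and P(g)
  itself brings one more logarithm. For g > j the truncated kernel contains P(g) only in the power
  \<theta>, hence only the power \<theta> < 1 of a logarithm, which leaves room.\<close>

lemma log_kernel_pointwise:
  fixes \<theta> b c lam a :: real
  assumes \<theta>: "1/2 \<le> \<theta>" "\<theta> < 1" and pos: "b > 0" "c > 0" "lam > 0" "a > 0"
  defines "P \<equiv> \<lambda>g. 2 * b / lam * g * ln (exp 1 + g)"
  shows "\<exists>T0\<ge>exp 1. \<forall>T\<ge>T0. \<forall>j\<ge>T. \<forall>g\<ge>0. P g > c * T \<longrightarrow> exp 1 \<le> g \<and>
     P g powr \<theta> * (min j (P g / c) powr (1 - \<theta>) * ln (min j (P g / c)) powr (a - 1))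
       \<le> 8 * b * c powr (\<theta> - 1) / lam * (g * ln (min g j) powr a)"
proof -
  \<comment> \<open>Chosen so that (1 + \<delta>)^(a-1) = 2 for a > 1. For a \<le> 1 the power of
    the logarithm does not increase, and the value 1 serves.\<close>
  define \<delta> where "\<delta> = (if a \<le> 1 then 1 else 2 powr (1 / (a - 1)) - 1)"
  have \<delta>: "\<delta> > 0" by (auto simp: \<delta>_def)
  have \<delta>a: "(1 + \<delta>) powr (a - 1) \<le> 2" if "a > 1" using that by (simp add: \<delta>_def powr_powr)
  have "\<forall>\<^sub>F g in at_top. c * g \<le> P g"
    unfolding P_def using pos by real_asymp
  moreover have "\<forall>\<^sub>F g in at_top. P g / c \<le> g powr (1 + \<delta>)"
    unfolding P_def using pos \<delta> by real_asymp
  moreover have "\<forall>\<^sub>F g in at_top. ln (exp 1 + g) \<le> 2 * ln (g::real)"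
    by real_asymp
  ultimately have "\<forall>\<^sub>F g in at_top. c * g \<le> P g \<and> P g / c \<le> g powr (1 + \<delta>) \<and> ln (exp 1 + g) \<le> 2 * ln g"
    by eventually_elim auto
  then obtain g1 where g1: "\<And>g. g \<ge> g1 \<Longrightarrow> c * g \<le> P g \<and> P g / c \<le> g powr (1 + \<delta>) \<and> ln (exp 1 + g) \<le> 2 * ln g"
    unfolding eventually_at_top_linorder by blast
  \<comment> \<open>As \<kappa> \<theta> = 1 - \<theta>, a factor (g / j)^\<kappa> in the logarithm
    becomes (g / j)^(1-\<theta>) in its power \<theta>, exactly what turns g^\<theta> j^(1-\<theta>)
    into g.\<close>
  define \<kappa> where "\<kappa> = (1 - \<theta>) / \<theta>"
  have \<kappa>: "0 < \<kappa>" "\<kappa> \<le> 1" using \<theta> by (auto simp: \<kappa>_def field_simps)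
  define A where "A = (2 * b / lam) powr \<theta> * (2 / \<kappa>) powr \<theta>"
  \<comment> \<open>The target constant. Since \<theta> < 1, the term D ln j eventually beats any
    multiple of (ln j)^\<theta>, whatever the size of \<open>A\<close>.\<close>
  define D where "D = 8 * b * c powr (\<theta> - 1) / lam"
  have D: "D > 0" using pos by (simp add: D_def)
  have "A \<ge> 0" by (simp add: A_def)
  have "\<forall>\<^sub>F j in at_top. A * ln j powr \<theta> \<le> D * ln j"
  proof (cases "A = 0")
    case True
    have "\<forall>\<^sub>F j in at_top. 0 \<le> D * ln (j::real)" using D by real_asymp
    then show ?thesis using True by simp
  next
    case False
    then have "A > 0" using \<open>A \<ge> 0\<close> by simp
    then show ?thesis using D \<theta> by real_asymp
  qed
  then obtain j0 where j0: "\<And>j. j \<ge> j0 \<Longrightarrow> A * ln j powr \<theta> \<le> D * ln j"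
    unfolding eventually_at_top_linorder by blast
  \<comment> \<open>\<open>P\<close> is increasing, so P(g) > c T \<ge> P(g0) forces g beyond
    \<open>g0\<close>, where the asymptotic inequalities hold.\<close>
  define g0 where "g0 = max (exp 1) g1"
  define T0 where "T0 = max (exp 1) (max j0 (P g0 / c))"
  have Pmono: "P x \<le> P y" if "0 \<le> x" "x \<le> y" for x y
  proof -
    have "x * ln (exp 1 + x) \<le> y * ln (exp 1 + y)"
    proof -
      have "(1::real) < exp 1" by simp
      then have "1 \<le> exp 1 + x" "exp 1 + x \<le> exp 1 + y" using that by linarith+
      then show ?thesis using that by (intro mult_mono ln_mono ln_ge_zero) auto
    qed
    then show ?thesis unfolding P_def using pos
      by (simp add: mult.assoc mult_left_mono del: times_divide_eq_left)
  qed
  show ?thesis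
  proof (intro exI[of _ T0] conjI allI impI)
    show "exp 1 \<le> T0" by (simp add: T0_def)
    fix T j g assume T: "T0 \<le> T" "T \<le> j" and g: "0 \<le> g" and big: "c * T < P g"
    have "P g0 \<le> c * T" using T pos by (simp add: T0_def field_simps)
    then have "P g0 < P g" using big by simp
    then have gg: "g0 < g" using Pmono[of g g0] g by fastforce
    then show eg: "exp 1 \<le> g" by (simp add: g0_def)
    have e1: "(1::real) < exp 1" by simp
    have g_gt1: "1 < g" using eg e1 by linarith
    have j_e: "exp 1 \<le> j" and jj0: "j0 \<le> j" using T by (auto simp: T0_def)
    have lng: "1 \<le> ln g" using eg g_gt1 by (metis exp_gt_zero ln_exp ln_le_cancel_iff order_less_le_trans)
    have lnj: "1 \<le> ln j" using j_e by (metis exp_gt_zero ln_exp ln_le_cancel_iff order_less_le_trans)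
    note G = g1[of g]
    have Gs: "c * g \<le> P g" "P g / c \<le> g powr (1 + \<delta>)" "ln (exp 1 + g) \<le> 2 * ln g"
      using G gg by (auto simp: g0_def)
    have gP: "g \<le> P g / c" using Gs(1) pos by (simp add: field_simps)
    have Ppos: "P g > 0" using gP g_gt1 pos by (smt (verit) divide_nonpos_pos)
    have Ple: "P g \<le> 4 * b / lam * (g * ln g)"
    proof -
      have "P g \<le> 2 * b / lam * g * (2 * ln g)"
        unfolding P_def using Gs(3) pos g by (intro mult_left_mono) auto
      then show ?thesis by (simp add: field_simps)
    qed
    show "P g powr \<theta> * (min j (P g / c) powr (1 - \<theta>) * ln (min j (P g / c)) powr (a - 1))
       \<le> 8 * b * c powr (\<theta> - 1) / lam * (g * ln (min g j) powr a)"
    proof (cases "g \<le> j")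
      case True
      define S where "S = min j (P g / c)"
      have S: "g \<le> S" "S \<le> P g / c" using True gP by (auto simp: S_def)
      have lnS: "ln g \<le> ln S" "ln S \<le> (1 + \<delta>) * ln g"
      proof -
        show "ln g \<le> ln S" using S g_gt1 by simp
        have "ln S \<le> ln (g powr (1 + \<delta>))" using S Gs(2) g_gt1 by (intro ln_mono) auto
        also have "\<dots> = (1 + \<delta>) * ln g" using g_gt1 by (simp add: ln_powr)
        finally show "ln S \<le> (1 + \<delta>) * ln g" by simp
      qed
      have l: "ln S powr (a - 1) \<le> 2 * ln g powr (a - 1)"
      proof (cases "a > 1")
        case True
        have "ln S powr (a - 1) \<le> ((1 + \<delta>) * ln g) powr (a - 1)"
          using lnS lng True by (intro powr_mono2) auto
        also have "\<dots> = (1 + \<delta>) powr (a - 1) * ln g powr (a - 1)"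
          using \<delta> lng by (simp add: powr_mult)
        also have "\<dots> \<le> 2 * ln g powr (a - 1)"
          using \<delta>a[OF True] by (intro mult_right_mono) auto
        finally show ?thesis .
      next
        case False
        have "ln S powr (a - 1) \<le> ln g powr (a - 1)"
          using lnS lng False by (intro powr_mono2') auto
        also have "\<dots> \<le> 2 * ln g powr (a - 1)" by simp
        finally show ?thesis .
      qed
      have "P g powr \<theta> * S powr (1 - \<theta>) \<le> P g powr \<theta> * (P g / c) powr (1 - \<theta>)"
        using S \<theta> g_gt1 by (intro mult_left_mono powr_mono2) auto
      also have "\<dots> = P g * c powr (\<theta> - 1)"
        using Ppos pos by (simp add: powr_divide powr_diff powr_add field_simps)
      also have "\<dots> \<le> 4 * b / lam * (g * ln g) * c powr (\<theta> - 1)"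
        using Ple by (intro mult_right_mono) auto
      finally have "P g powr \<theta> * S powr (1 - \<theta>) * ln S powr (a - 1)
          \<le> 4 * b / lam * (g * ln g) * c powr (\<theta> - 1) * (2 * ln g powr (a - 1))"
        using l pos g_gt1 lng by (intro mult_mono[of "P g powr \<theta> * S powr (1 - \<theta>)"]) auto
      also have "\<dots> = D * (g * (ln g * ln g powr (a - 1)))" by (simp add: D_def field_simps)
      also have "ln g * ln g powr (a - 1) = ln g powr a"
        using lng by (simp add: powr_diff)
      finally show ?thesis using True by (simp add: S_def D_def mult.assoc min_def)
    next
      case False
      then have jg: "j < g" by simp
      have Sj: "min j (P g / c) = j" "min g j = j" using jg gP by auto
      \<comment> \<open>ln g = ln j + ln x is at most ln j (1 + ln x) because ln j \<ge> 1, and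
        \<kappa> \<le> 1 gives 1 + ln x \<le> x^\<kappa> / \<kappa>.\<close>
      define x where "x = g / j"
      have j1: "1 < j" using j_e e1 by linarith
      have x: "x \<ge> 1" using jg j1 by (simp add: x_def)
      have "ln (x powr \<kappa>) \<le> x powr \<kappa> - 1" using x by (intro ln_le_minus_one) auto
      then have lx: "1 + ln x \<le> x powr \<kappa> / \<kappa>"
        using x \<kappa> by (simp add: ln_powr field_simps)
      have "ln g = ln j + ln x" using jg j1 by (simp add: x_def ln_div)
      also have "\<dots> \<le> ln j * (1 + ln x)"
      proof -
        have "ln x \<ge> 0" using x by simp
        then have "1 * ln x \<le> ln j * ln x" using lnj by (intro mult_right_mono) auto
        then show ?thesis by (simp add: algebra_simps)
      qed
      also have "\<dots> \<le> ln j * (x powr \<kappa> / \<kappa>)" using lx lnj by (intro mult_left_mono) auto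
      finally have "2 * ln g \<le> 2 * (ln j * (x powr \<kappa> / \<kappa>))" by simp
      also have "\<dots> = (2 / \<kappa>) * (ln j * x powr \<kappa>)" by simp
      finally have "2 * ln g \<le> (2 / \<kappa>) * (ln j * x powr \<kappa>)" .
      then have "ln (exp 1 + g) \<le> (2 / \<kappa>) * (ln j * x powr \<kappa>)" using Gs(3) by linarith
      moreover have "1 \<le> exp 1 + g" using g e1 by linarith
      ultimately have "ln (exp 1 + g) powr \<theta> \<le> ((2 / \<kappa>) * (ln j * x powr \<kappa>)) powr \<theta>"
        using \<theta> by (intro powr_mono2) (auto intro!: ln_ge_zero)
      also have "\<dots> = (2 / \<kappa>) powr \<theta> * ln j powr \<theta> * x powr (1 - \<theta>)"
        using \<theta> \<kappa> lnj x by (simp add: powr_mult powr_powr \<kappa>_def powr_divide)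
      finally have l1: "ln (exp 1 + g) powr \<theta> \<le> (2 / \<kappa>) powr \<theta> * ln j powr \<theta> * x powr (1 - \<theta>)" .
      have "P g powr \<theta> = (2 * b / lam) powr \<theta> * g powr \<theta> * ln (exp 1 + g) powr \<theta>"
        unfolding P_def using pos g by (simp add: powr_mult powr_divide)
      also have "\<dots> \<le> (2 * b / lam) powr \<theta> * g powr \<theta> * ((2 / \<kappa>) powr \<theta> * ln j powr \<theta> * x powr (1 - \<theta>))"
        using l1 by (intro mult_left_mono) auto
      also have "\<dots> = A * ln j powr \<theta> * (g powr \<theta> * x powr (1 - \<theta>))"
        by (simp add: A_def)
      finally have "P g powr \<theta> * j powr (1 - \<theta>) \<le> A * ln j powr \<theta> * (g powr \<theta> * x powr (1 - \<theta>)) * j powr (1 - \<theta>)"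
        by (intro mult_right_mono) auto
      also have "\<dots> = A * ln j powr \<theta> * (g powr \<theta> * g powr (1 - \<theta>))"
        using j1 g_gt1 by (simp add: x_def powr_divide)
      also have "g powr \<theta> * g powr (1 - \<theta>) = g" using g_gt1 by (simp flip: powr_add)
      also have "A * ln j powr \<theta> * g \<le> D * ln j * g"
        using j0[OF jj0] g by (intro mult_right_mono) auto
      finally have "P g powr \<theta> * j powr (1 - \<theta>) * ln j powr (a - 1) \<le> D * ln j * g * ln j powr (a - 1)"
        by (intro mult_right_mono) auto
      also have "\<dots> = D * (g * (ln j * ln j powr (a - 1)))" by simp
      also have "ln j * ln j powr (a - 1) = ln j powr a"
        using lnj by (simp add: powr_diff)
      finally show ?thesis using Sj by (simp add: D_def mult.assoc)
    qed
  qed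
qed

lemma nn_integral_ln_powr_inverse:
  fixes a T s :: real
  assumes "1 < T" "T \<le> s" "a > 0"
  shows "(\<integral>\<^sup>+t. ennreal (a * ln t powr (a - 1) / t) * indicator {T..s} t \<partial>lborel) = ennreal (ln s powr a - ln T powr a)"
  by (intro nn_integral_FTC_Icc)
     (use assms in \<open>auto intro!: derivative_eq_intros simp: powr_diff\<close>)

text \<open>The lower bound on ln T makes the derivative of t^(1-\<theta>) (ln t)^(a-1) at least (1
  - \<theta>) / 2 times the integrand, whatever the sign of a - 1.\<close>

lemma nn_integral_powr_ln_powr_le:
  fixes a T S \<theta> :: real
  assumes "T \<le> S" "0 < \<theta>" "\<theta> < 1" "exp 1 \<le> T" "ln T \<ge> 2 * \<bar>a - 1\<bar> / (1 - \<theta>)"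
  shows "(\<integral>\<^sup>+t. ennreal (t powr (-\<theta>) * ln t powr (a - 1)) * indicator {T..S} t \<partial>lborel)
           \<le> ennreal (2 / (1 - \<theta>) * (S powr (1 - \<theta>) * ln S powr (a - 1)))"
proof -
  define F where "F = (\<lambda>t::real. t powr (1 - \<theta>) * ln t powr (a - 1))"
  define f where "f = (\<lambda>t::real. ((1 - \<theta>) + (a - 1) / ln t) * (t powr (-\<theta>) * ln t powr (a - 1)))"
  have T1: "1 < T" using assms(4) exp_gt_one[of 1] by linarith
  have lnT: "0 < ln t" if "T \<le> t" for t using that T1 by simp
  have d: "(F has_real_derivative f t) (at t)" if "T \<le> t" for t
  proof -
    have t: "t > 0" using that T1 by simp
    have "((\<lambda>t. t powr (1 - \<theta>)) has_real_derivative (1 - \<theta>) * t powr (1 - \<theta> - 1)) (at t)"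
      by (rule has_real_derivative_powr[OF t])
    moreover have "((\<lambda>t. ln t powr (a - 1)) has_real_derivative (a - 1) * ln t powr (a - 1 - 1) * (1 / t)) (at t)"
      by (rule DERIV_chain2[where f = "\<lambda>z. z powr (a - 1)" and g = ln, OF has_real_derivative_powr[OF lnT[OF that]]])
        (use t in \<open>auto intro!: derivative_eq_intros\<close>)
    ultimately have "(F has_real_derivative (1 - \<theta>) * t powr (1 - \<theta> - 1) * ln t powr (a - 1) +
        (a - 1) * ln t powr (a - 1 - 1) * (1 / t) * t powr (1 - \<theta>)) (at t)"
      unfolding F_def by (rule DERIV_mult)
    moreover have "t powr (1 - \<theta> - 1) = t powr (-\<theta>)" "t powr (1 - \<theta>) = t * t powr (-\<theta>)"
      "ln t powr (a - 1 - 1) = ln t powr (a - 1) / ln t"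
      using t lnT[OF that] by (simp_all add: powr_diff powr_minus field_simps power2_eq_square)
    ultimately show ?thesis using t by (simp add: f_def algebra_simps diff_divide_distrib)
  qed
  have lb: "(1 - \<theta>) / 2 * (t powr (-\<theta>) * ln t powr (a - 1)) \<le> f t" if "T \<le> t" for t
  proof -
    have "2 * \<bar>a - 1\<bar> / (1 - \<theta>) \<le> ln t" using assms(5) that T1 ln_le_cancel_iff[of T t] by linarith
    then have "\<bar>(a - 1) / ln t\<bar> \<le> (1 - \<theta>) / 2" using lnT[OF that] assms by (simp add: field_simps)
    then have "- ((a - 1) / ln t) \<le> (1 - \<theta>) / 2" by (rule abs_le_D2)
    then have "(1 - \<theta>) / 2 \<le> (1 - \<theta>) + (a - 1) / ln t" by (simp add: field_simps)
    then show ?thesis unfolding f_def by (intro mult_right_mono) auto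
  qed
  have f0: "0 \<le> f t" if "T \<le> t" for t
    using order_trans[OF _ lb[OF that], of 0] assms by auto
  have "(\<integral>\<^sup>+t. ennreal (t powr (-\<theta>) * ln t powr (a - 1)) * indicator {T..S} t \<partial>lborel)
     \<le> (\<integral>\<^sup>+t. ennreal (2 / (1 - \<theta>)) * (ennreal (f t) * indicator {T..S} t) \<partial>lborel)"
  proof (intro nn_integral_mono)
    fix t
    show "ennreal (t powr (-\<theta>) * ln t powr (a - 1)) * indicator {T..S} t
        \<le> ennreal (2 / (1 - \<theta>)) * (ennreal (f t) * indicator {T..S} t)"
      using lb[of t] f0[of t] assms
      by (auto simp: indicator_def ennreal_mult'[symmetric] field_simps intro!: ennreal_leI)
  qed
  also have "\<dots> = ennreal (2 / (1 - \<theta>)) * (\<integral>\<^sup>+t. ennreal (f t) * indicator {T..S} t \<partial>lborel)"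
    by (intro nn_integral_cmult) (auto simp: f_def)
  also have "(\<integral>\<^sup>+t. ennreal (f t) * indicator {T..S} t \<partial>lborel) = ennreal (F S - F T)"
    using assms f0 d by (intro nn_integral_FTC_Icc) (auto simp: f_def)
  also have "ennreal (2 / (1 - \<theta>)) * \<dots> \<le> ennreal (2 / (1 - \<theta>)) * ennreal (F S)"
    by (intro mult_left_mono ennreal_leI) (auto simp: F_def)
  also have "\<dots> = ennreal (2 / (1 - \<theta>) * F S)" using assms by (intro ennreal_mult'[symmetric]) simp
  finally show ?thesis by (simp add: F_def)
qed

text \<open>By Fubini, t^(1-\<theta>) / t = t^(-\<theta>) is integrated for each x over the levels
  from T to the smaller of j and F(x) / c. The factor \<open>a\<close> from the derivative of (ln
  t)^a survives; it is what later makes the constant small.\<close>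

lemma (in sigma_finite_measure) nn_integral_level_sets_le:
  fixes F :: "'a \<Rightarrow> real" and a T j \<theta> c C :: real
  assumes [measurable]: "F \<in> borel_measurable M"
    and "0 < \<theta>" "\<theta> < 1" "exp 1 \<le> T" "ln T \<ge> 2 * \<bar>a - 1\<bar> / (1 - \<theta>)" "T \<le> j" "a > 0" "c > 0" "C \<ge> 0"
  shows "(\<integral>\<^sup>+t. ennreal (a * ln t powr (a - 1) / t) * indicator {T..j} t *
            (ennreal (C * t powr (1 - \<theta>)) * (\<integral>\<^sup>+x. ennreal (F x powr \<theta>) * indicator {x. c * t < F x} x \<partial>M)) \<partial>lborel)
    \<le> (\<integral>\<^sup>+x. ennreal (2 * C * a / (1 - \<theta>) * (F x powr \<theta> *
           (min j (F x / c) powr (1 - \<theta>) * ln (min j (F x / c)) powr (a - 1)))) * indicator {x. c * T < F x} x \<partial>M)"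
proof -
  interpret pair_sigma_finite lborel M ..
  have T1: "1 < T" using assms(4) exp_gt_one[of 1] by linarith
  have "(\<integral>\<^sup>+t. ennreal (a * ln t powr (a - 1) / t) * indicator {T..j} t *
            (ennreal (C * t powr (1 - \<theta>)) * (\<integral>\<^sup>+x. ennreal (F x powr \<theta>) * indicator {x. c * t < F x} x \<partial>M)) \<partial>lborel)
     = (\<integral>\<^sup>+t. \<integral>\<^sup>+x. ennreal (a * ln t powr (a - 1) / t) * indicator {T..j} t *
            (ennreal (C * t powr (1 - \<theta>)) * (ennreal (F x powr \<theta>) * (if c * t < F x then 1 else 0))) \<partial>M \<partial>lborel)"
    by (subst nn_integral_cmult[symmetric] | simp add: indicator_def of_bool_def)+
  also have "\<dots> = (\<integral>\<^sup>+x. \<integral>\<^sup>+t. ennreal (a * ln t powr (a - 1) / t) * indicator {T..j} t *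
            (ennreal (C * t powr (1 - \<theta>)) * (ennreal (F x powr \<theta>) * (if c * t < F x then 1 else 0))) \<partial>lborel \<partial>M)"
    by (rule Fubini'[symmetric]) measurable
  also have "\<dots> \<le> (\<integral>\<^sup>+x. ennreal (2 * C * a / (1 - \<theta>) * (F x powr \<theta> *
           (min j (F x / c) powr (1 - \<theta>) * ln (min j (F x / c)) powr (a - 1)))) * indicator {x. c * T < F x} x \<partial>M)"
  proof (intro nn_integral_mono)
    fix x
    define S where "S = min j (F x / c)"
    have "(\<integral>\<^sup>+t. ennreal (a * ln t powr (a - 1) / t) * indicator {T..j} t *
            (ennreal (C * t powr (1 - \<theta>)) * (ennreal (F x powr \<theta>) * (if c * t < F x then 1 else 0))) \<partial>lborel)
        \<le> (\<integral>\<^sup>+t. ennreal (a * C * F x powr \<theta>) * (ennreal (t powr (-\<theta>) * ln t powr (a - 1)) * indicator {T..S} t) \<partial>lborel)"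
    proof (intro nn_integral_mono)
      fix t
      show "ennreal (a * ln t powr (a - 1) / t) * indicator {T..j} t *
            (ennreal (C * t powr (1 - \<theta>)) * (ennreal (F x powr \<theta>) * (if c * t < F x then 1 else 0)))
          \<le> ennreal (a * C * F x powr \<theta>) * (ennreal (t powr (-\<theta>) * ln t powr (a - 1)) * indicator {T..S} t)"
      proof (cases "t \<in> {T..j} \<and> c * t < F x")
        case True
        then have "t > 0" using T1 by auto
        then have "a * ln t powr (a - 1) / t * (C * t powr (1 - \<theta>) * F x powr \<theta>)
           = a * C * F x powr \<theta> * (t powr (-\<theta>) * ln t powr (a - 1))"
          by (simp add: powr_diff powr_minus field_simps)
        moreover have "t \<in> {T..S}" using True assms by (auto simp: S_def field_simps)
        ultimately show ?thesis using True assms \<open>t > 0\<close>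
          by (simp add: ennreal_mult'[symmetric])
      qed auto
    qed
    also have "\<dots> = ennreal (a * C * F x powr \<theta>) * (\<integral>\<^sup>+t. ennreal (t powr (-\<theta>) * ln t powr (a - 1)) * indicator {T..S} t \<partial>lborel)"
      by (rule nn_integral_cmult) simp
    also have "\<dots> \<le> ennreal (2 * C * a / (1 - \<theta>) * (F x powr \<theta> * (S powr (1 - \<theta>) * ln S powr (a - 1))))
         * indicator {x. c * T < F x} x"
    proof (cases "T < S")
      case True
      then have i: "c * T < F x" using assms by (auto simp: S_def field_simps)
      have "ennreal (a * C * F x powr \<theta>) * (\<integral>\<^sup>+t. ennreal (t powr (-\<theta>) * ln t powr (a - 1)) * indicator {T..S} t \<partial>lborel)
         \<le> ennreal (a * C * F x powr \<theta>) * ennreal (2 / (1 - \<theta>) * (S powr (1 - \<theta>) * ln S powr (a - 1)))"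
        using True assms by (intro mult_left_mono nn_integral_powr_ln_powr_le) auto
      also have "\<dots> = ennreal (a * C * F x powr \<theta> * (2 / (1 - \<theta>) * (S powr (1 - \<theta>) * ln S powr (a - 1))))"
        using assms by (intro ennreal_mult'[symmetric]) auto
      also have "a * C * F x powr \<theta> * (2 / (1 - \<theta>) * (S powr (1 - \<theta>) * ln S powr (a - 1)))
          = 2 * C * a / (1 - \<theta>) * (F x powr \<theta> * (S powr (1 - \<theta>) * ln S powr (a - 1)))" by simp
      finally show ?thesis using i by simp
    next
      \<comment> \<open>The interval of levels is empty or the single point T.\<close>
      case False
      have "(\<integral>\<^sup>+t. ennreal (t powr (-\<theta>) * ln t powr (a - 1)) * indicator {T..S} t \<partial>lborel) = (\<integral>\<^sup>+(t::real). 0 \<partial>lborel)"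
        using AE_lborel_singleton[of T] False
        by (intro nn_integral_cong_AE) (auto simp: indicator_def)
      then show ?thesis by simp
    qed
    finally show "(\<integral>\<^sup>+t. ennreal (a * ln t powr (a - 1) / t) * indicator {T..j} t *
            (ennreal (C * t powr (1 - \<theta>)) * (ennreal (F x powr \<theta>) * (if c * t < F x then 1 else 0))) \<partial>lborel)
      \<le> ennreal (2 * C * a / (1 - \<theta>) * (F x powr \<theta> *
           (min j (F x / c) powr (1 - \<theta>) * ln (min j (F x / c)) powr (a - 1)))) * indicator {x. c * T < F x} x"
      by (simp add: S_def)
  qed
  finally show ?thesis .
qed

text \<open>The exponent \<open>a\<close> may have either sign. The quotient is continuous on the
  half line from e and tends to 0, hence is bounded.\<close>

lemma ln_powr_le_powr:
  fixes a \<eta> :: real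
  assumes "\<eta> > 0"
  obtains B where "B > 0" "\<And>S. S \<ge> exp 1 \<Longrightarrow> ln S powr a \<le> B * S powr \<eta>"
proof -
  have "((\<lambda>S::real. ln S powr a / S powr \<eta>) \<longlongrightarrow> 0) at_top" using assms by real_asymp
  then have "\<forall>\<^sub>F S in at_top. \<bar>ln S powr a / S powr \<eta>\<bar> < 1"
    using order_tendstoD(2)[OF tendsto_rabs[of _ 0], of _ _ 1] by fastforce
  then obtain S0 where S0: "\<And>S. S \<ge> S0 \<Longrightarrow> \<bar>ln S powr a / S powr \<eta>\<bar> < 1"
    unfolding eventually_at_top_linorder by blast
  have e1: "(1::real) < exp 1" by simp
  have "continuous_on {exp 1..max S0 (exp 1)} (\<lambda>S. ln S powr a / S powr \<eta>)"
  proof (intro continuous_intros ballI)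
    fix x :: real assume "x \<in> {exp 1..max S0 (exp 1)}"
    then have "1 < x" using e1 less_le_trans[of 1 "exp 1" x] by fastforce
    then show "ln x \<noteq> 0" "x \<noteq> 0" "x powr \<eta> \<noteq> 0" "x \<noteq> 0" by auto
  qed
  then have "bounded ((\<lambda>S. ln S powr a / S powr \<eta>) ` {exp 1..max S0 (exp 1)})"
    by (intro compact_imp_bounded compact_continuous_image) auto
  then obtain B where B: "B > 0" "\<And>S. S \<in> {exp 1..max S0 (exp 1)} \<Longrightarrow> \<bar>ln S powr a / S powr \<eta>\<bar> \<le> B"
    unfolding bounded_pos by auto
  show thesis
  proof (rule that[of "max 1 B"])
    fix S :: real assume S: "exp 1 \<le> S"
    then have "S > 0" using less_le_trans[OF exp_gt_zero] by blast
    have "\<bar>ln S powr a / S powr \<eta>\<bar> \<le> max 1 B"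
      using S S0[of S] B(2)[of S] by (cases "S \<ge> S0") (auto simp: le_max_iff_disj)
    then show "ln S powr a \<le> max 1 B * S powr \<eta>" using \<open>S > 0\<close> by (simp add: field_simps)
  qed auto
qed

text \<open>The level set estimate, integrated over the levels, bounds the truncated integral
  \<open>X j\<close> by half of itself plus terms independent of \<open>j\<close>. Absorbing is
  legitimate because the truncation acts inside the logarithm, so that \<open>X j\<close> is at most
  (ln j)^a times the finite integral of \<open>G\<close>. Fatou's lemma removes the
  truncation.\<close>

lemma (in sigma_finite_measure) log_integrability:
  fixes G H K :: "'a \<Rightarrow> real" and \<theta> b c C lam a t0 :: real
  assumes meas [measurable]: "G \<in> borel_measurable M" "H \<in> borel_measurable M" "K \<in> borel_measurable M"
    and G0: "\<And>x. 0 \<le> G x" and H0: "\<And>x. 0 \<le> H x" and K0: "\<And>x. 0 \<le> K x"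
    and dist: "AE x in M. H x \<le> b * K x * G x"
    and intG: "(\<integral>\<^sup>+x. ennreal (G x) \<partial>M) < \<infinity>"
    and expK: "(\<integral>\<^sup>+x. ennreal (exp (lam * K x)) \<partial>M) < \<infinity>"
    and level: "\<And>t. t0 \<le> t \<Longrightarrow> (\<integral>\<^sup>+x. ennreal (G x) * indicator {x. t < G x} x \<partial>M)
        \<le> ennreal (C * t powr (1 - \<theta>)) * (\<integral>\<^sup>+x. ennreal (H x powr \<theta>) * indicator {x. c * t < H x} x \<partial>M)"
    and \<theta>: "1/2 \<le> \<theta>" "\<theta> < 1" and pos: "b > 0" "c > 0" "lam > 0" "a > 0" "C \<ge> 0"
    and small: "32 * C * b * c powr (\<theta> - 1) * a \<le> (1 - \<theta>) * lam"
  shows "(\<integral>\<^sup>+x. ennreal (G x * ln (exp 1 + G x) powr a) \<partial>M) < \<infinity>"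
proof -
  define P where "P = (\<lambda>g. 2 * b / lam * g * ln (exp 1 + g))"
  \<comment> \<open>Bounds \<open>H\<close> where G is at most exp (lam K / 2). Taking only half of
    the exponent leaves room for the factor \<open>K\<close> and for the logarithms.\<close>
  define Q where "Q = (\<lambda>x. b * K x * exp (lam * K x / 2))"
  have P_meas [measurable]: "(\<lambda>x. P (G x)) \<in> borel_measurable M" unfolding P_def by measurable
  have Q_meas [measurable]: "Q \<in> borel_measurable M" unfolding Q_def by measurable
  have e1: "(1::real) < exp 1" by simp
  have HPQ: "AE x in M. H x \<le> max (P (G x)) (Q x)"
    using dist
  proof eventually_elim
    case (elim x)
    have g: "0 < exp 1 + G x" using G0[of x] by (simp add: add_pos_nonneg)
    show ?case
    proof (cases "lam * K x / 2 \<le> ln (exp 1 + G x)")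
      case True
      then have "K x \<le> 2 / lam * ln (exp 1 + G x)" using pos by (simp add: field_simps)
      then have "b * K x * G x \<le> b * (2 / lam * ln (exp 1 + G x)) * G x"
        using pos G0[of x] by (intro mult_right_mono mult_left_mono) auto
      then show ?thesis using elim by (simp add: P_def max_def field_simps)
    next
      case False
      then have "exp 1 + G x < exp (lam * K x / 2)" using g by (metis exp_less_mono exp_ln not_le)
      then have "G x \<le> exp (lam * K x / 2)" using e1 by linarith
      then have "b * K x * G x \<le> Q x" unfolding Q_def
        using pos K0[of x] by (intro mult_left_mono) auto
      then show ?thesis using elim by simp
    qed
  qed
  obtain T0 where T0: "T0 \<ge> exp 1" and pw: "\<And>T j g. T \<ge> T0 \<Longrightarrow> j \<ge> T \<Longrightarrow> g \<ge> 0 \<Longrightarrow> P g > c * T \<Longrightarrow>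
     exp 1 \<le> g \<and> P g powr \<theta> * (min j (P g / c) powr (1 - \<theta>) * ln (min j (P g / c)) powr (a - 1))
       \<le> 8 * b * c powr (\<theta> - 1) / lam * (g * ln (min g j) powr a)"
    using log_kernel_pointwise[OF \<theta> pos(1-4)] unfolding P_def by blast
  \<comment> \<open>Three thresholds: \<open>T0\<close> for the pointwise kernel bound,
    \<open>t0\<close> for the level set estimate, the exponential for the lower bound on ln
    T.\<close>
  define T where "T = max T0 (max t0 (exp (2 * \<bar>a - 1\<bar> / (1 - \<theta>))))"
  have T: "T0 \<le> T" "t0 \<le> T" "exp 1 \<le> T" using T0 by (auto simp: T_def)
  have T1: "1 < T" using T(3) e1 by linarith
  have lnT: "ln T \<ge> 2 * \<bar>a - 1\<bar> / (1 - \<theta>)"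
    using T1 by (subst ln_ge_iff) (auto simp: T_def)
  have lnT1: "ln T \<ge> 1" using T1 T(3) by (subst ln_ge_iff) auto
  define A where "A = 2 * C * a / (1 - \<theta>)"
  have A0: "0 \<le> A" using pos \<theta> by (simp add: A_def)
  \<comment> \<open>The hypothesis \<open>small\<close> in the form in which it is used, and the
    place where the size of a / lam matters: the left side is 16 C b c^(\<theta>-1) a / ((1 -
    \<theta>) lam).\<close>
  have A_small: "A * (8 * b * c powr (\<theta> - 1) / lam) \<le> 1 / 2"
    using small pos \<theta> by (simp add: A_def field_simps)
  \<comment> \<open>The exponents fit together: with the logarithmic factor below a multiple of the
    power 1/3, the kernel is at most a constant times Q^(4/3). \<open>K\<close> costs exp (lam K /
    4), so \<open>Q\<close> is at most a constant times exp (3/4 lam K), and 3/4 times 4/3 is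
    1.\<close>
  obtain Bl where Bl: "Bl > 0" "\<And>S. S \<ge> exp 1 \<Longrightarrow> ln S powr (a - 1) \<le> Bl * S powr (1/3)"
    using ln_powr_le_powr[of "1/3" "a - 1"] by auto
  define BQ where "BQ = A * (c powr (\<theta> - 1) * Bl * (1/c) powr (1/3) * (4 * b / lam) powr (4/3))"
  have Qpw: "A * (Q x powr \<theta> * (min j (Q x / c) powr (1 - \<theta>) * ln (min j (Q x / c)) powr (a - 1)))
      \<le> BQ * exp (lam * K x)" if Qx: "c * T < Q x" and j: "T \<le> j" for x j
  proof -
    define S where "S = min j (Q x / c)"
    have "T < Q x / c" using Qx pos by (simp add: field_simps)
    then have S: "exp 1 \<le> S" "S \<le> Q x / c" "0 < S" using j T(3) T1 by (auto simp: S_def)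
    have Q0: "Q x > 0" using Qx pos T1 by (smt (verit) mult_pos_pos)
    have "Q x powr \<theta> * (S powr (1 - \<theta>) * ln S powr (a - 1))
       \<le> Q x powr \<theta> * ((Q x / c) powr (1 - \<theta>) * (Bl * (Q x / c) powr (1/3)))"
    proof (intro mult_left_mono mult_mono)
      show "S powr (1 - \<theta>) \<le> (Q x / c) powr (1 - \<theta>)" using S \<theta> by (intro powr_mono2) auto
      have "ln S powr (a - 1) \<le> Bl * S powr (1/3)" using Bl(2) S by simp
      also have "\<dots> \<le> Bl * (Q x / c) powr (1/3)" using S Bl by (intro mult_left_mono powr_mono2) auto
      finally show "ln S powr (a - 1) \<le> Bl * (Q x / c) powr (1/3)" .
    qed auto
    also have "\<dots> = c powr (\<theta> - 1) * Bl * (1/c) powr (1/3) * Q x powr (4/3)"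
    proof -
      have "Q x powr (4/3) = Q x powr \<theta> * (Q x powr (1 - \<theta>) * Q x powr (1/3))"
        by (simp flip: powr_add)
      moreover have "(Q x / c) powr (1 - \<theta>) = Q x powr (1 - \<theta>) * c powr (\<theta> - 1)"
        using Q0 pos by (simp add: powr_divide powr_diff field_simps)
      moreover have "(Q x / c) powr (1/3) = Q x powr (1/3) * (1/c) powr (1/3)"
        using Q0 pos by (simp add: powr_divide)
      ultimately show ?thesis by simp
    qed
    also have "Q x powr (4/3) \<le> (4 * b / lam * exp (3/4 * (lam * K x))) powr (4/3)"
    proof (intro powr_mono2)
      have "lam * K x / 4 \<le> exp (lam * K x / 4)"
        using exp_ge_add_one_self[of "lam * K x / 4"] by linarith
      then have "K x \<le> 4 / lam * exp (lam * K x / 4)" using pos by (simp add: field_simps)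
      then have "Q x \<le> b * (4 / lam * exp (lam * K x / 4)) * exp (lam * K x / 2)"
        unfolding Q_def using pos by (intro mult_right_mono mult_left_mono) auto
      also have "\<dots> = 4 * b / lam * exp (3/4 * (lam * K x))"
        by (simp flip: exp_add add: algebra_simps)
      finally show "Q x \<le> 4 * b / lam * exp (3/4 * (lam * K x))" .
    qed (use Q0 in auto)
    also have "(4 * b / lam * exp (3/4 * (lam * K x))) powr (4/3) = (4 * b / lam) powr (4/3) * exp (lam * K x)"
    proof -
      have "exp (3/4 * (lam * K x)) powr (4/3) = exp (lam * K x)" by (simp add: powr_def)
      then show ?thesis using pos by (subst powr_mult) auto
    qed
    finally have "Q x powr \<theta> * (S powr (1 - \<theta>) * ln S powr (a - 1))
        \<le> c powr (\<theta> - 1) * Bl * (1/c) powr (1/3) * ((4 * b / lam) powr (4/3) * exp (lam * K x))"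
      using Bl by (simp add: mult_left_mono)
    from mult_left_mono[OF this A0] show ?thesis by (simp add: S_def BQ_def mult.assoc)
  qed
  have BQ0: "BQ \<ge> 0" using A0 Bl by (simp add: BQ_def)
  define IG where "IG = (\<integral>\<^sup>+x. ennreal (G x) \<partial>M)"
  define B where "B = ennreal BQ * (\<integral>\<^sup>+x. ennreal (exp (lam * K x)) \<partial>M)"
  define B2 where "B2 = B + 2 * (ennreal (ln T powr a) * IG)"
  have B2: "B2 < \<infinity>" using expK intG by (auto simp: B2_def B_def IG_def ennreal_mult_less_top)
  define X where "X = (\<lambda>j. \<integral>\<^sup>+x. ennreal (G x * ln (min (G x) j) powr a) * indicator {x. T < G x} x \<partial>M)"
  have Xb: "X j \<le> 2 * B2" if j: "T \<le> j" for j
  proof -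
    define V where "V = (\<lambda>t::real. ennreal (a * ln t powr (a - 1) / t) * indicator {T..j} t)"
    have [measurable]: "V \<in> borel_measurable borel" unfolding V_def by measurable
    note level_sets_le = nn_integral_level_sets_le
    interpret pair_sigma_finite lborel M ..
    \<comment> \<open>Subtracting (ln T)^a makes the layer cake formula start at the level T, from
      which on the level set estimate is available.\<close>
    define Y where "Y = (\<integral>\<^sup>+x. ennreal (G x * (ln (min (G x) j) powr a - ln T powr a)) * indicator {x. T < G x} x \<partial>M)"
    have "Y \<le> (\<integral>\<^sup>+x. \<integral>\<^sup>+t. V t * (ennreal (G x) * (if t < G x then 1 else 0)) \<partial>lborel \<partial>M)"
      unfolding Y_def
    proof (intro nn_integral_mono)
      fix x
      show "ennreal (G x * (ln (min (G x) j) powr a - ln T powr a)) * indicator {x. T < G x} x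
          \<le> (\<integral>\<^sup>+t. V t * (ennreal (G x) * (if t < G x then 1 else 0)) \<partial>lborel)"
      proof (cases "T < G x")
        case True
        define s where "s = min (G x) j"
        have s: "T \<le> s" using True j by (simp add: s_def)
        have "ennreal (G x * (ln s powr a - ln T powr a)) = ennreal (G x) * ennreal (ln s powr a - ln T powr a)"
          using G0 by (simp add: ennreal_mult')
        also have "\<dots> = ennreal (G x) * (\<integral>\<^sup>+t. ennreal (a * ln t powr (a - 1) / t) * indicator {T..s} t \<partial>lborel)"
          using nn_integral_ln_powr_inverse[OF T1 s pos(4)] by simp
        also have "\<dots> = (\<integral>\<^sup>+t. ennreal (G x) * (ennreal (a * ln t powr (a - 1) / t) * indicator {T..s} t) \<partial>lborel)"
          by (rule nn_integral_cmult[symmetric]) simp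
        also have "\<dots> \<le> (\<integral>\<^sup>+t. V t * (ennreal (G x) * (if t < G x then 1 else 0)) \<partial>lborel)"
          using AE_lborel_singleton[of "G x"]
          by (intro nn_integral_mono_AE, eventually_elim) (auto simp: V_def indicator_def s_def mult.commute)
        finally show ?thesis using True by (simp add: s_def)
      qed simp
    qed
    also have "\<dots> = (\<integral>\<^sup>+t. \<integral>\<^sup>+x. V t * (ennreal (G x) * (if t < G x then 1 else 0)) \<partial>M \<partial>lborel)"
      by (rule Fubini') measurable
    also have "\<dots> = (\<integral>\<^sup>+t. V t * (\<integral>\<^sup>+x. ennreal (G x) * indicator {x. t < G x} x \<partial>M) \<partial>lborel)"
      by (subst nn_integral_cmult[symmetric] | simp add: indicator_def of_bool_def)+
    also have "\<dots> \<le> (\<integral>\<^sup>+t. V t * (ennreal (C * t powr (1 - \<theta>)) *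
         (\<integral>\<^sup>+x. ennreal (P (G x) powr \<theta>) * indicator {x. c * t < P (G x)} x \<partial>M))
       + V t * (ennreal (C * t powr (1 - \<theta>)) * (\<integral>\<^sup>+x. ennreal (Q x powr \<theta>) * indicator {x. c * t < Q x} x \<partial>M)) \<partial>lborel)"
    proof (intro nn_integral_mono)
      fix t
      show "V t * (\<integral>\<^sup>+x. ennreal (G x) * indicator {x. t < G x} x \<partial>M) \<le>
         V t * (ennreal (C * t powr (1 - \<theta>)) *
         (\<integral>\<^sup>+x. ennreal (P (G x) powr \<theta>) * indicator {x. c * t < P (G x)} x \<partial>M))
       + V t * (ennreal (C * t powr (1 - \<theta>)) * (\<integral>\<^sup>+x. ennreal (Q x powr \<theta>) * indicator {x. c * t < Q x} x \<partial>M))"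
      proof (cases "T \<le> t")
        case True
        have "(\<integral>\<^sup>+x. ennreal (H x powr \<theta>) * indicator {x. c * t < H x} x \<partial>M)
          \<le> (\<integral>\<^sup>+x. ennreal (P (G x) powr \<theta>) * indicator {x. c * t < P (G x)} x
              + ennreal (Q x powr \<theta>) * indicator {x. c * t < Q x} x \<partial>M)"
          using HPQ
        proof (intro nn_integral_mono_AE, eventually_elim)
          case (elim x)
          have m: "H x powr \<theta> \<le> y powr \<theta>" if "H x \<le> y" for y
            using that H0[of x] \<theta> by (intro powr_mono2) auto
          show ?case
          proof (cases "H x \<le> P (G x)")
            case True
            have "ennreal (H x powr \<theta>) * indicator {x. c * t < H x} x
                \<le> ennreal (P (G x) powr \<theta>) * indicator {x. c * t < P (G x)} x"
              using True m[OF True] by (auto simp: indicator_def intro!: ennreal_leI)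
            then show ?thesis by (simp add: add_increasing2)
          next
            case False
            then have *: "H x \<le> Q x" using elim by simp
            have "ennreal (H x powr \<theta>) * indicator {x. c * t < H x} x
                \<le> ennreal (Q x powr \<theta>) * indicator {x. c * t < Q x} x"
              using * m[OF *] by (auto simp: indicator_def intro!: ennreal_leI)
            then show ?thesis by (simp add: add_increasing)
          qed
        qed
        also have "\<dots> = (\<integral>\<^sup>+x. ennreal (P (G x) powr \<theta>) * indicator {x. c * t < P (G x)} x \<partial>M)
              + (\<integral>\<^sup>+x. ennreal (Q x powr \<theta>) * indicator {x. c * t < Q x} x \<partial>M)"
          by (intro nn_integral_add) measurable
        finally have "(\<integral>\<^sup>+x. ennreal (G x) * indicator {x. t < G x} x \<partial>M)
          \<le> ennreal (C * t powr (1 - \<theta>)) * ((\<integral>\<^sup>+x. ennreal (P (G x) powr \<theta>) * indicator {x. c * t < P (G x)} x \<partial>M)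
              + (\<integral>\<^sup>+x. ennreal (Q x powr \<theta>) * indicator {x. c * t < Q x} x \<partial>M))"
          using level[of t] True T(2) by (meson order_trans mult_left_mono zero_le)
        from mult_left_mono[OF this, of "V t"] show ?thesis by (simp add: distrib_left)
      qed (simp add: V_def)
    qed
    also have "\<dots> = (\<integral>\<^sup>+t. V t * (ennreal (C * t powr (1 - \<theta>)) *
         (\<integral>\<^sup>+x. ennreal (P (G x) powr \<theta>) * indicator {x. c * t < P (G x)} x \<partial>M)) \<partial>lborel)
       + (\<integral>\<^sup>+t. V t * (ennreal (C * t powr (1 - \<theta>)) * (\<integral>\<^sup>+x. ennreal (Q x powr \<theta>) * indicator {x. c * t < Q x} x \<partial>M)) \<partial>lborel)"
      by (intro nn_integral_add) measurable
    also have "\<dots> \<le> (\<integral>\<^sup>+x. ennreal (A * (P (G x) powr \<theta> *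
           (min j (P (G x) / c) powr (1 - \<theta>) * ln (min j (P (G x) / c)) powr (a - 1)))) * indicator {x. c * T < P (G x)} x \<partial>M)
       + (\<integral>\<^sup>+x. ennreal (A * (Q x powr \<theta> *
           (min j (Q x / c) powr (1 - \<theta>) * ln (min j (Q x / c)) powr (a - 1)))) * indicator {x. c * T < Q x} x \<partial>M)"
      unfolding V_def A_def using T lnT j pos \<theta>
      by (intro add_mono level_sets_le[where F = "\<lambda>x. P (G x)"]
          level_sets_le[where F = Q] P_meas Q_meas) linarith+
    also have "\<dots> \<le> (\<integral>\<^sup>+x. ennreal (1/2) * (ennreal (G x * ln (min (G x) j) powr a) * indicator {x. T < G x} x
          + ennreal (ln T powr a) * ennreal (G x)) \<partial>M)
        + (\<integral>\<^sup>+x. ennreal BQ * ennreal (exp (lam * K x)) \<partial>M)"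
    proof (intro add_mono nn_integral_mono)
      fix x
      show "ennreal (A * (Q x powr \<theta> *
           (min j (Q x / c) powr (1 - \<theta>) * ln (min j (Q x / c)) powr (a - 1)))) * indicator {x. c * T < Q x} x
         \<le> ennreal BQ * ennreal (exp (lam * K x))"
        using Qpw[of x j] j BQ0 by (auto simp: indicator_def ennreal_mult'[symmetric] intro!: ennreal_leI)
      show "ennreal (A * (P (G x) powr \<theta> *
           (min j (P (G x) / c) powr (1 - \<theta>) * ln (min j (P (G x) / c)) powr (a - 1)))) * indicator {x. c * T < P (G x)} x
         \<le> ennreal (1/2) * (ennreal (G x * ln (min (G x) j) powr a) * indicator {x. T < G x} x
          + ennreal (ln T powr a) * ennreal (G x))"
      proof (cases "c * T < P (G x)")
        case True
        note p = pw[OF T(1) j G0 True]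
        have "A * (P (G x) powr \<theta> *
           (min j (P (G x) / c) powr (1 - \<theta>) * ln (min j (P (G x) / c)) powr (a - 1)))
          \<le> A * (8 * b * c powr (\<theta> - 1) / lam * (G x * ln (min (G x) j) powr a))"
          using p A0 by (intro mult_left_mono) auto
        also have "\<dots> = A * (8 * b * c powr (\<theta> - 1) / lam) * (G x * ln (min (G x) j) powr a)" by simp
        also have "\<dots> \<le> 1/2 * (G x * ln (min (G x) j) powr a)"
          using A_small G0 by (intro mult_right_mono) auto
        finally have 1: "ennreal (A * (P (G x) powr \<theta> *
           (min j (P (G x) / c) powr (1 - \<theta>) * ln (min j (P (G x) / c)) powr (a - 1))))
          \<le> ennreal (1/2) * ennreal (G x * ln (min (G x) j) powr a)"
          using G0 by (subst ennreal_mult'[symmetric]) (auto intro!: ennreal_leI)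
        \<comment> \<open>P(G) may exceed c T while G stays below T; the additional multiple of
          \<open>G\<close> covers these points.\<close>
        have 2: "ennreal (G x * ln (min (G x) j) powr a) \<le> ennreal (G x * ln (min (G x) j) powr a) * indicator {x. T < G x} x
          + ennreal (ln T powr a) * ennreal (G x)"
        proof (cases "T < G x")
          case False
          have g1: "1 < G x" using p e1 by linarith
          have "ln (min (G x) j) powr a \<le> ln T powr a"
            using False j g1 T1 pos by (intro powr_mono2) (auto simp: min_def)
          then have "G x * ln (min (G x) j) powr a \<le> ln T powr a * G x"
            using G0[of x] by (simp add: mult.commute mult_left_mono)
          then show ?thesis using False by (simp add: ennreal_mult'[symmetric] ennreal_leI)
        qed (simp add: add_increasing2)
        show ?thesis using True order_trans[OF 1 mult_left_mono[OF 2]] by simp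
      qed simp
    qed
    also have "\<dots> = ennreal (1/2) * (X j + ennreal (ln T powr a) * IG) + B"
      unfolding X_def IG_def B_def by (simp add: nn_integral_cmult nn_integral_add)
    finally have Y: "Y \<le> ennreal (1/2) * (X j + ennreal (ln T powr a) * IG) + B" .
    have "X j \<le> (\<integral>\<^sup>+x. ennreal (G x * (ln (min (G x) j) powr a - ln T powr a)) * indicator {x. T < G x} x
        + ennreal (ln T powr a) * ennreal (G x) \<partial>M)"
      unfolding X_def
    proof (intro nn_integral_mono)
      fix x
      show "ennreal (G x * ln (min (G x) j) powr a) * indicator {x. T < G x} x
         \<le> ennreal (G x * (ln (min (G x) j) powr a - ln T powr a)) * indicator {x. T < G x} x
        + ennreal (ln T powr a) * ennreal (G x)"
      proof (cases "T < G x")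
        case True
        have "ln T powr a \<le> ln (min (G x) j) powr a"
          using True j T1 pos by (intro powr_mono2) auto
        then have "0 \<le> G x * (ln (min (G x) j) powr a - ln T powr a)" using G0 by simp
        then have "ennreal (G x * (ln (min (G x) j) powr a - ln T powr a)) + ennreal (ln T powr a * G x)
            = ennreal (G x * ln (min (G x) j) powr a)"
          using G0[of x] by (subst ennreal_plus[symmetric]) (auto simp: algebra_simps)
        then show ?thesis using True by (simp add: ennreal_mult'[symmetric])
      qed simp
    qed
    also have "\<dots> = Y + ennreal (ln T powr a) * IG"
      unfolding Y_def IG_def by (simp add: nn_integral_cmult nn_integral_add)
    finally have "X j \<le> Y + ennreal (ln T powr a) * IG" .
    also have "\<dots> \<le> ennreal (1/2) * (X j + ennreal (ln T powr a) * IG) + B + ennreal (ln T powr a) * IG"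
      using Y by (intro add_right_mono)
    finally have X1: "X j \<le> ennreal (1/2) * (X j + ennreal (ln T powr a) * IG) + B + ennreal (ln T powr a) * IG" .
    have "X j \<le> (\<integral>\<^sup>+x. ennreal (ln j powr a) * ennreal (G x) \<partial>M)"
      unfolding X_def
    proof (intro nn_integral_mono)
      fix x
      show "ennreal (G x * ln (min (G x) j) powr a) * indicator {x. T < G x} x \<le> ennreal (ln j powr a) * ennreal (G x)"
      proof (cases "T < G x")
        case True
        have "ln (min (G x) j) powr a \<le> ln j powr a"
          using True j T1 pos by (intro powr_mono2) auto
        then show ?thesis using True G0[of x]
          by (simp add: ennreal_mult'[symmetric] mult.commute mult_left_mono ennreal_leI)
      qed simp
    qed
    also have "\<dots> = ennreal (ln j powr a) * IG" by (simp add: IG_def nn_integral_cmult)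
    also have "\<dots> < \<infinity>" using intG by (simp add: IG_def ennreal_mult_less_top)
    finally have Xfin: "X j < \<infinity>" .
    \<comment> \<open>All quantities are finite, so half of \<open>X j\<close> can be subtracted in
      the reals.\<close>
    obtain xj where xj: "X j = ennreal xj" "xj \<ge> 0" using Xfin by (cases "X j") auto
    obtain ig where ig: "ennreal (ln T powr a) * IG = ennreal ig" "ig \<ge> 0"
      using intG by (cases "ennreal (ln T powr a) * IG") (auto simp: IG_def ennreal_mult_eq_top_iff)
    have "B < \<infinity>" using B2 by (simp add: B2_def)
    then obtain bb where bb: "B = ennreal bb" "bb \<ge> 0" by (cases B) auto
    have "xj \<le> 1/2 * (xj + ig) + bb + ig"
    proof -
      have "ennreal xj \<le> ennreal (1/2 * (xj + ig) + bb + ig)"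
        using X1 unfolding xj ig bb
        using xj(2) ig(2) bb(2)
        by (simp only: ennreal_plus[symmetric] ennreal_mult'[symmetric] add_nonneg_nonneg
            mult_nonneg_nonneg divide_nonneg_nonneg zero_le_one zero_le_numeral)
      moreover have "0 \<le> 1/2 * (xj + ig) + bb + ig" using xj(2) ig(2) bb(2) by simp
      ultimately show ?thesis by (simp only: ennreal_le_iff)
    qed
    then have "xj \<le> 2 * (bb + 2 * ig)" using ig(2) by argo
    then have "ennreal xj \<le> ennreal (2 * (bb + 2 * ig))" by (rule ennreal_leI)
    also have "\<dots> = 2 * B2" unfolding B2_def ig bb using bb ig
      by (simp add: ennreal_mult')
    finally show ?thesis using xj by simp
  qed
  have "(\<integral>\<^sup>+x. ennreal (G x * ln (G x) powr a) * indicator {x. T < G x} x \<partial>M)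
     = (\<integral>\<^sup>+x. liminf (\<lambda>i::nat. ennreal (G x * ln (min (G x) (T + real i)) powr a) * indicator {x. T < G x} x) \<partial>M)"
  proof (intro nn_integral_cong)
    fix x
    \<comment> \<open>At each point the truncation is inactive for large indices, so the limit
      inferior is the untruncated integrand.\<close>
    obtain i0 :: nat where i0: "G x - T \<le> real i0" using real_arch_simple by blast
    have "\<forall>\<^sub>F i in sequentially. ennreal (G x * ln (min (G x) (T + real i)) powr a) * indicator {x. T < G x} x
       = ennreal (G x * ln (G x) powr a) * indicator {x. T < G x} x"
      using eventually_ge_at_top[of i0]
    proof eventually_elim
      case (elim i)
      then have "min (G x) (T + real i) = G x" using i0 by (simp add: min_def)
      then show ?case by simp
    qed
    then have "(\<lambda>i. ennreal (G x * ln (min (G x) (T + real i)) powr a) * indicator {x. T < G x} x)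
       \<longlonglongrightarrow> ennreal (G x * ln (G x) powr a) * indicator {x. T < G x} x"
      by (rule tendsto_eventually)
    then show "ennreal (G x * ln (G x) powr a) * indicator {x. T < G x} x
       = liminf (\<lambda>i::nat. ennreal (G x * ln (min (G x) (T + real i)) powr a) * indicator {x. T < G x} x)"
      by (simp add: lim_imp_Liminf)
  qed
  also have "\<dots> \<le> liminf (\<lambda>i. X (T + real i))"
    unfolding X_def by (intro nn_integral_liminf) measurable
  also have "\<dots> \<le> liminf (\<lambda>i::nat. 2 * B2)"
    by (intro Liminf_mono always_eventually allI Xb) simp
  also have "\<dots> = 2 * B2" by (simp add: Liminf_const)
  also have "\<dots> < \<infinity>" using B2 by (simp add: ennreal_mult_less_top)
  finally have fin: "(\<integral>\<^sup>+x. ennreal (G x * ln (G x) powr a) * indicator {x. T < G x} x \<partial>M) < \<infinity>" .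
  have "(\<integral>\<^sup>+x. ennreal (G x * ln (exp 1 + G x) powr a) \<partial>M)
     \<le> (\<integral>\<^sup>+x. ennreal (2 powr a) * (ennreal (G x * ln (G x) powr a) * indicator {x. T < G x} x)
           + ennreal (ln (exp 1 + T) powr a) * ennreal (G x) \<partial>M)"
  proof (intro nn_integral_mono)
    fix x
    show "ennreal (G x * ln (exp 1 + G x) powr a)
        \<le> ennreal (2 powr a) * (ennreal (G x * ln (G x) powr a) * indicator {x. T < G x} x)
           + ennreal (ln (exp 1 + T) powr a) * ennreal (G x)"
    proof (cases "T < G x")
      case True
      \<comment> \<open>For G \<ge> e \<ge> 2 one has e + G \<le> 2 G \<le> G^2, so ln (e + G) is at
        most twice ln G.\<close>
      have e2: "(2::real) \<le> exp 1" using exp_ge_add_one_self[of 1] by simp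
      have g: "exp 1 \<le> G x" "2 \<le> G x" using True T(3) e2 by linarith+
      have "exp 1 + G x \<le> 2 * G x" using g by linarith
      also have "\<dots> \<le> G x * G x" using g by (intro mult_right_mono) auto
      finally have "ln (exp 1 + G x) \<le> ln (G x * G x)" using g by (intro ln_mono) (auto intro: add_pos_pos)
      then have l: "ln (exp 1 + G x) \<le> 2 * ln (G x)" using g by (simp add: ln_mult)
      have "1 \<le> exp 1 + G x" using g e1 by linarith
      then have "ln (exp 1 + G x) powr a \<le> (2 * ln (G x)) powr a"
        using l pos by (intro powr_mono2) auto
      also have "\<dots> = 2 powr a * ln (G x) powr a" using g by (simp add: powr_mult)
      finally have "G x * ln (exp 1 + G x) powr a \<le> G x * (2 powr a * ln (G x) powr a)"
        using g by (intro mult_left_mono) auto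
      then have "ennreal (G x * ln (exp 1 + G x) powr a) \<le> ennreal (2 powr a) * ennreal (G x * ln (G x) powr a)"
        by (simp add: ennreal_mult'[symmetric] ennreal_leI mult.left_commute)
      then show ?thesis using True by (simp add: add_increasing2)
    next
      case False
      have "1 \<le> exp 1 + G x" "exp 1 + G x \<le> exp 1 + T" using False e1 G0[of x] by linarith+
      then have "ln (exp 1 + G x) powr a \<le> ln (exp 1 + T) powr a"
        using pos by (intro powr_mono2 ln_mono) auto
      then have "G x * ln (exp 1 + G x) powr a \<le> ln (exp 1 + T) powr a * G x"
        using G0[of x] by (simp add: mult.commute mult_left_mono)
      then show ?thesis using False by (simp add: ennreal_mult'[symmetric] ennreal_leI)
    qed
  qed
  also have "\<dots> = ennreal (2 powr a) * (\<integral>\<^sup>+x. ennreal (G x * ln (G x) powr a) * indicator {x. T < G x} x \<partial>M)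
       + ennreal (ln (exp 1 + T) powr a) * IG"
    unfolding IG_def by (simp add: nn_integral_cmult nn_integral_add)
  also have "\<dots> < \<infinity>" using fin intG by (simp add: IG_def ennreal_mult_less_top)
  finally show ?thesis .
qed

section \<open>Curves of finite distortion\<close>

text \<open>The cutoff of the ball of radius 2 \<rho> is at least 9 / 16 on the ball of radius
  \<rho>, so the non-negative pullback over the latter is controlled by the cutoff integral, and the
  comass cancels. With y = A' / (V \<rho>^n) the bound reads \<tau> \<le> C1 y^(1+p); since 1 + p =
  1 / \<theta>, the power \<theta> makes it linear in y.\<close>

lemma reverse_hoelder_level:
  fixes \<omega> :: "'n::{finite,linorder} const_form" and z x :: "(real, 'n) vec" and R \<rho> \<tau> \<theta> p C1 :: real and m :: nat
  assumes n2: "2 \<le> CARD('n)" and data: "local_sobolev_data z R u D"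
    and \<kappa>: "0 < comass m \<omega>"
    and P0: "AE x in lborel. 0 \<le> star_pullback m \<omega> (\<lambda>j. D j x)"
  defines "\<theta> \<equiv> (2 * real CARD('n) - 1) / (2 * real CARD('n))"
  defines "p \<equiv> 1 / (2 * real CARD('n) - 1)"
  defines "C1 \<equiv> 16 / 9 * (16 * (1 + 2 ^ CARD('n)) / (1 - real CARD('n) * p)) * 2 ^ CARD('n)"
  assumes \<rho>: "0 < \<rho>" "cball x (2 * \<rho>) \<subseteq> ball z R" and \<tau>: "0 < \<tau>"
    and lev: "ennreal (\<tau> * (ball_vol TYPE((real, 'n) vec) * \<rho> ^ CARD('n)))
      < (\<integral>\<^sup>+y\<in>ball x \<rho>. ennreal (max 0 (star_pullback m \<omega> (\<lambda>j. D j y) / comass m \<omega>)) \<partial>lborel)"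
  shows "ennreal (\<tau> powr \<theta> * (ball_vol TYPE((real, 'n) vec) * \<rho> ^ CARD('n)))
      \<le> ennreal (C1 powr \<theta>) * (\<integral>\<^sup>+y\<in>ball x (2 * \<rho>). ennreal ((hs_norm m (\<lambda>j. D j y) ^ CARD('n)) powr \<theta>) \<partial>lborel)"
proof -
  define n where "n = CARD('n)"
  have nn: "2 \<le> n" using n2 by (simp add: n_def)
  define q where "q = real n - 1/2"
  have \<theta>: "0 < \<theta>" "\<theta> < 1" using nn by (auto simp: \<theta>_def n_def field_simps)
  have n\<theta>: "real n * \<theta> = q" using nn by (simp add: \<theta>_def q_def n_def field_simps)
  have p\<theta>: "(1 + p) * \<theta> = 1" using nn by (simp add: \<theta>_def p_def n_def field_simps)
  have p0: "p > 0" using nn by (simp add: p_def n_def)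
  have np: "1 - real n * p > 0" using nn by (simp add: p_def n_def field_simps)
  have C1: "C1 > 0" using np by (simp add: C1_def n_def add_pos_pos)
  note dat = data[unfolded local_sobolev_data_def, rule_format]
  have [measurable]: "D j \<in> borel_measurable borel" for j using dat[of j] by auto
  define V where "V = unit_ball_vol (real n)"
  have V: "V > 0" by (simp add: V_def)
  define g where "g = (\<lambda>y. hs_norm m (\<lambda>j. D j y))"
  have g0: "0 \<le> g y" for y by (simp add: g_def)
  have gpow: "(g y ^ n) powr \<theta> = g y powr q" for y
  proof (cases "g y = 0")
    case False
    then have "g y ^ n = g y powr real n" using g0[of y] by (simp add: powr_realpow)
    then show ?thesis by (simp add: powr_powr n\<theta>)
  qed (use nn in \<open>simp add: power_0_left\<close>)
  define P where "P = (\<lambda>y. star_pullback m \<omega> (\<lambda>j. D j y))"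
  define \<kappa>' where "\<kappa>' = comass m \<omega>"
  define A where "A = (\<integral>\<^sup>+y\<in>ball x (2 * \<rho>). ennreal (g y powr q) \<partial>lborel)"
  \<comment> \<open>\<open>reverse_hoelder_limit\<close> takes a bound strictly above the integral;
    that bound is let down to \<open>A\<close> at the end.\<close>
  have main: "ennreal (\<tau> powr \<theta> * (V * \<rho> ^ n)) \<le> ennreal (C1 powr \<theta>) * ennreal A'" if A': "A < ennreal A'" for A'
  proof -
    have A'0: "A' > 0" using le_less_trans[OF zero_le A'] by simp
    define b where "b = V * (2 * \<rho>) ^ n"
    have b: "b > 0" using V \<rho>(1) by (simp add: b_def)
    have b2: "b = 2 ^ n * (V * \<rho> ^ n)" by (simp add: b_def power_mult_distrib)
    define I where "I = (LINT y|lborel. bump x (2 * \<rho>) y * P y)"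
    have I: "\<bar>I\<bar> \<le> 16 * (1 + 2 ^ n) / (1 - real n * p) * \<kappa>' * (2 ^ n * A') * (2 ^ n * A' / b) powr p"
      unfolding I_def P_def \<kappa>'_def b_def V_def p_def n_def
      by (rule reverse_hoelder_limit[OF n2 data]) (use \<rho> A' in \<open>auto simp: A_def g_def q_def n_def\<close>)
    define L where "L = (\<integral>\<^sup>+y\<in>ball x \<rho>. ennreal (max 0 (P y / \<kappa>')) \<partial>lborel)"
    have "L \<le> (\<integral>\<^sup>+y. ennreal (16 / 9 / \<kappa>') * ennreal (bump x (2 * \<rho>) y * P y) \<partial>lborel)"
      unfolding L_def using P0
    proof (intro nn_integral_mono_AE, eventually_elim)
      case (elim y)
      then have Py: "0 \<le> P y" by (simp add: P_def)
      show "ennreal (max 0 (P y / \<kappa>')) * indicator (ball x \<rho>) y \<le> ennreal (16 / 9 / \<kappa>') * ennreal (bump x (2 * \<rho>) y * P y)"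
      proof (cases "y \<in> ball x \<rho>")
        case True
        have "9 / 16 \<le> bump x (2 * \<rho>) y" using \<rho>(1) True by (intro bump_ge) auto
        then have "9 / 16 * P y \<le> bump x (2 * \<rho>) y * P y" using Py by (intro mult_right_mono)
        then have "16 / 9 / \<kappa>' * (9 / 16 * P y) \<le> 16 / 9 / \<kappa>' * (bump x (2 * \<rho>) y * P y)"
          using \<kappa> by (intro mult_left_mono) (auto simp: \<kappa>'_def)
        then have "max 0 (P y / \<kappa>') \<le> 16 / 9 / \<kappa>' * (bump x (2 * \<rho>) y * P y)"
          using Py \<kappa> by (simp add: \<kappa>'_def)
        then have "ennreal (max 0 (P y / \<kappa>')) \<le> ennreal (16 / 9 / \<kappa>' * (bump x (2 * \<rho>) y * P y))" by (rule ennreal_leI)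
        also have "\<dots> = ennreal (16 / 9 / \<kappa>') * ennreal (bump x (2 * \<rho>) y * P y)"
          using \<kappa> by (intro ennreal_mult') (simp add: \<kappa>'_def)
        finally show ?thesis using True by simp
      qed simp
    qed
    also have "\<dots> = ennreal (16 / 9 / \<kappa>') * (\<integral>\<^sup>+y. ennreal (bump x (2 * \<rho>) y * P y) \<partial>lborel)"
      unfolding P_def bump_def by (intro nn_integral_cmult) measurable
    finally have L1: "L \<le> ennreal (16 / 9 / \<kappa>') * (\<integral>\<^sup>+y. ennreal (bump x (2 * \<rho>) y * P y) \<partial>lborel)" .
    have intI: "integrable lborel (\<lambda>y. bump x (2 * \<rho>) y * P y)"
      unfolding P_def by (rule star_pullback_integrable(3)[OF data])
    have "(\<integral>\<^sup>+y. ennreal (bump x (2 * \<rho>) y * P y) \<partial>lborel) = ennreal I"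
      unfolding I_def using P0
    proof (intro nn_integral_eq_integral intI, eventually_elim)
      case (elim y)
      then show ?case by (simp add: P_def bump_nonneg)
    qed
    then have "L \<le> ennreal (16 / 9 / \<kappa>') * ennreal I" using L1 by simp
    also have "\<dots> \<le> ennreal (16 / 9 / \<kappa>') * ennreal (16 * (1 + 2 ^ n) / (1 - real n * p) * \<kappa>' * (2 ^ n * A') * (2 ^ n * A' / b) powr p)"
      using I by (intro mult_left_mono ennreal_leI) auto
    also have "\<dots> = ennreal (16 / 9 * (16 * (1 + 2 ^ n) / (1 - real n * p)) * (2 ^ n * A') * (2 ^ n * A' / b) powr p)"
    proof -
      have "16 / 9 / \<kappa>' * (X * \<kappa>' * Y * Z) = 16 / 9 * X * Y * Z" for X Y Z :: real
        using \<kappa> by (simp add: \<kappa>'_def)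
      moreover have "0 \<le> 16 / 9 / \<kappa>'" using \<kappa> by (simp add: \<kappa>'_def)
      ultimately show ?thesis by (simp only: ennreal_mult'[symmetric])
    qed
    finally have "ennreal (\<tau> * (V * \<rho> ^ n)) < ennreal (16 / 9 * (16 * (1 + 2 ^ n) / (1 - real n * p)) * (2 ^ n * A') * (2 ^ n * A' / b) powr p)"
      using lev unfolding L_def P_def \<kappa>'_def V_def n_def by (simp add: less_le_trans)
    then have le: "\<tau> * (V * \<rho> ^ n) \<le> 16 / 9 * (16 * (1 + 2 ^ n) / (1 - real n * p)) * (2 ^ n * A') * (2 ^ n * A' / b) powr p"
      using \<tau> V \<rho>(1) np A'0 b by (subst (asm) ennreal_less_iff) auto
    define y where "y = A' / (V * \<rho> ^ n)"
    have y: "y > 0" using A'0 V \<rho>(1) by (simp add: y_def)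
    \<comment> \<open>The 2^n lost in the passage to the limit cancels against the volume of the
      doubled ball.\<close>
    have yb: "2 ^ n * A' / b = y" by (simp add: b2 y_def)
    have Ay: "A' = y * (V * \<rho> ^ n)" using V \<rho>(1) by (simp add: y_def)
    have "\<tau> * (V * \<rho> ^ n) \<le> (C1 * (y * y powr p)) * (V * \<rho> ^ n)"
      using le unfolding yb unfolding Ay C1_def n_def[symmetric] by (simp add: mult_ac)
    then have "\<tau> \<le> C1 * (y * y powr p)" using V \<rho>(1) by (simp add: mult_le_cancel_right)
    also have "y * y powr p = y powr (1 + p)" using y by (simp add: powr_add)
    finally have "\<tau> powr \<theta> \<le> (C1 * y powr (1 + p)) powr \<theta>" using \<tau> \<theta> by (intro powr_mono2) auto
    also have "\<dots> = C1 powr \<theta> * y" using C1 y p\<theta> by (subst powr_mult) (auto simp: powr_powr)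
    finally have "\<tau> powr \<theta> * (V * \<rho> ^ n) \<le> C1 powr \<theta> * y * (V * \<rho> ^ n)"
      using V \<rho>(1) by (intro mult_right_mono) auto
    also have "\<dots> = C1 powr \<theta> * A'" by (simp add: Ay mult.assoc)
    finally show ?thesis by (simp add: ennreal_mult'[symmetric] ennreal_leI)
  qed
  have "ennreal (\<tau> powr \<theta> * (V * \<rho> ^ n)) \<le> ennreal (C1 powr \<theta>) * A"
  proof (cases "A = \<infinity>")
    case True
    then show ?thesis using C1 by (simp add: ennreal_mult_top)
  next
    case False
    then obtain ar where ar: "A = ennreal ar" "0 \<le> ar" by (cases A) auto
    have "\<tau> powr \<theta> * (V * \<rho> ^ n) \<le> C1 powr \<theta> * ar + \<delta>" if \<delta>: "\<delta> > 0" for \<delta>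
    proof -
      define A' where "A' = ar + \<delta> / C1 powr \<theta>"
      have "ar < A'" using \<delta> C1 by (simp add: A'_def)
      then have "ennreal (\<tau> powr \<theta> * (V * \<rho> ^ n)) \<le> ennreal (C1 powr \<theta> * A')"
        using main[of A'] ar by (simp add: ennreal_less_iff ennreal_mult')
      then have "\<tau> powr \<theta> * (V * \<rho> ^ n) \<le> C1 powr \<theta> * A'"
        using \<open>ar < A'\<close> ar by (subst (asm) ennreal_le_iff) auto
      then show ?thesis using C1 by (simp add: A'_def distrib_left)
    qed
    then have "\<tau> powr \<theta> * (V * \<rho> ^ n) \<le> C1 powr \<theta> * ar" by (rule field_le_epsilon)
    then show ?thesis using ar by (simp add: ennreal_mult'[symmetric] ennreal_leI)
  qed
  then show ?thesis unfolding A_def gpow[symmetric] by (simp add: V_def n_def g_def)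
qed

section \<open>Measurability of the operator norm and pointwise logarithmic bounds\<close>

text \<open>By continuity in the direction, the supremum over the unit ball is one over a countable
  dense subset.\<close>

lemma op_norm_measurable:
  fixes D :: "'b \<Rightarrow> nat \<Rightarrow> 'a::euclidean_space"
  assumes [measurable]: "\<And>j. j < m \<Longrightarrow> (\<lambda>x. D x j) \<in> borel_measurable M"
  shows "(\<lambda>x. op_norm m (D x)) \<in> borel_measurable M"
proof -
  obtain T where T: "countable T" "T \<subseteq> cball (0::'a) 1" "cball (0::'a) 1 \<subseteq> closure T"
    using separable by blast
  have Tne: "T \<noteq> {}" using T(3) by fastforce
  have bdd: "bdd_above ((\<lambda>h. L2_set (\<lambda>j. L j \<bullet> h) {..<m}) ` T)" for L :: "nat \<Rightarrow> 'a"
    by (rule bdd_above_mono[OF bdd_above_op_norm[of L m]]) (use T(2) in auto)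
  have eq: "op_norm m L = (SUP h\<in>T. L2_set (\<lambda>j. L j \<bullet> h) {..<m})" for L
  proof (rule antisym)
    show "op_norm m L \<le> (SUP h\<in>T. L2_set (\<lambda>j. L j \<bullet> h) {..<m})"
      unfolding op_norm_def
    proof (rule cSUP_least)
      fix h :: 'a assume h: "h \<in> cball 0 1"
      have "closed {h. L2_set (\<lambda>j. L j \<bullet> h) {..<m} \<le> (SUP h\<in>T. L2_set (\<lambda>j. L j \<bullet> h) {..<m})}"
        unfolding L2_set_def by (intro closed_Collect_le continuous_intros)
      moreover have "T \<subseteq> {h. L2_set (\<lambda>j. L j \<bullet> h) {..<m} \<le> (SUP h\<in>T. L2_set (\<lambda>j. L j \<bullet> h) {..<m})}"
        using bdd by (auto intro!: cSUP_upper)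
      ultimately have "closure T \<subseteq> {h. L2_set (\<lambda>j. L j \<bullet> h) {..<m} \<le> (SUP h\<in>T. L2_set (\<lambda>j. L j \<bullet> h) {..<m})}"
        by (intro closure_minimal)
      then show "L2_set (\<lambda>j. L j \<bullet> h) {..<m} \<le> (SUP h\<in>T. L2_set (\<lambda>j. L j \<bullet> h) {..<m})" using h T(3) by auto
    qed simp
    show "(SUP h\<in>T. L2_set (\<lambda>j. L j \<bullet> h) {..<m}) \<le> op_norm m L"
      unfolding op_norm_def using Tne T(2) by (intro cSUP_subset_mono bdd_above_op_norm) auto
  qed
  have "(\<lambda>x. SUP h\<in>T. L2_set (\<lambda>j. D x j \<bullet> h) {..<m}) \<in> borel_measurable M"
  proof (rule borel_measurable_cSUP[OF T(1)])
    fix h assume "h \<in> T"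
    have "(\<lambda>x. D x j \<bullet> h) \<in> borel_measurable M" if "j \<in> {..<m}" for j using that by simp
    then have "(\<lambda>x. \<Sum>j<m. (D x j \<bullet> h)\<^sup>2) \<in> borel_measurable M"
      by (intro borel_measurable_sum borel_measurable_power)
    then show "(\<lambda>x. L2_set (\<lambda>j. D x j \<bullet> h) {..<m}) \<in> borel_measurable M" unfolding L2_set_def
      by (rule measurable_compose[OF _ borel_measurable_sqrt])
  qed (use bdd in auto)
  then show ?thesis unfolding eq .
qed

lemma ln_exp1_ge_1: "0 \<le> x \<Longrightarrow> 1 \<le> ln (exp 1 + x :: real)"
  by (subst ln_ge_iff) (auto simp: add_pos_nonneg)

text \<open>A factor \<Lambda> in the argument adds at most ln (1 + \<Lambda>) to a logarithm that
  is at least 1, and is therefore only a factor. This undoes the weight d^n and the division by the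
  comass.\<close>

lemma log_weight_scale:
  fixes G J \<Lambda> a :: real
  assumes "0 \<le> G" "0 \<le> J" "J \<le> \<Lambda> * G" "0 \<le> \<Lambda>" "0 \<le> a"
  shows "J * ln (exp 1 + J) powr a \<le> \<Lambda> * (1 + ln (1 + \<Lambda>)) powr a * (G * ln (exp 1 + G) powr a)"
proof -
  have e1: "(1::real) \<le> exp 1" by simp
  have lG: "1 \<le> ln (exp 1 + G)" using assms by (intro ln_exp1_ge_1)
  have "exp 1 + J \<le> (1 + \<Lambda>) * (exp 1 + G)"
  proof -
    have "0 \<le> \<Lambda> * exp 1" using assms by simp
    moreover have "(1 + \<Lambda>) * (exp 1 + G) = exp 1 + G + (\<Lambda> * exp 1 + \<Lambda> * G)" by (simp add: algebra_simps)
    ultimately show ?thesis using assms by linarith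
  qed
  then have "ln (exp 1 + J) \<le> ln ((1 + \<Lambda>) * (exp 1 + G))"
    using assms by (intro ln_mono) (auto simp: add_pos_nonneg)
  also have "\<dots> = ln (1 + \<Lambda>) + ln (exp 1 + G)"
  proof -
    have "0 < exp 1 + G" using assms by (simp add: add_pos_nonneg)
    then show ?thesis using assms by (subst ln_mult) auto
  qed
  also have "\<dots> \<le> (1 + ln (1 + \<Lambda>)) * ln (exp 1 + G)"
  proof -
    have "ln (1 + \<Lambda>) * 1 \<le> ln (1 + \<Lambda>) * ln (exp 1 + G)" using lG assms by (intro mult_left_mono) auto
    then show ?thesis by (simp add: algebra_simps)
  qed
  finally have "ln (exp 1 + J) powr a \<le> ((1 + ln (1 + \<Lambda>)) * ln (exp 1 + G)) powr a"
    using assms order_trans[OF zero_le_one ln_exp1_ge_1[of J]] by (intro powr_mono2) auto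
  also have "\<dots> = (1 + ln (1 + \<Lambda>)) powr a * ln (exp 1 + G) powr a"
    by (rule powr_mult)
  finally have "J * ln (exp 1 + J) powr a \<le> \<Lambda> * G * ((1 + ln (1 + \<Lambda>)) powr a * ln (exp 1 + G) powr a)"
    using assms by (intro mult_mono) auto
  then show ?thesis by (simp add: mult_ac)
qed

text \<open>The dichotomy used for \<open>H\<close>, now for \<bar>Df\<bar> itself. If lam K / 2
  \<le> ln (e + J), the factor \<open>K\<close> of the distortion inequality costs one logarithm of
  J, which is the loss from a to a - 1. Otherwise J is at most exp (lam K / 2), and the exponents
  3/4 and 4/3 again combine to exp (lam K).\<close>

lemma distortion_log_bound:
  fixes \<kappa> lam a :: real
  assumes "0 < \<kappa>" "0 < lam" "1 < a" "1 \<le> n"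
  obtains C where "C \<ge> 0" "\<And>s K J. 0 \<le> s \<Longrightarrow> 0 \<le> K \<Longrightarrow> 0 \<le> J \<Longrightarrow> \<kappa> * s ^ n \<le> K * J \<Longrightarrow>
    s ^ n * ln (exp 1 + s) powr (a - 1) \<le> C * (J * ln (exp 1 + J) powr a + exp (lam * K))"
proof -
  obtain B where B: "B > 0" "\<And>S. S \<ge> exp 1 \<Longrightarrow> ln S powr (a - 1) \<le> B * S powr (1/3)"
    using ln_powr_le_powr[of "1/3" "a - 1"] by auto
  define c where "c = 2 / (lam * \<kappa>)"
  have c: "c > 0" using assms by (simp add: c_def)
  define E where "E = exp 1 + (1::real)"
  have E: "E > 1" by (simp add: E_def)
  define C1 where "C1 = c * (2 + ln (E + c)) powr (a - 1)"
  define C2 where "C2 = B * (E + 2 * c) powr (4/3)"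
  have C12: "0 \<le> C1" "0 \<le> C2" using c B by (auto simp: C1_def C2_def)
  show thesis
  proof (rule that[of "C1 + C2"])
    fix s K J :: real assume s: "0 \<le> s" and K: "0 \<le> K" and J: "0 \<le> J" and le: "\<kappa> * s ^ n \<le> K * J"
    \<comment> \<open>The distortion inequality controls s^n; this carries the control over to the s
      inside the logarithm, at the price of replacing e by \<open>E\<close>.\<close>
    have s1: "s \<le> 1 + s ^ n"
    proof (cases "s \<le> 1")
      case False
      then have "s ^ 1 \<le> s ^ n" using assms by (intro power_increasing) auto
      then show ?thesis by simp
    qed (use s in \<open>simp add: add_increasing2\<close>)
    have es: "exp 1 \<le> exp 1 + s" "exp 1 + s \<le> E + s ^ n" using s s1 by (auto simp: E_def)
    have sK: "s ^ n \<le> K * J / \<kappa>" using le assms by (simp add: field_simps)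
    have l1: "1 \<le> ln (exp 1 + J)" "1 \<le> ln (exp 1 + s)" using J s by (auto intro: ln_exp1_ge_1)
    show "s ^ n * ln (exp 1 + s) powr (a - 1) \<le> (C1 + C2) * (J * ln (exp 1 + J) powr a + exp (lam * K))"
    proof (cases "lam * K / 2 \<le> ln (exp 1 + J)")
      case True
      define l where "l = ln (exp 1 + J)"
      have "K \<le> 2 / lam * l" using True assms by (simp add: l_def field_simps)
      then have "K * J / \<kappa> \<le> 2 / lam * l * J / \<kappa>" using J assms by (intro divide_right_mono mult_right_mono) auto
      then have sl: "s ^ n \<le> c * (J * l)" using sK by (simp add: c_def mult_ac)
      have lJ: "l \<le> exp 1 + J" unfolding l_def using J ln_le_minus_one[of "exp 1 + J"] by (simp add: add_pos_nonneg)
      have "exp 1 + s \<le> (E + c) * (exp 1 + J)\<^sup>2"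
      proof -
        have "J * l \<le> (exp 1 + J) * (exp 1 + J)" using J lJ l1 by (intro mult_mono) (auto simp: l_def)
        then have "c * (J * l) \<le> c * (exp 1 + J)\<^sup>2" using c by (intro mult_left_mono) (auto simp: power2_eq_square)
        moreover have "1 \<le> (exp 1 + J)\<^sup>2" using J by (intro one_le_power) (simp add: add_increasing2)
        then have "E * 1 \<le> E * (exp 1 + J)\<^sup>2" using E by (intro mult_left_mono) auto
        ultimately show ?thesis using es sl by (simp add: distrib_right)
      qed
      then have "ln (exp 1 + s) \<le> ln ((E + c) * (exp 1 + J)\<^sup>2)" using s by (intro ln_mono) (auto simp: add_pos_nonneg)
      also have "\<dots> = ln (E + c) + 2 * l"
      proof -
        have "0 < exp 1 + J" using J by (simp add: add_pos_nonneg)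
        then show ?thesis unfolding l_def using E c by (subst ln_mult) (auto simp: ln_realpow)
      qed
      also have "\<dots> \<le> (2 + ln (E + c)) * l"
      proof -
        have "ln (E + c) * 1 \<le> ln (E + c) * l" using l1 E c by (intro mult_left_mono) (auto simp: l_def)
        then show ?thesis by (simp add: algebra_simps)
      qed
      finally have "ln (exp 1 + s) powr (a - 1) \<le> ((2 + ln (E + c)) * l) powr (a - 1)"
        using l1 assms by (intro powr_mono2) auto
      also have "\<dots> = (2 + ln (E + c)) powr (a - 1) * l powr (a - 1)"
        by (rule powr_mult)
      finally have "s ^ n * ln (exp 1 + s) powr (a - 1) \<le> c * (J * l) * ((2 + ln (E + c)) powr (a - 1) * l powr (a - 1))"
        using sl s J c l1 by (intro mult_mono) (auto simp: l_def)
      also have "\<dots> = C1 * (J * (l * l powr (a - 1)))" by (simp add: C1_def mult_ac)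
      also have "l * l powr (a - 1) = l powr a" using l1 by (simp add: l_def powr_diff)
      also have "C1 * (J * l powr a) \<le> (C1 + C2) * (J * l powr a + exp (lam * K))"
        using C12 J by (intro mult_mono) auto
      finally show ?thesis by (simp add: l_def)
    next
      case False
      have "J \<le> exp (lam * K / 2)"
      proof -
        have "exp 1 + J < exp (lam * K / 2)" using False J by (metis add_pos_nonneg exp_gt_zero exp_less_mono exp_ln not_le)
        moreover have "(0::real) < exp 1" by simp
        ultimately show ?thesis by linarith
      qed
      then have "K * J / \<kappa> \<le> K * exp (lam * K / 2) / \<kappa>" using K assms by (intro divide_right_mono mult_left_mono) auto
      also have "\<dots> \<le> (4 / lam * exp (lam * K / 4)) * exp (lam * K / 2) / \<kappa>"
      proof -
        have "lam * K / 4 \<le> exp (lam * K / 4)" using exp_ge_add_one_self[of "lam * K / 4"] by linarith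
        then have "K \<le> 4 / lam * exp (lam * K / 4)" using assms by (simp add: field_simps)
        then show ?thesis using assms by (intro divide_right_mono mult_right_mono) auto
      qed
      also have "\<dots> = 2 * c * exp (3/4 * (lam * K))"
      proof -
        have "exp (lam * K / 4) * exp (lam * K / 2) = exp (3/4 * (lam * K))" by (simp flip: exp_add)
        then show ?thesis by (simp add: c_def mult.assoc)
      qed
      finally have sb: "s ^ n \<le> 2 * c * exp (3/4 * (lam * K))" using sK by linarith
      have "1 \<le> exp (3/4 * (lam * K))" using K assms by simp
      then have "E * 1 \<le> E * exp (3/4 * (lam * K))" using E by (intro mult_left_mono) auto
      then have Es: "E + s ^ n \<le> (E + 2 * c) * exp (3/4 * (lam * K))" using sb by (simp add: distrib_right)
      have "ln (exp 1 + s) powr (a - 1) \<le> B * (exp 1 + s) powr (1/3)" using B(2) es by simp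
      also have "\<dots> \<le> B * (E + s ^ n) powr (1/3)"
        using B es s by (intro mult_left_mono powr_mono2) (auto simp: add_nonneg_nonneg)
      finally have "s ^ n * ln (exp 1 + s) powr (a - 1) \<le> (E + s ^ n) * (B * (E + s ^ n) powr (1/3))"
        using s E B by (intro mult_mono) auto
      also have "\<dots> = B * (E + s ^ n) powr (4/3)"
      proof -
        have pos: "0 < E + s ^ n" using E s by (simp add: add_pos_nonneg)
        have "(E + s ^ n) powr (4/3) = (E + s ^ n) powr 1 * (E + s ^ n) powr (1/3)"
          by (subst powr_add[symmetric]) simp
        then show ?thesis using pos by simp
      qed
      also have "\<dots> \<le> B * ((E + 2 * c) * exp (3/4 * (lam * K))) powr (4/3)"
        using Es E s B by (intro mult_left_mono powr_mono2) (auto simp: add_nonneg_nonneg)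
      also have "\<dots> = C2 * exp (lam * K)"
      proof -
        have "exp (3/4 * (lam * K)) powr (4/3) = exp (lam * K)" by (simp add: powr_def)
        then show ?thesis using E c by (subst powr_mult) (auto simp: C2_def)
      qed
      also have "\<dots> \<le> (C1 + C2) * (J * ln (exp 1 + J) powr a + exp (lam * K))"
        using C12 J by (intro mult_mono) auto
      finally show ?thesis .
    qed
  qed (use C12 in simp)
qed

text \<open>\<open>c3\<close> precedes \<open>m\<close> and all data, since it may depend on n only.
  The conclusion concerns the ball of half the radius, where the weight is bounded below.\<close>

lemma local_log_integrability:
  assumes n2: "2 \<le> CARD('n::{finite,linorder})"
  shows "\<exists>c3>0. \<forall>m (\<omega> :: 'n const_form) z R u D K lam (a :: real).
    0 < R \<and> local_sobolev_data z R u D \<and> 0 < comass m \<omega> \<and>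
    (AE x in lborel. 0 \<le> star_pullback m \<omega> (\<lambda>j. D j x)) \<and>
    K \<in> borel_measurable borel \<and> (\<forall>x. 0 \<le> K x) \<and>
    (AE x in lborel. x \<in> ball z R \<longrightarrow>
      comass m \<omega> * op_norm m (\<lambda>j. D j x) ^ CARD('n) \<le> K x * star_pullback m \<omega> (\<lambda>j. D j x)) \<and>
    (\<integral>\<^sup>+x\<in>ball z R. ennreal (exp (lam * K x)) \<partial>lborel) < \<infinity> \<and> 0 < lam \<and> 0 < a \<and> a \<le> c3 * lam \<longrightarrow>
    (\<integral>\<^sup>+x\<in>ball z (R / 2). ennreal (star_pullback m \<omega> (\<lambda>j. D j x) *
        ln (exp 1 + star_pullback m \<omega> (\<lambda>j. D j x)) powr a) \<partial>lborel) < \<infinity> \<and>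
    (\<integral>\<^sup>+x\<in>ball z (R / 2). ennreal (op_norm m (\<lambda>j. D j x) ^ CARD('n) *
        ln (exp 1 + op_norm m (\<lambda>j. D j x)) powr (a - 1)) \<partial>lborel) < \<infinity>"
proof -
  define n where "n = CARD('n)"
  have nn: "2 \<le> n" using n2 by (simp add: n_def)
  define \<theta> where "\<theta> = (2 * real n - 1) / (2 * real n)"
  define p where "p = 1 / (2 * real n - 1)"
  define C1 where "C1 = 16 / 9 * (16 * (1 + 2 ^ n) / (1 - real n * p)) * 2 ^ n"
  define C\<theta> where "C\<theta> = C1 powr \<theta>"
  define c where "c = (1 / (2 * C\<theta> * 4 ^ n)) powr (1 / \<theta>)"
  \<comment> \<open>The factor between Hilbert-Schmidt norm and operator norm, raised to the power
    n.\<close>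
  define b where "b = sqrt (real n) ^ n"
  define C where "C = 2 * C\<theta> * 64 ^ n"
  \<comment> \<open>The value that turns \<open>small\<close> into an equality for a = c3
    lam.\<close>
  define c3 where "c3 = (1 - \<theta>) / (32 * C * b * c powr (\<theta> - 1))"
  have \<theta>: "1/2 \<le> \<theta>" "0 < \<theta>" "\<theta> < 1" using nn by (auto simp: \<theta>_def field_simps)
  have np: "1 - real n * p > 0" using nn by (simp add: p_def field_simps)
  have C1: "C1 > 0" using np by (simp add: C1_def add_pos_pos)
  have C\<theta>: "C\<theta> > 0" using C1 by (simp add: C\<theta>_def)
  have c: "c > 0" using C\<theta> by (simp add: c_def)
  have b: "b > 0" using nn by (simp add: b_def)
  have C: "C > 0" using C\<theta> by (simp add: C_def)
  have c3: "c3 > 0" using \<theta> C b c by (simp add: c3_def)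
  show ?thesis
  proof (intro exI[of _ c3] conjI[OF c3] allI impI, goal_cases)
    case (1 m \<omega> z R u D K lam a)
    define P where "P = (\<lambda>x. star_pullback m \<omega> (\<lambda>j. D j x))"
    define \<kappa> where "\<kappa> = comass m \<omega>"
    define s where "s = (\<lambda>x. op_norm m (\<lambda>j. D j x))"
    have R: "0 < R" and data: "local_sobolev_data z R u D" and \<kappa>: "0 < \<kappa>"
      and P0: "AE x in lborel. 0 \<le> P x"
      and Km [measurable]: "K \<in> borel_measurable borel" and K0: "\<And>x. 0 \<le> K x"
      and dist: "AE x in lborel. x \<in> ball z R \<longrightarrow> \<kappa> * s x ^ n \<le> K x * P x"
      and expK: "(\<integral>\<^sup>+x\<in>ball z R. ennreal (exp (lam * K x)) \<partial>lborel) < \<infinity>"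
      and lam: "0 < lam" and a: "0 < a" "a \<le> c3 * lam"
      using 1 by (auto simp: P_def \<kappa>_def s_def n_def)
    note dat = data[unfolded local_sobolev_data_def, rule_format]
    have [measurable]: "D j \<in> borel_measurable borel" for j using dat[of j] by auto
    have [measurable]: "ball y r \<in> sets borel" for y :: "(real, 'n) vec" and r by simp
    have Pm [measurable]: "P \<in> borel_measurable borel" unfolding P_def by measurable
    have sm [measurable]: "s \<in> borel_measurable borel" unfolding s_def by (rule op_norm_measurable) simp
    define J where "J = (\<lambda>x. max 0 (P x / \<kappa>))"
    define h where "h = (\<lambda>x. hs_norm m (\<lambda>j. D j x) ^ n)"
    have Jm [measurable]: "J \<in> borel_measurable borel" unfolding J_def by measurable
    have hm [measurable]: "h \<in> borel_measurable borel" unfolding h_def by measurable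
    have J0: "0 \<le> J x" for x by (simp add: J_def)
    have h0: "0 \<le> h x" for x by (simp add: h_def)
    have Jint: "integrable lborel J"
      unfolding J_def P_def using star_pullback_integrable(1)[OF data, of m \<omega>]
      by (intro integrable_max) auto
    have Jfin: "(\<integral>\<^sup>+x. ennreal (J x) \<partial>lborel) < \<infinity>"
      using Jint J0 by (simp add: nn_integral_eq_integral)
    define d where "d = (\<lambda>x. max 0 (R - dist z x))"
    define G where "G = (\<lambda>x. d x ^ n * J x)"
    define H where "H = (\<lambda>x. d x ^ n * h x)"
    have [measurable]: "d \<in> borel_measurable borel" unfolding d_def by measurable
    have Gm [measurable]: "G \<in> borel_measurable borel" unfolding G_def by measurable
    have Hm [measurable]: "H \<in> borel_measurable borel" unfolding H_def by measurable
    have d0: "0 \<le> d x" for x by (simp add: d_def)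
    have G0: "0 \<le> G x" for x using d0 J0 by (simp add: G_def)
    have H0: "0 \<le> H x" for x using d0 h0 by (simp add: H_def)
    have off: "H x = 0" if "x \<notin> ball z R" for x
      using that nn by (simp add: H_def d_def max_def)
    define t0 where "t0 = 64 ^ n * enn2real (\<integral>\<^sup>+x. ennreal (J x) \<partial>lborel) / ball_vol TYPE((real, 'n) vec) + 1"
    have dim: "DIM((real, 'n) vec) = n" by (simp add: n_def)
    have RH: "ennreal (\<tau> powr \<theta> * (ball_vol TYPE((real, 'n) vec) * \<rho> ^ n))
        \<le> ennreal C\<theta> * (\<integral>\<^sup>+y\<in>ball x (2 * \<rho>). ennreal (h y powr \<theta>) \<partial>lborel)"
      if "0 < \<rho>" "cball x (2 * \<rho>) \<subseteq> ball z R" "0 < \<tau>"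
        "ennreal (\<tau> * (ball_vol TYPE((real, 'n) vec) * \<rho> ^ n)) < (\<integral>\<^sup>+y\<in>ball x \<rho>. ennreal (J y) \<partial>lborel)" for x \<rho> \<tau>
      using reverse_hoelder_level[OF n2 data \<kappa>[unfolded \<kappa>_def] P0[unfolded P_def] that(1,2,3)] that(4)
      by (simp add: C\<theta>_def C1_def p_def \<theta>_def h_def J_def P_def \<kappa>_def n_def)
    have level: "(\<integral>\<^sup>+x. ennreal (G x) * indicator {x. t < G x} x \<partial>lborel)
      \<le> ennreal (C * t powr (1 - \<theta>)) * (\<integral>\<^sup>+x. ennreal (H x powr \<theta>) * indicator {x. c * t < H x} x \<partial>lborel)"
      if "t0 \<le> t" for t
      using level_set_estimate[where 'a = "(real, 'n) vec", OF Jm hm J0 h0 Jfin \<theta>(2,3) C\<theta>, of z R t, unfolded dim, OF RH[unfolded dim]] that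
      unfolding dim by (simp add: G_def H_def d_def C_def c_def t0_def n_def[symmetric])
    \<comment> \<open>exp (lam K) \<ge> 1 is not integrable over the whole space, so the absorption
      takes place on the ball. The level set estimate restricts to it because \<open>H\<close>
      vanishes outside.\<close>
    define M where "M = restrict_space lborel (ball z R)"
    interpret M: sigma_finite_measure M
      unfolding M_def by (rule sigma_finite_measure_restrict_space[OF sigma_finite_lborel]) simp
    have nM: "(\<integral>\<^sup>+x. f x \<partial>M) = (\<integral>\<^sup>+x\<in>ball z R. f x \<partial>lborel)" for f
      unfolding M_def by (subst nn_integral_restrict_space) auto
    have aeM: "(AE x in M. Q x) \<longleftrightarrow> (AE x in lborel. x \<in> ball z R \<longrightarrow> Q x)" for Q
      unfolding M_def by (subst AE_restrict_space_iff) auto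
    have distM: "AE x in M. H x \<le> b * K x * G x"
      unfolding aeM using P0 dist
    proof eventually_elim
      case (elim x)
      show ?case
      proof
        assume x: "x \<in> ball z R"
        have "h x \<le> (sqrt (real n) * s x) ^ n"
          unfolding h_def s_def dim[symmetric] by (intro power_mono hs_norm_le_op_norm) simp
        also have "\<dots> = b * s x ^ n" by (simp add: b_def power_mult_distrib)
        also have "\<dots> \<le> b * (K x * J x)"
        proof -
          have "s x ^ n \<le> K x * (P x / \<kappa>)" using elim x \<kappa> by (simp add: field_simps)
          moreover have "J x = P x / \<kappa>" using elim \<kappa> by (simp add: J_def)
          ultimately show ?thesis using b by (intro mult_left_mono) auto
        qed
        finally have "d x ^ n * h x \<le> d x ^ n * (b * (K x * J x))" using d0 by (intro mult_left_mono) auto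
        then show "H x \<le> b * K x * G x" by (simp add: H_def G_def mult_ac)
      qed
    qed
    have intGM: "(\<integral>\<^sup>+x. ennreal (G x) \<partial>M) < \<infinity>"
    proof -
      have "(\<integral>\<^sup>+x. ennreal (G x) \<partial>M) \<le> (\<integral>\<^sup>+x. ennreal (R ^ n) * ennreal (J x) \<partial>lborel)"
        unfolding nM
      proof (rule nn_integral_mono)
        fix x
        have "d x ^ n \<le> R ^ n" using R by (intro power_mono) (auto simp: d_def)
        then have "G x \<le> R ^ n * J x" unfolding G_def using J0 by (intro mult_right_mono)
        then have "ennreal (G x) \<le> ennreal (R ^ n) * ennreal (J x)"
          using R by (subst ennreal_mult'[symmetric]) (auto intro: ennreal_leI)
        then show "ennreal (G x) * indicator (ball z R) x \<le> ennreal (R ^ n) * ennreal (J x)"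
          by (auto split: split_indicator)
      qed
      also have "\<dots> = ennreal (R ^ n) * (\<integral>\<^sup>+x. ennreal (J x) \<partial>lborel)" by (intro nn_integral_cmult) measurable
      also have "\<dots> < \<infinity>" using Jfin by (simp add: ennreal_mult_less_top)
      finally show ?thesis .
    qed
    have levelM: "(\<integral>\<^sup>+x. ennreal (G x) * indicator {x. t < G x} x \<partial>M)
      \<le> ennreal (C * t powr (1 - \<theta>)) * (\<integral>\<^sup>+x. ennreal (H x powr \<theta>) * indicator {x. c * t < H x} x \<partial>M)"
      if "t0 \<le> t" for t
    proof -
      have "(\<integral>\<^sup>+x. ennreal (G x) * indicator {x. t < G x} x \<partial>M) \<le> (\<integral>\<^sup>+x. ennreal (G x) * indicator {x. t < G x} x \<partial>lborel)"
        unfolding nM by (intro nn_integral_mono) (auto split: split_indicator)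
      also note level[OF that]
      also have "(\<integral>\<^sup>+x. ennreal (H x powr \<theta>) * indicator {x. c * t < H x} x \<partial>lborel)
        = (\<integral>\<^sup>+x. ennreal (H x powr \<theta>) * indicator {x. c * t < H x} x \<partial>M)"
        unfolding nM by (intro nn_integral_cong) (auto simp: off split: split_indicator)
      finally show ?thesis .
    qed
    have meas_M: "f \<in> borel_measurable M" if "f \<in> borel_measurable borel" for f :: "(real, 'n) vec \<Rightarrow> real"
      unfolding M_def by (rule measurable_restrict_space1) (use that in simp)
    have small: "32 * C * b * c powr (\<theta> - 1) * a \<le> (1 - \<theta>) * lam"
    proof -
      have pos: "0 < 32 * C * b * c powr (\<theta> - 1)" using C b c by simp
      then have "32 * C * b * c powr (\<theta> - 1) * a \<le> 32 * C * b * c powr (\<theta> - 1) * (c3 * lam)"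
        using a by (intro mult_left_mono) auto
      also have "\<dots> = (1 - \<theta>) * lam" using C b c by (simp add: c3_def)
      finally show ?thesis .
    qed
    have Glog: "(\<integral>\<^sup>+x. ennreal (G x * ln (exp 1 + G x) powr a) \<partial>M) < \<infinity>"
      by (rule M.log_integrability[OF meas_M[OF Gm] meas_M[OF Hm] meas_M[OF Km] G0 H0 K0 distM intGM
            expK[folded nM] levelM \<theta>(1,3) b c lam a(1) less_imp_le[OF C] small])
    \<comment> \<open>On the half ball d \<ge> R / 2, which gives P \<le> \<Lambda> G there.\<close>
    define \<Lambda> where "\<Lambda> = \<kappa> * (2 / R) ^ n"
    define B where "B = \<Lambda> * (1 + ln (1 + \<Lambda>)) powr a"
    have \<Lambda>: "0 < \<Lambda>" using \<kappa> R by (simp add: \<Lambda>_def)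
    have B: "0 \<le> B" using \<Lambda> by (simp add: B_def)
    have Plog: "(\<integral>\<^sup>+x\<in>ball z (R / 2). ennreal (P x * ln (exp 1 + P x) powr a) \<partial>lborel) < \<infinity>"
    proof -
      have "(\<integral>\<^sup>+x\<in>ball z (R / 2). ennreal (P x * ln (exp 1 + P x) powr a) \<partial>lborel)
        \<le> (\<integral>\<^sup>+x. ennreal B * (ennreal (G x * ln (exp 1 + G x) powr a) * indicator (ball z R) x) \<partial>lborel)"
        using P0
      proof (intro nn_integral_mono_AE, eventually_elim)
        case (elim x)
        show ?case
        proof (cases "x \<in> ball z (R / 2)")
          case True
          then have xR: "x \<in> ball z R" using R by simp
          have "(R / 2) ^ n \<le> d x ^ n" using True R by (intro power_mono) (auto simp: d_def)
          then have "(R / 2) ^ n * (2 / R) ^ n * P x \<le> d x ^ n * (2 / R) ^ n * P x"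
            using R elim by (intro mult_right_mono) auto
          moreover have "(R / 2) ^ n * (2 / R) ^ n = 1" using R by (simp flip: power_mult_distrib)
          moreover have "\<Lambda> * G x = d x ^ n * (2 / R) ^ n * P x"
            using elim \<kappa> by (simp add: \<Lambda>_def G_def J_def)
          ultimately have "P x \<le> \<Lambda> * G x" by simp
          then have "P x * ln (exp 1 + P x) powr a \<le> B * (G x * ln (exp 1 + G x) powr a)"
            unfolding B_def using G0 elim \<Lambda> a by (intro log_weight_scale) auto
          then have "ennreal (P x * ln (exp 1 + P x) powr a) \<le> ennreal B * ennreal (G x * ln (exp 1 + G x) powr a)"
            using B by (subst ennreal_mult'[symmetric]) (auto intro: ennreal_leI)
          then show ?thesis using True xR by simp
        qed simp
      qed
      also have "\<dots> = ennreal B * (\<integral>\<^sup>+x. ennreal (G x * ln (exp 1 + G x) powr a) \<partial>M)"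
        unfolding nM by (intro nn_integral_cmult) measurable
      also have "\<dots> < \<infinity>" using Glog by (simp add: ennreal_mult_less_top)
      finally show ?thesis .
    qed
    have slog: "(\<integral>\<^sup>+x\<in>ball z (R / 2). ennreal (s x ^ n * ln (exp 1 + s x) powr (a - 1)) \<partial>lborel) < \<infinity>"
    \<comment> \<open>For a \<le> 1 the logarithmic factor is at most 1 and the integrability of
      \<bar>Df\<bar>^n suffices. For a > 1 the factor grows, and the distortion inequality trades it
      for the first conclusion.\<close>
    proof (cases "a \<le> 1")
      case True
      have "(\<integral>\<^sup>+x\<in>ball z (R / 2). ennreal (s x ^ n * ln (exp 1 + s x) powr (a - 1)) \<partial>lborel)
        \<le> (\<integral>\<^sup>+x. ennreal (h x) \<partial>lborel)"
      proof (rule nn_integral_mono)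
        fix x
        have s0: "0 \<le> s x" by (simp add: s_def op_norm_nonneg)
        have "ln (exp 1 + s x) powr (a - 1) \<le> ln (exp 1 + s x) powr 0"
          using True ln_exp1_ge_1[OF s0] by (intro powr_mono) auto
        then have "s x ^ n * ln (exp 1 + s x) powr (a - 1) \<le> s x ^ n * 1"
          using s0 ln_exp1_ge_1[OF s0] by (intro mult_left_mono) auto
        also have "\<dots> \<le> h x" using s0 by (simp add: h_def s_def power_mono op_norm_le_hs_norm)
        finally show "ennreal (s x ^ n * ln (exp 1 + s x) powr (a - 1)) * indicator (ball z (R / 2)) x \<le> ennreal (h x)"
          by (auto intro: ennreal_leI split: split_indicator)
      qed
      also have "\<dots> < \<infinity>"
        using star_pullback_integrable(2)[OF data, of m] h0 by (simp add: nn_integral_eq_integral h_def n_def)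
      finally show ?thesis .
    next
      case False
      then have a1: "1 < a" by simp
      have n1: "1 \<le> n" using nn by simp
      obtain C' where C': "C' \<ge> 0" "\<And>s K J. 0 \<le> s \<Longrightarrow> 0 \<le> K \<Longrightarrow> 0 \<le> J \<Longrightarrow> \<kappa> * s ^ n \<le> K * J \<Longrightarrow>
        s ^ n * ln (exp 1 + s) powr (a - 1) \<le> C' * (J * ln (exp 1 + J) powr a + exp (lam * K))"
        using distortion_log_bound[OF \<kappa> lam a1 n1] by blast
      have "(\<integral>\<^sup>+x\<in>ball z (R / 2). ennreal (s x ^ n * ln (exp 1 + s x) powr (a - 1)) \<partial>lborel)
        \<le> (\<integral>\<^sup>+x. ennreal C' * (ennreal (P x * ln (exp 1 + P x) powr a) * indicator (ball z (R / 2)) x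
             + ennreal (exp (lam * K x)) * indicator (ball z R) x) \<partial>lborel)"
        using P0 dist
      proof (intro nn_integral_mono_AE, eventually_elim)
        case (elim x)
        show ?case
        proof (cases "x \<in> ball z (R / 2)")
          case True
          then have xR: "x \<in> ball z R" using R by simp
          have P': "0 \<le> P x * ln (exp 1 + P x) powr a" using elim by simp
          have "s x ^ n * ln (exp 1 + s x) powr (a - 1) \<le> C' * (P x * ln (exp 1 + P x) powr a + exp (lam * K x))"
            using elim xR K0 by (intro C'(2)) (auto simp: s_def op_norm_nonneg)
          then have "ennreal (s x ^ n * ln (exp 1 + s x) powr (a - 1))
              \<le> ennreal C' * (ennreal (P x * ln (exp 1 + P x) powr a) + ennreal (exp (lam * K x)))"
            using C' P' by (simp add: ennreal_leI ennreal_mult'[symmetric] flip: ennreal_plus)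
          then show ?thesis using True xR by simp
        qed simp
      qed
      also have "\<dots> = ennreal C' * ((\<integral>\<^sup>+x\<in>ball z (R / 2). ennreal (P x * ln (exp 1 + P x) powr a) \<partial>lborel)
          + (\<integral>\<^sup>+x\<in>ball z R. ennreal (exp (lam * K x)) \<partial>lborel))"
        by (subst nn_integral_cmult, measurable) (subst nn_integral_add, auto)
      also have "\<dots> < \<infinity>" using Plog expK by (simp add: ennreal_mult_less_top)
      finally show ?thesis .
    qed
    show ?case using Plog slog by (simp add: P_def s_def n_def)
  qed
qed

section \<open>Borel representatives of Sobolev maps\<close>

text \<open>Cutting off at \<open>C\<close> first gives a Lebesgue measurable function on the whole
  space, each coordinate of which agrees almost everywhere with a Borel function. The result is cut
  off once more, as the representatives may be non-zero on a null set outside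
  \<open>C\<close>.\<close>

lemma borel_representative_on_compact:
  fixes v :: "'a::euclidean_space \<Rightarrow> 'b::euclidean_space"
  assumes v: "v \<in> borel_measurable (lebesgue_on \<Omega>)" and C: "compact C" "C \<subseteq> \<Omega>"
  obtains w where "w \<in> borel_measurable borel" "(\<lambda>x. if x \<in> C then v x else 0) \<in> borel_measurable lebesgue"
    "AE x in lborel. w x = (if x \<in> C then v x else 0)" "\<And>x. x \<notin> C \<Longrightarrow> w x = 0"
proof -
  define g where "g = (\<lambda>x. if x \<in> C then v x else 0)"
  have Cb [measurable]: "C \<in> sets borel" using C by (simp add: borel_compact)
  have g [measurable]: "g \<in> borel_measurable lebesgue"
    unfolding g_def using C by (intro borel_measurable_if_I measurable_restrict_mono[OF v]) auto
  have "\<exists>w'\<in>borel_measurable lborel. AE x in lborel. g x \<bullet> b = w' x" for b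
    by (rule completion_ex_borel_measurable_real) measurable
  then obtain w' where w': "\<And>b. w' b \<in> borel_measurable lborel" "\<And>b. AE x in lborel. g x \<bullet> b = w' b x"
    by metis
  define w where "w = (\<lambda>x. if x \<in> C then \<Sum>b\<in>Basis. w' b x *\<^sub>R b else 0)"
  have "AE x in lborel. \<forall>b\<in>Basis. g x \<bullet> b = w' b x"
    using w'(2) by (subst AE_ball_countable) (auto intro: countable_finite)
  then have ae: "AE x in lborel. w x = g x"
  proof eventually_elim
    case (elim x)
    then have "(\<Sum>b\<in>Basis. w' b x *\<^sub>R b) = (\<Sum>b\<in>Basis. (g x \<bullet> b) *\<^sub>R b)" by (intro sum.cong) auto
    then show ?case by (simp add: w_def euclidean_representation g_def)
  qed
  have [measurable]: "w' b \<in> borel_measurable borel" for b using w'(1)[of b] by simp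
  have "w \<in> borel_measurable borel" unfolding w_def by measurable
  moreover have "w x = 0" if "x \<notin> C" for x using that by (simp add: w_def)
  ultimately show thesis using that[of w] g ae by (simp add: g_def)
qed

lemma Lp_loc_nn_integral_finite:
  fixes v :: "'a::euclidean_space \<Rightarrow> 'b::euclidean_space"
  assumes "Lp_loc p \<Omega> v" "compact C" "C \<subseteq> \<Omega>"
  shows "(\<integral>\<^sup>+x\<in>C. ennreal (norm (v x) ^ p) \<partial>lebesgue) < \<infinity>"
proof -
  have "integrable lebesgue (\<lambda>x. indicator C x *\<^sub>R (norm (v x) ^ p))"
    using assms by (auto simp: Lp_loc_def set_integrable_def)
  then have "(\<integral>\<^sup>+x. norm (indicator C x *\<^sub>R (norm (v x) ^ p)) \<partial>lebesgue) < \<infinity>"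
    unfolding integrable_iff_bounded by simp
  also have "(\<integral>\<^sup>+x. norm (indicator C x *\<^sub>R (norm (v x) ^ p)) \<partial>lebesgue) = (\<integral>\<^sup>+x\<in>C. ennreal (norm (v x) ^ p) \<partial>lebesgue)"
    by (intro nn_integral_cong) (auto split: split_indicator)
  finally show ?thesis .
qed

lemma integrable_norm_power_representative:
  fixes v w :: "'a::euclidean_space \<Rightarrow> 'b::euclidean_space"
  assumes L: "Lp_loc p \<Omega> v" and p: "1 \<le> p" and C: "compact C" "C \<subseteq> \<Omega>"
    and w [measurable]: "w \<in> borel_measurable borel" and ae: "AE x in lborel. w x = (if x \<in> C then v x else 0)"
  shows "integrable lborel (\<lambda>x. norm (w x) ^ p)"
proof (rule integrableI_bounded)
  have "(\<integral>\<^sup>+x. norm (norm (w x) ^ p) \<partial>lborel) = (\<integral>\<^sup>+x\<in>C. ennreal (norm (v x) ^ p) \<partial>lborel)"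
    using ae p by (intro nn_integral_cong_AE) (auto elim!: eventually_mono split: split_indicator simp: power_0_left)
  also have "\<dots> < \<infinity>"
    using Lp_loc_nn_integral_finite[OF L C] by (simp add: nn_integral_completion)
  finally show "(\<integral>\<^sup>+x. norm (norm (w x) ^ p) \<partial>lborel) < \<infinity>" .
qed measurable

text \<open>The kernel centred at x is an admissible test function because its support lies in
  \<open>C\<close>. Its derivative in y brings out - 1 / \<epsilon>, whose sign cancels that of the
  integration by parts.\<close>

lemma weak_gradient_bump_conv:
  fixes v :: "'a::euclidean_space \<Rightarrow> real" and x :: 'a and \<epsilon> :: real
  assumes wg: "weak_gradient \<Omega> v V" and \<epsilon>: "0 < \<epsilon>" and sub: "cball x (DIM('a) * \<epsilon>) \<subseteq> C" and C: "compact C" "C \<subseteq> \<Omega>"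
    and b: "b \<in> Basis"
    and u [measurable]: "u \<in> borel_measurable borel" and u_ae: "AE x in lborel. u x = (if x \<in> C then v x else 0)"
    and vm [measurable]: "(\<lambda>x. if x \<in> C then v x else 0) \<in> borel_measurable lebesgue"
    and D [measurable]: "D \<in> borel_measurable borel" and D_ae: "AE x in lborel. D x = (if x \<in> C then V x else 0)"
    and Vm [measurable]: "(\<lambda>x. if x \<in> C then V x else 0) \<in> borel_measurable lebesgue"
  shows "bump_conv \<epsilon> ((\<lambda>_. 0)(b := Suc 0)) u x / \<epsilon> = bump_conv \<epsilon> (\<lambda>_. 0) (\<lambda>y. D y \<bullet> b) x"
proof -
  have Cb [measurable]: "C \<in> sets borel" using C by (simp add: borel_compact)
  have bp [measurable]: "(\<lambda>y. bump_prod \<kappa> ((x - y) /\<^sub>R \<epsilon>)) \<in> borel_measurable borel" for \<kappa>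
    by (intro borel_measurable_continuous_onI continuous_on_compose2[OF continuous_bump_prod[where S = UNIV]] continuous_intros) auto
  have bpl [measurable]: "(\<lambda>y. bump_prod \<kappa> ((x - y) /\<^sub>R \<epsilon>)) \<in> borel_measurable lebesgue" for \<kappa>
    using bp[of \<kappa>] by (intro measurable_completion) simp
  have out: "bump_prod \<kappa> ((x - y) /\<^sub>R \<epsilon>) = 0" if "y \<notin> C" for \<kappa> y
  proof (rule bump_prod_outside)
    have "real DIM('a) * \<epsilon> < dist x y" using that sub by (auto simp: not_le)
    then show "(x - y) /\<^sub>R \<epsilon> \<notin> cball 0 (real DIM('a))"
      using \<epsilon> by (simp add: dist_norm divide_inverse_commute[symmetric] pos_divide_le_eq mult.commute)
  qed
  \<comment> \<open>One computation for both sides of the weak equation: the support of the kernel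
    allows \<Omega> to be replaced by the whole space, and the Borel representative then allows
    \<open>lebesgue\<close> to be replaced by \<open>lborel\<close>.\<close>
  have conv: "(LINT y:\<Omega>|lebesgue. g y * (c * bump_prod \<kappa> ((x - y) /\<^sub>R \<epsilon>))) = c * bump_conv \<epsilon> \<kappa> w x"
    if w [measurable]: "w \<in> borel_measurable borel" and ae: "AE y in lborel. w y = (if y \<in> C then g y else 0)"
      and gm [measurable]: "(\<lambda>y. if y \<in> C then g y else 0) \<in> borel_measurable lebesgue" for g w :: "'a \<Rightarrow> real" and c \<kappa>
  proof -
    have "(LINT y:\<Omega>|lebesgue. g y * (c * bump_prod \<kappa> ((x - y) /\<^sub>R \<epsilon>)))
      = (LINT y|lebesgue. (if y \<in> C then g y else 0) * (c * bump_prod \<kappa> ((x - y) /\<^sub>R \<epsilon>)))"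
      unfolding set_lebesgue_integral_def using C out
      by (intro Bochner_Integration.integral_cong) (auto split: split_indicator)
    also have "\<dots> = (LINT y|lebesgue. w y * (c * bump_prod \<kappa> ((x - y) /\<^sub>R \<epsilon>)))"
    proof (rule integral_cong_AE)
      have "w \<in> borel_measurable lebesgue" using w by (intro measurable_completion) simp
      then show "(\<lambda>y. w y * (c * bump_prod \<kappa> ((x - y) /\<^sub>R \<epsilon>))) \<in> borel_measurable lebesgue" by measurable
      show "AE y in lebesgue. (if y \<in> C then g y else 0) * (c * bump_prod \<kappa> ((x - y) /\<^sub>R \<epsilon>)) = w y * (c * bump_prod \<kappa> ((x - y) /\<^sub>R \<epsilon>))"
        using AE_completion[OF ae] by eventually_elim simp
    qed measurable
    also have "\<dots> = (LINT y|lborel. c * (w y * bump_prod \<kappa> ((x - y) /\<^sub>R \<epsilon>)))"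
      by (subst integral_completion) (auto simp: mult_ac)
    also have "\<dots> = c * bump_conv \<epsilon> \<kappa> w x" by (simp add: bump_conv_def)
    finally show ?thesis .
  qed
  have test: "test_function \<Omega> (\<lambda>y. 1 * bump_prod (\<lambda>_. 0) ((x - y) /\<^sub>R \<epsilon>))"
    using \<epsilon> sub C by (intro test_function_scaled_bump) auto
  have "(LINT y:\<Omega>|lebesgue. v y * partial_deriv b (\<lambda>y. 1 * bump_prod (\<lambda>_. 0) ((x - y) /\<^sub>R \<epsilon>)) y) =
        - (LINT y:\<Omega>|lebesgue. (V y \<bullet> b) * (1 * bump_prod (\<lambda>_. 0) ((x - y) /\<^sub>R \<epsilon>)))"
    using wg test b unfolding weak_gradient_def by blast
  moreover have "partial_deriv b (\<lambda>y. 1 * bump_prod (\<lambda>_. 0) ((x - y) /\<^sub>R \<epsilon>)) y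
      = (- (1 / \<epsilon>)) * bump_prod ((\<lambda>_. 0)(b := Suc 0)) ((x - y) /\<^sub>R \<epsilon>)" for y
    using \<epsilon> by (subst frechet_scaled_bump[OF _ b]) auto
  ultimately have "(LINT y:\<Omega>|lebesgue. v y * ((- (1 / \<epsilon>)) * bump_prod ((\<lambda>_. 0)(b := Suc 0)) ((x - y) /\<^sub>R \<epsilon>))) =
        - (LINT y:\<Omega>|lebesgue. (V y \<bullet> b) * (1 * bump_prod (\<lambda>_. 0) ((x - y) /\<^sub>R \<epsilon>)))"
    by simp
  moreover have "AE y in lborel. D y \<bullet> b = (if y \<in> C then V y \<bullet> b else 0)"
    using D_ae by eventually_elim simp
  moreover have "(\<lambda>y. if y \<in> C then V y \<bullet> b else 0) \<in> borel_measurable lebesgue"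
  proof -
    have "(\<lambda>y. (if y \<in> C then V y else 0) \<bullet> b) \<in> borel_measurable lebesgue" by measurable
    then show ?thesis by (rule measurable_cong[THEN iffD1, rotated]) simp
  qed
  ultimately show ?thesis
    using conv[OF u u_ae vm, of "- (1 / \<epsilon>)" "(\<lambda>_. 0)(b := Suc 0)"]
      conv[of "\<lambda>y. D y \<bullet> b" "\<lambda>y. V y \<bullet> b" 1 "\<lambda>_. 0"] by simp
qed

lemma sobolev_loc_local_data:
  fixes \<Omega> :: "(real, 'n::finite) vec set"
  assumes S: "sobolev_loc (CARD('n)) m \<Omega> f Df" and sub: "cball z R \<subseteq> \<Omega>"
  obtains u D where "local_sobolev_data z R u D"
    "\<And>j. j < m \<Longrightarrow> AE x in lborel. x \<in> cball z R \<longrightarrow> D j x = Df x j" "\<And>j x. x \<notin> cball z R \<Longrightarrow> D j x = 0"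
proof -
  define P where "P = (\<lambda>j u D. integrable lborel (u :: (real, 'n) vec \<Rightarrow> real) \<and> integrable lborel (D :: (real, 'n) vec \<Rightarrow> (real, 'n) vec) \<and>
     integrable lborel (\<lambda>x. norm (D x) ^ CARD('n)) \<and>
     (\<forall>x (\<epsilon>::real) k. 0 < \<epsilon> \<and> cball x (CARD('n) * \<epsilon>) \<subseteq> cball z R \<longrightarrow>
        bump_conv \<epsilon> ((\<lambda>_. 0)(axis k 1 := Suc 0)) u x / \<epsilon> = bump_conv \<epsilon> (\<lambda>_. 0) (\<lambda>y. D y $ k) x) \<and>
     (j < m \<longrightarrow> (AE x in lborel. x \<in> cball z R \<longrightarrow> D x = Df x j)) \<and> (\<forall>x. x \<notin> cball z R \<longrightarrow> D x = 0))"
  have "\<exists>u D. P j u D" for j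
  proof (cases "j < m")
    \<comment> \<open>The hypothesis says nothing about components from \<open>m\<close> on, while
      \<open>local_sobolev_data\<close> speaks of every index; they are taken to be zero.\<close>
    case False
    then show ?thesis
      by (intro exI[of _ "\<lambda>_. 0"]) (simp add: P_def bump_conv_def power_0_left)
  next
    case True
    let ?C = "cball z R"
    have wg: "weak_gradient \<Omega> (\<lambda>x. f x j) (\<lambda>x. Df x j)" and Dn: "Lp_loc (CARD('n)) \<Omega> (\<lambda>x. Df x j)"
      using S True by (auto simp: sobolev_loc_def)
    have f1: "Lp_loc 1 \<Omega> (\<lambda>x. f x j)" and D1: "Lp_loc 1 \<Omega> (\<lambda>x. Df x j)"
      using wg unfolding weak_gradient_def by blast+
    obtain u where u: "u \<in> borel_measurable borel" "(\<lambda>x. if x \<in> ?C then f x j else 0) \<in> borel_measurable lebesgue"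
      "AE x in lborel. u x = (if x \<in> ?C then f x j else 0)" "\<And>x. x \<notin> ?C \<Longrightarrow> u x = 0"
      by (rule borel_representative_on_compact[OF f1[unfolded Lp_loc_def, THEN conjunct1] compact_cball sub]) (rule that)
    obtain D where D: "D \<in> borel_measurable borel" "(\<lambda>x. if x \<in> ?C then Df x j else 0) \<in> borel_measurable lebesgue"
      "AE x in lborel. D x = (if x \<in> ?C then Df x j else 0)" "\<And>x. x \<notin> ?C \<Longrightarrow> D x = 0"
      by (rule borel_representative_on_compact[OF D1[unfolded Lp_loc_def, THEN conjunct1] compact_cball sub]) (rule that)
    have "integrable lborel u"
      using integrable_norm_power_representative[OF f1 order_refl compact_cball sub u(1,3)] u(1)
      by (auto intro!: integrable_norm_cancel[of _ u])
    moreover have "integrable lborel D"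
      using integrable_norm_power_representative[OF D1 order_refl compact_cball sub D(1,3)] D(1)
      by (auto intro!: integrable_norm_cancel[of _ D])
    moreover have "integrable lborel (\<lambda>x. norm (D x) ^ CARD('n))"
      by (rule integrable_norm_power_representative[OF Dn _ compact_cball sub D(1,3)]) (simp add: Suc_leI)
    moreover have "bump_conv \<epsilon> ((\<lambda>_. 0)(axis k 1 := Suc 0)) u x / \<epsilon> = bump_conv \<epsilon> (\<lambda>_. 0) (\<lambda>y. D y $ k) x"
      if "0 < \<epsilon>" "cball x (real CARD('n) * \<epsilon>) \<subseteq> ?C" for x \<epsilon> k
      using weak_gradient_bump_conv[OF wg that(1) _ compact_cball sub axis_in_Basis_iff[THEN iffD2] u(1,3,2) D(1,3,2), of x 1 k] that
      by (simp add: inner_axis)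
    moreover have "AE x in lborel. x \<in> ?C \<longrightarrow> D x = Df x j" using D(3) by eventually_elim simp
    ultimately show ?thesis using D(4) unfolding P_def by blast
  qed
  then obtain u D where "\<And>j. P j (u j) (D j)" by metis
  then show thesis by (intro that[of u D]) (auto simp: P_def local_sobolev_data_def)
qed

text \<open>Finitely many of the balls cover a compact set. Measurability is given on \<Omega> only,
  hence the extension by zero before restricting to \<open>C\<close>.\<close>

lemma L1_loc_if_locally_finite:
  fixes v :: "'a::euclidean_space \<Rightarrow> real"
  assumes \<Omega>: "open \<Omega>" and v: "v \<in> borel_measurable (lebesgue_on \<Omega>)"
    and loc: "\<And>z. z \<in> \<Omega> \<Longrightarrow> \<exists>r>0. (\<integral>\<^sup>+x\<in>ball z r. ennreal \<bar>v x\<bar> \<partial>lebesgue) < \<infinity>"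
  shows "L1_loc \<Omega> v"
  unfolding Lp_loc_def
proof (intro conjI allI impI v, elim conjE)
  fix C assume C: "compact C" "C \<subseteq> \<Omega>"
  obtain r where r: "\<And>z. z \<in> \<Omega> \<Longrightarrow> r z > 0" "\<And>z. z \<in> \<Omega> \<Longrightarrow> (\<integral>\<^sup>+x\<in>ball z (r z). ennreal \<bar>v x\<bar> \<partial>lebesgue) < \<infinity>"
    using loc by metis
  obtain T where T: "T \<subseteq> C" "finite T" "C \<subseteq> (\<Union>z\<in>T. ball z (r z))"

  proof (rule compactE_image[OF C(1), of C "\<lambda>z. ball z (r z)"])
    show "C \<subseteq> (\<Union>z\<in>C. ball z (r z))" using r(1) C(2) by force
  qed auto
  have m0: "(\<lambda>x. if x \<in> \<Omega> then v x else 0) \<in> borel_measurable lebesgue"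
    using \<Omega> by (intro borel_measurable_if_I v) auto
  have Cl [measurable]: "C \<in> sets lebesgue" using C by (simp add: borel_compact)
  have meas: "(\<lambda>x. indicator C x *\<^sub>R (norm (v x) ^ 1)) \<in> borel_measurable lebesgue"
  proof -
    have "(\<lambda>x. indicator C x *\<^sub>R \<bar>if x \<in> \<Omega> then v x else 0\<bar>) \<in> borel_measurable lebesgue" using m0 by measurable
    then show ?thesis by (rule measurable_cong[THEN iffD1, rotated]) (use C(2) in \<open>auto split: split_indicator\<close>)
  qed
  have bl: "(\<lambda>x. ennreal \<bar>v x\<bar> * indicator (ball z (r z)) x * indicator C x) \<in> borel_measurable lebesgue" for z
  proof -
    have "ball z (r z) \<in> sets lebesgue" by simp
    then have "(\<lambda>x. ennreal \<bar>indicator C x *\<^sub>R (norm (v x) ^ 1)\<bar> * indicator (ball z (r z)) x) \<in> borel_measurable lebesgue"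
      using meas by measurable
    then show ?thesis by (rule measurable_cong[THEN iffD1, rotated]) (auto split: split_indicator)
  qed
  have "(\<integral>\<^sup>+x. norm (indicator C x *\<^sub>R (norm (v x) ^ 1)) \<partial>lebesgue)
    \<le> (\<integral>\<^sup>+x. (\<Sum>z\<in>T. ennreal \<bar>v x\<bar> * indicator (ball z (r z)) x * indicator C x) \<partial>lebesgue)"
  proof (rule nn_integral_mono)
    fix x
    show "ennreal (norm (indicator C x *\<^sub>R (norm (v x) ^ 1))) \<le> (\<Sum>z\<in>T. ennreal \<bar>v x\<bar> * indicator (ball z (r z)) x * indicator C x)"
    proof (cases "x \<in> C")
      case True
      then obtain z where z: "z \<in> T" "x \<in> ball z (r z)" using T(3) by auto
      have "ennreal \<bar>v x\<bar> * indicator (ball z (r z)) x * indicator C x \<le> (\<Sum>z\<in>T. ennreal \<bar>v x\<bar> * indicator (ball z (r z)) x * indicator C x)"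
        using z T(2) by (intro member_le_sum) auto
      then show ?thesis using True z by simp
    qed simp
  qed
  also have "\<dots> = (\<Sum>z\<in>T. (\<integral>\<^sup>+x. ennreal \<bar>v x\<bar> * indicator (ball z (r z)) x * indicator C x \<partial>lebesgue))"
    by (intro nn_integral_sum bl)
  also have "\<dots> < \<infinity>"
  proof -
    have "(\<integral>\<^sup>+x. ennreal \<bar>v x\<bar> * indicator (ball z (r z)) x * indicator C x \<partial>lebesgue) < \<infinity>" if "z \<in> T" for z
    proof (rule le_less_trans[OF nn_integral_mono r(2)])
      show "z \<in> \<Omega>" using that T C by auto
      show "ennreal \<bar>v x\<bar> * indicator (ball z (r z)) x * indicator C x \<le> ennreal \<bar>v x\<bar> * indicator (ball z (r z)) x" for x
        by (auto split: split_indicator)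
    qed
    then show ?thesis using T(2) by (auto simp: less_top)
  qed
  finally have "integrable lebesgue (\<lambda>x. indicator C x *\<^sub>R (norm (v x) ^ 1))"
    using meas by (intro integrableI_bounded) auto
  then show "(\<lambda>x. norm (v x) ^ 1) absolutely_integrable_on C" by (simp add: set_integrable_def)
qed

text \<open>What remains is to pass to Borel data on a ball around each point, to apply the local
  result there, and to admit every real \<open>a\<close> below the threshold.\<close>

theorem theorem1p8:
  assumes "2 \<le> CARD('n::{finite,linorder})"
  shows "\<exists>c>0. \<forall>m\<ge>CARD('n). \<forall>(\<Omega>::(real, 'n) vec set) (\<omega>::'n const_form) f Df K lam.
    open \<Omega> \<and> connected \<Omega> \<and> \<Omega> \<noteq> {} \<and>
    const_volume_form m \<omega> \<and>
    finite_distortion_curve m \<Omega> \<omega> f Df K \<and>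
    lam > 0 \<and> L1_loc \<Omega> (\<lambda>x. exp (lam * real_of_ereal (K x))) \<and>
    sobolev_loc (CARD('n)) m \<Omega> f Df \<longrightarrow>
    (\<forall>a::real. a < c * lam \<longrightarrow>
      L1_loc \<Omega> (\<lambda>x. star_pullback m \<omega> (Df x) *
                   ln (exp 1 + star_pullback m \<omega> (Df x)) powr a) \<and>
      L1_loc \<Omega> (\<lambda>x. op_norm m (Df x) ^ CARD('n) *
                   ln (exp 1 + op_norm m (Df x)) powr (a - 1)))"
proof -
  obtain c3 where c3: "c3 > 0" and loc: "\<forall>m (\<omega> :: 'n const_form) z R u D K lam (a :: real).
    0 < R \<and> local_sobolev_data z R u D \<and> 0 < comass m \<omega> \<and>
    (AE x in lborel. 0 \<le> star_pullback m \<omega> (\<lambda>j. D j x)) \<and>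
    K \<in> borel_measurable borel \<and> (\<forall>x. 0 \<le> K x) \<and>
    (AE x in lborel. x \<in> ball z R \<longrightarrow>
      comass m \<omega> * op_norm m (\<lambda>j. D j x) ^ CARD('n) \<le> K x * star_pullback m \<omega> (\<lambda>j. D j x)) \<and>
    (\<integral>\<^sup>+x\<in>ball z R. ennreal (exp (lam * K x)) \<partial>lborel) < \<infinity> \<and> 0 < lam \<and> 0 < a \<and> a \<le> c3 * lam \<longrightarrow>
    (\<integral>\<^sup>+x\<in>ball z (R / 2). ennreal (star_pullback m \<omega> (\<lambda>j. D j x) *
        ln (exp 1 + star_pullback m \<omega> (\<lambda>j. D j x)) powr a) \<partial>lborel) < \<infinity> \<and>
    (\<integral>\<^sup>+x\<in>ball z (R / 2). ennreal (op_norm m (\<lambda>j. D j x) ^ CARD('n) *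
        ln (exp 1 + op_norm m (\<lambda>j. D j x)) powr (a - 1)) \<partial>lborel) < \<infinity>"
    using local_log_integrability[OF assms] by (elim exE conjE) (rule that)
  show ?thesis
  proof (intro exI[of _ c3] conjI[OF c3] allI impI, elim conjE)
    fix m and \<Omega> :: "(real, 'n) vec set" and \<omega> :: "'n const_form" and f Df K and lam a :: real
    assume \<Omega>: "open \<Omega>" and vol: "const_volume_form m \<omega>" and fd: "finite_distortion_curve m \<Omega> \<omega> f Df K"
      and lam: "0 < lam" and expK: "L1_loc \<Omega> (\<lambda>x. exp (lam * real_of_ereal (K x)))"
      and S: "sobolev_loc (CARD('n)) m \<Omega> f Df" and a: "a < c3 * lam"
    define P where "P = (\<lambda>x. star_pullback m \<omega> (Df x))"
    define s where "s = (\<lambda>x. op_norm m (Df x))"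
    define \<kappa> where "\<kappa> = comass m \<omega>"
    have \<kappa>: "0 < \<kappa>" using comass_pos[OF vol] by (simp add: \<kappa>_def)
    have \<Omega>l: "\<Omega> \<inter> space lebesgue \<in> sets lebesgue" using \<Omega> by simp
    have Pm [measurable]: "P \<in> borel_measurable (lebesgue_on \<Omega>)"
      using fd by (simp add: finite_distortion_curve_def Lp_loc_def P_def)
    have sm [measurable]: "s \<in> borel_measurable (lebesgue_on \<Omega>)"
      unfolding s_def using S by (intro op_norm_measurable) (auto simp: sobolev_loc_def Lp_loc_def)
    have Km: "K \<in> borel_measurable (lebesgue_on \<Omega>)" and K1: "\<And>x. x \<in> \<Omega> \<Longrightarrow> 1 \<le> K x"
      using fd by (auto simp: finite_distortion_curve_def)
    have "AE x in lebesgue. x \<in> \<Omega> \<longrightarrow> K x < \<infinity>"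
      "AE x in lebesgue. x \<in> \<Omega> \<longrightarrow> \<kappa> * s x ^ CARD('n) \<le> real_of_ereal (K x) * P x"
      using fd unfolding finite_distortion_curve_def AE_restrict_space_iff[OF \<Omega>l] by (auto simp: \<kappa>_def s_def P_def)
    then have Kfin: "AE x in lborel. x \<in> \<Omega> \<longrightarrow> K x < \<infinity>"
      and dist: "AE x in lborel. x \<in> \<Omega> \<longrightarrow> \<kappa> * s x ^ CARD('n) \<le> real_of_ereal (K x) * P x"
      by (simp_all add: AE_completion_iff)
    \<comment> \<open>Where 1 \<le> K < \<infinity>, the distortion inequality can be divided by K
      and shows that the pullback is non-negative.\<close>
    have Ppos: "AE x in lborel. x \<in> \<Omega> \<longrightarrow> 0 \<le> P x"
      using Kfin dist
    proof eventually_elim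
      case (elim x)
      show ?case
      proof
        assume x: "x \<in> \<Omega>"
        then have "0 < real_of_ereal (K x)" using elim K1[OF x] by (cases "K x") auto
        moreover have "0 \<le> \<kappa> * s x ^ CARD('n)" using \<kappa> by (simp add: s_def op_norm_nonneg)
        then have "0 \<le> real_of_ereal (K x) * P x" using elim x by simp
        ultimately show "0 \<le> P x" using zero_le_mult_iff[of "real_of_ereal (K x)" "P x"] by linarith
      qed
    qed
    \<comment> \<open>\<open>a\<close> may be zero or negative. The local result is applied to a
      positive exponent a' \<ge> a, and ln (e + x) \<ge> 1 makes both integrands monotone in the
      exponent.\<close>
    define a' where "a' = max a (c3 * lam / 2)"
    have a': "0 < a'" "a' \<le> c3 * lam" "a \<le> a'" using a c3 lam by (auto simp: a'_def max_def)
    have fin: "\<exists>r>0. (\<integral>\<^sup>+x\<in>ball z r. ennreal \<bar>P x * ln (exp 1 + P x) powr a\<bar> \<partial>lebesgue) < \<infinity> \<and>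
      (\<integral>\<^sup>+x\<in>ball z r. ennreal \<bar>s x ^ CARD('n) * ln (exp 1 + s x) powr (a - 1)\<bar> \<partial>lebesgue) < \<infinity>"
      if z: "z \<in> \<Omega>" for z
    proof -
      obtain R where R: "0 < R" "cball z R \<subseteq> \<Omega>" using open_contains_cball[THEN iffD1, OF \<Omega>] z by blast
      obtain u D where data: "local_sobolev_data z R u D"
        and D: "\<And>j. j < m \<Longrightarrow> AE x in lborel. x \<in> cball z R \<longrightarrow> D j x = Df x j" "\<And>j x. x \<notin> cball z R \<Longrightarrow> D j x = 0"
        by (rule sobolev_loc_local_data[OF S R(2)]) (rule that)
      have "AE x in lborel. \<forall>j\<in>{..<m}. x \<in> cball z R \<longrightarrow> D j x = Df x j"
        using D(1) by (subst AE_ball_countable) (auto intro: countable_finite)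
      then have eq: "AE x in lborel. x \<in> cball z R \<longrightarrow>
        star_pullback m \<omega> (\<lambda>j. D j x) = P x \<and> op_norm m (\<lambda>j. D j x) = s x"
      proof eventually_elim
        case (elim x)
        show ?case
        proof (intro impI conjI)
          assume x: "x \<in> cball z R"
          show "star_pullback m \<omega> (\<lambda>j. D j x) = P x"
            unfolding star_pullback_def P_def using elim x by (intro form_eval_cong) auto
          show "op_norm m (\<lambda>j. D j x) = s x"
            unfolding op_norm_def s_def L2_set_def using elim x by (intro SUP_cong refl arg_cong[where f = sqrt] sum.cong) auto
        qed
      qed
      obtain k where k [measurable]: "k \<in> borel_measurable borel"
        and k_ae: "AE x in lborel. k x = (if x \<in> cball z R then real_of_ereal (K x) else 0)"
        by (rule borel_representative_on_compact[OF borel_measurable_real_of_ereal[OF Km] compact_cball R(2)]) (rule that)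
      \<comment> \<open>The Borel representative may be negative on a null set, whereas the local
        result asks for a function that is non-negative everywhere.\<close>
      define k' where "k' = (\<lambda>x. max 0 (k x))"
      have k'm: "k' \<in> borel_measurable borel" unfolding k'_def by measurable
      have k'_ae: "AE x in lborel. x \<in> cball z R \<longrightarrow> k' x = real_of_ereal (K x)"
        using k_ae Kfin
      proof eventually_elim
        case (elim x)
        show ?case
        proof
          assume x: "x \<in> cball z R"
          have "x \<in> \<Omega>" using x R(2) by blast
          then have "0 \<le> real_of_ereal (K x)" using elim K1[of x] by (cases "K x") auto
          then show "k' x = real_of_ereal (K x)" using elim x by (simp add: k'_def)
        qed
      qed
      have P0: "AE x in lborel. 0 \<le> star_pullback m \<omega> (\<lambda>j. D j x)"
        using eq Ppos
      proof eventually_elim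
        case (elim x)
        show ?case
        proof (cases "x \<in> cball z R")
          case True
          then show ?thesis using elim R(2) by auto
        next
          \<comment> \<open>Outside the ball \<open>D\<close> vanishes, and the bound by the
            Hilbert-Schmidt norm makes the pullback zero.\<close>
          case False
          then show ?thesis using star_pullback_le_hs_norm[of m \<omega> "\<lambda>j. D j x"] by (simp add: D(2) hs_norm_def L2_set_def power_0_left)
        qed
      qed
      have distD: "AE x in lborel. x \<in> ball z R \<longrightarrow>
          comass m \<omega> * op_norm m (\<lambda>j. D j x) ^ CARD('n) \<le> k' x * star_pullback m \<omega> (\<lambda>j. D j x)"
        using eq k'_ae dist
      proof eventually_elim
        case (elim x)
        show ?case
        proof
          assume "x \<in> ball z R"
          then have x: "x \<in> cball z R" by simp
          then have "x \<in> \<Omega>" using R(2) by blast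
          then show "comass m \<omega> * op_norm m (\<lambda>j. D j x) ^ CARD('n) \<le> k' x * star_pullback m \<omega> (\<lambda>j. D j x)"
            using elim x by (simp add: \<kappa>_def)
        qed
      qed
      have "(\<integral>\<^sup>+x\<in>ball z R. ennreal (exp (lam * k' x)) \<partial>lborel)
        \<le> (\<integral>\<^sup>+x\<in>cball z R. ennreal (norm (exp (lam * real_of_ereal (K x))) ^ 1) \<partial>lborel)"
        using k'_ae by (intro nn_integral_mono_AE) (auto elim!: eventually_mono split: split_indicator)
      also have "\<dots> < \<infinity>"
        using Lp_loc_nn_integral_finite[OF expK compact_cball R(2)] by (simp add: nn_integral_completion)
      finally have expk: "(\<integral>\<^sup>+x\<in>ball z R. ennreal (exp (lam * k' x)) \<partial>lborel) < \<infinity>" .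
      have k'0: "\<forall>x. 0 \<le> k' x" by (simp add: k'_def)
      have fin': "(\<integral>\<^sup>+x\<in>ball z (R / 2). ennreal (star_pullback m \<omega> (\<lambda>j. D j x) *
            ln (exp 1 + star_pullback m \<omega> (\<lambda>j. D j x)) powr a') \<partial>lborel) < \<infinity> \<and>
          (\<integral>\<^sup>+x\<in>ball z (R / 2). ennreal (op_norm m (\<lambda>j. D j x) ^ CARD('n) *
            ln (exp 1 + op_norm m (\<lambda>j. D j x)) powr (a' - 1)) \<partial>lborel) < \<infinity>"
        by (rule loc[rule_format, where u = u and K = k' and lam = lam]) (intro conjI R(1) data P0 k'm k'0 distD expk lam a' \<kappa>[unfolded \<kappa>_def])
      have sub: "x \<in> cball z R" if "x \<in> ball z (R / 2)" for x using that R(1) by simp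
      have mono: "\<bar>y * ln (exp 1 + x) powr b\<bar> \<le> y * ln (exp 1 + x) powr b'" if "0 \<le> y" "0 \<le> x" "b \<le> b'" for x y b b' :: real
        using that ln_exp1_ge_1[of x] by (auto simp: abs_mult intro!: mult_left_mono powr_mono)
      have "(\<integral>\<^sup>+x\<in>ball z (R / 2). ennreal \<bar>P x * ln (exp 1 + P x) powr a\<bar> \<partial>lebesgue)
        \<le> (\<integral>\<^sup>+x\<in>ball z (R / 2). ennreal (star_pullback m \<omega> (\<lambda>j. D j x) *
            ln (exp 1 + star_pullback m \<omega> (\<lambda>j. D j x)) powr a') \<partial>lborel)"
        unfolding nn_integral_completion using eq Ppos
      proof (intro nn_integral_mono_AE, eventually_elim)
        case (elim x)
        show ?case
        proof (cases "x \<in> ball z (R / 2)")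
          case True
          then show ?thesis using elim sub[OF True] R(2) a' by (auto intro!: ennreal_leI mono)
        qed simp
      qed
      moreover have "(\<integral>\<^sup>+x\<in>ball z (R / 2). ennreal \<bar>s x ^ CARD('n) * ln (exp 1 + s x) powr (a - 1)\<bar> \<partial>lebesgue)
        \<le> (\<integral>\<^sup>+x\<in>ball z (R / 2). ennreal (op_norm m (\<lambda>j. D j x) ^ CARD('n) *
            ln (exp 1 + op_norm m (\<lambda>j. D j x)) powr (a' - 1)) \<partial>lborel)"
        unfolding nn_integral_completion using eq
      proof (intro nn_integral_mono_AE, eventually_elim)
        case (elim x)
        show ?case
        proof (cases "x \<in> ball z (R / 2)")
          case True
          have "0 \<le> s x" by (simp add: s_def op_norm_nonneg)
          then have "\<bar>s x ^ CARD('n) * ln (exp 1 + s x) powr (a - 1)\<bar> \<le> s x ^ CARD('n) * ln (exp 1 + s x) powr (a' - 1)"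
            using a' by (intro mono) auto
          then show ?thesis using elim True sub[OF True] by (simp only: ennreal_leI indicator_simps mult_1_right simp_thms)
        qed simp
      qed
      ultimately show ?thesis using fin' R(1) by (intro exI[of _ "R / 2"]) (auto intro: le_less_trans)
    qed
    have "L1_loc \<Omega> (\<lambda>x. P x * ln (exp 1 + P x) powr a)"
      by (rule L1_loc_if_locally_finite[OF \<Omega>]) (measurable, use fin in blast)
    moreover have "L1_loc \<Omega> (\<lambda>x. s x ^ CARD('n) * ln (exp 1 + s x) powr (a - 1))"
      by (rule L1_loc_if_locally_finite[OF \<Omega>]) (measurable, use fin in blast)
    ultimately show "L1_loc \<Omega> (\<lambda>x. star_pullback m \<omega> (Df x) * ln (exp 1 + star_pullback m \<omega> (Df x)) powr a) \<and>
      L1_loc \<Omega> (\<lambda>x. op_norm m (Df x) ^ CARD('n) * ln (exp 1 + op_norm m (Df x)) powr (a - 1))"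
      unfolding P_def s_def ..
  qed
qed

end
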